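(* Fix $M\in\mathbb{N}$ and a master graph $\mathbf{\Gamma}$ on $\{1,\ldots,M\}$ with adjacency entries $\gamma_{s,t}(\mathbf{\Gamma})$, and let $\mathcal{E}=\{(s,t)\in\{1,\ldots,M\}^2\colon\gamma_{s,t}(\mathbf{\Gamma})=1\}$. Let $\mathcal{E}$ be partitioned into two disjoint symmetric parts $\mathcal{D}$ and $\mathcal{L}$ (symmetric: $(s,t)\in\mathcal{D}$ iff $(t,s)\in\mathcal{D}$, and likewise for $\mathcal{L}$). Let $n=\sum_{s=1}^Mn_s$ with layer sizes $n_s=n_s(n)\to\infty$ for all $s$, and let $\mathcal{G}_{n_1,\ldots,n_M}(\mathbf{\Gamma})$ be the associated set of multi-layer graphs with layers $\Lambda_1,\ldots,\Lambda_M$. Consider the microcanonical and canonical ensembles $P_{\mathrm{mic}},P_{\mathrm{can}}$ on $\mathcal{G}_{n_1,\ldots,n_M}(\mathbf{\Gamma})$ with the following constraints: for each $(s,t)\in\mathcal{D}$ the $t$-targeted degree sequence of layer $s$ is constrained to $\vec{k}^{\,*}_{s\to t}=(k_i^{*\,t})_{i\in\Lambda_s}$, and for each $(s,t)\in\mathcal{L}$ the total number of links between layers $s$ and $t$ is constrained to $L^*_{s,t}=L^*_{t,s}$; the constraints are assumed to be jointly realised by at least one graph in $\mathcal{G}_{n_1,\ldots,n_M}(\mathbf{\Gamma})$. For $(s,t)\in\mathcal{D}$ put $$L^*_{s,t}=\sum_{i\in\Lambda_s}k_i^{*\,t}=\sum_{j\in\Lambda_t}k_j^{*\,s},\qquad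 m^*_{s\to t}=\max_{i\in\Lambda_s}k_i^{*\,t},\qquad f_{s\to t}^{(n_s)}=n_s^{-1}\sum_{i\in\Lambda_s}\delta_{k_i^{*\,t}}.$$ Suppose that the limits $A_s=\lim_{n_1,\ldots,n_M\to\infty}\frac{n_s}{n}$ exist for all $s$, that $m^*_{s\to t}m^*_{t\to s}=o({L^*_{s,t}}^{2/3})$ for all $(s,t)\in\mathcal{D}$ with $s\ne t$, that $m^*_{s\to s}=o(n_s^{1/2})$ for all $(s,s)\in\mathcal{D}$, and that for all $(s,t)\in\mathcal{D}$ there exist probability distributions $f_{s\to t}$ on $\mathbb{N}_0$ such that $\lim_{n_s\to\infty}\|f_{s\to t}^{(n_s)}-f_{s\to t}\|_{\ell^1(g)}=0$. Then $$s_\infty=\lim_{n\to\infty}n^{-1}S_n(P_{\mathrm{mic}}\mid P_{\mathrm{can}})=\sum_{(s,t)\in\mathcal{D}}A_s\,\|f_{s\to t}\|_{\ell^1(g)}.$$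
   Context: $\mathbb{N}_0=\{0,1,2,\ldots\}$; $\delta_k$ is the point measure at $k$; $a=o(b)$ means that for every $\varepsilon>0$, eventually $|a|\le\varepsilon b$. Graphs are simple and undirected, with adjacency entries $g_{i,j}(\mathbf{G})\in\{0,1\}$. The master graph $\mathbf{\Gamma}$ is an undirected graph with node set $\{1,\ldots,M\}$ in which self-loops are allowed but multi-links are not; $\gamma_{s,t}(\mathbf{\Gamma})=\gamma_{t,s}(\mathbf{\Gamma})\in\{0,1\}$ equals $1$ iff there is a link between $s$ and $t$. The set $\mathcal{G}_{n_1,\ldots,n_M}(\mathbf{\Gamma})$ consists of all simple undirected graphs whose node set is the disjoint union of layers $\Lambda_1,\ldots,\Lambda_M$, $|\Lambda_s|=n_s$, and in which a link between a node of $\Lambda_s$ and a node of $\Lambda_t$ ($s=t$ allowed) is permitted only if $\gamma_{s,t}(\mathbf{\Gamma})=1$. The $t$-targeted degree sequence of layer $s$ in $\mathbf{G}$ is $\vec k_{s\to t}(\mathbf{G})=(k_i^t(\mathbf{G}))_{i\in\Lambda_s}$ with $k_i^t(\mathbf{G})=\sum_{j\in\Lambda_t}g_{i,j}(\mathbf{G})$. The number of links between layers $s$ and $t$ is $\sum_{i\in\Lambda_s}\sum_{j\in\Lambda_t}g_{i,j}(\mathbf{G})$ (for $s=t$ this is twice the number of links inside layer $s$). Ensembles: given a finite set $\mathcal{G}$ of graphs, a vector-valued function $\vec C$ on $\mathcal{G}$ and a value $\vec C^*$ attained by $\vec C$ for at least one graph in $\mathcal{G}$, the microcanonical distribution is $P_{\mathrm{mic}}(\mathbf{G})=1/\Omega_{\vec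 C^*}$ if $\vec C(\mathbf{G})=\vec C^*$ and $0$ otherwise, where $\Omega_{\vec C^*}=|\{\mathbf{G}\in\mathcal{G}\colon\vec C(\mathbf{G})=\vec C^*\}|$. The canonical distribution $P_{\mathrm{can}}$ is the probability distribution on $\mathcal{G}$ that maximises the entropy $-\sum_{\mathbf{G}\in\mathcal{G}}P(\mathbf{G})\ln P(\mathbf{G})$ subject to $\sum_{\mathbf{G}\in\mathcal{G}}P(\mathbf{G})\,\vec C(\mathbf{G})=\vec C^*$; it has the form $P_{\mathrm{can}}(\mathbf{G})=e^{-\vec\theta^*\cdot\vec C(\mathbf{G})}/Z(\vec\theta^* )$ with $Z(\vec\theta)=\sum_{\mathbf{G}\in\mathcal{G}}e^{-\vec\theta\cdot\vec C(\mathbf{G})}$ and $\vec\theta^*$ chosen such that the average of $\vec C$ equals $\vec C^*$. The relative entropy is $S_n(P_{\mathrm{mic}}\mid P_{\mathrm{can}})=\sum_{\mathbf{G}\in\mathcal{G}}P_{\mathrm{mic}}(\mathbf{G})\ln\frac{P_{\mathrm{mic}}(\mathbf{G})}{P_{\mathrm{can}}(\mathbf{G})}$. The function $g\colon\mathbb{N}_0\to[0,\infty)$ is $g(k)=\log\left(\frac{k!}{k^ke^{-k}}\right)$ (so $g(0)=0$), and $\|h\|_{\ell^1(g)}=\sum_{k\in\mathbb{N}_0}|h(k)|\,g(k)$. *)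

theory Defs
  imports "HOL-Probability.Probability" "HOL-Library.Landau_Symbols"
    "HOL-Real_Asymp.Real_Asymp"
begin

section \<open>Multi-layer graphs\<close>

definition master_graph :: "nat \<Rightarrow> (nat \<Rightarrow> nat \<Rightarrow> nat) \<Rightarrow> bool" where
  "master_graph M \<gamma> \<longleftrightarrow>
     (\<forall>s\<in>{1..M}. \<forall>t\<in>{1..M}. \<gamma> s t \<in> {0, 1} \<and> \<gamma> s t = \<gamma> t s)"

definition master_pairs :: "nat \<Rightarrow> (nat \<Rightarrow> nat \<Rightarrow> nat) \<Rightarrow> (nat \<times> nat) set" where
  "master_pairs M \<gamma> = {(s, t). s \<in> {1..M} \<and> t \<in> {1..M} \<and> \<gamma> s t = 1}"

text \<open>A node is a pair of its layer and its position inside that layer, so that distinct layers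
  are disjoint.  A simple graph is its set of links, a link being a set of two distinct nodes.\<close>

type_synonym node = "nat \<times> nat"
type_synonym graph = "node set set"

definition layer :: "(nat \<Rightarrow> nat) \<Rightarrow> nat \<Rightarrow> node set" where
  "layer N s = {s} \<times> {..<N s}"

definition multilayer_graphs :: "nat \<Rightarrow> (nat \<Rightarrow> nat \<Rightarrow> nat) \<Rightarrow> (nat \<Rightarrow> nat) \<Rightarrow> graph set" where
  "multilayer_graphs M \<gamma> N =
     {G. \<forall>e\<in>G. \<exists>(s, t)\<in>master_pairs M \<gamma>. \<exists>i\<in>layer N s. \<exists>j\<in>layer N t. i \<noteq> j \<and> e = {i, j}}"

lemma finite_multilayer_graphs: "finite (multilayer_graphs M \<gamma> N)"
proof (rule finite_subset)
  show "multilayer_graphs M \<gamma> N \<subseteq> Pow (Pow (\<Union>s\<in>{1..M}. layer N s))"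
    unfolding multilayer_graphs_def master_pairs_def by fastforce
  show "finite (Pow (Pow (\<Union>s\<in>{1..M}. layer N s)))" by (simp add: layer_def)
qed

definition adj :: "graph \<Rightarrow> node \<Rightarrow> node \<Rightarrow> nat" where
  "adj G i j = (if {i, j} \<in> G then 1 else 0)"

definition targeted_degree :: "(nat \<Rightarrow> nat) \<Rightarrow> graph \<Rightarrow> nat \<Rightarrow> node \<Rightarrow> nat" where
  "targeted_degree N G t i = (\<Sum>j\<in>layer N t. adj G i j)"

definition num_links :: "(nat \<Rightarrow> nat) \<Rightarrow> graph \<Rightarrow> nat \<Rightarrow> nat \<Rightarrow> nat" where
  "num_links N G s t = (\<Sum>i\<in>layer N s. \<Sum>j\<in>layer N t. adj G i j)"

section \<open>Ensembles\<close>

text \<open>Throughout this section \<open>\<G>\<close> is a finite set of graphs, and \<open>C\<close> is a vector-valued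
  function on it whose components are indexed by the finite set \<open>I\<close>; only the components in \<open>I\<close>
  matter.\<close>

definition realisations :: "'g set \<Rightarrow> 'c set \<Rightarrow> ('g \<Rightarrow> 'c \<Rightarrow> real) \<Rightarrow> ('c \<Rightarrow> real) \<Rightarrow> 'g set" where
  "realisations \<G> I C c = {G\<in>\<G>. \<forall>x\<in>I. C G x = c x}"

definition microcanonical :: "'g set \<Rightarrow> 'c set \<Rightarrow> ('g \<Rightarrow> 'c \<Rightarrow> real) \<Rightarrow> ('c \<Rightarrow> real) \<Rightarrow> 'g pmf" where
  "microcanonical \<G> I C c = pmf_of_set (realisations \<G> I C c)"

text \<open>Since \<^term>\<open>ln 0 = (0::real)\<close>, the usual convention \<open>0 ln 0 = 0\<close> holds in the sums below.\<close>

definition shannon_entropy :: "'g set \<Rightarrow> 'g pmf \<Rightarrow> real" where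
  "shannon_entropy \<G> P = - (\<Sum>G\<in>\<G>. pmf P G * ln (pmf P G))"

definition soft_constrained ::
    "'g set \<Rightarrow> 'c set \<Rightarrow> ('g \<Rightarrow> 'c \<Rightarrow> real) \<Rightarrow> ('c \<Rightarrow> real) \<Rightarrow> 'g pmf set" where
  "soft_constrained \<G> I C c =
     {P. set_pmf P \<subseteq> \<G> \<and> (\<forall>x\<in>I. (\<Sum>G\<in>\<G>. pmf P G * C G x) = c x)}"

definition is_canonical ::
    "'g set \<Rightarrow> 'c set \<Rightarrow> ('g \<Rightarrow> 'c \<Rightarrow> real) \<Rightarrow> ('c \<Rightarrow> real) \<Rightarrow> 'g pmf \<Rightarrow> bool" where
  "is_canonical \<G> I C c P \<longleftrightarrow>
     P \<in> soft_constrained \<G> I C c \<and>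
     (\<forall>Q\<in>soft_constrained \<G> I C c. shannon_entropy \<G> Q \<le> shannon_entropy \<G> P)"

text \<open>The canonical distribution is defined as the maximiser of the entropy.  It exists and is
  unique as soon as the constraint is realised (lemma \<open>canonical_ex1\<close> below), and it is
  the Gibbs distribution whenever there are finite Lagrange multipliers (lemma \<open>gibbs_canonical\<close>).
  There are none when the constraint lies on the boundary, for example when some prescribed degree
  is 0; the maximiser is then a limit of Gibbs distributions.\<close>

definition canonical :: "'g set \<Rightarrow> 'c set \<Rightarrow> ('g \<Rightarrow> 'c \<Rightarrow> real) \<Rightarrow> ('c \<Rightarrow> real) \<Rightarrow> 'g pmf" where
  "canonical \<G> I C c = (THE P. is_canonical \<G> I C c P)"

definition relative_entropy :: "'g set \<Rightarrow> 'g pmf \<Rightarrow> 'g pmf \<Rightarrow> real" where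
  "relative_entropy \<G> P Q = (\<Sum>G\<in>\<G>. pmf P G * ln (pmf P G / pmf Q G))"

lemma sum_pmf_1:
  assumes "finite \<G>" "set_pmf P \<subseteq> \<G>"
  shows "(\<Sum>G\<in>\<G>. pmf P G) = 1"
  using assms by (rule sum_pmf_eq_1)

lemma xlnx_ge:
  fixes x r :: real
  assumes "x \<ge> 0" "r > 0"
  shows "x * ln x \<ge> x * ln r + (x - r)"
proof (cases "x = 0")
  case False
  then have x: "x > 0" using assms by simp
  have "ln (r / x) \<le> r / x - 1" using x assms by (intro ln_le_minus_one) simp
  then have "x * ln (r / x) \<le> x * (r / x - 1)" using x by (intro mult_left_mono) auto
  also have "\<dots> = r - x" using x by (simp add: field_simps)
  finally show ?thesis using x assms by (simp add: ln_div algebra_simps)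
qed (use assms in simp)

lemma xlnx_gt:
  fixes x r :: real
  assumes "x \<ge> 0" "r > 0" "x \<noteq> r"
  shows "x * ln x > x * ln r + (x - r)"
proof (cases "x = 0")
  case False
  then have x: "x > 0" using assms by simp
  have "ln (r / x) \<noteq> r / x - 1"
    using ln_eq_minus_one[of "r / x"] x assms by auto
  moreover have "ln (r / x) \<le> r / x - 1" using x assms by (intro ln_le_minus_one) simp
  ultimately have "ln (r / x) < r / x - 1" by simp
  then have "x * ln (r / x) < x * (r / x - 1)" using x by (intro mult_strict_left_mono) auto
  also have "\<dots> = r - x" using x by (simp add: field_simps)
  finally show ?thesis using x assms by (simp add: ln_div algebra_simps)
qed (use assms in simp)

lemma gibbs_canonical:
  fixes \<theta> :: "'c \<Rightarrow> real" and \<G> :: "'g set"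
  assumes fin: "finite \<G>" "finite I"
    and P: "P \<in> soft_constrained \<G> I C c"
    and gibbs: "\<And>G. G \<in> \<G> \<Longrightarrow> pmf P G =
      exp (- (\<Sum>x\<in>I. \<theta> x * C G x)) / (\<Sum>H\<in>\<G>. exp (- (\<Sum>x\<in>I. \<theta> x * C H x)))"
  shows "is_canonical \<G> I C c P"
proof -
  define Z where "Z = (\<Sum>H\<in>\<G>. exp (- (\<Sum>x\<in>I. \<theta> x * C H x)))"
  have P0: "set_pmf P \<subseteq> \<G>" using P by (auto simp: soft_constrained_def)
  then have "\<G> \<noteq> {}" using set_pmf_not_empty[of P] by auto
  then have Z: "Z > 0" using fin unfolding Z_def by (intro sum_pos) auto
  have pP: "pmf P G = exp (- (\<Sum>x\<in>I. \<theta> x * C G x)) / Z" if "G \<in> \<G>" for G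
    using gibbs[OF that] by (simp add: Z_def)
  have lnP: "ln (pmf P G) = - (\<Sum>x\<in>I. \<theta> x * C G x) - ln Z" if "G \<in> \<G>" for G
    using pP[OF that] Z by (simp add: ln_div)
  have cross: "(\<Sum>G\<in>\<G>. pmf Q G * ln (pmf P G)) = - (\<Sum>x\<in>I. \<theta> x * c x) - ln Z"
    if Q: "Q \<in> soft_constrained \<G> I C c" for Q
  proof -
    have Q1: "(\<Sum>G\<in>\<G>. pmf Q G) = 1"
      using Q fin by (intro sum_pmf_1) (auto simp: soft_constrained_def)
    have "(\<Sum>G\<in>\<G>. pmf Q G * ln (pmf P G)) =
        (\<Sum>G\<in>\<G>. - (\<Sum>x\<in>I. \<theta> x * (pmf Q G * C G x)) - ln Z * pmf Q G)"
      by (intro sum.cong) (auto simp: lnP right_diff_distrib sum_distrib_left mult_ac)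
    also have "\<dots> = - (\<Sum>G\<in>\<G>. \<Sum>x\<in>I. \<theta> x * (pmf Q G * C G x)) - ln Z * (\<Sum>G\<in>\<G>. pmf Q G)"
      by (simp add: sum_subtractf sum_negf sum_distrib_left)
    also have "(\<Sum>G\<in>\<G>. \<Sum>x\<in>I. \<theta> x * (pmf Q G * C G x)) =
        (\<Sum>x\<in>I. \<theta> x * (\<Sum>G\<in>\<G>. pmf Q G * C G x))"
      by (subst sum.swap) (simp add: sum_distrib_left)
    also have "\<dots> = (\<Sum>x\<in>I. \<theta> x * c x)"
      using Q by (intro sum.cong) (auto simp: soft_constrained_def)
    finally show ?thesis using Q1 by simp
  qed
  have "shannon_entropy \<G> Q \<le> shannon_entropy \<G> P" if Q: "Q \<in> soft_constrained \<G> I C c" for Q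
  proof -
    have Q1: "(\<Sum>G\<in>\<G>. pmf Q G) = 1" and P1: "(\<Sum>G\<in>\<G>. pmf P G) = 1"
      using Q P fin by (auto intro!: sum_pmf_1 simp: soft_constrained_def)
    have "(\<Sum>G\<in>\<G>. pmf Q G * ln (pmf P G) + (pmf Q G - pmf P G)) \<le> (\<Sum>G\<in>\<G>. pmf Q G * ln (pmf Q G))"
      using pP Z by (intro sum_mono xlnx_ge) auto
    then have "(\<Sum>G\<in>\<G>. pmf Q G * ln (pmf P G)) \<le> (\<Sum>G\<in>\<G>. pmf Q G * ln (pmf Q G))"
      by (simp add: sum.distrib sum_subtractf Q1 P1)
    then show ?thesis using cross[OF Q] cross[OF P] by (simp add: shannon_entropy_def)
  qed
  then show ?thesis using P by (auto simp: is_canonical_def)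
qed

lemma ex_pmf_of_weights:
  fixes w :: "'g \<Rightarrow> real"
  assumes "finite \<G>" "\<And>G. w G \<ge> 0" "\<And>G. G \<notin> \<G> \<Longrightarrow> w G = 0" "(\<Sum>G\<in>\<G>. w G) = 1"
  obtains P where "pmf P = w" "set_pmf P \<subseteq> \<G>"
proof -
  have "(\<integral>\<^sup>+G. ennreal (w G) \<partial>count_space UNIV) = (\<Sum>G\<in>\<G>. ennreal (w G))"
    using assms by (intro nn_integral_count_space') auto
  also have "\<dots> = 1" using assms by (subst sum_ennreal) auto
  finally have *: "(\<integral>\<^sup>+G. ennreal (w G) \<partial>count_space UNIV) = 1" .
  have "pmf (embed_pmf w) = w" using pmf_embed_pmf[of w] assms(2) * by auto
  moreover from this have "set_pmf (embed_pmf w) \<subseteq> \<G>"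
    using assms(3) by (metis set_pmf_iff subsetI)
  ultimately show ?thesis using that by blast
qed

lemma continuous_on_xlnx: "continuous_on {0..} (\<lambda>x::real. x * ln x)"
proof -
  have "((\<lambda>x::real. x * ln x) \<longlongrightarrow> 0) (at_right 0)"
    by real_asymp
  then have "continuous (at 0 within {0..}) (\<lambda>x::real. x * ln x)"
    by (simp add: continuous_within at_within_Ici_at_right)
  moreover have "continuous (at x within {0..}) (\<lambda>x::real. x * ln x)" if "x > 0" for x :: real
    using that by (intro continuous_intros continuous_within_ln) auto
  ultimately show ?thesis
    unfolding continuous_on_eq_continuous_within
    by (metis atLeast_iff order_le_less)
qed

lemma is_canonical_unique:
  fixes \<G> :: "'g set"
  assumes fin: "finite \<G>" and P: "is_canonical \<G> I C c P" and Q: "is_canonical \<G> I C c Q"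
  shows "P = Q"
proof (rule ccontr)
  assume "P \<noteq> Q"
  have sP: "P \<in> soft_constrained \<G> I C c" and sQ: "Q \<in> soft_constrained \<G> I C c"
    using P Q by (auto simp: is_canonical_def)
  have P1: "(\<Sum>G\<in>\<G>. pmf P G) = 1" and Q1: "(\<Sum>G\<in>\<G>. pmf Q G) = 1"
    using sP sQ fin by (auto intro!: sum_pmf_1 simp: soft_constrained_def)
  have out: "pmf P G = 0" "pmf Q G = 0" if "G \<notin> \<G>" for G
    using that sP sQ by (auto simp: soft_constrained_def set_pmf_iff)
  define w where "w G = (pmf P G + pmf Q G) / 2" for G
  have "(\<Sum>G\<in>\<G>. w G) = 1" using P1 Q1
    by (simp add: w_def sum.distrib flip: sum_divide_distrib)
  then obtain R where R: "pmf R = w" "set_pmf R \<subseteq> \<G>"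
    using ex_pmf_of_weights[of \<G> w] fin out by (auto simp: w_def)
  have "(\<Sum>G\<in>\<G>. pmf R G * C G x) = c x" if "x \<in> I" for x
  proof -
    have "(\<Sum>G\<in>\<G>. pmf R G * C G x) =
        ((\<Sum>G\<in>\<G>. pmf P G * C G x) + (\<Sum>G\<in>\<G>. pmf Q G * C G x)) / 2"
      by (simp add: R w_def sum.distrib add_divide_distrib sum_divide_distrib algebra_simps)
    then show ?thesis using sP sQ that by (simp add: soft_constrained_def)
  qed
  then have sR: "R \<in> soft_constrained \<G> I C c" using R by (simp add: soft_constrained_def)
  obtain G0 where G0: "pmf P G0 \<noteq> pmf Q G0" using \<open>P \<noteq> Q\<close> by (meson pmf_eqI)
  then have G0': "G0 \<in> \<G>" using out by metis
  have le: "2 * (w G * ln (w G)) \<le> pmf P G * ln (pmf P G) + pmf Q G * ln (pmf Q G)"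
    and lt: "pmf P G \<noteq> pmf Q G \<Longrightarrow>
      2 * (w G * ln (w G)) < pmf P G * ln (pmf P G) + pmf Q G * ln (pmf Q G)" for G
  proof -
    consider "w G = 0" | "w G > 0" using pmf_nonneg[of P G] pmf_nonneg[of Q G]
      by (auto simp: w_def) (smt (verit) pmf_nonneg)
    then have "2 * (w G * ln (w G)) \<le> pmf P G * ln (pmf P G) + pmf Q G * ln (pmf Q G) \<and>
      (pmf P G \<noteq> pmf Q G \<longrightarrow>
        2 * (w G * ln (w G)) < pmf P G * ln (pmf P G) + pmf Q G * ln (pmf Q G))"
    proof cases
      case 1
      then have "pmf P G = 0" "pmf Q G = 0"
        using pmf_nonneg[of P G] pmf_nonneg[of Q G] by (simp_all add: w_def add_nonneg_eq_0_iff)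
      then show ?thesis using 1 by simp
    next
      case 2
      have e: "2 * (w G * ln (w G)) = (pmf P G * ln (w G) + (pmf P G - w G)) +
          (pmf Q G * ln (w G) + (pmf Q G - w G))"
        by (simp add: w_def field_simps)
      show ?thesis
      proof (cases "pmf P G = pmf Q G")
        case True
        then show ?thesis by (simp add: w_def)
      next
        case False
        then have "pmf P G \<noteq> w G" "pmf Q G \<noteq> w G" by (auto simp: w_def field_simps)
        then have "2 * (w G * ln (w G)) < pmf P G * ln (pmf P G) + pmf Q G * ln (pmf Q G)"
          unfolding e using 2 by (intro add_strict_mono xlnx_gt) auto
        then show ?thesis by simp
      qed
    qed
    then show "2 * (w G * ln (w G)) \<le> pmf P G * ln (pmf P G) + pmf Q G * ln (pmf Q G)"
      "pmf P G \<noteq> pmf Q G \<Longrightarrow>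
        2 * (w G * ln (w G)) < pmf P G * ln (pmf P G) + pmf Q G * ln (pmf Q G)" by auto
  qed
  have "(\<Sum>G\<in>\<G>. 2 * (w G * ln (w G))) <
      (\<Sum>G\<in>\<G>. pmf P G * ln (pmf P G) + pmf Q G * ln (pmf Q G))"
    using fin G0 G0' le lt by (intro sum_strict_mono_ex1) auto
  then have "2 * shannon_entropy \<G> R > shannon_entropy \<G> P + shannon_entropy \<G> Q"
    by (simp add: shannon_entropy_def R sum.distrib flip: sum_distrib_left)
  moreover have "shannon_entropy \<G> R \<le> shannon_entropy \<G> P"
    "shannon_entropy \<G> R \<le> shannon_entropy \<G> Q"
    using P Q sR by (auto simp: is_canonical_def)
  ultimately show False by simp
qed

lemma is_canonical_exists:
  fixes \<G> :: "'g set"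
  assumes fin: "finite \<G>" and ne: "realisations \<G> I C c \<noteq> {}"
  shows "\<exists>P. is_canonical \<G> I C c P"
proof -
  define B where "B = (\<lambda>G. if G \<in> \<G> then {0..1::real} else {0})"
  define K where "K = PiE UNIV B \<inter> {w. (\<Sum>G\<in>\<G>. w G) = 1} \<inter>
     (\<Inter>x\<in>I. {w. (\<Sum>G\<in>\<G>. w G * C G x) = c x})"
  have "compactin (product_topology (\<lambda>_. euclidean) UNIV) (PiE UNIV B)"
    unfolding compactin_PiE by (auto simp: B_def)
  then have "compact (PiE UNIV B)" by (simp add: euclidean_product_topology)
  then have compK: "compact K" unfolding K_def
    by (intro compact_Int_closed closed_INT ballI closed_Collect_eq continuous_intros
        continuous_on_product_coordinates)
  have contH: "continuous_on K (\<lambda>w. - (\<Sum>G\<in>\<G>. w G * ln (w G)))"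
  proof (intro continuous_on_minus continuous_on_sum)
    fix G assume "G \<in> \<G>"
    have "continuous_on K (\<lambda>w. w G)"
      by (rule continuous_on_subset[OF continuous_on_product_coordinates]) auto
    moreover have "(\<lambda>w. w G) ` K \<subseteq> {0..}" using \<open>G \<in> \<G>\<close> by (auto simp: K_def B_def PiE_iff split: if_splits)
    ultimately show "continuous_on K (\<lambda>w. w G * ln (w G))"
      using continuous_on_compose2[OF continuous_on_xlnx] by blast
  qed
  have pmfK: "pmf P \<in> K" if "P \<in> soft_constrained \<G> I C c" for P
    using that sum_pmf_1[OF fin, of P]
    by (auto simp: K_def B_def PiE_iff soft_constrained_def pmf_le_1 set_pmf_iff)
  obtain G0 where "G0 \<in> \<G>" "\<forall>x\<in>I. C G0 x = c x" using ne by (auto simp: realisations_def)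
  then have "return_pmf G0 \<in> soft_constrained \<G> I C c"
    using fin by (auto simp: soft_constrained_def indicator_def if_distrib cong: if_cong)
  then have "K \<noteq> {}" using pmfK by blast
  from continuous_attains_sup[OF compK this contH] obtain w where w: "w \<in> K"
    "\<And>v. v \<in> K \<Longrightarrow> - (\<Sum>G\<in>\<G>. v G * ln (v G)) \<le> - (\<Sum>G\<in>\<G>. w G * ln (w G))" by blast
  have wB: "w G \<in> B G" for G using w(1) by (auto simp: K_def PiE_iff)
  have "w G \<ge> 0" "G \<notin> \<G> \<Longrightarrow> w G = 0" for G
    using wB[of G] by (auto simp: B_def split: if_splits)
  then obtain P where P: "pmf P = w" "set_pmf P \<subseteq> \<G>"
    using ex_pmf_of_weights[of \<G> w] fin w(1) by (auto simp: K_def)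
  have "P \<in> soft_constrained \<G> I C c"
    using w(1) P by (auto simp: K_def soft_constrained_def)
  then have "is_canonical \<G> I C c P"
    using w(2)[OF pmfK] P(1) by (simp add: is_canonical_def shannon_entropy_def)
  then show ?thesis ..
qed

lemma canonical_ex1:
  assumes "finite \<G>" "realisations \<G> I C c \<noteq> {}"
  shows "\<exists>!P. is_canonical \<G> I C c P"
  using is_canonical_exists[OF assms] is_canonical_unique[OF assms(1)] by blast

section \<open>The constraints on multi-layer graphs\<close>

text \<open>\<open>Degree t i\<close> indexes the degree of node \<open>i\<close> into layer \<open>t\<close>; \<open>Links s t\<close> indexes
  the number of links between the layers \<open>s\<close> and \<open>t\<close>.\<close>

datatype constraint = Degree nat node | Links nat nat

definition constraint_index ::
    "(nat \<times> nat) set \<Rightarrow> (nat \<times> nat) set \<Rightarrow> (nat \<Rightarrow> nat) \<Rightarrow> constraint set" where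
  "constraint_index D L N =
     {Degree t i | s t i. (s, t) \<in> D \<and> i \<in> layer N s} \<union> {Links s t | s t. (s, t) \<in> L}"

definition constraint_value :: "(nat \<Rightarrow> nat) \<Rightarrow> graph \<Rightarrow> constraint \<Rightarrow> real" where
  "constraint_value N G x =
     (case x of Degree t i \<Rightarrow> real (targeted_degree N G t i) | Links s t \<Rightarrow> real (num_links N G s t))"

definition constraint_target ::
    "(nat \<Rightarrow> node \<Rightarrow> nat) \<Rightarrow> (nat \<Rightarrow> nat \<Rightarrow> nat) \<Rightarrow> constraint \<Rightarrow> real" where
  "constraint_target k Lst x =
     (case x of Degree t i \<Rightarrow> real (k t i) | Links s t \<Rightarrow> real (Lst s t))"

section \<open>Degree distributions\<close>

definition max_degree :: "(nat \<Rightarrow> nat) \<Rightarrow> (nat \<Rightarrow> node \<Rightarrow> nat) \<Rightarrow> nat \<Rightarrow> nat \<Rightarrow> nat" where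
  "max_degree N k s t = Max (k t ` layer N s)"

definition empirical_distr ::
    "(nat \<Rightarrow> nat) \<Rightarrow> (nat \<Rightarrow> node \<Rightarrow> nat) \<Rightarrow> nat \<Rightarrow> nat \<Rightarrow> nat \<Rightarrow> real" where
  "empirical_distr N k s t j = (\<Sum>i\<in>layer N s. if k t i = j then 1 else 0) / real (N s)"

definition g_fun :: "nat \<Rightarrow> real" where
  "g_fun k = ln (fact k / (real k ^ k * exp (- real k)))"

text \<open>The weighted norm takes values in \<open>ereal\<close>, where it is infinite if the series diverges.\<close>

definition l1g_norm :: "(nat \<Rightarrow> real) \<Rightarrow> ereal" where
  "l1g_norm h = (\<Sum>k. ereal (\<bar>h k\<bar> * g_fun k))"

end

theory Submission
  imports Defs "HOL-Combinatorics.Combinatorics"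
begin

text \<open>
  By first-order optimality the relative entropy equals the canonical entropy minus the logarithm of
  the number \<open>\<Omega>\<close> of realisations, and it splits over the blocks of links between two layers. In each
  block it is bounded from below by the entropy of independent links with the prescribed mean degrees,
  and from above by the Lagrangian dual \<open>\<Sum>e. ln (1 + \<omega> e) - p e * ln (\<omega> e)\<close> for arbitrary weights \<open>\<omega>\<close>.

  For a bipartite block, \<open>j! N\<^sub>j\<close> is log-concave, where \<open>N\<^sub>j\<close> is the weighted number of graphs
  in which a given node has degree \<open>j\<close>. Freeing the degrees one by one therefore costs a factor
  \<open>exp (g k)\<close> per node and yields the upper bound \<open>\<Sum>g\<close> without any assumption; the lower bound comes
  from the link probabilities \<open>k i * l j / L\<close> and \<open>\<Omega> \<le> L! / (\<Prod>k! * \<Prod>l!)\<close>.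

  For the links inside one layer, a sparse degree sequence (\<open>8 m\<^sup>2 \<le> L\<close>) is handled by switchings,
  which show that \<open>\<Omega>\<close> agrees with \<open>L! / ((L/2)! * 2^(L/2) * \<Prod>k!)\<close> up to a factor \<open>exp (O(m\<^sup>2))\<close>. If
  \<open>L < 8 m\<^sup>2\<close>, then \<open>L = o(n)\<close>, and it suffices to control the error up to \<open>O(L)\<close>: there the
  number of directed graphs with these in- and out-degrees, to which the bipartite bound applies,
  is compared with \<open>\<Omega>\<^sup>2\<close>.
\<close>

section \<open>Alternating paths between two injections\<close>

text \<open>\<open>exp (g_fun k)\<close> is the inverse of the probability that a Poisson variable
  of mean \<open>k\<close> equals \<open>k\<close>. In sparse graphs the canonical degrees behave
  like independent Poisson variables, and each prescribed degree pays this price. The canonical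
  probabilities are never computed: a degree that is 0 or maximal leaves no finite multipliers, so a
  lower bound is certified by one feasible vector of link probabilities, and an upper bound by one
  vector of positive weights that works for all feasible probabilities, with a small slack. The
  obstacle is the undirected layer. Log-concavity comes from injections of links into stubs, each
  link using a stub of its head if present and of its tail if absent, and this needs two sides.
  Splitting a digraph with equal in- and out-degrees into two undirected graphs is obstructed by
  closed walks of odd length, and disposing of these costs a factor exponential in \<open>L\<close>.
  Word switchings cost only \<open>exp (O(m^2))\<close>, which is harmless as
  \<open>m^2 = o(n)\<close>, but they need enough links to switch with. The threshold between the
  two methods is chosen so that each is used only where its cost is \<open>o(n)\<close>.\<close>

definition inj_hits :: "'e set \<Rightarrow> 's set \<Rightarrow> 's set \<Rightarrow> 's set \<Rightarrow> ('e \<Rightarrow> 's) set" where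
  "inj_hits E S Q T = {f \<in> E \<rightarrow>\<^sub>E S. inj_on f E \<and> f ` E \<inter> Q = T}"

text \<open>View \<open>f\<close> and \<open>g\<close> as two matchings of \<open>E\<close> into
  \<open>S\<close>. These are the members of \<open>E\<close> on the alternating path that starts at
  \<open>a\<close>, goes back along \<open>f\<close>, forward along \<open>g\<close>, back along
  \<open>f\<close> again, and so on, until \<open>g\<close> reaches a point outside the image of
  \<open>f\<close>.\<close>

inductive_set alternating :: "'e set \<Rightarrow> ('e \<Rightarrow> 's) \<Rightarrow> ('e \<Rightarrow> 's) \<Rightarrow> 's \<Rightarrow> 'e set"
  for E f g a where
    start: "e \<in> E \<Longrightarrow> f e = a \<Longrightarrow> e \<in> alternating E f g a"
  | step: "e \<in> alternating E f g a \<Longrightarrow> e' \<in> E \<Longrightarrow> f e' = g e \<Longrightarrow> e' \<in> alternating E f g a"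

lemma alternating_subset: "alternating E f g a \<subseteq> E"
proof
  fix x assume "x \<in> alternating E f g a"
  then show "x \<in> E" by induction auto
qed

definition swap_on :: "'e set \<Rightarrow> ('e \<Rightarrow> 's) \<Rightarrow> ('e \<Rightarrow> 's) \<Rightarrow> 'e \<Rightarrow> 's" where
  "swap_on K f g = (\<lambda>e. if e \<in> K then g e else f e)"

text \<open>The swap moves \<open>a\<close> from the image of \<open>f\<close> to that of
  \<open>g\<close>. The far end of the path lies in the image of \<open>g\<close> but not of
  \<open>f\<close>; as \<open>T \<subseteq> T'\<close>, it is outside \<open>Q\<close>, so nothing
  else changes within \<open>Q\<close>. By the third claim the path can be read off from the swapped
  pair, so the swap can be undone.\<close>

lemma swap_on_exchange:
  assumes f: "f \<in> inj_hits E S Q T'" and g: "g \<in> inj_hits E S Q T"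
    and T: "T \<subseteq> T'" "T' \<subseteq> Q" "a \<in> T'" "a \<notin> T"
  defines "K \<equiv> alternating E f g a"
  shows "swap_on K f g \<in> inj_hits E S Q (T' - {a})"
    and "swap_on K g f \<in> inj_hits E S Q (insert a T)"
    and "alternating E (swap_on K g f) (swap_on K f g) a = K"
proof -
  have KE: "K \<subseteq> E" unfolding K_def by (rule alternating_subset)
  have injf: "inj_on f E" and injg: "inj_on g E" and fT: "f ` E \<inter> Q = T'" and gT: "g ` E \<inter> Q = T"
    and fP: "f \<in> E \<rightarrow>\<^sub>E S" and gP: "g \<in> E \<rightarrow>\<^sub>E S"
    using f g by (auto simp: inj_hits_def)
  have step: "e' \<in> K" if "e \<in> K" "e' \<in> E" "f e' = g e" for e e'
    using that unfolding K_def by (rule alternating.step)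
  have start: "e \<in> K" if "e \<in> E" "f e = a" for e
    using that unfolding K_def by (rule alternating.start)
  have fK: "f e = a \<or> (\<exists>e'\<in>K. f e = g e')" if "e \<in> K" for e
    using that unfolding K_def by cases auto
  \<comment> \<open>Since \<open>a\<close> lies in \<open>Q\<close> but not in \<open>T\<close>, the
    path never returns to its starting point.\<close>
  have ag: "a \<notin> g ` E" using gT T by auto
  have af: "a \<in> f ` K" using fT T start by auto
  have injf': "inj_on (swap_on K f g) E"
  proof (rule inj_onI)
    fix x y assume xy: "x \<in> E" "y \<in> E" "swap_on K f g x = swap_on K f g y"
    show "x = y"
      using xy step[of x y] step[of y x] inj_onD[OF injf, of x y] inj_onD[OF injg, of x y]
      by (auto simp: swap_on_def split: if_splits)
  qed
  have injg': "inj_on (swap_on K g f) E"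
  proof (rule inj_onI)
    fix x y assume xy: "x \<in> E" "y \<in> E" "swap_on K g f x = swap_on K g f y"
    \<comment> \<open>An \<open>f\<close>-value on the path is either \<open>a\<close>, which
      \<open>g\<close> avoids, or the \<open>g\<close>-value of a member of the path; injectivity of
      \<open>g\<close> then puts \<open>v\<close> on the path.\<close>
    have key: "u \<in> K \<Longrightarrow> v \<in> E \<Longrightarrow> f u = g v \<Longrightarrow> v \<in> K" for u v
      using fK[of u] ag KE inj_onD[OF injg, of v] by (metis image_eqI subsetD)
    show "x = y"
      using xy key[of x y] key[of y x] inj_onD[OF injf, of x y] inj_onD[OF injg, of x y]
      by (auto simp: swap_on_def split: if_splits)
  qed
  have img: "swap_on K f g ` E = g ` K \<union> f ` (E - K)" "swap_on K g f ` E = f ` K \<union> g ` (E - K)"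
    using KE by (auto simp: swap_on_def image_iff)
  \<comment> \<open>A value \<open>g e\<close> in \<open>Q\<close> belongs to \<open>T\<close>,
    hence to the image of \<open>f\<close>, so the path continues through it.\<close>
  have gKQ: "g ` K \<inter> Q = (f ` K \<inter> Q) - {a}"
  proof (intro equalityI subsetI)
    fix x assume "x \<in> g ` K \<inter> Q"
    then obtain e where e: "e \<in> K" "x = g e" "x \<in> Q" by auto
    then have "x \<in> T" using gT KE by auto
    then obtain e' where "e' \<in> E" "f e' = x" using T fT by auto
    moreover have "e' \<in> K" using step[of e e'] e calculation by simp
    ultimately have "x \<in> f ` K" by blast
    then show "x \<in> (f ` K \<inter> Q) - {a}" using e \<open>x \<in> T\<close> T by auto
  next
    fix x assume "x \<in> (f ` K \<inter> Q) - {a}"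
    then show "x \<in> g ` K \<inter> Q" using fK by auto
  qed
  have fEK: "f ` (E - K) \<inter> f ` K = {}" using injf KE by (auto dest: inj_onD)
  have gEK: "g ` (E - K) \<inter> g ` K = {}" using injg KE by (auto dest: inj_onD)
  have fsplit: "f ` E = f ` K \<union> f ` (E - K)" "g ` E = g ` K \<union> g ` (E - K)" using KE by auto
  have "swap_on K f g ` E \<inter> Q = T' - {a}"
  proof -
    have "swap_on K f g ` E \<inter> Q = (f ` K \<inter> Q - {a}) \<union> (f ` (E - K) \<inter> Q)"
      unfolding img Int_Un_distrib2 gKQ ..
    also have "\<dots> = (f ` K \<union> f ` (E - K)) \<inter> Q - {a}" using fEK af by auto
    finally show ?thesis using fT fsplit by simp
  qed
  moreover have "swap_on K f g \<in> E \<rightarrow>\<^sub>E S"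
    using fP gP KE by (auto simp: swap_on_def PiE_iff extensional_def)
  ultimately show "swap_on K f g \<in> inj_hits E S Q (T' - {a})"
    using injf' by (simp add: inj_hits_def)
  have "swap_on K g f ` E \<inter> Q = insert a T"
  proof -
    have "f ` K \<inter> Q = insert a (g ` K \<inter> Q)" using gKQ af T by auto
    then have "swap_on K g f ` E \<inter> Q = insert a ((g ` K \<union> g ` (E - K)) \<inter> Q)"
      unfolding img by auto
    then show ?thesis using gT fsplit by simp
  qed
  moreover have "swap_on K g f \<in> E \<rightarrow>\<^sub>E S"
    using fP gP KE by (auto simp: swap_on_def PiE_iff extensional_def)
  ultimately show "swap_on K g f \<in> inj_hits E S Q (insert a T)"
    using injg' by (simp add: inj_hits_def)
  show "alternating E (swap_on K g f) (swap_on K f g) a = K"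
  proof (intro equalityI subsetI)
    fix x assume "x \<in> alternating E (swap_on K g f) (swap_on K f g) a"
    then show "x \<in> K"
    proof induction
      case (start e)
      then show ?case using ag by (auto simp: swap_on_def split: if_splits)
    next
      case (step e e')
      then have "swap_on K g f e' = g e" by (simp add: swap_on_def)
      then show ?case using step KE inj_onD[OF injg, of e' e]
        by (auto simp: swap_on_def split: if_splits)
    qed
  next
    fix x assume "x \<in> K"
    then show "x \<in> alternating E (swap_on K g f) (swap_on K f g) a"
      unfolding K_def
    proof induction
      case (start e)
      then have "e \<in> K" by (intro \<open>\<And>e. e \<in> E \<Longrightarrow> f e = a \<Longrightarrow> e \<in> K\<close>)
      then show ?case using start
        by (intro alternating.start) (auto simp: swap_on_def K_def)
    next
      case (step e e')
      have "e \<in> K" "e' \<in> K" using step by (auto simp: K_def intro: alternating.step)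
      then show ?case using step
        by (intro alternating.step[OF step.IH]) (auto simp: swap_on_def K_def)
    qed
  qed
qed

text \<open>The swap is injective, and it preserves the product of the two weights because for every
  \<open>e\<close> the values \<open>f e\<close> and \<open>g e\<close> are at most interchanged.
  The sums are permanents restricted to prescribed columns.\<close>

lemma alternating_exchange:
  fixes w :: "'e \<Rightarrow> 's \<Rightarrow> real"
  assumes fin: "finite E" "finite S" and w: "\<And>e s. w e s \<ge> 0"
    and T: "T \<subseteq> T'" "T' \<subseteq> Q" "a \<in> T'" "a \<notin> T"
  shows "(\<Sum>f\<in>inj_hits E S Q T'. \<Prod>e\<in>E. w e (f e)) * (\<Sum>f\<in>inj_hits E S Q T. \<Prod>e\<in>E. w e (f e))
    \<le> (\<Sum>f\<in>inj_hits E S Q (T' - {a}). \<Prod>e\<in>E. w e (f e)) *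
       (\<Sum>f\<in>inj_hits E S Q (insert a T). \<Prod>e\<in>E. w e (f e))"
proof -
  define W where "W f = (\<Prod>e\<in>E. w e (f e))" for f
  define \<Phi> where "\<Phi> = (\<lambda>(f, g). (swap_on (alternating E f g a) f g, swap_on (alternating E f g a) g f))"
  define X where "X = inj_hits E S Q T' \<times> inj_hits E S Q T"
  have fin': "finite (inj_hits E S Q U)" for U
    unfolding inj_hits_def using fin by (intro finite_subset[OF _ finite_PiE[of E "\<lambda>_. S"]]) auto
  have sub: "\<Phi> ` X \<subseteq> inj_hits E S Q (T' - {a}) \<times> inj_hits E S Q (insert a T)"
    using swap_on_exchange(1,2)[OF _ _ T] by (auto simp: X_def \<Phi>_def)
  have inj: "inj_on \<Phi> X"
  proof (rule inj_onI)
    fix p q assume pq: "p \<in> X" "q \<in> X" "\<Phi> p = \<Phi> q"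
    obtain f g f1 g1 where [simp]: "p = (f, g)" "q = (f1, g1)" by (cases p; cases q)
    have fg: "f \<in> inj_hits E S Q T'" "g \<in> inj_hits E S Q T"
      "f1 \<in> inj_hits E S Q T'" "g1 \<in> inj_hits E S Q T" using pq by (auto simp: X_def)
    have K: "alternating E f g a = alternating E f1 g1 a"
      using swap_on_exchange(3)[OF fg(1,2) T] swap_on_exchange(3)[OF fg(3,4) T] pq(3)
      by (simp add: \<Phi>_def)
    have "f e = f1 e \<and> g e = g1 e" for e
      using pq(3) unfolding \<Phi>_def by (auto simp: K swap_on_def fun_eq_iff dest: spec[of _ e] split: if_splits)
    then show "p = q" by auto
  qed
  have wt: "W (fst (\<Phi> p)) * W (snd (\<Phi> p)) = W (fst p) * W (snd p)" for p
    by (cases p) (auto simp: \<Phi>_def W_def swap_on_def mult.commute simp flip: prod.distrib intro!: prod.cong)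
  have "(\<Sum>f\<in>inj_hits E S Q T'. W f) * (\<Sum>f\<in>inj_hits E S Q T. W f) = (\<Sum>p\<in>X. W (fst p) * W (snd p))"
    by (simp add: X_def sum_product sum.cartesian_product case_prod_unfold)
  also have "\<dots> = (\<Sum>p\<in>\<Phi> ` X. W (fst p) * W (snd p))"
    using inj wt by (subst sum.reindex) auto
  also have "\<dots> \<le> (\<Sum>p\<in>inj_hits E S Q (T' - {a}) \<times> inj_hits E S Q (insert a T). W (fst p) * W (snd p))"
    using sub fin' w by (intro sum_mono2) (auto simp: W_def intro!: mult_nonneg_nonneg prod_nonneg)
  also have "\<dots> = (\<Sum>f\<in>inj_hits E S Q (T' - {a}). W f) * (\<Sum>f\<in>inj_hits E S Q (insert a T). W f)"
    by (simp add: sum_product sum.cartesian_product case_prod_unfold)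
  finally show ?thesis by (simp add: W_def)
qed

section \<open>Log-concavity of the number of graphs in one degree\<close>

lemma card_ext_bij:
  assumes A: "finite A" and B: "finite B" "card B = card A"
  shows "card {f \<in> extensional A. bij_betw f A B} = fact (card A)"
proof -
  obtain h where h: "bij_betw h A B"
    using finite_same_card_bij[OF A B(1)] B(2) by auto
  define \<Phi> where "\<Phi> p = restrict (h \<circ> p) A" for p
  have "bij_betw \<Phi> {p. p permutes A} {f \<in> extensional A. bij_betw f A B}"
  proof (rule bij_betwI')
    fix p q assume "p \<in> {p. p permutes A}" "q \<in> {p. p permutes A}"
    then have p: "p permutes A" and q: "q permutes A" by auto
    show "(\<Phi> p = \<Phi> q) = (p = q)"
    proof
      assume eq: "\<Phi> p = \<Phi> q"
      show "p = q"
      proof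
        fix x
        show "p x = q x"
        proof (cases "x \<in> A")
          case True
          then have "h (p x) = h (q x)" using eq by (auto simp: \<Phi>_def fun_eq_iff restrict_def split: if_splits)
          then show ?thesis
            using h p q True by (auto simp: bij_betw_def permutes_in_image dest: inj_onD)
        qed (use p q in \<open>auto simp: permutes_not_in\<close>)
      qed
    qed auto
  next
    fix p assume "p \<in> {p. p permutes A}"
    then have "bij_betw (h \<circ> p) A B"
      using h by (auto intro: bij_betw_trans permutes_imp_bij)
    then have "bij_betw (\<Phi> p) A B"
      by (rule bij_betw_cong[THEN iffD1, rotated]) (simp add: \<Phi>_def)
    then show "\<Phi> p \<in> {f \<in> extensional A. bij_betw f A B}" by (simp add: \<Phi>_def)
  next
    fix f assume f: "f \<in> {f \<in> extensional A. bij_betw f A B}"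
    define p where "p x = (if x \<in> A then the_inv_into A h (f x) else x)" for x
    have "bij_betw (the_inv_into A h \<circ> f) A A"
      using f h by (auto intro: bij_betw_trans bij_betw_the_inv_into)
    then have "bij_betw p A A"
      by (rule bij_betw_cong[THEN iffD1, rotated]) (simp add: p_def)
    then have pp: "p permutes A" by (intro bij_imp_permutes) (auto simp: p_def)
    have "\<Phi> p = f"
    proof
      fix x
      show "\<Phi> p x = f x"
      proof (cases "x \<in> A")
        case True
        then have "f x \<in> h ` A" using f h by (auto simp: bij_betw_def)
        then show ?thesis using True h by (simp add: \<Phi>_def p_def f_the_inv_into_f bij_betw_def)
      qed (use f in \<open>auto simp: \<Phi>_def extensional_def\<close>)
    qed
    then show "\<exists>p\<in>{p. p permutes A}. f = \<Phi> p" using pp by auto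
  qed
  then have "card {p. p permutes A} = card {f \<in> extensional A. bij_betw f A B}"
    by (rule bij_betw_same_card)
  then show ?thesis using A by (simp add: card_permutations)
qed

definition block_labellings :: "'c set \<Rightarrow> ('c \<Rightarrow> 'e set) \<Rightarrow> ('e \<Rightarrow> nat) set" where
  "block_labellings C B =
     {lab \<in> extensional (\<Union>c\<in>C. B c). \<forall>c\<in>C. bij_betw lab (B c) {..<card (B c)}}"

lemma card_block_labellings:
  assumes "finite C" "\<And>c. c \<in> C \<Longrightarrow> finite (B c)" "disjoint_family_on B C"
  shows "card (block_labellings C B) = (\<Prod>c\<in>C. fact (card (B c)))"
  using assms
proof (induction C rule: finite_induct)
  case empty
  have "block_labellings {} B = {\<lambda>_. undefined}" by (auto simp: block_labellings_def)
  then show ?case by simp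
next
  case (insert c C)
  define U where "U = (\<Union>c\<in>C. B c)"
  define X where "X = {f \<in> extensional (B c). bij_betw f (B c) {..<card (B c)}}"
  have disj: "B c \<inter> U = {}" "\<And>d. d \<in> C \<Longrightarrow> B d \<inter> B c = {}"
    using insert.prems(2) insert.hyps by (auto simp: disjoint_family_on_def U_def)
  have df: "disjoint_family_on B C"
    using insert.prems(2) by (auto simp: disjoint_family_on_def)
  define \<Phi> where "\<Phi> lab = (restrict lab (B c), restrict lab U)" for lab :: "'b \<Rightarrow> nat"
  have "bij_betw \<Phi> (block_labellings (insert c C) B) (X \<times> block_labellings C B)"
  proof (rule bij_betwI')
    fix f g assume fg: "f \<in> block_labellings (insert c C) B" "g \<in> block_labellings (insert c C) B"
    then have e: "f \<in> extensional (B c \<union> U)" "g \<in> extensional (B c \<union> U)"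
      by (auto simp: block_labellings_def U_def)
    show "(\<Phi> f = \<Phi> g) = (f = g)"
    proof
      assume "\<Phi> f = \<Phi> g"
      then have "f x = g x" if "x \<in> B c \<union> U" for x
        using that by (auto simp: \<Phi>_def fun_eq_iff restrict_def split: if_splits)
      then show "f = g" using e by (metis extensionalityI)
    qed auto
  next
    fix f assume f: "f \<in> block_labellings (insert c C) B"
    have "bij_betw (restrict f (B c)) (B c) {..<card (B c)}"
      using f by (auto simp: block_labellings_def cong: bij_betw_cong)
    moreover have "bij_betw (restrict f U) (B d) {..<card (B d)}" if "d \<in> C" for d
    proof -
      have "bij_betw f (B d) {..<card (B d)}" using f that by (auto simp: block_labellings_def)
      then show ?thesis
        by (rule bij_betw_cong[THEN iffD1, rotated]) (use that in \<open>auto simp: U_def\<close>)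
    qed
    ultimately show "\<Phi> f \<in> X \<times> block_labellings C B"
      by (auto simp: \<Phi>_def X_def block_labellings_def U_def)
  next
    fix p assume p: "p \<in> X \<times> block_labellings C B"
    obtain a b where [simp]: "p = (a, b)" by (cases p)
    define f where "f x = (if x \<in> B c then a x else b x)" for x
    have a: "a \<in> extensional (B c)" "bij_betw a (B c) {..<card (B c)}"
      and b: "b \<in> extensional U" "\<And>d. d \<in> C \<Longrightarrow> bij_betw b (B d) {..<card (B d)}"
      using p by (auto simp: X_def block_labellings_def U_def)
    have "bij_betw f (B c) {..<card (B c)}"
      using a(2) by (rule bij_betw_cong[THEN iffD1, rotated]) (simp add: f_def)
    moreover have "bij_betw f (B d) {..<card (B d)}" if "d \<in> C" for d
      using b(2)[OF that] by (rule bij_betw_cong[THEN iffD1, rotated])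
        (use disj(2)[OF that] in \<open>auto simp: f_def\<close>)
    moreover have "f \<in> extensional (B c \<union> U)" using a b by (auto simp: f_def extensional_def)
    ultimately have "f \<in> block_labellings (insert c C) B" by (auto simp: block_labellings_def U_def)
    moreover have "\<Phi> f = p"
    proof -
      have "restrict f (B c) = a" using a by (auto simp: f_def restrict_def extensional_def)
      moreover have "restrict f U = b"
        using b disj(1) by (auto simp: f_def restrict_def extensional_def fun_eq_iff)
      ultimately show ?thesis by (simp add: \<Phi>_def)
    qed
    ultimately show "\<exists>f\<in>block_labellings (insert c C) B. p = \<Phi> f" by blast
  qed
  then have "card (block_labellings (insert c C) B) = card (X \<times> block_labellings C B)"
    by (rule bij_betw_same_card)
  also have "\<dots> = card X * card (block_labellings C B)" by (rule card_cartesian_product)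
  also have "card X = fact (card (B c))" unfolding X_def
    using insert.prems(1) by (intro card_ext_bij) auto
  finally show ?case using insert.IH insert.prems(1) insert.hyps df by simp
qed

section \<open>Degree-constrained graphs as injections into stubs\<close>

text \<open>Only the sources in \<open>Y\<close> and the targets in \<open>X\<close> are
  constrained, so that degrees can be freed one node at a time.\<close>

definition degree_graphs ::
    "'e set \<Rightarrow> ('e \<Rightarrow> 'u) \<Rightarrow> ('e \<Rightarrow> 'v) \<Rightarrow> 'u set \<Rightarrow> ('u \<Rightarrow> nat) \<Rightarrow> 'v set \<Rightarrow> ('v \<Rightarrow> nat) \<Rightarrow> 'e set set" where
  "degree_graphs E src tgt Y k X l =
     {G. G \<subseteq> E \<and> (\<forall>u\<in>Y. card {e \<in> G. src e = u} = k u) \<and> (\<forall>v\<in>X. card {e \<in> G. tgt e = v} = l v)}"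

definition graph_sum ::
    "'e set \<Rightarrow> ('e \<Rightarrow> 'u) \<Rightarrow> ('e \<Rightarrow> 'v) \<Rightarrow> 'u set \<Rightarrow> ('u \<Rightarrow> nat) \<Rightarrow> 'v set \<Rightarrow> ('v \<Rightarrow> nat) \<Rightarrow> ('e \<Rightarrow> real) \<Rightarrow> real" where
  "graph_sum E src tgt Y k X l \<omega> = (\<Sum>G\<in>degree_graphs E src tgt Y k X l. \<Prod>e\<in>G. \<omega> e)"

lemma finite_degree_graphs: "finite E \<Longrightarrow> finite (degree_graphs E src tgt Y k X l)"
  by (rule finite_subset[of _ "Pow E"]) (auto simp: degree_graphs_def)

text \<open>Each potential link occupies one stub: a numbered stub of its head if it is present, a
  numbered stub of its tail if it is absent. A head \<open>v\<close> offers \<open>l v\<close>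
  stubs, and a tail \<open>u\<close> as many as there are links to be left out at \<open>u\<close>;
  filling them all means having the prescribed degrees. At an unconstrained end the link has a
  private stub \<open>PIn\<close> or \<open>POut\<close>.\<close>

datatype ('e, 'u, 'v) stub = In 'v nat | Out 'u nat | PIn 'e | POut 'e

definition stub_weight ::
    "('e \<Rightarrow> 'u) \<Rightarrow> ('e \<Rightarrow> 'v) \<Rightarrow> 'u set \<Rightarrow> 'v set \<Rightarrow> ('e \<Rightarrow> real) \<Rightarrow> 'e \<Rightarrow> ('e, 'u, 'v) stub \<Rightarrow> real" where
  "stub_weight src tgt Y X \<omega> e c = (case c of
       In v a \<Rightarrow> if tgt e = v then \<omega> e else 0
     | Out u a \<Rightarrow> if src e = u then 1 else 0
     | PIn e' \<Rightarrow> if e' = e \<and> tgt e \<notin> X then \<omega> e else 0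
     | POut e' \<Rightarrow> if e' = e \<and> src e \<notin> Y then 1 else 0)"

definition public_stubs :: "('e, 'u, 'v) stub set" where
  "public_stubs = range (case_prod In) \<union> range (case_prod Out)"

definition stub_target ::
    "'e set \<Rightarrow> ('e \<Rightarrow> 'u) \<Rightarrow> 'u set \<Rightarrow> ('u \<Rightarrow> nat) \<Rightarrow> 'v set \<Rightarrow> ('v \<Rightarrow> nat) \<Rightarrow> ('e, 'u, 'v) stub set" where
  "stub_target E src Y k X l = {In v a | v a. v \<in> X \<and> a < l v} \<union>
     {Out u a | u a. u \<in> Y \<and> a < card {e \<in> E. src e = u} - k u}"

text \<open>An injection of nonzero weight is a graph together with a numbering of the present links
  at each constrained head and of the absent links at each constrained tail; the factorials count
  the numberings. \<open>S\<close> may be any finite superset of the listed stubs, so that one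
  \<open>S\<close> serves several values of a degree.\<close>

lemma graph_sum_stubs:
  fixes src :: "'e \<Rightarrow> 'u" and tgt :: "'e \<Rightarrow> 'v"
  assumes fin: "finite E" "finite X" "finite Y" "finite S"
    and S: "stub_target E src Y k X l \<subseteq> S" "PIn ` E \<subseteq> S" "POut ` E \<subseteq> S"
    and k: "\<And>u. u \<in> Y \<Longrightarrow> k u \<le> card {e \<in> E. src e = u}"
  shows "(\<Sum>f\<in>inj_hits E S public_stubs (stub_target E src Y k X l).
        \<Prod>e\<in>E. stub_weight src tgt Y X \<omega> e (f e)) =
     (\<Prod>v\<in>X. fact (l v)) * (\<Prod>u\<in>Y. fact (card {e \<in> E. src e = u} - k u)) *
       graph_sum E src tgt Y k X l \<omega>"
proof -
  define T where "T = stub_target E src Y k X l"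
  \<comment> \<open>The block \<open>Inl v\<close> consists of the links present at the head
    \<open>v\<close>, the block \<open>Inr u\<close> of the links absent at the tail
    \<open>u\<close>.\<close>
  define B where "B G c = (case c of Inl v \<Rightarrow> {e \<in> G. tgt e = v} | Inr u \<Rightarrow> {e \<in> E - G. src e = u})"
    for G :: "'e set" and c :: "'v + 'u"
  define C where "C = X <+> Y"
  define col where "col G lab = (\<lambda>e\<in>E. if e \<in> G then (if tgt e \<in> X then In (tgt e) (lab e) else PIn e)
     else (if src e \<in> Y then Out (src e) (lab e) else POut e))"
    for G :: "'e set" and lab :: "'e \<Rightarrow> nat"
  define W where "W f = (\<Prod>e\<in>E. stub_weight src tgt Y X \<omega> e (f e))" for f :: "'e \<Rightarrow> ('e, 'u, 'v) stub"
  define R where "R = degree_graphs E src tgt Y k X l"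
  define A where "A = (SIGMA G:R. block_labellings C (B G))"
  have RE: "G \<subseteq> E" if "G \<in> R" for G using that by (auto simp: R_def degree_graphs_def)
  have finR: "finite R" unfolding R_def by (rule finite_degree_graphs[OF fin(1)])
  have cardO: "card {e \<in> E - G. src e = u} = card {e \<in> E. src e = u} - k u"
    if "G \<in> R" "u \<in> Y" for G u
  proof -
    have "{e \<in> E - G. src e = u} = {e \<in> E. src e = u} - {e \<in> G. src e = u}" by auto
    moreover have "{e \<in> G. src e = u} \<subseteq> {e \<in> E. src e = u}" using RE[OF that(1)] by auto
    ultimately show ?thesis using that fin RE[OF that(1)]
      by (simp add: card_Diff_subset finite_subset[OF RE[OF that(1)]] R_def degree_graphs_def)
  qed
  have cardI: "card {e \<in> G. tgt e = v} = l v" if "G \<in> R" "v \<in> X" for G v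
    using that by (auto simp: R_def degree_graphs_def)
  have cardL: "card (block_labellings C (B G)) =
      (\<Prod>v\<in>X. fact (l v)) * (\<Prod>u\<in>Y. fact (card {e \<in> E. src e = u} - k u))" if G: "G \<in> R" for G
  proof -
    have "card (block_labellings C (B G)) = (\<Prod>c\<in>C. fact (card (B G c)))"
      using fin G RE[OF G] finite_subset[OF RE[OF G]]
      by (intro card_block_labellings) (auto simp: C_def B_def disjoint_family_on_def)
    also have "\<dots> = (\<Prod>v\<in>X. fact (card (B G (Inl v)))) * (\<Prod>u\<in>Y. fact (card (B G (Inr u))))"
      unfolding C_def using fin by (subst prod.Plus) auto
    finally show ?thesis using cardO[OF G] cardI[OF G] by (simp add: B_def)
  qed
  have finL: "finite (block_labellings C (B G))" if "G \<in> R" for G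
    by (rule card_ge_0_finite) (simp add: cardL[OF that] prod_pos)
  have lab_bij: "bij_betw lab {e \<in> G. tgt e = v} {..<l v}"
    if "G \<in> R" "lab \<in> block_labellings C (B G)" "v \<in> X" for G lab v
    using that cardI[OF that(1,3)] unfolding block_labellings_def C_def B_def by (auto dest: bspec[of _ _ "Inl v"])
  have lab_bij': "bij_betw lab {e \<in> E - G. src e = u} {..<card {e \<in> E. src e = u} - k u}"
    if "G \<in> R" "lab \<in> block_labellings C (B G)" "u \<in> Y" for G lab u
    using that cardO[OF that(1,3)] unfolding block_labellings_def C_def B_def by (auto dest: bspec[of _ _ "Inr u"])
  have col_in: "col G lab \<in> inj_hits E S public_stubs T"
    if G: "G \<in> R" and lab: "lab \<in> block_labellings C (B G)" for G lab
  proof -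
    have lt: "lab e < l (tgt e)" if "e \<in> G" "tgt e \<in> X" for e
      using lab_bij[OF G lab that(2)] that by (auto simp: bij_betw_def)
    have lt': "lab e < card {e' \<in> E. src e' = src e} - k (src e)" if "e \<in> E - G" "src e \<in> Y" for e
      using lab_bij'[OF G lab that(2)] that by (auto simp: bij_betw_def)
    have inT: "In (tgt e) (lab e) \<in> T" if "e \<in> G" "tgt e \<in> X" for e
      using lt[OF that] that by (auto simp: T_def stub_target_def)
    have inT': "Out (src e) (lab e) \<in> T" if "e \<in> E - G" "src e \<in> Y" for e
      using lt'[OF that] that by (auto simp: T_def stub_target_def)
    have "col G lab \<in> E \<rightarrow>\<^sub>E S"
    proof (rule PiE_I)
      fix e assume "e \<in> E"
      then show "col G lab e \<in> S"
        using S inT[of e] inT'[of e] unfolding T_def by (auto simp: col_def)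
    qed (simp add: col_def)
    moreover have "inj_on (col G lab) E"
    proof (rule inj_onI)
      fix x y assume xy: "x \<in> E" "y \<in> E" "col G lab x = col G lab y"
      consider "x \<in> G" "y \<in> G" "tgt x \<in> X" "tgt y = tgt x" "lab x = lab y"
        | "x \<notin> G" "y \<notin> G" "src x \<in> Y" "src y = src x" "lab x = lab y" | "x = y"
        using xy by (auto simp: col_def split: if_splits)
      then show "x = y"
      proof cases
        case 1
        have "inj_on lab {e \<in> G. tgt e = tgt x}" using lab_bij[OF G lab 1(3)] by (rule bij_betw_imp_inj_on)
        then show ?thesis using 1 xy by (auto simp: inj_on_def)
      next
        case 2
        have "inj_on lab {e \<in> E - G. src e = src x}" using lab_bij'[OF G lab 2(3)] by (rule bij_betw_imp_inj_on)
        then show ?thesis using 2 xy by (auto simp: inj_on_def)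
      qed
    qed
    moreover have "col G lab ` E \<inter> public_stubs = T"
    proof (intro equalityI subsetI)
      fix s assume "s \<in> col G lab ` E \<inter> public_stubs"
      then show "s \<in> T" using inT inT' by (auto simp: col_def public_stubs_def split: if_splits)
    next
      fix s assume "s \<in> T"
      then consider v a where "s = In v a" "v \<in> X" "a < l v"
        | u a where "s = Out u a" "u \<in> Y" "a < card {e \<in> E. src e = u} - k u"
        by (auto simp: T_def stub_target_def)
      then show "s \<in> col G lab ` E \<inter> public_stubs"
      proof cases
        case 1
        then have "a \<in> lab ` {e \<in> G. tgt e = v}" using lab_bij[OF G lab 1(2)] by (simp add: bij_betw_def)
        then obtain e where "e \<in> G" "tgt e = v" "lab e = a" by auto
        then have "col G lab e = s" "e \<in> E" using 1 RE[OF G] by (auto simp: col_def)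
        then have "s \<in> col G lab ` E" by (metis image_eqI)
        then show ?thesis using 1 by (auto simp: public_stubs_def)
      next
        case 2
        then have "a \<in> lab ` {e \<in> E - G. src e = u}" using lab_bij'[OF G lab 2(2)] by (simp add: bij_betw_def)
        then obtain e where "e \<in> E - G" "src e = u" "lab e = a" by auto
        then have "col G lab e = s" "e \<in> E" using 2 by (auto simp: col_def)
        then have "s \<in> col G lab ` E" by (metis image_eqI)
        then show ?thesis using 2 by (auto simp: public_stubs_def)
      qed
    qed
    ultimately show ?thesis by (simp add: inj_hits_def)
  qed
  have col_inj: "inj_on (case_prod col) A"
  proof (rule inj_onI)
    fix p q assume p: "p \<in> A" and q: "q \<in> A" and eq: "case_prod col p = case_prod col q"
    obtain G lab H mab where pq: "p = (G, lab)" "q = (H, mab)" by (cases p; cases q)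
    have R: "G \<in> R" "H \<in> R" "lab \<in> block_labellings C (B G)" "mab \<in> block_labellings C (B H)"
      using p q by (auto simp: pq A_def)
    have e: "col G lab e = col H mab e" for e using eq by (simp add: pq)
    have "e \<in> G \<longleftrightarrow> e \<in> H" if "e \<in> E" for e
      using e[of e] that by (auto simp: col_def split: if_splits)
    then have GH: "G = H" using RE[OF R(1)] RE[OF R(2)] by blast
    have "lab e = mab e" for e
    proof (cases "e \<in> (\<Union>c\<in>C. B G c)")
      case True
      then have "e \<in> E \<and> (e \<in> G \<and> tgt e \<in> X \<or> e \<notin> G \<and> src e \<in> Y)"
        using RE[OF R(1)] by (auto simp: C_def B_def)
      then show ?thesis using e[of e] GH by (auto simp: col_def)
    next
      case False
      then show ?thesis using R GH by (auto simp: block_labellings_def extensional_def)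
    qed
    then show "p = q" using GH by (auto simp: pq)
  qed
  \<comment> \<open>A nonzero weight forces every link onto a stub of its own head or tail or onto
    its own private stub, so the graph and the numbering can be recovered from
    \<open>f\<close>.\<close>
  have col_surj: "f \<in> case_prod col ` A"
    if f: "f \<in> inj_hits E S public_stubs T" and W: "W f \<noteq> 0" for f
  proof -
    have ok: "stub_weight src tgt Y X \<omega> e (f e) \<noteq> 0" if "e \<in> E" for e
      using W that fin by (auto simp: W_def)
    have fE: "f \<in> extensional E" and inj: "inj_on f E" and hit: "f ` E \<inter> public_stubs = T"
      using f by (auto simp: inj_hits_def PiE_def)
    define G where "G = {e \<in> E. (\<exists>v a. f e = In v a) \<or> (\<exists>e'. f e = PIn e')}"
    have hitI: "v \<in> X \<and> a < l v" if "e \<in> E" "f e = In v a" for e v a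
    proof -
      have "f e \<in> public_stubs" using that(2) by (auto simp: public_stubs_def)
      then have "f e \<in> T" using hit that(1) by blast
      then show ?thesis using that by (auto simp: T_def stub_target_def)
    qed
    have hitO: "u \<in> Y \<and> a < card {e \<in> E. src e = u} - k u" if "e \<in> E" "f e = Out u a" for e u a
    proof -
      have "f e \<in> public_stubs" using that(2) by (auto simp: public_stubs_def)
      then have "f e \<in> T" using hit that(1) by blast
      then show ?thesis using that by (auto simp: T_def stub_target_def)
    qed
    have form: "(e \<in> G \<and> tgt e \<in> X \<and> (\<exists>a. f e = In (tgt e) a)) \<or> (e \<in> G \<and> tgt e \<notin> X \<and> f e = PIn e) \<or>
        (e \<notin> G \<and> src e \<in> Y \<and> (\<exists>a. f e = Out (src e) a)) \<or> (e \<notin> G \<and> src e \<notin> Y \<and> f e = POut e)"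
      if "e \<in> E" for e
      using ok[OF that] that hitI[OF that] hitO[OF that]
      by (cases "f e") (auto simp: stub_weight_def G_def split: if_splits)
    define num where "num e = (case f e of In v a \<Rightarrow> a | Out u a \<Rightarrow> a | _ \<Rightarrow> undefined)" for e
    have GE: "G \<subseteq> E" by (auto simp: G_def)
    have bI: "bij_betw num {e \<in> G. tgt e = v} {..<l v}" if v: "v \<in> X" for v
    proof -
      have fnum: "f e = In v (num e)" if "e \<in> G" "tgt e = v" for e
      proof -
        have "e \<in> E" using that GE by auto
        then have "\<exists>a. f e = In v a" using form[of e] that v by auto
        then show ?thesis by (auto simp: num_def)
      qed
      have "inj_on num {e \<in> G. tgt e = v}"
      proof (rule inj_onI)
        fix x y assume "x \<in> {e \<in> G. tgt e = v}" "y \<in> {e \<in> G. tgt e = v}" "num x = num y"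
        then have "f x = f y" "x \<in> E" "y \<in> E" using fnum[of x] fnum[of y] GE by auto
        then show "x = y" using inj by (auto simp: inj_on_def)
      qed
      moreover have "num e < l v" if "e \<in> G" "tgt e = v" for e
        using fnum[OF that] hitI[of e] that GE by auto
      moreover have "\<exists>e\<in>{e \<in> G. tgt e = v}. num e = a" if "a < l v" for a
      proof -
        have "In v a \<in> T" using v that by (auto simp: T_def stub_target_def)
        then obtain e where e: "e \<in> E" "f e = In v a" using hit by force
        then have "e \<in> G" "tgt e = v" using form[OF e(1)] by auto
        then show ?thesis using fnum[of e] e by auto
      qed
      ultimately show ?thesis by (auto simp: bij_betw_def image_iff)
    qed
    have bO: "bij_betw num {e \<in> E - G. src e = u} {..<card {e \<in> E. src e = u} - k u}" if u: "u \<in> Y" for u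
    proof -
      have fnum: "f e = Out u (num e)" if "e \<in> E - G" "src e = u" for e
      proof -
        have "e \<in> E" using that by auto
        then have "\<exists>a. f e = Out u a" using form[of e] that u by auto
        then show ?thesis by (auto simp: num_def)
      qed
      have "inj_on num {e \<in> E - G. src e = u}"
      proof (rule inj_onI)
        fix x y assume "x \<in> {e \<in> E - G. src e = u}" "y \<in> {e \<in> E - G. src e = u}" "num x = num y"
        then have "f x = f y" "x \<in> E" "y \<in> E" using fnum[of x] fnum[of y] by auto
        then show "x = y" using inj by (auto simp: inj_on_def)
      qed
      moreover have "num e < card {e \<in> E. src e = u} - k u" if "e \<in> E - G" "src e = u" for e
        using fnum[OF that] hitO[of e] that by auto
      moreover have "\<exists>e\<in>{e \<in> E - G. src e = u}. num e = a" if "a < card {e \<in> E. src e = u} - k u" for a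
      proof -
        have "Out u a \<in> T" using u that by (auto simp: T_def stub_target_def)
        then obtain e where e: "e \<in> E" "f e = Out u a" using hit by force
        then have "e \<notin> G" "src e = u" using form[OF e(1)] by auto
        then show ?thesis using fnum[of e] e by auto
      qed
      ultimately show ?thesis by (auto simp: bij_betw_def image_iff)
    qed
    have finG: "finite G" using fin GE by (auto intro: finite_subset)
    have "card {e \<in> G. src e = u} = k u" if u: "u \<in> Y" for u
    proof -
      have "card {e \<in> E - G. src e = u} = card {e \<in> E. src e = u} - k u"
        using bij_betw_same_card[OF bO[OF u]] by simp
      moreover have Esplit: "{e \<in> E. src e = u} = {e \<in> G. src e = u} \<union> {e \<in> E - G. src e = u}" using GE by auto
      have "card {e \<in> E. src e = u} = card {e \<in> G. src e = u} + card {e \<in> E - G. src e = u}"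
        unfolding Esplit using fin finG by (intro card_Un_disjoint) auto
      ultimately show ?thesis using k[OF u] by simp
    qed
    moreover have "card {e \<in> G. tgt e = v} = l v" if "v \<in> X" for v
      using bij_betw_same_card[OF bI[OF that]] by simp
    ultimately have GR: "G \<in> R" using GE by (auto simp: R_def degree_graphs_def)
    define lab where "lab = restrict num (\<Union>c\<in>C. B G c)"
    have "bij_betw lab (B G c) {..<card (B G c)}" if c: "c \<in> C" for c
    proof -
      have "bij_betw num (B G c) {..<card (B G c)}"
        using c bI bO cardI[OF GR] cardO[OF GR] by (auto simp: C_def B_def)
      then show ?thesis
        by (rule bij_betw_cong[THEN iffD1, rotated]) (use c in \<open>auto simp: lab_def\<close>)
    qed
    then have "lab \<in> block_labellings C (B G)" by (auto simp: block_labellings_def lab_def)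
    then have "(G, lab) \<in> A" using GR by (simp add: A_def)
    moreover have "col G lab = f"
    proof
      fix e
      show "col G lab e = f e"
      proof (cases "e \<in> E")
        case True
        have "lab e = num e" if "e \<in> G \<and> tgt e \<in> X \<or> e \<notin> G \<and> src e \<in> Y"
        proof -
          have "e \<in> B G (Inl (tgt e)) \<and> Inl (tgt e) \<in> C \<or> e \<in> B G (Inr (src e)) \<and> Inr (src e) \<in> C"
            using that True by (auto simp: C_def B_def)
          then have "e \<in> (\<Union>c\<in>C. B G c)" by blast
          then show ?thesis by (simp add: lab_def)
        qed
        then show ?thesis using form[OF True] True by (auto simp: col_def num_def)
      qed (use fE in \<open>auto simp: col_def extensional_def\<close>)
    qed
    ultimately show ?thesis by force
  qed
  have finH: "finite (inj_hits E S public_stubs T)"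
    unfolding inj_hits_def using fin by (intro finite_subset[OF _ finite_PiE[of E "\<lambda>_. S"]]) auto
  have Wcol: "W (col G lab) = (\<Prod>e\<in>G. \<omega> e)" if "G \<in> R" for G lab
  proof -
    have "W (col G lab) = (\<Prod>e\<in>E. if e \<in> G then \<omega> e else 1)"
      unfolding W_def by (intro prod.cong) (auto simp: col_def stub_weight_def)
    also have "\<dots> = (\<Prod>e\<in>G. \<omega> e)"
      using RE[OF that] fin by (simp add: prod.If_cases Int_absorb1)
    finally show ?thesis .
  qed
  have "(\<Sum>f\<in>inj_hits E S public_stubs T. W f) = (\<Sum>f\<in>case_prod col ` A. W f)"
    using finH col_in col_surj by (intro sum.mono_neutral_right) (auto simp: A_def)
  also have "\<dots> = (\<Sum>p\<in>A. W (case_prod col p))" using col_inj by (subst sum.reindex) auto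
  also have "\<dots> = (\<Sum>(G, lab)\<in>A. W (col G lab))" by (simp add: case_prod_unfold)
  also have "\<dots> = (\<Sum>G\<in>R. \<Sum>lab\<in>block_labellings C (B G). W (col G lab))"
    unfolding A_def using finR finL by (subst sum.Sigma) auto
  also have "\<dots> = (\<Sum>G\<in>R. real (card (block_labellings C (B G))) * (\<Prod>e\<in>G. \<omega> e))"
    by (intro sum.cong) (auto simp: Wcol)
  also have "\<dots> = (\<Prod>v\<in>X. fact (l v)) * (\<Prod>u\<in>Y. fact (card {e \<in> E. src e = u} - k u)) *
      graph_sum E src tgt Y k X l \<omega>"
    by (simp add: cardL graph_sum_def R_def sum_distrib_left)
  finally show ?thesis by (simp add: W_def T_def)
qed

text \<open>Up to a constant, \<open>b j\<close> is the weight of the injections that use the first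
  \<open>j\<close> stubs of \<open>m\<close>. The exchange is applied to the stub
  \<open>In m (j - 1)\<close>: without it the first \<open>j\<close> stubs become the first
  \<open>j - 1\<close>, and added to the first \<open>i\<close> it gives a set that only has to be
  renumbered into the first \<open>i + 1\<close>.\<close>

lemma degree_sequence_log_concave:
  fixes src :: "'e \<Rightarrow> 'u" and tgt :: "'e \<Rightarrow> 'v" and l :: "'v \<Rightarrow> nat"
  assumes fin: "finite E" "finite X" "finite Y" and m: "m \<notin> X"
    and \<omega>: "\<And>e. \<omega> e \<ge> 0" and ij: "i < j"
    and k: "\<And>u. u \<in> Y \<Longrightarrow> k u \<le> card {e \<in> E. src e = u}"
  defines "b \<equiv> \<lambda>j. fact j * graph_sum E src tgt Y k (insert m X) (l(m := j)) \<omega>"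
  shows "b j * b i \<le> b (j - 1) * b (i + 1)"
proof -
  define T where "T j = stub_target E src Y k (insert m X) (l(m := j))" for j
  define S :: "('e, 'u, 'v) stub set" where "S = T j \<union> PIn ` E \<union> POut ` E"
  define c :: real where "c = (\<Prod>v\<in>X. fact (l v)) * (\<Prod>u\<in>Y. fact (card {e \<in> E. src e = u} - k u))"
  define P where "P T = (\<Sum>f\<in>inj_hits E S public_stubs T. \<Prod>e\<in>E. stub_weight src tgt Y (insert m X) \<omega> e (f e))"
    for T :: "('e, 'u, 'v) stub set"
  have Tmono: "T i' \<subseteq> T j'" if "i' \<le> j'" for i' j'
    using that by (auto simp: T_def stub_target_def)
  have finT: "finite (T j)"
  proof -
    have "T j \<subseteq> (\<lambda>(v, a). In v a) ` (SIGMA v:insert m X. {..<(l(m := j)) v}) \<union>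
        (\<lambda>(u, a). Out u a) ` (SIGMA u:Y. {..<card {e \<in> E. src e = u} - k u})"
      by (force simp: T_def stub_target_def)
    then show ?thesis using fin by (auto intro: finite_subset)
  qed
  have finS: "finite S" using finT fin by (auto simp: S_def)
  have Pb: "P (T i') = c * b i'" if "i' \<le> j" for i'
  proof -
    have "(\<Prod>v\<in>insert m X. fact ((l(m := i')) v)) = (fact i' * (\<Prod>v\<in>X. fact (l v)) :: real)"
      using fin m by (auto intro!: prod.cong)
    then show ?thesis
      unfolding P_def T_def b_def c_def using fin finS k Tmono[OF that]
      by (subst graph_sum_stubs) (auto simp: S_def T_def)
  qed
  have c: "c > 0" by (auto simp: c_def intro!: mult_pos_pos prod_pos)
  have "P (T j) * P (T i) \<le> P (T j - {In m (j - 1)}) * P (insert (In m (j - 1)) (T i))"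
    unfolding P_def
  proof (rule alternating_exchange)
    show "T i \<subseteq> T j" using ij by (intro Tmono) simp
    show "T j \<subseteq> public_stubs" by (auto simp: T_def stub_target_def public_stubs_def)
    show "In m (j - 1) \<in> T j" "In m (j - 1) \<notin> T i" using ij by (auto simp: T_def stub_target_def)
    show "stub_weight src tgt Y (insert m X) \<omega> e s \<ge> 0" for e s
      using \<omega> by (auto simp: stub_weight_def split: stub.splits)
  qed (use fin finS in auto)
  also have "T j - {In m (j - 1)} = T (j - 1)"
    using ij m by (auto simp: T_def stub_target_def split: if_splits)
  finally have 1: "P (T j) * P (T i) \<le> P (T (j - 1)) * P (insert (In m (j - 1)) (T i))" .
  \<comment> \<open>All stubs of \<open>m\<close> carry the same weights, so exchanging the numbers
    \<open>j - 1\<close> and \<open>i\<close> changes no weighted count.\<close>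
  define \<pi> :: "('e, 'u, 'v) stub \<Rightarrow> ('e, 'u, 'v) stub" where "\<pi> = Transposition.transpose (In m (j - 1)) (In m i)"
  have pS: "\<pi> s \<in> S" if "s \<in> S" for s
    using that ij by (auto simp: \<pi>_def S_def T_def stub_target_def Transposition.transpose_def)
  have pp: "\<pi> s \<in> public_stubs \<longleftrightarrow> s \<in> public_stubs" for s
    by (auto simp: \<pi>_def Transposition.transpose_def public_stubs_def)
  have pi2: "\<pi> (\<pi> s) = s" for s by (simp add: \<pi>_def)
  have piT: "\<pi> ` insert (In m (j - 1)) (T i) = T (i + 1)"
  proof -
    have "insert (In m (j - 1)) (T i) - {In m (j - 1)} = T i"
      using ij by (auto simp: T_def stub_target_def)
    moreover have "\<pi> s = s" if "s \<in> T i" for s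
      using that ij by (auto simp: \<pi>_def T_def stub_target_def Transposition.transpose_def)
    then have "\<pi> ` T i = T i" by force
    ultimately have "\<pi> ` insert (In m (j - 1)) (T i) = insert (In m i) (T i)"
      by (simp add: \<pi>_def)
    also have "\<dots> = T (i + 1)" using m by (auto simp: T_def stub_target_def split: if_splits)
    finally show ?thesis .
  qed
  have piT': "\<pi> ` T (i + 1) = insert (In m (j - 1)) (T i)"
    unfolding piT[symmetric] by (simp add: image_image pi2)
  have hits: "restrict (\<pi> \<circ> f) E \<in> inj_hits E S public_stubs (\<pi> ` U)"
    if "f \<in> inj_hits E S public_stubs U" for f U
  proof -
    have "inj_on (restrict (\<pi> \<circ> f) E) E"
      using that by (auto simp: inj_hits_def inj_on_def) (metis pi2)
    moreover have "restrict (\<pi> \<circ> f) E ` E \<inter> public_stubs = \<pi> ` (f ` E \<inter> public_stubs)"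
      using pp by (force simp: image_iff)
    moreover have "restrict (\<pi> \<circ> f) E \<in> E \<rightarrow>\<^sub>E S"
      using that pS by (fastforce simp: inj_hits_def PiE_iff)
    ultimately show ?thesis using that by (simp add: inj_hits_def)
  qed
  have "P (insert (In m (j - 1)) (T i)) = P (T (i + 1))"
    unfolding P_def
  proof (rule sum.reindex_bij_witness[where i = "\<lambda>f. restrict (\<pi> \<circ> f) E" and j = "\<lambda>f. restrict (\<pi> \<circ> f) E"])
    fix f assume f: "f \<in> inj_hits E S public_stubs (insert (In m (j - 1)) (T i))"
    show "restrict (\<pi> \<circ> restrict (\<pi> \<circ> f) E) E = f"
      using f by (auto simp: inj_hits_def pi2 fun_eq_iff PiE_def extensional_def)
    show "restrict (\<pi> \<circ> f) E \<in> inj_hits E S public_stubs (T (i + 1))"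
      using hits[OF f] by (simp only: piT)
    have "stub_weight src tgt Y (insert m X) \<omega> e (\<pi> s) = stub_weight src tgt Y (insert m X) \<omega> e s" for e s
      by (auto simp: \<pi>_def Transposition.transpose_def stub_weight_def)
    then show "(\<Prod>e\<in>E. stub_weight src tgt Y (insert m X) \<omega> e (restrict (\<pi> \<circ> f) E e)) =
        (\<Prod>e\<in>E. stub_weight src tgt Y (insert m X) \<omega> e (f e))"
      by (intro prod.cong) auto
  next
    fix f assume f: "f \<in> inj_hits E S public_stubs (T (i + 1))"
    show "restrict (\<pi> \<circ> restrict (\<pi> \<circ> f) E) E = f"
      using f by (auto simp: inj_hits_def pi2 fun_eq_iff PiE_def extensional_def)
    show "restrict (\<pi> \<circ> f) E \<in> inj_hits E S public_stubs (insert (In m (j - 1)) (T i))"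
      using hits[OF f] by (simp only: piT')
  qed
  then have "c * b j * (c * b i) \<le> c * b (j - 1) * (c * b (i + 1))"
    using 1 Pb[of j] Pb[of i] Pb[of "j - 1"] Pb[of "i + 1"] ij by simp
  then have "c * c * (b j * b i) \<le> c * c * (b (j - 1) * b (i + 1))" by (simp add: mult_ac)
  then show ?thesis using c by simp
qed

section \<open>Capacity bounds for bipartite degree sequences\<close>

lemma g_fun_eq: "g_fun k = ln (fact k) - real k * ln (real k) + real k"
  by (cases "k = 0") (auto simp: g_fun_def ln_div ln_mult ln_realpow)

lemma exp_g_fun: "exp (g_fun k) * (real k ^ k * exp (- real k)) = fact k"
proof -
  have "real k ^ k > 0" by (cases "k = 0") auto
  then show ?thesis by (simp add: g_fun_def)
qed

lemma sum_exp_le: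
  fixes x :: real
  assumes "x \<ge> 0"
  shows "(\<Sum>j\<le>n. x ^ j / fact j) \<le> exp x"
proof -
  have "(\<Sum>j\<le>n. inverse (fact j) * x ^ j) \<le> (\<Sum>j. inverse (fact j) * x ^ j)"
    using assms by (intro sum_le_suminf summable_exp) auto
  also have "\<dots> = exp x" by (simp add: exp_def field_simps)
  finally show ?thesis by (simp add: field_simps)
qed

text \<open>A sequence \<open>N\<close> whose Poisson-normalised version is log-concave loses at most the factor
  \<open>exp (g l)\<close>, the inverse of the modal Poisson probability, against the best exponential tilt.\<close>

lemma log_concave_tilt:
  fixes N :: "nat \<Rightarrow> real"
  assumes N0: "\<And>j. N j \<ge> 0" and pos: "N l > 0" and \<delta>: "\<delta> > 0"
    and lc: "\<And>i j. i < j \<Longrightarrow> fact j * N j * (fact i * N i) \<le> fact (j - 1) * N (j - 1) * (fact (i + 1) * N (i + 1))"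
  obtains t where "t > 0" "(\<Sum>j\<le>B. N j * t ^ j) \<le> N l * t ^ l * exp (g_fun l + \<delta>)"
proof -
  define b where "b j = fact j * N j" for j
  have b0: "b j \<ge> 0" and bl: "b l > 0" for j using N0 pos by (auto simp: b_def)
  have lc': "b j * b i \<le> b (j - 1) * b (i + 1)" if "i < j" for i j
    using lc[OF that] by (simp add: b_def)
  \<comment> \<open>\<open>r\<close> is a growth ratio of \<open>b\<close> at \<open>l\<close>. By
    log-concavity the geometric sequence through \<open>b l\<close> with this ratio dominates
    \<open>b\<close>.\<close>
  obtain r where r: "r > 0" and br: "\<And>j. b j * r ^ l \<le> b l * r ^ j"
  proof (cases "l > 0 \<and> b (l - 1) > 0")
    case True
    define r where "r = b l / b (l - 1)"
    have r: "r > 0" using True bl by (simp add: r_def)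
    have up: "b (l + i) \<le> b l * r ^ i" for i
    proof (induction i)
      case (Suc i)
      have "b (l + Suc i) * b (l - 1) \<le> b (l + i) * b l"
        using lc'[of "l - 1" "l + Suc i"] True by simp
      then have "b (l + Suc i) \<le> b (l + i) * r" using True by (simp add: r_def field_simps)
      also have "\<dots> \<le> b l * r ^ i * r" using Suc r by (intro mult_right_mono) auto
      finally show ?case by (simp add: mult_ac)
    qed simp
    have down: "b (l - i) * r ^ i \<le> b l" if "i \<le> l" for i
      using that
    proof (induction i)
      case (Suc i)
      have "b l * b (l - Suc i) \<le> b (l - 1) * b (l - i)"
        using lc'[of "l - Suc i" l] Suc.prems by (simp add: Suc_diff_Suc)
      then have "b (l - Suc i) * r \<le> b (l - i)" using True by (simp add: r_def field_simps)
      then have "b (l - Suc i) * r * r ^ i \<le> b (l - i) * r ^ i" using r by (intro mult_right_mono) auto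
      then show ?case using Suc by (simp add: mult_ac)
    qed simp
    have "b j * r ^ l \<le> b l * r ^ j" for j
    proof (cases "j \<ge> l")
      case True
      then have "b j * r ^ l \<le> b l * r ^ (j - l) * r ^ l"
        using up[of "j - l"] r by (intro mult_right_mono) auto
      then show ?thesis using True by (simp add: mult.assoc flip: power_add)
    next
      case False
      then have "b j * r ^ (l - j) * r ^ j \<le> b l * r ^ j"
        using down[of "l - j"] r by (intro mult_right_mono) auto
      then show ?thesis using False by (simp add: mult.assoc flip: power_add)
    qed
    then show ?thesis using that r by blast
  next
    case False
    \<comment> \<open>In this case \<open>b\<close> vanishes below \<open>l\<close>, so only the
      growth above \<open>l\<close> has to be bounded. The summand 1 keeps \<open>r\<close> positive
      when \<open>b (l + 1) = 0\<close>.\<close>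
    define r where "r = b (l + 1) / b l + 1"
    have r: "r > 0" using bl b0[of "l + 1"] by (auto simp: r_def intro: add_nonneg_pos)
    have rl: "b (l + 1) \<le> r * b l" using bl by (simp add: r_def field_simps)
    have zero: "b j = 0" if "j < l" for j
    proof -
      have "b (l - 1) = 0" using False that b0[of "l - 1"] by auto
      then have "b l * b j \<le> 0" using lc'[OF that] by simp
      then show ?thesis using bl b0[of j] by (simp add: mult_le_0_iff)
    qed
    have up: "b (l + i) \<le> b l * r ^ i" for i
    proof (induction i)
      case (Suc i)
      have "b (l + Suc i) * b l \<le> b (l + i) * b (l + 1)" using lc'[of l "l + Suc i"] by simp
      also have "\<dots> \<le> b (l + i) * (r * b l)" using rl b0 by (intro mult_left_mono) auto
      finally have "b (l + Suc i) \<le> b (l + i) * r" using bl by (simp add: mult_ac)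
      also have "\<dots> \<le> b l * r ^ i * r" using Suc r by (intro mult_right_mono) auto
      finally show ?case by (simp add: mult_ac)
    qed simp
    have "b j * r ^ l \<le> b l * r ^ j" for j
    proof (cases "j \<ge> l")
      case True
      then have "b j * r ^ l \<le> b l * r ^ (j - l) * r ^ l"
        using up[of "j - l"] r by (intro mult_right_mono) auto
      then show ?thesis using True by (simp add: mult.assoc flip: power_add)
    qed (use zero bl r in auto)
    then show ?thesis using that r by blast
  qed
  have bound: "(\<Sum>j\<le>B. N j * t ^ j) \<le> b l / r ^ l * exp (r * t)" if "t > 0" for t
  proof -
    have "(\<Sum>j\<le>B. N j * t ^ j) \<le> (\<Sum>j\<le>B. b l / r ^ l * ((r * t) ^ j / fact j))"
    proof (rule sum_mono)
      fix j
      have "b j \<le> b l * r ^ j / r ^ l" using br[of j] r by (simp add: field_simps)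
      then have "b j * (t ^ j / fact j) \<le> b l * r ^ j / r ^ l * (t ^ j / fact j)"
        using that by (intro mult_right_mono) auto
      then show "N j * t ^ j \<le> b l / r ^ l * ((r * t) ^ j / fact j)"
        by (simp add: b_def power_mult_distrib)
    qed
    also have "\<dots> = b l / r ^ l * (\<Sum>j\<le>B. (r * t) ^ j / fact j)" by (simp add: sum_distrib_left)
    also have "\<dots> \<le> b l / r ^ l * exp (r * t)"
      using that r bl by (intro mult_left_mono sum_exp_le) auto
    finally show ?thesis .
  qed
  show ?thesis
  proof (cases "l = 0")
    case True
    \<comment> \<open>The optimal \<open>t = l / r\<close> would be 0, which is not allowed as a
      weight; the slack \<open>\<delta>\<close> pays for a small positive \<open>t\<close>.\<close>
    have "(\<Sum>j\<le>B. N j * (\<delta> / r) ^ j) \<le> N l * (\<delta> / r) ^ l * exp (g_fun l + \<delta>)"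
      using bound[of "\<delta> / r"] \<delta> r True by (simp add: b_def g_fun_eq)
    then show ?thesis using that[of "\<delta> / r"] \<delta> r by simp
  next
    case False
    \<comment> \<open>This \<open>t\<close> minimises \<open>exp (r * t) / t ^ l\<close>, and
      \<open>fact l * exp l / l ^ l\<close> is \<open>exp (g_fun l)\<close>.\<close>
    define t where "t = real l / r"
    have t: "t > 0" using False r by (simp add: t_def)
    have "b l / r ^ l * exp (r * t) = N l * t ^ l * exp (g_fun l)"
    proof -
      have "exp (g_fun l) * real l ^ l = fact l * exp (real l)"
        using exp_g_fun[of l] by (simp add: exp_minus field_simps)
      then show ?thesis using r by (simp add: t_def b_def power_divide field_simps)
    qed
    also have "\<dots> \<le> N l * t ^ l * exp (g_fun l + \<delta>)"
      using \<delta> pos t by (intro mult_left_mono) auto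
    finally show ?thesis using that[of t] t bound[OF t] by linarith
  qed
qed

section \<open>Freeing the degrees one at a time\<close>

text \<open>Graphs without a constraint at \<open>m\<close> are grouped by their degree at
  \<open>m\<close>; a factor \<open>t\<close> on each link into \<open>m\<close> makes the weighted
  count a generating function of this degree.\<close>

lemma graph_sum_split:
  fixes src :: "'e \<Rightarrow> 'u" and tgt :: "'e \<Rightarrow> 'v"
  assumes fin: "finite E" and m: "m \<notin> X"
  shows "graph_sum E src tgt Y k X l (\<lambda>e. \<omega> e * (if tgt e = m then t else 1)) =
    (\<Sum>j\<le>card E. graph_sum E src tgt Y k (insert m X) (l(m := j)) \<omega> * t ^ j)"
proof -
  define R where "R = degree_graphs E src tgt Y k X l"
  define d where "d G = card {e \<in> G. tgt e = m}" for G
  have RE: "G \<subseteq> E" "finite G" if "G \<in> R" for G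
    using that fin by (auto simp: R_def degree_graphs_def intro: finite_subset)
  have sub: "{G \<in> R. d G = j} = degree_graphs E src tgt Y k (insert m X) (l(m := j))" for j
    using m by (auto simp: R_def degree_graphs_def d_def)
  have wt: "(\<Prod>e\<in>G. \<omega> e * (if tgt e = m then t else 1)) = (\<Prod>e\<in>G. \<omega> e) * t ^ d G" if "G \<in> R" for G
    using RE[OF that] by (simp add: prod.distrib d_def prod.If_cases Int_def)
  have "(\<Sum>G\<in>R. (\<Prod>e\<in>G. \<omega> e) * t ^ d G) =
      (\<Sum>j\<le>card E. \<Sum>G\<in>{G \<in> R. d G = j}. (\<Prod>e\<in>G. \<omega> e) * t ^ d G)"
  proof (rule sum.group[symmetric])
    show "finite R" unfolding R_def by (rule finite_degree_graphs[OF fin])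
    show "d ` R \<subseteq> {..card E}"
      using RE fin by (auto simp: d_def intro!: card_mono)
  qed auto
  also have "\<dots> = (\<Sum>j\<le>card E. graph_sum E src tgt Y k (insert m X) (l(m := j)) \<omega> * t ^ j)"
    unfolding graph_sum_def sub[symmetric] by (intro sum.cong) (auto simp: sum_distrib_right)
  finally show ?thesis unfolding graph_sum_def R_def[symmetric] using wt by simp
qed

lemma graph_sum_nonneg: "(\<And>e. \<omega> e \<ge> 0) \<Longrightarrow> graph_sum E src tgt Y k X l \<omega> \<ge> 0"
  by (auto simp: graph_sum_def intro!: sum_nonneg prod_nonneg)

lemma graph_sum_pos:
  assumes "finite E" "\<And>e. \<omega> e > 0" "degree_graphs E src tgt Y k X l \<noteq> {}"
  shows "graph_sum E src tgt Y k X l \<omega> > 0"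
  unfolding graph_sum_def using assms(2,3)
  by (intro sum_pos finite_degree_graphs[OF assms(1)]) (auto intro!: prod_pos)

text \<open>Multiplied by factorials, the coefficients of the generating function in the degree at
  \<open>m\<close> are log-concave, so the right tilt \<open>t\<close> allows the constraint to be
  dropped at the cost \<open>exp (g_fun (l m) + \<delta>)\<close>.\<close>

lemma free_target:
  fixes src :: "'e \<Rightarrow> 'u" and tgt :: "'e \<Rightarrow> 'v"
  assumes fin: "finite E" "finite X" "finite Y" and m: "m \<notin> X" and \<omega>: "\<And>e. \<omega> e > 0" and \<delta>: "\<delta> > 0"
    and ne: "degree_graphs E src tgt Y k (insert m X) l \<noteq> {}"
  obtains t where "t > 0"
    "graph_sum E src tgt Y k X l (\<lambda>e. \<omega> e * (if tgt e = m then t else 1))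
      \<le> graph_sum E src tgt Y k (insert m X) l \<omega> * (t ^ l m * exp (g_fun (l m) + \<delta>))"
proof -
  define N where "N j = graph_sum E src tgt Y k (insert m X) (l(m := j)) \<omega>" for j
  obtain G where G: "G \<in> degree_graphs E src tgt Y k (insert m X) l" using ne by blast
  have k: "k u \<le> card {e \<in> E. src e = u}" if "u \<in> Y" for u
  proof -
    have "card {e \<in> G. src e = u} \<le> card {e \<in> E. src e = u}"
      using G fin by (intro card_mono) (auto simp: degree_graphs_def)
    then show ?thesis using G that by (auto simp: degree_graphs_def)
  qed
  have N0: "N j \<ge> 0" for j unfolding N_def using \<omega> by (intro graph_sum_nonneg) (simp add: less_imp_le)
  have pos: "N (l m) > 0" unfolding N_def using graph_sum_pos[OF fin(1) \<omega> ne] by simp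
  have lc: "fact j * N j * (fact i * N i) \<le> fact (j - 1) * N (j - 1) * (fact (i + 1) * N (i + 1))"
    if "i < j" for i j
    unfolding N_def using degree_sequence_log_concave[OF fin m _ that k] \<omega> by (simp add: less_imp_le)
  obtain t where t: "t > 0" "(\<Sum>j\<le>card E. N j * t ^ j) \<le> N (l m) * t ^ l m * exp (g_fun (l m) + \<delta>)"
    using log_concave_tilt[OF N0 pos \<delta> lc] by blast
  have "graph_sum E src tgt Y k X l (\<lambda>e. \<omega> e * (if tgt e = m then t else 1)) = (\<Sum>j\<le>card E. N j * t ^ j)"
    unfolding N_def by (rule graph_sum_split[OF fin(1) m])
  then show ?thesis using that[of t] t by (simp add: N_def mult_ac)
qed

text \<open>The weights already acquired for other targets are absorbed into
  \<open>\<omega>\<close>, which is why \<open>free_target\<close> allows arbitrary positive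
  weights. Setting \<open>y\<close> to 1 off \<open>F\<close> lets the next node contribute its own
  factor.\<close>

lemma free_targets:
  fixes src :: "'e \<Rightarrow> 'u" and tgt :: "'e \<Rightarrow> 'v" and l :: "'v \<Rightarrow> nat"
  assumes fin: "finite E" "finite Y" and \<omega>: "\<And>e. \<omega> e > 0" and \<delta>: "\<delta> > 0"
    and F: "finite F"
  shows "finite X \<Longrightarrow> F \<inter> X = {} \<Longrightarrow> degree_graphs E src tgt Y k (X \<union> F) l \<noteq> {} \<Longrightarrow>
    \<exists>y. (\<forall>v. y v > 0) \<and> (\<forall>v. v \<notin> F \<longrightarrow> y v = 1) \<and>
      graph_sum E src tgt Y k X l (\<lambda>e. \<omega> e * y (tgt e))
      \<le> graph_sum E src tgt Y k (X \<union> F) l \<omega> * (\<Prod>v\<in>F. y v ^ l v * exp (g_fun (l v) + \<delta>))"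
  using F
proof (induction F arbitrary: X rule: finite_induct)
  case empty
  show ?case by (rule exI[of _ "\<lambda>_. 1"]) simp
next
  case (insert m F)
  have eq: "insert m X \<union> F = X \<union> insert m F" by auto
  have "F \<inter> insert m X = {}" using insert.prems insert.hyps by auto
  then obtain y where y: "\<And>v. y v > 0" "\<And>v. v \<notin> F \<Longrightarrow> y v = (1::real)"
    and le: "graph_sum E src tgt Y k (insert m X) l (\<lambda>e. \<omega> e * y (tgt e))
      \<le> graph_sum E src tgt Y k (X \<union> insert m F) l \<omega> * (\<Prod>v\<in>F. y v ^ l v * exp (g_fun (l v) + \<delta>))"
    using insert.IH[of "insert m X"] insert.prems unfolding eq by auto
  have ne: "degree_graphs E src tgt Y k (insert m X) l \<noteq> {}"
    using insert.prems(3) by (auto simp: degree_graphs_def)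
  have m: "m \<notin> X" using insert.prems by auto
  have wpos: "\<omega> e * y (tgt e) > 0" for e using \<omega> y by simp
  obtain t where t: "t > 0"
    "graph_sum E src tgt Y k X l (\<lambda>e. \<omega> e * y (tgt e) * (if tgt e = m then t else 1))
      \<le> graph_sum E src tgt Y k (insert m X) l (\<lambda>e. \<omega> e * y (tgt e)) * (t ^ l m * exp (g_fun (l m) + \<delta>))"
    by (rule free_target[OF fin(1) insert.prems(1) fin(2) m wpos \<delta> ne])
  define y' where "y' = y(m := t)"
  have y'eq: "\<omega> e * y (tgt e) * (if tgt e = m then t else 1) = \<omega> e * y' (tgt e)" for e
    using y(2)[of m] insert.hyps by (simp add: y'_def)
  have "graph_sum E src tgt Y k X l (\<lambda>e. \<omega> e * y' (tgt e))
      \<le> graph_sum E src tgt Y k (insert m X) l (\<lambda>e. \<omega> e * y (tgt e)) * (t ^ l m * exp (g_fun (l m) + \<delta>))"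
    using t(2) by (simp add: y'eq)
  also have "\<dots> \<le> (graph_sum E src tgt Y k (X \<union> insert m F) l \<omega> * (\<Prod>v\<in>F. y v ^ l v * exp (g_fun (l v) + \<delta>))) *
      (t ^ l m * exp (g_fun (l m) + \<delta>))"
    using le t(1) by (intro mult_right_mono) auto
  also have "(\<Prod>v\<in>F. y v ^ l v * exp (g_fun (l v) + \<delta>)) = (\<Prod>v\<in>F. y' v ^ l v * exp (g_fun (l v) + \<delta>))"
    using insert.hyps by (intro prod.cong) (auto simp: y'_def)
  also have "graph_sum E src tgt Y k (X \<union> insert m F) l \<omega> * (\<Prod>v\<in>F. y' v ^ l v * exp (g_fun (l v) + \<delta>)) *
      (t ^ l m * exp (g_fun (l m) + \<delta>)) =
      graph_sum E src tgt Y k (X \<union> insert m F) l \<omega> * (\<Prod>v\<in>insert m F. y' v ^ l v * exp (g_fun (l v) + \<delta>))"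
    using insert.hyps by (simp add: y'_def mult_ac)
  finally show ?case
    using y t(1) by (intro exI[of _ y']) (auto simp: y'_def)
qed

lemma degree_graphs_swap: "degree_graphs E src tgt Y k X l = degree_graphs E tgt src X l Y k"
  by (auto simp: degree_graphs_def)

lemma graph_sum_unconstrained:
  "finite E \<Longrightarrow> graph_sum E src tgt {} k {} l \<omega> = (\<Prod>e\<in>E. 1 + \<omega> e)"
proof -
  assume "finite E"
  then have "(\<Prod>e\<in>E. \<omega> e + 1) = (\<Sum>G\<in>Pow E. \<Prod>e\<in>G. \<omega> e)" by (simp add: prod_add)
  moreover have "degree_graphs E src tgt {} k {} l = Pow E" by (auto simp: degree_graphs_def)
  ultimately show ?thesis by (simp add: graph_sum_def add.commute)
qed

text \<open>If all links share one target, the only degree is the number of links.\<close>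

lemma single_capacity:
  fixes E :: "'e set"
  assumes fin: "finite E" and \<delta>: "\<delta> > 0" and ne: "{G. G \<subseteq> E \<and> card G = l} \<noteq> {}"
  obtains t :: real where "t > 0"
    "(\<Prod>e\<in>E. 1 + t) \<le> card {G. G \<subseteq> E \<and> card G = l} * t ^ l * exp (g_fun l + \<delta>)"
proof -
  have R: "degree_graphs E (\<lambda>_. ()) (\<lambda>_. ()) {} (\<lambda>_. 0) {()} (\<lambda>_. l) = {G. G \<subseteq> E \<and> card G = l}"
    by (auto simp: degree_graphs_def)
  obtain t where "t > 0" "graph_sum E (\<lambda>_. ()) (\<lambda>_. ()) {} (\<lambda>_. 0) {} (\<lambda>_. l) (\<lambda>e. 1 * (if () = () then t else 1))
      \<le> graph_sum E (\<lambda>_. ()) (\<lambda>_. ()) {} (\<lambda>_. 0) {()} (\<lambda>_. l) (\<lambda>_. 1) * (t ^ l * exp (g_fun l + \<delta>))"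
    using free_target[OF fin, of "{}" "{}" "()" "\<lambda>_. 1" \<delta> "\<lambda>_. ()" "\<lambda>_. ()" "\<lambda>_. 0" "\<lambda>_. l"] \<delta> ne
    by (auto simp: R)
  then show ?thesis using that[of t]
    by (simp add: graph_sum_unconstrained[OF fin]) (simp add: graph_sum_def R mult_ac)
qed

text \<open>The targets are freed while the sources are still constrained; the sources are freed
  after exchanging the two roles, under the weights \<open>y\<close>. With no constraint left, the
  weighted count factorises over the links.\<close>

lemma bipartite_capacity:
  fixes src :: "'e \<Rightarrow> 'u" and tgt :: "'e \<Rightarrow> 'v"
  assumes fin: "finite E" "finite U" "finite V" and \<delta>: "\<delta> > 0"
    and ne: "degree_graphs E src tgt U k V l \<noteq> {}"
  obtains x y where "\<And>u. x u > (0::real)" "\<And>v. y v > (0::real)"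
    "(\<Prod>e\<in>E. 1 + x (src e) * y (tgt e)) \<le> card (degree_graphs E src tgt U k V l) *
      (\<Prod>u\<in>U. x u ^ k u * exp (g_fun (k u) + \<delta>)) * (\<Prod>v\<in>V. y v ^ l v * exp (g_fun (l v) + \<delta>))"
proof -
  obtain y where y: "\<And>v. y v > (0::real)"
    "graph_sum E src tgt U k {} l (\<lambda>e. 1 * y (tgt e))
      \<le> graph_sum E src tgt U k ({} \<union> V) l (\<lambda>_. 1) * (\<Prod>v\<in>V. y v ^ l v * exp (g_fun (l v) + \<delta>))"
    using free_targets[OF fin(1,2) _ \<delta> fin(3), of "\<lambda>_. 1" "{}" src tgt k l] ne by auto
  have ne': "degree_graphs E tgt src {} l ({} \<union> U) k \<noteq> {}"
    using ne by (auto simp: degree_graphs_def)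
  obtain x where x: "\<And>u. x u > (0::real)"
    "graph_sum E tgt src {} l {} k (\<lambda>e. y (tgt e) * x (src e))
      \<le> graph_sum E tgt src {} l ({} \<union> U) k (\<lambda>e. y (tgt e)) * (\<Prod>u\<in>U. x u ^ k u * exp (g_fun (k u) + \<delta>))"
    using free_targets[OF fin(1) finite.emptyI _ \<delta> fin(2) finite.emptyI _ ne', of "\<lambda>e. y (tgt e)"] y(1) by auto
  have "(\<Prod>e\<in>E. 1 + x (src e) * y (tgt e)) \<le>
      graph_sum E src tgt U k {} l (\<lambda>e. y (tgt e)) * (\<Prod>u\<in>U. x u ^ k u * exp (g_fun (k u) + \<delta>))"
    using x(2) by (simp add: graph_sum_unconstrained[OF fin(1)] mult.commute)
      (simp add: graph_sum_def degree_graphs_swap[of E tgt src])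
  also have "\<dots> \<le> (card (degree_graphs E src tgt U k V l) * (\<Prod>v\<in>V. y v ^ l v * exp (g_fun (l v) + \<delta>))) *
      (\<Prod>u\<in>U. x u ^ k u * exp (g_fun (k u) + \<delta>))"
    using y(2) x(1) by (intro mult_right_mono) (auto simp: graph_sum_def less_imp_le intro!: prod_nonneg)
  finally show ?thesis using that[of x y] x(1) y(1) by (simp add: mult_ac)
qed

section \<open>Undirected graphs: arcs with equal in- and out-degrees\<close>

text \<open>Such a permutation decomposes the arcs of \<open>Z\<close> into closed walks: each arc
  is followed by one that starts at its head.\<close>

definition arc_config :: "('a \<times> 'a) set \<Rightarrow> ('a \<times> 'a \<Rightarrow> 'a \<times> 'a) \<Rightarrow> bool" where
  "arc_config Z \<rho> \<longleftrightarrow> \<rho> permutes Z \<and> (\<forall>a\<in>Z. snd a = fst (\<rho> a))"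

text \<open>The colours should alternate along each closed walk, which is impossible on a walk of
  odd length; a defect is a place where two consecutive arcs have the same colour.\<close>

definition defects :: "('a \<times> 'a) set \<Rightarrow> ('a \<times> 'a \<Rightarrow> 'a \<times> 'a) \<Rightarrow> ('a \<times> 'a \<Rightarrow> bool) \<Rightarrow> ('a \<times> 'a) set" where
  "defects Z \<rho> \<kappa> = {a \<in> Z. \<kappa> (\<rho> a) = \<kappa> a}"

definition min_config :: "('a \<times> 'a) set \<Rightarrow> ('a \<times> 'a \<Rightarrow> 'a \<times> 'a) \<Rightarrow> ('a \<times> 'a \<Rightarrow> bool) \<Rightarrow> bool" where
  "min_config Z \<rho> \<kappa> \<longleftrightarrow> arc_config Z \<rho> \<and>
     (\<forall>\<rho>' \<kappa>'. arc_config Z \<rho>' \<longrightarrow> card (defects Z \<rho> \<kappa>) \<le> card (defects Z \<rho>' \<kappa>'))"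

lemma defects_subset: "defects Z \<rho> \<kappa> \<subseteq> Z"
  by (auto simp: defects_def)

lemma arc_config_pow:
  assumes "arc_config Z \<rho>" "x \<in> Z"
  shows "(\<rho> ^^ n) x \<in> Z"
  using assms by (induction n) (auto simp: arc_config_def permutes_in_image)

text \<open>Flipping the colours of the \<open>n\<close> arcs that follow \<open>x\<close> affects
  only the status of \<open>x\<close> and of \<open>(\<rho> ^^ n) x\<close>. The exclusive or also
  covers the case in which these coincide.\<close>

lemma toggle_defects:
  assumes Z: "arc_config Z \<rho>" and x: "x \<in> Z"
  shows "\<exists>\<kappa>'. \<forall>a. a \<in> defects Z \<rho> \<kappa>' \<longleftrightarrow> (a \<in> defects Z \<rho> \<kappa>) \<noteq> ((a = x) \<noteq> (a = (\<rho> ^^ n) x))"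
proof (induction n)
  case 0
  show ?case by (rule exI[of _ \<kappa>]) simp
next
  case (Suc n)
  then obtain \<kappa>' where \<kappa>': "\<And>a. a \<in> defects Z \<rho> \<kappa>' \<longleftrightarrow> (a \<in> defects Z \<rho> \<kappa>) \<noteq> ((a = x) \<noteq> (a = (\<rho> ^^ n) x))"
    by blast
  define y where "y = (\<rho> ^^ n) x"
  have y: "y \<in> Z" "\<rho> y \<in> Z" using arc_config_pow[OF Z x, of n] arc_config_pow[OF Z x, of "Suc n"] by (auto simp: y_def)
  have inj: "\<rho> a = \<rho> b \<longleftrightarrow> a = b" for a b
    using Z permutes_inj[of \<rho> Z] by (auto simp: arc_config_def inj_eq)
  define \<kappa>'' where "\<kappa>'' = \<kappa>'(\<rho> y := \<not> \<kappa>' (\<rho> y))"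
  have "a \<in> defects Z \<rho> \<kappa>'' \<longleftrightarrow> (a \<in> defects Z \<rho> \<kappa>') \<noteq> ((a = y) \<noteq> (a = \<rho> y))" for a
    using y inj[of a y] by (auto simp: defects_def \<kappa>''_def)
  then have "a \<in> defects Z \<rho> \<kappa>'' \<longleftrightarrow> (a \<in> defects Z \<rho> \<kappa>) \<noteq> ((a = x) \<noteq> (a = (\<rho> ^^ Suc n) x))" for a
    using \<kappa>'[of a] by (auto simp: y_def)
  then show ?case by blast
qed

section \<open>Moving defects in a minimal configuration\<close>

context
  fixes Z :: "('a \<times> 'a) set"
  assumes finZ: "finite Z"
begin

lemma finite_defects: "finite (defects Z \<rho> \<kappa>)"
  by (rule finite_subset[OF defects_subset finZ])

text \<open>Were there already a defect at the destination, the two would cancel, against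
  minimality.\<close>

lemma move_defect:
  assumes m: "min_config Z \<rho> \<kappa>" and x: "x \<in> defects Z \<rho> \<kappa>"
  obtains \<kappa>' where "min_config Z \<rho> \<kappa>'"
    "defects Z \<rho> \<kappa>' = insert ((\<rho> ^^ n) x) (defects Z \<rho> \<kappa> - {x})"
    "(\<rho> ^^ n) x \<notin> defects Z \<rho> \<kappa> - {x}"
proof -
  define y where "y = (\<rho> ^^ n) x"
  define \<Delta> where "\<Delta> = defects Z \<rho> \<kappa>"
  have Z: "arc_config Z \<rho>" and xZ: "x \<in> Z" using m x by (auto simp: min_config_def defects_def)
  obtain \<kappa>' where \<kappa>': "\<And>a. a \<in> defects Z \<rho> \<kappa>' \<longleftrightarrow> (a \<in> \<Delta>) \<noteq> ((a = x) \<noteq> (a = y))"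
    using toggle_defects[OF Z xZ, of \<kappa> n] by (auto simp: y_def \<Delta>_def)
  have le: "card \<Delta> \<le> card (defects Z \<rho> \<kappa>')" using m Z by (auto simp: min_config_def \<Delta>_def)
  have fin: "finite \<Delta>" unfolding \<Delta>_def by (rule finite_defects)
  have x\<Delta>: "x \<in> \<Delta>" using x by (simp add: \<Delta>_def)
  have y\<Delta>: "y \<notin> \<Delta> - {x}"
  proof
    assume "y \<in> \<Delta> - {x}"
    then have "defects Z \<rho> \<kappa>' \<subseteq> \<Delta> - {x}" using \<kappa>' x\<Delta> by auto
    then have "card (defects Z \<rho> \<kappa>') \<le> card (\<Delta> - {x})" using fin by (intro card_mono) auto
    also have "\<dots> < card \<Delta>" using fin x\<Delta> by (intro card_Diff1_less)
    finally show False using le by simp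
  qed
  have eq: "defects Z \<rho> \<kappa>' = insert y (\<Delta> - {x})" using \<kappa>' x\<Delta> y\<Delta> by (cases "x = y") auto
  have "card (insert y (\<Delta> - {x})) = card \<Delta>" using fin y\<Delta> card_Suc_Diff1[OF fin x\<Delta>] by simp
  then have "min_config Z \<rho> \<kappa>'" using m by (auto simp: min_config_def eq \<Delta>_def)
  then show ?thesis using that eq y\<Delta> by (auto simp: y_def \<Delta>_def)
qed

lemma move_two_defects:
  assumes m: "min_config Z \<rho> \<kappa>" and ab: "a \<in> defects Z \<rho> \<kappa>" "b \<in> defects Z \<rho> \<kappa>" "a \<noteq> b"
  obtains \<kappa>' where "min_config Z \<rho> \<kappa>'" "(\<rho> ^^ n) a \<in> defects Z \<rho> \<kappa>'" "(\<rho> ^^ i) b \<in> defects Z \<rho> \<kappa>'"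
    "(\<rho> ^^ n) a \<noteq> (\<rho> ^^ i) b"
    "card (defects Z \<rho> \<kappa>') = card (defects Z \<rho> \<kappa>)"
proof -
  obtain \<kappa>1 where 1: "min_config Z \<rho> \<kappa>1"
    "defects Z \<rho> \<kappa>1 = insert ((\<rho> ^^ n) a) (defects Z \<rho> \<kappa> - {a})"
    "(\<rho> ^^ n) a \<notin> defects Z \<rho> \<kappa> - {a}"
    by (rule move_defect[OF m ab(1)])
  have b: "b \<in> defects Z \<rho> \<kappa>1" unfolding 1(2) using ab by blast
  have ne: "(\<rho> ^^ n) a \<noteq> b"
  proof
    assume "(\<rho> ^^ n) a = b"
    moreover have "b \<in> defects Z \<rho> \<kappa> - {a}" using ab(2,3) by simp
    ultimately show False using 1(3) by (simp only: simp_thms)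
  qed
  obtain \<kappa>2 where 2: "min_config Z \<rho> \<kappa>2"
    "defects Z \<rho> \<kappa>2 = insert ((\<rho> ^^ i) b) (defects Z \<rho> \<kappa>1 - {b})"
    "(\<rho> ^^ i) b \<notin> defects Z \<rho> \<kappa>1 - {b}"
    by (rule move_defect[OF 1(1) b])
  have "card (defects Z \<rho> \<kappa>2) = card (defects Z \<rho> \<kappa>)"
    using m 2(1) unfolding min_config_def by (meson le_antisym)
  moreover have "(\<rho> ^^ n) a \<in> defects Z \<rho> \<kappa>1 - {b}" unfolding 1(2) using ne by blast
  then have "(\<rho> ^^ n) a \<noteq> (\<rho> ^^ i) b" "(\<rho> ^^ n) a \<in> defects Z \<rho> \<kappa>2"
    unfolding 2(2) using 2(3) by (metis, blast)
  moreover have "(\<rho> ^^ i) b \<in> defects Z \<rho> \<kappa>2" unfolding 2(2) by blast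
  ultimately show ?thesis using that 2(1) by blast
qed

text \<open>Flipping all colours on a whole closed walk keeps the defects, so arcs on different
  walks can be given equal or different colours at will.\<close>

lemma recolour_orbit:
  assumes m: "min_config Z \<rho> \<kappa>" and b: "\<And>n. b \<noteq> (\<rho> ^^ n) a"
  obtains \<kappa>' where "min_config Z \<rho> \<kappa>'" "defects Z \<rho> \<kappa>' = defects Z \<rho> \<kappa>" "(\<kappa>' a = \<kappa>' b) = e"
proof (cases "(\<kappa> a = \<kappa> b) = e")
  case True
  then show ?thesis using that m by blast
next
  case False
  define S where "S = range (\<lambda>n. (\<rho> ^^ n) a)"
  have perm: "\<rho> permutes Z" using m by (auto simp: min_config_def arc_config_def)
  then have "permutation \<rho>" using finZ by (auto simp: permutation_permutes)
  then obtain N where N: "\<rho> ^^ N = id" "N > 0" using permutation_is_nilpotent by blast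
  have fwd: "\<rho> z \<in> S" if "z \<in> S" for z
  proof -
    obtain n where "z = (\<rho> ^^ n) a" using \<open>z \<in> S\<close> by (auto simp: S_def)
    then have "\<rho> z = (\<rho> ^^ Suc n) a" by simp
    then show ?thesis unfolding S_def by (rule range_eqI)
  qed
  have pow: "(\<rho> ^^ i) z \<in> S" if "z \<in> S" for i z using that fwd by (induction i) auto
  have bwd: "z \<in> S" if "\<rho> z \<in> S" for z
  proof -
    have "(\<rho> ^^ (N - 1)) (\<rho> z) = (\<rho> ^^ N) z"
      using N(2) by (metis Suc_diff_1 funpow_Suc_right o_apply)
    then show ?thesis using pow[OF that, of "N - 1"] N(1) by simp
  qed
  define \<kappa>' where "\<kappa>' z = (\<kappa> z \<noteq> (z \<in> S))" for z
  have iff: "\<rho> z \<in> S \<longleftrightarrow> z \<in> S" for z using fwd bwd by blast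
  have "\<kappa>' (\<rho> z) = \<kappa>' z \<longleftrightarrow> \<kappa> (\<rho> z) = \<kappa> z" for z
    unfolding \<kappa>'_def iff by (cases "z \<in> S") simp_all
  then have "defects Z \<rho> \<kappa>' = defects Z \<rho> \<kappa>" by (simp only: defects_def)
  moreover have "a \<in> S" unfolding S_def by (rule range_eqI[of _ _ 0]) simp
  moreover have "b \<notin> S" using b by (auto simp: S_def)
  ultimately show ?thesis using that[of \<kappa>'] False m by (auto simp: min_config_def \<kappa>'_def)
qed

text \<open>Two defects on the same closed walk could be moved together and would cancel.\<close>

lemma defect_orbits_distinct:
  assumes m: "min_config Z \<rho> \<kappa>" and ab: "a \<in> defects Z \<rho> \<kappa>" "b \<in> defects Z \<rho> \<kappa>" "a \<noteq> b"
  shows "b \<noteq> (\<rho> ^^ n) a"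
proof
  assume eq: "b = (\<rho> ^^ n) a"
  have "(\<rho> ^^ n) a \<notin> defects Z \<rho> \<kappa> - {a}" by (rule move_defect[OF m ab(1)])
  then show False unfolding eq[symmetric] using ab by simp
qed

text \<open>Exchanging the successors of two arcs with a common head is how closed walks are joined
  or split.\<close>

lemma transpose_config:
  assumes Z: "arc_config Z \<rho>" and ab: "a \<in> Z" "b \<in> Z" "snd a = snd b"
  shows "arc_config Z (\<rho> \<circ> Transposition.transpose a b)"
  unfolding arc_config_def
proof (intro conjI ballI)
  show "\<rho> \<circ> Transposition.transpose a b permutes Z"
    using Z ab by (intro permutes_compose permutes_swap_id) (auto simp: arc_config_def)
  fix c assume "c \<in> Z"
  then show "snd c = fst ((\<rho> \<circ> Transposition.transpose a b) c)"
    using Z ab by (auto simp: arc_config_def Transposition.transpose_def)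
qed

text \<open>If the walks of two defects meet at a common head, exchanging the successors there joins
  them. Once \<open>a\<close> and \<open>b\<close> are coloured differently, both defects disappear,
  against minimality.\<close>

lemma defect_heads_distinct:
  assumes m: "min_config Z \<rho> \<kappa>" and ab: "a \<in> defects Z \<rho> \<kappa>" "b \<in> defects Z \<rho> \<kappa>" "a \<noteq> b"
  shows "snd a \<noteq> snd b"
proof
  assume eq: "snd a = snd b"
  obtain \<kappa>' where \<kappa>': "min_config Z \<rho> \<kappa>'" "defects Z \<rho> \<kappa>' = defects Z \<rho> \<kappa>" "(\<kappa>' a = \<kappa>' b) = False"
    by (rule recolour_orbit[OF m defect_orbits_distinct[OF m ab]])
  have abZ: "a \<in> Z" "b \<in> Z" using ab by (auto simp: defects_def)
  define \<rho>2 where "\<rho>2 = \<rho> \<circ> Transposition.transpose a b"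
  have Z2: "arc_config Z \<rho>2" unfolding \<rho>2_def
    using transpose_config[OF _ abZ eq] m by (simp add: min_config_def)
  have col: "\<kappa>' (\<rho> a) = \<kappa>' a" "\<kappa>' (\<rho> b) = \<kappa>' b" using ab \<kappa>'(2) by (auto simp: defects_def)
  have "defects Z \<rho>2 \<kappa>' \<subseteq> defects Z \<rho> \<kappa>' - {a}"
  proof
    fix c assume c: "c \<in> defects Z \<rho>2 \<kappa>'"
    have "c \<noteq> a" "c \<noteq> b" using c col \<kappa>'(3) by (auto simp: defects_def \<rho>2_def)
    then show "c \<in> defects Z \<rho> \<kappa>' - {a}" using c by (auto simp: defects_def \<rho>2_def)
  qed
  then have "card (defects Z \<rho>2 \<kappa>') \<le> card (defects Z \<rho> \<kappa>' - {a})"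
    by (intro card_mono) (auto simp: finite_defects)
  also have "\<dots> < card (defects Z \<rho> \<kappa>')"
    using ab \<kappa>' by (intro card_Diff1_less finite_defects) auto
  finally show False using \<kappa>'(1) Z2 unfolding min_config_def by (meson leD)
qed

text \<open>If an arc \<open>c\<close> led from the head of \<open>a\<close> to the head of
  \<open>b\<close>, the walk of \<open>a\<close> could be rerouted through \<open>c\<close> without
  a new defect; moving the defect from \<open>a\<close> to \<open>c\<close> would then put two
  defects on one head.\<close>

lemma no_arc_between_defects:
  assumes m: "min_config Z \<rho> \<kappa>" and ab: "a \<in> defects Z \<rho> \<kappa>" "b \<in> defects Z \<rho> \<kappa>" "a \<noteq> b"
    and c: "c \<in> Z" "fst c = snd a"
  shows "snd c \<noteq> snd b"
proof
  assume eq: "snd c = snd b"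
  have Z: "arc_config Z \<rho>" using m by (simp add: min_config_def)
  have far: "snd ((\<rho> ^^ n) a) \<noteq> snd b" for n
  proof -
    obtain \<kappa>' where "min_config Z \<rho> \<kappa>'" "(\<rho> ^^ n) a \<in> defects Z \<rho> \<kappa>'" "(\<rho> ^^ 0) b \<in> defects Z \<rho> \<kappa>'"
      "(\<rho> ^^ n) a \<noteq> (\<rho> ^^ 0) b" by (rule move_two_defects[OF m ab])
    then show ?thesis using defect_heads_distinct[of \<rho> \<kappa>' "(\<rho> ^^ n) a" "(\<rho> ^^ 0) b"] by simp
  qed
  \<comment> \<open>The defect of \<open>a\<close> can be moved to any arc of its walk, whose head
    therefore differs from that of \<open>b\<close>. So \<open>c\<close> is on another walk, and its
    colour can be matched to that of \<open>a\<close>.\<close>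
  have c_far: "c \<noteq> (\<rho> ^^ n) a" for n using far[of n] eq by auto
  have "c \<in> \<rho> ` Z" using Z c permutes_image[of \<rho> Z] by (auto simp: arc_config_def)
  then obtain c0 where c0: "c0 \<in> Z" "\<rho> c0 = c" by auto
  have c0a: "snd c0 = snd a" using Z c0 c by (auto simp: arc_config_def)
  have c0_ne: "c0 \<noteq> a" using c0 c_far[of 1] by auto
  obtain \<kappa>' where \<kappa>': "min_config Z \<rho> \<kappa>'" "defects Z \<rho> \<kappa>' = defects Z \<rho> \<kappa>" "(\<kappa>' a = \<kappa>' c) = True"
    by (rule recolour_orbit[OF m c_far])
  have c0_nd: "c0 \<notin> defects Z \<rho> \<kappa>'"
    using defect_heads_distinct[OF m ab(1), of c0] c0_ne c0a \<kappa>'(2) by auto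
  have aZ: "a \<in> Z" using ab by (auto simp: defects_def)
  \<comment> \<open>The new successor of \<open>a\<close> is \<open>c\<close>, which has the colour
    of \<open>a\<close>, so \<open>a\<close> stays a defect. The predecessor \<open>c0\<close> of
    \<open>c\<close> gets a successor of the same colour as its former one, so it does not become a
    defect.\<close>
  define \<rho>2 where "\<rho>2 = \<rho> \<circ> Transposition.transpose a c0"
  have Z2: "arc_config Z \<rho>2" unfolding \<rho>2_def
    using transpose_config[OF Z aZ c0(1)] c0a by simp
  have col: "\<kappa>' (\<rho> a) = \<kappa>' a" using ab \<kappa>'(2) by (auto simp: defects_def)
  have D2: "defects Z \<rho>2 \<kappa>' = defects Z \<rho> \<kappa>'"
  proof (rule set_eqI)
    fix d
    consider "d = a" | "d = c0" | "d \<noteq> a" "d \<noteq> c0" by blast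
    then show "d \<in> defects Z \<rho>2 \<kappa>' \<longleftrightarrow> d \<in> defects Z \<rho> \<kappa>'"
      using c0 c0_nd \<kappa>'(3) col aZ by cases (auto simp: defects_def \<rho>2_def)
  qed
  have m2: "min_config Z \<rho>2 \<kappa>'" using \<kappa>'(1) Z2 by (auto simp: min_config_def D2)
  have ab2: "a \<in> defects Z \<rho>2 \<kappa>'" "b \<in> defects Z \<rho>2 \<kappa>'" using ab D2 \<kappa>'(2) by auto
  obtain \<kappa>3 where "min_config Z \<rho>2 \<kappa>3" "(\<rho>2 ^^ 1) a \<in> defects Z \<rho>2 \<kappa>3" "(\<rho>2 ^^ 0) b \<in> defects Z \<rho>2 \<kappa>3"
      "(\<rho>2 ^^ 1) a \<noteq> (\<rho>2 ^^ 0) b" by (rule move_two_defects[OF m2 ab2 ab(3)])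
  then have "snd (\<rho>2 a) \<noteq> snd b"
    using defect_heads_distinct[of \<rho>2 \<kappa>3 "(\<rho>2 ^^ 1) a" "(\<rho>2 ^^ 0) b"] by simp
  then show False using eq c0 by (simp add: \<rho>2_def)
qed

text \<open>Along the walk the colour is repeated once, after \<open>a\<close>, and alternates
  everywhere else, so the walk closes up after an odd number of steps.\<close>

lemma defect_odd_period:
  assumes m: "min_config Z \<rho> \<kappa>" and a: "a \<in> defects Z \<rho> \<kappa>"
  obtains P where "odd P" "(\<rho> ^^ P) a = a"
proof -
  have perm: "\<rho> permutes Z" using m by (auto simp: min_config_def arc_config_def)
  have aZ: "a \<in> Z" using a by (simp add: defects_def)
  have Z: "arc_config Z \<rho>" using m by (simp add: min_config_def)
  have "permutation \<rho>" using perm finZ by (auto simp: permutation_permutes)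
  then obtain N where N: "\<rho> ^^ N = id" "N > 0" using permutation_is_nilpotent by blast
  define P where "P = (LEAST P. P > 0 \<and> (\<rho> ^^ P) a = a)"
  have P: "P > 0" "(\<rho> ^^ P) a = a"
    using LeastI[of "\<lambda>P. P > 0 \<and> (\<rho> ^^ P) a = a" N] N by (auto simp: P_def)
  have least: "(\<rho> ^^ t) a \<noteq> a" if "0 < t" "t < P" for t
    using not_less_Least[of t "\<lambda>P. P > 0 \<and> (\<rho> ^^ P) a = a"] that by (auto simp: P_def)
  have "Suc t \<le> P \<Longrightarrow> \<kappa> ((\<rho> ^^ Suc t) a) = (\<kappa> a = even t)" for t
  proof (induction t)
    case 0
    then show ?case using a by (simp add: defects_def)
  next
    case (Suc t)
    define z where "z = (\<rho> ^^ Suc t) a"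
    have "z \<notin> defects Z \<rho> \<kappa> - {a}" unfolding z_def by (rule move_defect[OF m a, of "Suc t"])
    moreover have "z \<noteq> a" unfolding z_def by (rule least) (use Suc.prems in auto)
    moreover have "z \<in> Z" unfolding z_def by (rule arc_config_pow[OF Z aZ])
    ultimately have "\<kappa> (\<rho> z) \<noteq> \<kappa> z" by (auto simp: defects_def)
    then show ?case using Suc by (auto simp: z_def)
  qed
  from this[of "P - 1"] have "\<kappa> a = (\<kappa> a = even (P - 1))" using P by simp
  then have "odd P" using P(1) by (cases "\<kappa> a") auto
  then show ?thesis using that P(2) by blast
qed


end

text \<open>If the two values always differed, then \<open>h\<close> would alternate while one walks
  forward on the first cycle and backward on the second. After \<open>P * Q\<close> steps, an odd
  number, both are back at the start.\<close>

lemma odd_torus_switch: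
  fixes h :: "'b \<Rightarrow> 'b \<Rightarrow> bool"
  assumes P: "odd P" "(\<rho> ^^ P) a = a" and Q: "odd Q" "(\<rho> ^^ Q) b = b"
  shows "\<exists>t s. h ((\<rho> ^^ t) a) ((\<rho> ^^ Suc s) b) = h ((\<rho> ^^ Suc t) a) ((\<rho> ^^ s) b)"
proof (rule ccontr)
  assume "\<not> ?thesis"
  then have alt: "h ((\<rho> ^^ t) a) ((\<rho> ^^ Suc s) b) \<noteq> h ((\<rho> ^^ Suc t) a) ((\<rho> ^^ s) b)" for t s by blast
  define N where "N = P * Q"
  have fixed: "((\<rho> ^^ R) ^^ j) x = x" if "(\<rho> ^^ R) x = x" for R j x using that by (induction j) auto
  have Na: "(\<rho> ^^ N) a = a" using fixed[OF P(2), of Q] by (simp only: N_def funpow_mult)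
  have Nb: "(\<rho> ^^ N) b = b" using fixed[OF Q(2), of P] by (simp only: N_def funpow_mult mult.commute[of P Q])
  have "t \<le> N \<Longrightarrow> h ((\<rho> ^^ t) a) ((\<rho> ^^ (N - t)) b) = (h a b = even t)" for t
  proof (induction t)
    case 0
    then show ?case by (simp add: Nb)
  next
    case (Suc t)
    then have "N - t = Suc (N - Suc t)" by simp
    then show ?case using Suc alt[of t "N - Suc t"] by auto
  qed
  from this[of N] have "h a b = (h a b = even N)" by (simp add: Na)
  moreover have "odd N" using P Q by (simp add: N_def)
  ultimately show False by simp
qed

text \<open>Serves to read a configuration as one on the arc set that results from a switching; only
  the heads prescribed by \<open>\<phi>\<close> have to match.\<close>

lemma transport_config:
  fixes \<kappa> :: "'a \<times> 'a \<Rightarrow> bool"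
  assumes \<phi>: "bij_betw \<phi> Z Z'" and perm: "\<rho> permutes Z"
    and heads: "\<And>a. a \<in> Z \<Longrightarrow> snd (\<phi> a) = fst (\<phi> (\<rho> a))"
  obtains \<rho>' \<kappa>' where "arc_config Z' \<rho>'" "card (defects Z' \<rho>' \<kappa>') = card {a \<in> Z. \<kappa> (\<rho> a) = \<kappa> a}"
proof -
  define \<psi> where "\<psi> = the_inv_into Z \<phi>"
  have \<psi>: "bij_betw \<psi> Z' Z" unfolding \<psi>_def by (rule bij_betw_the_inv_into[OF \<phi>])
  have \<phi>\<psi>: "\<phi> (\<psi> x) = x" if "x \<in> Z'" for x
    using \<phi> that by (auto simp: \<psi>_def bij_betw_def f_the_inv_into_f)
  have \<psi>\<phi>: "\<psi> (\<phi> x) = x" if "x \<in> Z" for x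
    using \<phi> that by (auto simp: \<psi>_def bij_betw_def the_inv_into_f_f)
  have \<psi>Z: "\<psi> x \<in> Z" if "x \<in> Z'" for x using \<psi> that by (auto simp: bij_betw_def)
  have \<phi>Z: "\<phi> x \<in> Z'" if "x \<in> Z" for x using \<phi> that by (auto simp: bij_betw_def)
  define \<rho>' where "\<rho>' x = (if x \<in> Z' then \<phi> (\<rho> (\<psi> x)) else x)" for x
  have "bij_betw (\<phi> \<circ> (\<rho> \<circ> \<psi>)) Z' Z'"
    using \<phi> \<psi> permutes_imp_bij[OF perm] by (blast intro: bij_betw_trans)
  then have "bij_betw \<rho>' Z' Z'"
    by (rule bij_betw_cong[THEN iffD1, rotated]) (simp add: \<rho>'_def)
  then have p': "\<rho>' permutes Z'" by (intro bij_imp_permutes) (auto simp: \<rho>'_def)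
  have \<rho>Z: "\<rho> x \<in> Z" if "x \<in> Z" for x using perm that by (simp add: permutes_in_image)
  have "arc_config Z' \<rho>'" unfolding arc_config_def
  proof (intro conjI ballI p')
    fix x assume x: "x \<in> Z'"
    then show "snd x = fst (\<rho>' x)" using heads[OF \<psi>Z[OF x]] \<phi>\<psi>[OF x] by (simp add: \<rho>'_def)
  qed
  moreover have k1: "\<psi> (\<rho>' x) = \<rho> (\<psi> x)" if "x \<in> Z'" for x
    using that \<psi>\<phi>[OF \<rho>Z[OF \<psi>Z[OF that]]] by (simp add: \<rho>'_def)
  moreover have "defects Z' \<rho>' (\<kappa> \<circ> \<psi>) = \<phi> ` {a \<in> Z. \<kappa> (\<rho> a) = \<kappa> a}"
  proof (intro equalityI subsetI)
    fix x assume "x \<in> defects Z' \<rho>' (\<kappa> \<circ> \<psi>)"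
    then have "x \<in> Z'" "\<kappa> (\<rho> (\<psi> x)) = \<kappa> (\<psi> x)"
      using k1[of x] by (simp_all add: defects_def)
    then show "x \<in> \<phi> ` {a \<in> Z. \<kappa> (\<rho> a) = \<kappa> a}" using \<phi>\<psi> \<psi>Z by (intro image_eqI[of _ _ "\<psi> x"]) auto
  next
    fix x assume "x \<in> \<phi> ` {a \<in> Z. \<kappa> (\<rho> a) = \<kappa> a}"
    then obtain a where a: "a \<in> Z" "\<kappa> (\<rho> a) = \<kappa> a" "x = \<phi> a" by blast
    then show "x \<in> defects Z' \<rho>' (\<kappa> \<circ> \<psi>)"
      using k1[OF \<phi>Z[OF a(1)]] \<psi>\<phi>[OF a(1)] \<phi>Z[OF a(1)] by (simp add: defects_def)
  qed
  moreover have "inj_on \<phi> {a \<in> Z. \<kappa> (\<rho> a) = \<kappa> a}"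
    using \<phi> by (auto simp: bij_betw_def intro: inj_on_subset)
  ultimately show ?thesis using that[of \<rho>' "\<kappa> \<circ> \<psi>"] by (simp add: card_image)
qed

text \<open>At each vertex any bijection from the incoming to the outgoing arcs will do.\<close>

lemma ex_arc_config:
  assumes fin: "finite Z" and bal: "\<And>v. card {e \<in> Z. snd e = v} = card {e \<in> Z. fst e = v}"
  shows "\<exists>\<rho>. arc_config Z \<rho>"
proof -
  have "\<forall>v. \<exists>f. bij_betw f {e \<in> Z. snd e = v} {e \<in> Z. fst e = v}"
    using fin bal by (intro allI finite_same_card_bij) auto
  from choice[OF this] obtain \<beta> where \<beta>: "\<And>v. bij_betw (\<beta> v) {e \<in> Z. snd e = v} {e \<in> Z. fst e = v}"
    by blast
  define \<rho> where "\<rho> z = (if z \<in> Z then \<beta> (snd z) z else z)" for z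
  have \<rho>Z: "\<rho> z \<in> Z \<and> fst (\<rho> z) = snd z" if "z \<in> Z" for z
  proof -
    have "\<beta> (snd z) z \<in> {e \<in> Z. fst e = snd z}"
      using \<beta>[of "snd z"] that unfolding bij_betw_def by blast
    then show ?thesis using that by (simp add: \<rho>_def)
  qed
  have "inj_on \<rho> Z"
  proof (rule inj_onI)
    fix x y assume xy: "x \<in> Z" "y \<in> Z" "\<rho> x = \<rho> y"
    then have "snd x = snd y" using \<rho>Z by metis
    then show "x = y"
      using inj_onD[OF bij_betw_imp_inj_on[OF \<beta>[of "snd x"]], of x y] xy by (simp add: \<rho>_def)
  qed
  moreover have "\<rho> ` Z \<subseteq> Z" using \<rho>Z by blast
  ultimately have "bij_betw \<rho> Z Z" using fin by (metis bij_betw_def endo_inj_surj)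
  then have "\<rho> permutes Z" by (intro bij_imp_permutes) (auto simp: \<rho>_def)
  then show ?thesis using \<rho>Z by (auto simp: arc_config_def)
qed

section \<open>Digraphs with equal in- and out-degrees, and switching a pair of defects\<close>

text \<open>A pair of opposite arcs gives one link to each of the two undirected graphs, so only the
  remaining arcs have to be split by colouring.\<close>

definition simple_arcs :: "('a \<times> 'a) set \<Rightarrow> ('a \<times> 'a) set" where
  "simple_arcs A = {e \<in> A. prod.swap e \<notin> A}"

definition regular_arcs :: "'a set \<Rightarrow> ('a \<Rightarrow> nat) \<Rightarrow> ('a \<times> 'a) set set" where
  "regular_arcs V k = degree_graphs {e \<in> V \<times> V. fst e \<noteq> snd e} fst snd V k V k"

definition swap_heads :: "('a \<times> 'a) set \<Rightarrow> 'a \<times> 'a \<Rightarrow> 'a \<times> 'a \<Rightarrow> ('a \<times> 'a) set" where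
  "swap_heads A x y = A - {x, y} \<union> {(fst x, snd y), (fst y, snd x)}"

definition defect_number :: "('a \<times> 'a) set \<Rightarrow> nat" where
  "defect_number Z = (LEAST n. \<exists>\<rho> \<kappa>. arc_config Z \<rho> \<and> card (defects Z \<rho> \<kappa>) = n)"

lemma defect_number_le: "arc_config Z \<rho> \<Longrightarrow> defect_number Z \<le> card (defects Z \<rho> \<kappa>)"
  unfolding defect_number_def by (rule Least_le) blast

lemma min_config_exists:
  assumes "arc_config Z \<rho>"
  obtains \<rho>' \<kappa>' where "min_config Z \<rho>' \<kappa>'" "card (defects Z \<rho>' \<kappa>') = defect_number Z"
proof -
  have "\<exists>\<rho> \<kappa>. arc_config Z \<rho> \<and> card (defects Z \<rho> \<kappa>) = defect_number Z"
    unfolding defect_number_def by (rule LeastI) (use assms in blast)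
  then obtain \<rho>' \<kappa>' where *: "arc_config Z \<rho>'" "card (defects Z \<rho>' \<kappa>') = defect_number Z" by blast
  then have "min_config Z \<rho>' \<kappa>'" using defect_number_le[of Z] by (auto simp: min_config_def)
  then show ?thesis using that * by blast
qed

lemma regular_arcsD:
  assumes "A \<in> regular_arcs V k"
  shows "A \<subseteq> V \<times> V" "\<And>e. e \<in> A \<Longrightarrow> fst e \<noteq> snd e"
    "\<And>v. v \<in> V \<Longrightarrow> card {e \<in> A. fst e = v} = k v" "\<And>v. v \<in> V \<Longrightarrow> card {e \<in> A. snd e = v} = k v"
  using assms by (auto simp: regular_arcs_def degree_graphs_def)

lemma regular_arcs_balanced:
  assumes V: "finite V" and A: "A \<in> regular_arcs V k"
  shows "card {e \<in> simple_arcs A. snd e = v} = card {e \<in> simple_arcs A. fst e = v}"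
proof (cases "v \<in> V")
  case True
  have finA: "finite A" using regular_arcsD(1)[OF A] V by (auto intro: finite_subset)
  define D where "D = {e \<in> A. prod.swap e \<in> A}"
  have "bij_betw prod.swap {e \<in> D. snd e = v} {e \<in> D. fst e = v}"
    by (rule bij_betw_byWitness[where f' = prod.swap]) (auto simp: D_def)
  then have "card {e \<in> D. snd e = v} = card {e \<in> D. fst e = v}" by (rule bij_betw_same_card)
  moreover have "card {e \<in> A. f e = v} = card {e \<in> simple_arcs A. f e = v} + card {e \<in> D. f e = v}"
    for f :: "'a \<times> 'a \<Rightarrow> 'a"
  proof -
    have eq: "{e \<in> A. f e = v} = {e \<in> simple_arcs A. f e = v} \<union> {e \<in> D. f e = v}"
      by (auto simp: D_def simple_arcs_def)
    show ?thesis unfolding eq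
      using finA by (intro card_Un_disjoint) (auto simp: D_def simple_arcs_def)
  qed
  from this[of fst] this[of snd] have "card {e \<in> simple_arcs A. fst e = v} + card {e \<in> D. fst e = v} =
      card {e \<in> simple_arcs A. snd e = v} + card {e \<in> D. snd e = v}"
    using regular_arcsD(3,4)[OF A True] by simp
  ultimately show ?thesis by simp
next
  case False
  then have e: "{e \<in> simple_arcs A. snd e = v} = {}" "{e \<in> simple_arcs A. fst e = v} = {}"
    using regular_arcsD(1)[OF A] by (auto simp: simple_arcs_def)
  show ?thesis unfolding e ..
qed

lemma even_card_symmetric:
  assumes "finite S" "\<And>e. e \<in> S \<Longrightarrow> prod.swap e \<in> S" "\<And>e. e \<in> S \<Longrightarrow> fst e \<noteq> snd e"
  shows "even (card S)"
  using assms
proof (induction "card S" arbitrary: S rule: less_induct)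
  case less
  show ?case
  proof (cases "S = {}")
    case False
    then obtain e where e: "e \<in> S" by blast
    define S' where "S' = S - {e, prod.swap e}"
    have e': "prod.swap e \<in> S" "prod.swap e \<noteq> e"
      using less.prems(2)[OF e] less.prems(3)[OF e] by (cases e; auto)+
    have sub: "{e, prod.swap e} \<subseteq> S" using e e' by auto
    have c2: "card {e, prod.swap e} = 2" using e'(2) by simp
    have "card S = card S' + 2"
      using card_Diff_subset[OF _ sub] card_mono[OF less.prems(1) sub] c2 by (simp add: S'_def)
    moreover have "even (card S')"
    proof (rule less.hyps)
      show "card S' < card S" using \<open>card S = card S' + 2\<close> by simp
      show "finite S'" using less.prems(1) by (simp add: S'_def)
      fix x assume x: "x \<in> S'"
      then show "prod.swap x \<in> S'" using less.prems(2)[of x] by (cases x; cases e) (auto simp: S'_def)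
      show "fst x \<noteq> snd x" using x less.prems(3)[of x] by (auto simp: S'_def)
    qed
    ultimately show ?thesis by simp
  qed simp
qed

text \<open>As many arcs lose the colour \<open>\<kappa>\<close> on passing to the successor as gain
  it, since \<open>\<rho>\<close> is a bijection. The number of non-defects is therefore
  even.\<close>

lemma even_defects:
  assumes fin: "finite Z" and Z: "arc_config Z \<rho>" and even: "even (card Z)"
  shows "even (card (defects Z \<rho> \<kappa>))"
proof -
  have perm: "\<rho> permutes Z" using Z by (simp add: arc_config_def)
  define T where "T = {z \<in> Z. \<kappa> z}"
  define T' where "T' = {z \<in> Z. \<kappa> (\<rho> z)}"
  have "bij_betw \<rho> T' T"
  proof (rule bij_betw_imageI)
    show "inj_on \<rho> T'" using permutes_inj[OF perm] by (rule inj_on_subset) auto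
    show "\<rho> ` T' = T"
    proof (intro equalityI subsetI)
      fix x assume "x \<in> T"
      then have "x \<in> \<rho> ` Z" using permutes_image[OF perm] by (auto simp: T_def)
      then show "x \<in> \<rho> ` T'" using \<open>x \<in> T\<close> by (auto simp: T_def T'_def)
    qed (use perm in \<open>auto simp: T_def T'_def permutes_in_image\<close>)
  qed
  then have TT: "card T' = card T" by (rule bij_betw_same_card)
  have f: "finite T" "finite T'" using fin by (auto simp: T_def T'_def)
  have "card T = card (T \<inter> T') + card (T - T')" "card T' = card (T \<inter> T') + card (T' - T)"
    using f by (metis card_Int_Diff, metis card_Int_Diff Int_commute)
  then have "card (T - T') = card (T' - T)" using TT by simp
  moreover have "card (Z - defects Z \<rho> \<kappa>) = card (T - T') + card (T' - T)"
  proof -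
    have "Z - defects Z \<rho> \<kappa> = (T - T') \<union> (T' - T)" by (auto simp: defects_def T_def T'_def)
    then show ?thesis using f by (simp add: card_Un_disjoint Diff_disjoint disjoint_iff)
  qed
  moreover have "card Z = card (defects Z \<rho> \<kappa>) + card (Z - defects Z \<rho> \<kappa>)"
    using card_Int_Diff[OF fin, of "defects Z \<rho> \<kappa>"] defects_subset[of Z \<rho> \<kappa>] by (simp add: Int_absorb1)
  ultimately show ?thesis using even by simp
qed

lemma swap_heads_card:
  assumes fin: "finite A" and xy: "x \<in> A" "y \<in> A" "x \<noteq> y"
    and new: "(fst x, snd y) \<notin> A" "(fst y, snd x) \<notin> A" "(fst x, snd y) \<noteq> (fst y, snd x)"
  shows "card {e \<in> swap_heads A x y. fst e = v} = card {e \<in> A. fst e = v}"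
    and "card {e \<in> swap_heads A x y. snd e = v} = card {e \<in> A. snd e = v}"
proof -
  have *: "card {e \<in> swap_heads A x y. f e = v} = card {e \<in> A. f e = v}"
    if "card {e \<in> {(fst x, snd y), (fst y, snd x)}. f e = v} = card {e \<in> {x, y}. f e = v}"
    for f :: "'a \<times> 'a \<Rightarrow> 'a"
  proof -
    have "{e \<in> swap_heads A x y. f e = v} =
        {e \<in> A - {x, y}. f e = v} \<union> {e \<in> {(fst x, snd y), (fst y, snd x)}. f e = v}"
      by (auto simp: swap_heads_def)
    also have "card \<dots> = card {e \<in> A - {x, y}. f e = v} + card {e \<in> {(fst x, snd y), (fst y, snd x)}. f e = v}"
      using fin new by (intro card_Un_disjoint) auto
    also have "\<dots> = card {e \<in> A - {x, y}. f e = v} + card {e \<in> {x, y}. f e = v}" using that by simp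
    also have "\<dots> = card ({e \<in> A - {x, y}. f e = v} \<union> {e \<in> {x, y}. f e = v})"
      using fin by (intro card_Un_disjoint[symmetric]) auto
    also have "{e \<in> A - {x, y}. f e = v} \<union> {e \<in> {x, y}. f e = v} = {e \<in> A. f e = v}"
      using xy by auto
    finally show ?thesis .
  qed
  have two: "card {e \<in> {p, q}. f e = v} = (if f p = v then 1 else 0) + (if f q = v then 1 else 0)"
    if "p \<noteq> q" for p q and f :: "'a \<times> 'a \<Rightarrow> 'a"
  proof -
    have "{e \<in> {p, q}. f e = v} = (if f p = v then {p} else {}) \<union> (if f q = v then {q} else {})" by auto
    then show ?thesis using that by simp
  qed
  show "card {e \<in> swap_heads A x y. fst e = v} = card {e \<in> A. fst e = v}"
    by (rule *) (simp only: two[OF xy(3)] two[OF new(3)] fst_conv snd_conv add.commute)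
  show "card {e \<in> swap_heads A x y. snd e = v} = card {e \<in> A. snd e = v}"
    by (rule *) (simp only: two[OF xy(3)] two[OF new(3)] fst_conv snd_conv add.commute)
qed

text \<open>Swapping the heads of \<open>a\<close> and \<open>b\<close> joins their two odd closed
  walks into an even one. As \<open>a\<close> and \<open>b\<close> can be coloured differently,
  neither remains a defect.\<close>

lemma defect_number_relinked:
  assumes fin: "finite Z" and m: "min_config Z \<rho> \<kappa>"
    and ab: "a \<in> defects Z \<rho> \<kappa>" "b \<in> defects Z \<rho> \<kappa>" "a \<noteq> b"
    and new: "(fst a, snd b) \<notin> Z" "(fst b, snd a) \<notin> Z"
  shows "defect_number (swap_heads Z a b) < card (defects Z \<rho> \<kappa>)"
proof -
  obtain \<kappa>' where \<kappa>': "min_config Z \<rho> \<kappa>'" "defects Z \<rho> \<kappa>' = defects Z \<rho> \<kappa>" "(\<kappa>' a = \<kappa>' b) = False"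
    by (rule recolour_orbit[OF fin m defect_orbits_distinct[OF fin m ab]])
  have Z: "arc_config Z \<rho>" and perm: "\<rho> permutes Z" using m by (auto simp: min_config_def arc_config_def)
  have abZ: "a \<in> Z" "b \<in> Z" using ab by (auto simp: defects_def)
  have heads: "snd a \<noteq> snd b" by (rule defect_heads_distinct[OF fin m ab])
  define \<phi> where "\<phi> e = (if e = a then (fst a, snd b) else if e = b then (fst b, snd a) else e)" for e
  define \<rho>2 where "\<rho>2 = \<rho> \<circ> Transposition.transpose a b"
  have fst\<phi>: "fst (\<phi> e) = fst e" for e by (auto simp: \<phi>_def)
  have "inj_on \<phi> Z"
  proof (rule inj_onI)
    fix x y assume xy: "x \<in> Z" "y \<in> Z" "\<phi> x = \<phi> y"
    then show "x = y" using new ab(3) heads by (auto simp: \<phi>_def split: if_splits)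
  qed
  moreover have "\<phi> ` Z = swap_heads Z a b"
  proof (intro equalityI subsetI)
    fix x assume "x \<in> swap_heads Z a b"
    then consider "x \<in> Z" "x \<noteq> a" "x \<noteq> b" | "x = \<phi> a" | "x = \<phi> b"
      using ab(3) by (auto simp: swap_heads_def \<phi>_def)
    then show "x \<in> \<phi> ` Z"
    proof cases
      case 1
      then have "\<phi> x = x" by (simp add: \<phi>_def)
      then show ?thesis using 1 by (metis imageI)
    qed (use abZ in auto)
  qed (auto simp: \<phi>_def swap_heads_def)
  ultimately have bij: "bij_betw \<phi> Z (swap_heads Z a b)" by (simp add: bij_betw_def)
  have perm2: "\<rho>2 permutes Z" unfolding \<rho>2_def
    using perm abZ by (intro permutes_compose permutes_swap_id) auto
  have "snd (\<phi> e) = fst (\<phi> (\<rho>2 e))" if "e \<in> Z" for e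
    using Z abZ that ab(3) unfolding fst\<phi> by (auto simp: \<phi>_def \<rho>2_def arc_config_def Transposition.transpose_def)
  then obtain \<rho>' \<kappa>'' where c: "arc_config (swap_heads Z a b) \<rho>'"
    "card (defects (swap_heads Z a b) \<rho>' \<kappa>'') = card {e \<in> Z. \<kappa>' (\<rho>2 e) = \<kappa>' e}"
    by (rule transport_config[OF bij perm2])
  have col: "\<kappa>' (\<rho> a) = \<kappa>' a" "\<kappa>' (\<rho> b) = \<kappa>' b" using ab \<kappa>'(2) by (auto simp: defects_def)
  have sub: "{e \<in> Z. \<kappa>' (\<rho>2 e) = \<kappa>' e} \<subseteq> defects Z \<rho> \<kappa>' - {a}"
  proof
    fix e assume e: "e \<in> {e \<in> Z. \<kappa>' (\<rho>2 e) = \<kappa>' e}"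
    have "e \<noteq> a" "e \<noteq> b" using e col \<kappa>'(3) by (auto simp: \<rho>2_def)
    then show "e \<in> defects Z \<rho> \<kappa>' - {a}" using e by (auto simp: defects_def \<rho>2_def)
  qed
  have "defect_number (swap_heads Z a b) \<le> card (defects Z \<rho> \<kappa>' - {a})"
    using defect_number_le[OF c(1), of \<kappa>''] c(2) card_mono[OF _ sub] finite_defects[OF fin] by auto
  also have "\<dots> < card (defects Z \<rho> \<kappa>')"
    using ab(1) \<kappa>'(2) by (intro card_Diff1_less finite_defects[OF fin]) simp
  finally show ?thesis using \<kappa>'(2) by simp
qed

text \<open>Two defects sit on vertex-disjoint closed walks of odd length with no simple arc between
  them, so that the pairs joining the two walks are either absent or doubled.  Walking along both of
  them at once, presence cannot alternate, which gives a place where the heads can be swapped.\<close>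

lemma switch_defects:
  fixes A :: "('a \<times> 'a) set"
  defines "Z \<equiv> simple_arcs A"
  assumes V: "finite V" and A: "A \<in> regular_arcs V k"
    and m: "min_config Z \<rho> \<kappa>" and ab: "a \<in> defects Z \<rho> \<kappa>" "b \<in> defects Z \<rho> \<kappa>" "a \<noteq> b"
  obtains A' n i where "A' \<in> regular_arcs V k" "defect_number (simple_arcs A') < card (defects Z \<rho> \<kappa>)"
    "\<exists>x\<in>A'. \<exists>y\<in>A'. A = swap_heads A' x y"
    "((A - A') \<union> prod.swap ` (A' - A)) \<inter> Z = {(\<rho> ^^ n) a, (\<rho> ^^ i) b}"
proof -
  note found = that
  have finA: "finite A" using regular_arcsD(1)[OF A] V by (auto intro: finite_subset)
  have fin: "finite Z" using finA by (simp add: Z_def simple_arcs_def)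
  have Z: "arc_config Z \<rho>" using m by (simp add: min_config_def)
  obtain P where P: "odd P" "(\<rho> ^^ P) a = a" by (rule defect_odd_period[OF fin m ab(1)])
  obtain Q where Q: "odd Q" "(\<rho> ^^ Q) b = b" by (rule defect_odd_period[OF fin m ab(2)])
  obtain t s where ts: "((fst ((\<rho> ^^ t) a), fst ((\<rho> ^^ Suc s) b)) \<in> A) =
      ((fst ((\<rho> ^^ Suc t) a), fst ((\<rho> ^^ s) b)) \<in> A)"
    using odd_torus_switch[OF P Q, of "\<lambda>x y. (fst x, fst y) \<in> A"] by blast
  define a' where "a' = (\<rho> ^^ t) a"
  define b' where "b' = (\<rho> ^^ s) b"
  obtain \<kappa>' where m': "min_config Z \<rho> \<kappa>'" and ab': "a' \<in> defects Z \<rho> \<kappa>'" "b' \<in> defects Z \<rho> \<kappa>'" "a' \<noteq> b'"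
    and card': "card (defects Z \<rho> \<kappa>') = card (defects Z \<rho> \<kappa>)"
    unfolding a'_def b'_def by (rule move_two_defects[OF fin m ab])
  have abZ: "a' \<in> Z" "b' \<in> Z" using ab' by (auto simp: defects_def)
  have next_ab: "fst (\<rho> a') = snd a'" "fst (\<rho> b') = snd b'"
    using Z abZ by (auto simp: arc_config_def)
  obtain p p' where a'p: "a' = (p, p')" by (cases a')
  obtain r r' where b'r: "b' = (r, r')" by (cases b')
  have ts': "(p, r') \<in> A \<longleftrightarrow> (p', r) \<in> A"
    using ts next_ab by (simp add: a'_def[symmetric] b'_def[symmetric] a'p b'r)
  \<comment> \<open>Each defect can be placed anywhere on its walk, so the facts on heads and on
    arcs between them hold for all pairs of arcs of the two walks.\<close>
  have far: "snd ((\<rho> ^^ n) a) \<noteq> snd ((\<rho> ^^ i) b) \<and>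
      (\<forall>c\<in>Z. \<not> (fst c = snd ((\<rho> ^^ n) a) \<and> snd c = snd ((\<rho> ^^ i) b)) \<and>
             \<not> (fst c = snd ((\<rho> ^^ i) b) \<and> snd c = snd ((\<rho> ^^ n) a)))" for n i
  proof -
    obtain \<kappa>1 where 1: "min_config Z \<rho> \<kappa>1" "(\<rho> ^^ n) a \<in> defects Z \<rho> \<kappa>1" "(\<rho> ^^ i) b \<in> defects Z \<rho> \<kappa>1"
      "(\<rho> ^^ n) a \<noteq> (\<rho> ^^ i) b" by (rule move_two_defects[OF fin m ab])
    show ?thesis
      using defect_heads_distinct[OF fin 1(1-4)] no_arc_between_defects[OF fin 1(1-4)]
        no_arc_between_defects[OF fin 1(1,3,2) 1(4)[symmetric]] by blast
  qed
  have pred: "\<exists>n. fst ((\<rho> ^^ t) x) = snd ((\<rho> ^^ n) x)" if x: "x \<in> Z" "(\<rho> ^^ R) x = x" "odd R" for x R t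
  proof -
    have "(\<rho> ^^ t) x = (\<rho> ^^ (t + R)) x" using x(2) by (simp add: funpow_add)
    also have "t + R = Suc (t + R - 1)" using x(3) by (cases R) auto
    finally have "fst ((\<rho> ^^ t) x) = fst (\<rho> ((\<rho> ^^ (t + R - 1)) x))" by simp
    moreover have "(\<rho> ^^ (t + R - 1)) x \<in> Z" by (rule arc_config_pow[OF Z x(1)])
    then have "fst (\<rho> ((\<rho> ^^ (t + R - 1)) x)) = snd ((\<rho> ^^ (t + R - 1)) x)"
      using Z by (simp add: arc_config_def)
    ultimately show ?thesis by (metis (no_types))
  qed
  have abZ0: "a \<in> Z" "b \<in> Z" using ab by (auto simp: defects_def)
  obtain n0 where n0: "p = snd ((\<rho> ^^ n0) a)" using pred[OF abZ0(1) P(2,1), of t] by (auto simp: a'_def[symmetric] a'p)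
  obtain i0 where i0: "r = snd ((\<rho> ^^ i0) b)" using pred[OF abZ0(2) Q(2,1), of s] by (auto simp: b'_def[symmetric] b'r)
  have n1: "p' = snd ((\<rho> ^^ t) a)" and i1: "r' = snd ((\<rho> ^^ s) b)"
    by (simp_all add: a'_def[symmetric] b'_def[symmetric] a'p b'r)
  have vne: "p \<noteq> r" "p \<noteq> r'" "p' \<noteq> r" "p' \<noteq> r'"
    using far[of n0 i0] far[of n0 s] far[of t i0] far[of t s] by (auto simp: n0 i0 n1 i1)
  have noZ: "(u, w) \<notin> Z" "(w, u) \<notin> Z" if "u \<in> {p, p'}" "w \<in> {r, r'}" for u w
  proof -
    obtain n i where "u = snd ((\<rho> ^^ n) a)" "w = snd ((\<rho> ^^ i) b)"
      using \<open>u \<in> {p, p'}\<close> \<open>w \<in> {r, r'}\<close> n0 i0 n1 i1 by blast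
    then show "(u, w) \<notin> Z" "(w, u) \<notin> Z" using far[of n i] by force+
  qed
  have sym: "(u, w) \<in> A \<longleftrightarrow> (w, u) \<in> A" if "u \<in> {p, p'}" "w \<in> {r, r'}" for u w
    using noZ[OF that] by (auto simp: Z_def simple_arcs_def)
  have abA: "(p, p') \<in> A" "(p', p) \<notin> A" "(r, r') \<in> A" "(r', r) \<notin> A"
    using abZ by (auto simp: a'p b'r Z_def simple_arcs_def)
  have pp: "p \<noteq> p'" "r \<noteq> r'" using regular_arcsD(2)[OF A abA(1)] regular_arcsD(2)[OF A abA(3)] by auto
  have inV: "p \<in> V" "p' \<in> V" "r \<in> V" "r' \<in> V" using regular_arcsD(1)[OF A] abA by auto
  have finish: thesis if xy: "x \<in> A" "y \<in> A" "x \<noteq> y" and new: "(fst x, snd y) \<notin> A" "(fst y, snd x) \<notin> A"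
      "(fst x, snd y) \<noteq> (fst y, snd x)" "fst x \<noteq> snd y" "fst y \<noteq> snd x"
      and Z': "simple_arcs (swap_heads A x y) = swap_heads Z a' b'"
      and D: "((A - swap_heads A x y) \<union> prod.swap ` (swap_heads A x y - A)) \<inter> Z = {a', b'}" for x y
  proof (rule found)
    show "swap_heads A x y \<in> regular_arcs V k"
      unfolding regular_arcs_def degree_graphs_def
      using swap_heads_card[OF finA xy new(1-3)] regular_arcsD[OF A] xy new regular_arcsD(1)[OF A]
      by (auto simp: swap_heads_def)
    show "defect_number (simple_arcs (swap_heads A x y)) < card (defects Z \<rho> \<kappa>)"
      using defect_number_relinked[OF fin m' ab'] noZ[of p r'] noZ[of p' r] unfolding Z' card'
      by (simp add: a'p b'r)
    \<comment> \<open>In both kinds of switching this expression recovers the two simple arcs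
      involved from \<open>A\<close> and \<open>A'\<close>, so a switching remembers its pair of
      defects.\<close>
    show "((A - swap_heads A x y) \<union> prod.swap ` (swap_heads A x y - A)) \<inter> Z = {(\<rho> ^^ t) a, (\<rho> ^^ s) b}"
      using D by (simp add: a'_def b'_def)
    show "\<exists>x'\<in>swap_heads A x y. \<exists>y'\<in>swap_heads A x y. A = swap_heads (swap_heads A x y) x' y'"
    proof (intro bexI)
      show "A = swap_heads (swap_heads A x y) (fst x, snd y) (fst y, snd x)"
        using xy new by (auto simp: swap_heads_def)
    qed (simp_all add: swap_heads_def)
  qed
  have pr: "(p, r) \<in> A \<longleftrightarrow> (r, p) \<in> A" "(p, r') \<in> A \<longleftrightarrow> (r', p) \<in> A" "(p', r) \<in> A \<longleftrightarrow> (r, p') \<in> A"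
      "(p', r') \<in> A \<longleftrightarrow> (r', p') \<in> A" by (rule sym; simp)+
  show thesis
  proof (cases "(p, r') \<in> A")
    \<comment> \<open>Both joining pairs are absent in either direction, so the heads of the two
      simple arcs themselves are swapped.\<close>
    case False
    then have no: "(p, r') \<notin> A" "(r', p) \<notin> A" "(p', r) \<notin> A" "(r, p') \<notin> A" using ts' pr by auto
    show thesis
    proof (rule finish[of "(p, p')" "(r, r')"])
      show "simple_arcs (swap_heads A (p, p') (r, r')) = swap_heads Z a' b'"
        using no abA vne pp unfolding Z_def a'p b'r simple_arcs_def swap_heads_def by auto
      show "((A - swap_heads A (p, p') (r, r')) \<union> prod.swap ` (swap_heads A (p, p') (r, r') - A)) \<inter> Z = {a', b'}"
        using no abA vne pp unfolding Z_def a'p b'r simple_arcs_def swap_heads_def by auto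
    qed (use abA no vne in auto)
  next
    \<comment> \<open>Both joining pairs are doubled. Removing \<open>(p', r)\<close> and
      \<open>(r', p)\<close> turns \<open>(p, r')\<close> and \<open>(r, p')\<close> into simple
      arcs, while the new arcs \<open>(p', p)\<close> and \<open>(r', r)\<close> double the old
      simple ones. The simple arcs change as in the other case.\<close>
    case True
    then have yes: "(p, r') \<in> A" "(r', p) \<in> A" "(p', r) \<in> A" "(r, p') \<in> A" using ts' pr by auto
    show thesis
    proof (rule finish[of "(p', r)" "(r', p)"])
      show "simple_arcs (swap_heads A (p', r) (r', p)) = swap_heads Z a' b'"
        using yes abA vne pp unfolding Z_def a'p b'r simple_arcs_def swap_heads_def by auto
      show "((A - swap_heads A (p', r) (r', p)) \<union> prod.swap ` (swap_heads A (p', r) (r', p) - A)) \<inter> Z = {a', b'}"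
        using yes abA vne pp unfolding Z_def a'p b'r simple_arcs_def swap_heads_def by auto
    qed (use abA yes vne pp in auto)
  qed
qed

section \<open>Splitting a digraph without defects into two undirected graphs\<close>

definition pair_graphs :: "'a set \<Rightarrow> ('a \<Rightarrow> nat) \<Rightarrow> 'a set set set" where
  "pair_graphs V k = {G. G \<subseteq> {e. e \<subseteq> V \<and> card e = 2} \<and> (\<forall>v\<in>V. card {e \<in> G. v \<in> e} = k v)}"

lemma finite_pair_graphs: "finite V \<Longrightarrow> finite (pair_graphs V k)"
  by (rule finite_subset[of _ "Pow (Pow V)"]) (auto simp: pair_graphs_def)

lemma card_arcs_of_graph:
  assumes V: "finite V" and G: "G \<in> pair_graphs V k"
  shows "card {(u, w). {u, w} \<in> G} = (\<Sum>v\<in>V. k v)" and "finite {(u, w). {u, w} \<in> G}"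
    and "(u, w) \<in> {(u, w). {u, w} \<in> G} \<Longrightarrow> u \<noteq> w"
proof -
  have G2: "e \<subseteq> V" "card e = 2" if "e \<in> G" for e using G that by (auto simp: pair_graphs_def)
  have eq: "{(u, w). {u, w} \<in> G} = (SIGMA v:V. {w. {v, w} \<in> G})" using G2(1) by auto
  have fin: "finite {w. {v, w} \<in> G}" for v
    by (rule finite_subset[OF _ V]) (use G2(1) in auto)
  have "card {w. {v, w} \<in> G} = k v" if v: "v \<in> V" for v
  proof -
    have "bij_betw (\<lambda>w. {v, w}) {w. {v, w} \<in> G} {e \<in> G. v \<in> e}"
    proof (rule bij_betw_imageI)
      show "inj_on (\<lambda>w. {v, w}) {w. {v, w} \<in> G}" by (auto simp: inj_on_def doubleton_eq_iff)
      show "(\<lambda>w. {v, w}) ` {w. {v, w} \<in> G} = {e \<in> G. v \<in> e}"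
      proof (intro equalityI subsetI)
        fix e assume e: "e \<in> {e \<in> G. v \<in> e}"
        then obtain x y where "e = {x, y}" "x \<noteq> y" using G2(2)[of e] by (auto simp: card_2_iff)
        then have "\<exists>w. e = {v, w}" using e by auto
        then show "e \<in> (\<lambda>w. {v, w}) ` {w. {v, w} \<in> G}" using e by auto
      qed auto
    qed
    then have "card {w. {v, w} \<in> G} = card {e \<in> G. v \<in> e}" by (rule bij_betw_same_card)
    then show ?thesis using G v by (simp add: pair_graphs_def)
  qed
  then show "card {(u, w). {u, w} \<in> G} = (\<Sum>v\<in>V. k v)" unfolding eq using V fin by simp
  show "finite {(u, w). {u, w} \<in> G}" unfolding eq using V fin by simp
  show "u \<noteq> w" if "(u, w) \<in> {(u, w). {u, w} \<in> G}"
  proof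
    assume "u = w"
    then have "card {u} = 2" using G2(2)[of "{u, w}"] that by simp
    then show False by simp
  qed
qed

lemma even_degree_sum:
  assumes V: "finite V" and ne: "pair_graphs V k \<noteq> {}"
  shows "even (\<Sum>v\<in>V. k v)"
proof -
  obtain G where G: "G \<in> pair_graphs V k" using ne by blast
  have "even (card {(u, w). {u, w} \<in> G})"
    using card_arcs_of_graph(2,3)[OF V G] by (intro even_card_symmetric) (auto simp: insert_commute)
  then show ?thesis by (simp add: card_arcs_of_graph(1)[OF V G])
qed

text \<open>Used with a colouring and with its complement; the doubled pairs belong to both
  halves.\<close>

definition half_graph :: "('a \<times> 'a) set \<Rightarrow> ('a \<times> 'a \<Rightarrow> bool) \<Rightarrow> 'a set set" where
  "half_graph A \<kappa> = {{fst e, snd e} | e. e \<in> A \<and> (prod.swap e \<in> A \<or> \<kappa> e)}"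

text \<open>By alternation \<open>\<rho>\<close> maps the coloured arcs into \<open>v\<close>
  bijectively to the uncoloured arcs out of \<open>v\<close>. The coloured arcs at \<open>v\<close>,
  in either direction, are thus as many as all simple arcs out of \<open>v\<close>.\<close>

lemma half_graph_regular:
  assumes V: "finite V" and A: "A \<in> regular_arcs V k"
    and Z: "arc_config (simple_arcs A) \<rho>" and alt: "\<And>e. e \<in> simple_arcs A \<Longrightarrow> \<kappa> (\<rho> e) \<noteq> \<kappa> e"
  shows "half_graph A \<kappa> \<in> pair_graphs V k"
proof -
  have finA: "finite A" using regular_arcsD(1)[OF A] V by (auto intro: finite_subset)
  have ne: "fst e \<noteq> snd e" if "e \<in> A" for e using regular_arcsD(2)[OF A that] .
  have perm: "\<rho> permutes simple_arcs A" using Z by (simp add: arc_config_def)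
  have "card {e \<in> half_graph A \<kappa>. v \<in> e} = k v" if v: "v \<in> V" for v
  proof -
    define C1 where "C1 = {e \<in> A. fst e = v \<and> prod.swap e \<in> A}"
    define C2 where "C2 = {e \<in> simple_arcs A. fst e = v \<and> \<kappa> e}"
    define C3 where "C3 = {e \<in> simple_arcs A. snd e = v \<and> \<kappa> e}"
    define C4 where "C4 = {e \<in> simple_arcs A. fst e = v \<and> \<not> \<kappa> e}"
    have fin: "finite C1" "finite C2" "finite C3" "finite C4"
      using finA by (auto simp: C1_def C2_def C3_def C4_def simple_arcs_def)
    have "bij_betw \<rho> C3 C4"
    proof (rule bij_betw_imageI)
      show "inj_on \<rho> C3" using permutes_inj[OF perm] by (rule inj_on_subset) auto
      show "\<rho> ` C3 = C4"
      proof (intro equalityI subsetI)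
        fix x assume "x \<in> \<rho> ` C3"
        then obtain e where e: "e \<in> simple_arcs A" "snd e = v" "\<kappa> e" "x = \<rho> e" by (auto simp: C3_def)
        then show "x \<in> C4" using Z alt[of e] permutes_in_image[OF perm, of e] by (auto simp: C4_def arc_config_def)
      next
        fix x assume x: "x \<in> C4"
        then have "x \<in> \<rho> ` simple_arcs A" using permutes_image[OF perm] by (simp add: C4_def)
        then obtain e where e: "e \<in> simple_arcs A" "x = \<rho> e" by blast
        then have "e \<in> C3" using x Z alt[of e] by (auto simp: C3_def C4_def arc_config_def)
        then show "x \<in> \<rho> ` C3" using e by blast
      qed
    qed
    then have c34: "card C3 = card C4" by (rule bij_betw_same_card)
    have "{e \<in> A. fst e = v} = C1 \<union> (C2 \<union> C4)" by (auto simp: C1_def C2_def C4_def simple_arcs_def)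
    moreover have "card (C1 \<union> (C2 \<union> C4)) = card C1 + (card C2 + card C4)"
    proof -
      have "C1 \<inter> (C2 \<union> C4) = {}" "C2 \<inter> C4 = {}" by (auto simp: C1_def C2_def C4_def simple_arcs_def)
      then show ?thesis using fin by (simp add: card_Un_disjoint)
    qed
    ultimately have k: "k v = card C1 + card C2 + card C4" using regular_arcsD(3)[OF A v] by simp
    have "card (C1 \<union> (C2 \<union> C3)) = card C1 + (card C2 + card C3)"
    proof -
      have "C2 \<inter> C3 = {}" using ne by (auto simp: C2_def C3_def simple_arcs_def)
      moreover have "C1 \<inter> (C2 \<union> C3) = {}" by (auto simp: C1_def C2_def C3_def simple_arcs_def)
      ultimately show ?thesis using fin by (simp add: card_Un_disjoint)
    qed
    moreover have "bij_betw (\<lambda>e. {fst e, snd e}) (C1 \<union> (C2 \<union> C3)) {e \<in> half_graph A \<kappa>. v \<in> e}"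
    proof (rule bij_betw_imageI)
      show "inj_on (\<lambda>e. {fst e, snd e}) (C1 \<union> (C2 \<union> C3))"
      proof (rule inj_onI)
        fix x y assume xy: "x \<in> C1 \<union> (C2 \<union> C3)" "y \<in> C1 \<union> (C2 \<union> C3)" "{fst x, snd x} = {fst y, snd y}"
        then consider "x = y" | "y = prod.swap x" by (cases x; cases y) (auto simp: doubleton_eq_iff)
        then show "x = y"
        proof cases
          case 2
          then show ?thesis using xy ne[of x] by (cases x) (auto simp: C1_def C2_def C3_def simple_arcs_def)
        qed
      qed
      show "(\<lambda>e. {fst e, snd e}) ` (C1 \<union> (C2 \<union> C3)) = {e \<in> half_graph A \<kappa>. v \<in> e}"
      proof (intro equalityI subsetI)
        fix E assume "E \<in> {e \<in> half_graph A \<kappa>. v \<in> e}"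
        then obtain e where e: "e \<in> A" "prod.swap e \<in> A \<or> \<kappa> e" "E = {fst e, snd e}" "v = fst e \<or> v = snd e"
          by (auto simp: half_graph_def)
        show "E \<in> (\<lambda>e. {fst e, snd e}) ` (C1 \<union> (C2 \<union> C3))"
        proof (cases "prod.swap e \<in> A")
          case True
          then have "(if v = fst e then e else prod.swap e) \<in> C1" using e by (auto simp: C1_def)
          then show ?thesis using e(3) by (rule_tac image_eqI[where x = "if v = fst e then e else prod.swap e"]) auto
        next
          case False
          then have "e \<in> C2 \<union> C3" using e by (auto simp: C2_def C3_def simple_arcs_def)
          then show ?thesis using e(3) by blast
        qed
      next
        fix E assume "E \<in> (\<lambda>e. {fst e, snd e}) ` (C1 \<union> (C2 \<union> C3))"
        then obtain e where e: "e \<in> C1 \<union> (C2 \<union> C3)" "E = {fst e, snd e}" by blast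
        have "e \<in> A" "prod.swap e \<in> A \<or> \<kappa> e" "v = fst e \<or> v = snd e"
          using e(1) by (auto simp: C1_def C2_def C3_def simple_arcs_def)
        then show "E \<in> {e \<in> half_graph A \<kappa>. v \<in> e}"
          unfolding half_graph_def e(2) by blast
      qed
    qed
    then have "card (C1 \<union> (C2 \<union> C3)) = card {e \<in> half_graph A \<kappa>. v \<in> e}" by (rule bij_betw_same_card)
    ultimately show ?thesis using k c34 by simp
  qed
  moreover have "half_graph A \<kappa> \<subseteq> {e. e \<subseteq> V \<and> card e = 2}"
    using regular_arcsD(1)[OF A] ne by (fastforce simp: half_graph_def)
  ultimately show ?thesis by (simp add: pair_graphs_def)
qed

text \<open>A digraph without defects consists of arcs whose underlying links lie in one of its two
  halves. Each half has \<open>L\<close> arcs if both directions are counted, so two halves carry at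
  most \<open>2 ^ (2 * L) = 4 ^ L\<close> digraphs.\<close>

lemma card_defect_free:
  assumes V: "finite V"
  shows "card {A \<in> regular_arcs V k. defect_number (simple_arcs A) = 0}
    \<le> 4 ^ (\<Sum>v\<in>V. k v) * card (pair_graphs V k) ^ 2"
proof -
  define L where "L = (\<Sum>v\<in>V. k v)"
  define S where "S = pair_graphs V k"
  define U where "U p = {(u, w). {u, w} \<in> fst p} \<union> {(u, w). {u, w} \<in> snd p}" for p :: "'a set set \<times> 'a set set"
  have U: "finite (U p)" "card (U p) \<le> 2 * L" if "p \<in> S \<times> S" for p
  proof -
    have p: "fst p \<in> pair_graphs V k" "snd p \<in> pair_graphs V k" using that by (auto simp: S_def)
    show "finite (U p)" unfolding U_def using card_arcs_of_graph(2)[OF V p(1)] card_arcs_of_graph(2)[OF V p(2)] by simp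
    show "card (U p) \<le> 2 * L" unfolding U_def
      by (rule order_trans[OF card_Un_le]) (simp add: L_def card_arcs_of_graph(1)[OF V p(1)] card_arcs_of_graph(1)[OF V p(2)])
  qed
  have finS: "finite (S \<times> S)" unfolding S_def using finite_pair_graphs[OF V] by simp
  have "{A \<in> regular_arcs V k. defect_number (simple_arcs A) = 0} \<subseteq> (\<Union>p\<in>S \<times> S. Pow (U p))"
  proof
    fix A assume "A \<in> {A \<in> regular_arcs V k. defect_number (simple_arcs A) = 0}"
    then have A: "A \<in> regular_arcs V k" and 0: "defect_number (simple_arcs A) = 0" by auto
    have finA: "finite A" using regular_arcsD(1)[OF A] V by (auto intro: finite_subset)
    have fin: "finite (simple_arcs A)" using finA by (simp add: simple_arcs_def)
    obtain \<rho>0 where "arc_config (simple_arcs A) \<rho>0"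
      using ex_arc_config[OF fin regular_arcs_balanced[OF V A]] by blast
    then obtain \<rho> \<kappa> where m: "min_config (simple_arcs A) \<rho> \<kappa>" "card (defects (simple_arcs A) \<rho> \<kappa>) = 0"
      using min_config_exists[of "simple_arcs A"] 0 by metis
    then have "defects (simple_arcs A) \<rho> \<kappa> = {}" using finite_defects[OF fin] by auto
    then have alt: "\<kappa> (\<rho> e) \<noteq> \<kappa> e" if "e \<in> simple_arcs A" for e using that unfolding defects_def by blast
    have Z: "arc_config (simple_arcs A) \<rho>" using m by (simp add: min_config_def)
    have 1: "half_graph A \<kappa> \<in> S" unfolding S_def by (rule half_graph_regular[OF V A Z]) (use alt in blast)
    have 2: "half_graph A (\<lambda>e. \<not> \<kappa> e) \<in> S" unfolding S_def
      by (rule half_graph_regular[OF V A Z]) (use alt in blast)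
    have "A \<subseteq> U (half_graph A \<kappa>, half_graph A (\<lambda>e. \<not> \<kappa> e))"
    proof
      fix e assume e: "e \<in> A"
      obtain u w where uw: "e = (u, w)" by (cases e)
      have "{u, w} \<in> half_graph A \<kappa> \<or> {u, w} \<in> half_graph A (\<lambda>e. \<not> \<kappa> e)"
        unfolding half_graph_def using e uw by (cases "\<kappa> e") (force+)
      then show "e \<in> U (half_graph A \<kappa>, half_graph A (\<lambda>e. \<not> \<kappa> e))" by (auto simp: U_def uw)
    qed
    then show "A \<in> (\<Union>p\<in>S \<times> S. Pow (U p))" using 1 2 by blast
  qed
  then have "card {A \<in> regular_arcs V k. defect_number (simple_arcs A) = 0} \<le> card (\<Union>p\<in>S \<times> S. Pow (U p))"
    using finS U(1) by (intro card_mono) auto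
  also have "\<dots> \<le> (\<Sum>p\<in>S \<times> S. card (Pow (U p)))" by (rule card_UN_le[OF finS])
  also have "\<dots> \<le> (\<Sum>p\<in>S \<times> S. 4 ^ L)"
  proof (rule sum_mono)
    fix p assume "p \<in> S \<times> S"
    then have "2 ^ card (U p) \<le> (2::nat) ^ (2 * L)" using U(2) by (intro power_increasing) auto
    then show "card (Pow (U p)) \<le> 4 ^ L" using U(1)[OF \<open>p \<in> S \<times> S\<close>] by (simp add: card_Pow power_mult)
  qed
  also have "\<dots> = 4 ^ L * card S ^ 2" by (simp add: card_cartesian_product power2_eq_square)
  finally show ?thesis by (simp add: L_def S_def)
qed

section \<open>Counting digraphs by their number of defects\<close>

lemma finite_regular_arcs: "finite V \<Longrightarrow> finite (regular_arcs V k)"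
  by (rule finite_subset[of _ "Pow (V \<times> V)"]) (auto dest: regular_arcsD(1))

lemma card_regular_arcs_member:
  assumes V: "finite V" and A: "A \<in> regular_arcs V k"
  shows "finite A" and "card A = (\<Sum>v\<in>V. k v)"
proof -
  show fin: "finite A" using regular_arcsD(1)[OF A] V by (auto intro: finite_subset)
  have "fst ` A \<subseteq> V" using regular_arcsD(1)[OF A] by auto
  then have "(\<Sum>v\<in>V. card {e \<in> A. fst e = v}) = card A"
    using sum.group[of A V fst "\<lambda>_. 1::nat"] fin V by (simp add: card_eq_sum del: sum_constant)
  then show "card A = (\<Sum>v\<in>V. k v)" using regular_arcsD(3)[OF A] by simp
qed

text \<open>Double counting of switchings: different pairs of defects lead from \<open>A\<close> to
  different digraphs with fewer defects, and a switching is reversed by selecting two of the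
  \<open>L\<close> arcs of the new digraph.\<close>

lemma card_defect_class:
  fixes V :: "'a set" and k :: "'a \<Rightarrow> nat"
  assumes V: "finite V" and q: "q > 0"
  defines "R \<equiv> regular_arcs V k" and "dn \<equiv> \<lambda>A. defect_number (simple_arcs A)"
  shows "card {A \<in> R. dn A = q} * (q choose 2) \<le> (\<Sum>v\<in>V. k v) ^ 2 * card {A \<in> R. dn A < q}"
proof -
  define L where "L = (\<Sum>v\<in>V. k v)"
  define rel where "rel A A' \<longleftrightarrow> (\<exists>x\<in>A'. \<exists>y\<in>A'. A = swap_heads A' x y)" for A A' :: "('a \<times> 'a) set"
  have finR: "finite R" unfolding R_def by (rule finite_regular_arcs[OF V])
  have finA: "finite A" and cardA: "card A = L" if "A \<in> R" for A
    using card_regular_arcs_member[OF V, of A k] that by (simp_all add: R_def L_def)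
  have fwd: "q choose 2 \<le> card {A' \<in> {A \<in> R. dn A < q}. rel A A'}" if A: "A \<in> R" "dn A = q" for A
  proof -
    define Z where "Z = simple_arcs A"
    have fin: "finite Z" using finA[OF A(1)] by (simp add: Z_def simple_arcs_def)
    have AR: "A \<in> regular_arcs V k" using A by (simp add: R_def)
    obtain \<rho>0 where "arc_config Z \<rho>0"
      using ex_arc_config[OF fin] regular_arcs_balanced[OF V AR] by (auto simp: Z_def)
    then obtain \<rho> \<kappa> where m: "min_config Z \<rho> \<kappa>" "card (defects Z \<rho> \<kappa>) = q"
      using min_config_exists[of Z] A(2) unfolding dn_def Z_def by metis
    define \<Delta> where "\<Delta> = defects Z \<rho> \<kappa>"
    define D where "D A' = ((A - A') \<union> prod.swap ` (A' - A)) \<inter> Z" for A'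
    \<comment> \<open>The two simple arcs involved in the switching lie on the walks of exactly two
      defects, so the pair is determined by \<open>A'\<close>.\<close>
    define \<Phi> where "\<Phi> A' = {d \<in> \<Delta>. \<exists>n. (\<rho> ^^ n) d \<in> D A'}" for A'
    have "{B. B \<subseteq> \<Delta> \<and> card B = 2} \<subseteq> \<Phi> ` {A' \<in> {A \<in> R. dn A < q}. rel A A'}"
    proof
      fix B assume "B \<in> {B. B \<subseteq> \<Delta> \<and> card B = 2}"
      then obtain a b where B: "B = {a, b}" "a \<noteq> b" "a \<in> \<Delta>" "b \<in> \<Delta>" by (auto simp: card_2_iff)
      obtain A' n i where A': "A' \<in> regular_arcs V k" "defect_number (simple_arcs A') < card (defects Z \<rho> \<kappa>)"
        "\<exists>x\<in>A'. \<exists>y\<in>A'. A = swap_heads A' x y"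
        "((A - A') \<union> prod.swap ` (A' - A)) \<inter> Z = {(\<rho> ^^ n) a, (\<rho> ^^ i) b}"
        using B m(1) unfolding \<Delta>_def Z_def by (metis switch_defects[OF V AR])
      have D: "D A' = {(\<rho> ^^ n) a, (\<rho> ^^ i) b}" using A'(4) by (simp add: D_def)
      have same: "d = x" if "d \<in> \<Delta>" "x \<in> \<Delta>" "(\<rho> ^^ j) d = (\<rho> ^^ l) x" for d x j l
      proof (rule ccontr)
        assume "d \<noteq> x"
        have "(\<rho> ^^ j) d \<noteq> (\<rho> ^^ l) x"
          by (rule move_two_defects[OF fin m(1) that(1,2)[unfolded \<Delta>_def] \<open>d \<noteq> x\<close>])
        then show False using that(3) by simp
      qed
      have "\<Phi> A' = B"
      proof (intro equalityI subsetI)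
        fix d assume "d \<in> \<Phi> A'"
        then show "d \<in> B" using same[of d a] same[of d b] B by (auto simp: \<Phi>_def D)
      next
        fix d assume "d \<in> B"
        then show "d \<in> \<Phi> A'" using B by (auto simp: \<Phi>_def D)
      qed
      moreover have "A' \<in> {A' \<in> {A \<in> R. dn A < q}. rel A A'}"
        using A' m(2) by (simp add: R_def dn_def rel_def)
      ultimately show "B \<in> \<Phi> ` {A' \<in> {A \<in> R. dn A < q}. rel A A'}" by blast
    qed
    then have "card {B. B \<subseteq> \<Delta> \<and> card B = 2} \<le> card {A' \<in> {A \<in> R. dn A < q}. rel A A'}"
      using finR by (intro surj_card_le[where f = \<Phi>]) auto
    then show ?thesis using n_subsets[of \<Delta> 2] finite_defects[OF fin] m(2) by (simp add: \<Delta>_def)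
  qed
  have bwd: "card {A \<in> {A \<in> R. dn A = q}. rel A A'} \<le> L ^ 2" if A': "A' \<in> R" for A'
  proof -
    have "{A \<in> {A \<in> R. dn A = q}. rel A A'} \<subseteq> (\<lambda>(x, y). swap_heads A' x y) ` (A' \<times> A')"
      by (auto simp: rel_def)
    then have "card {A \<in> {A \<in> R. dn A = q}. rel A A'} \<le> card (A' \<times> A')"
      using finA[OF A'] by (intro surj_card_le) auto
    then show ?thesis using cardA[OF A'] by (simp add: card_cartesian_product power2_eq_square)
  qed
  have "card {A \<in> R. dn A = q} * (q choose 2) \<le> (\<Sum>A\<in>{A \<in> R. dn A = q}. card {A' \<in> {A \<in> R. dn A < q}. rel A A'})"
    using fwd sum_mono[of "{A \<in> R. dn A = q}" "\<lambda>_. q choose 2"] by simp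
  also have "\<dots> = (\<Sum>A'\<in>{A \<in> R. dn A < q}. card {A \<in> {A \<in> R. dn A = q}. rel A A'})"
    using sum.swap_restrict[of "{A \<in> R. dn A = q}" "{A \<in> R. dn A < q}" "\<lambda>_ _. 1::nat" rel] finR by (simp add: card_eq_sum del: sum_constant)
  also have "\<dots> \<le> (\<Sum>A'\<in>{A \<in> R. dn A < q}. L ^ 2)" using bwd by (intro sum_mono) auto
  finally show ?thesis by (simp add: L_def mult.commute)
qed

text \<open>Admitting defect number \<open>q\<close> enlarges the class by at most the factor
  \<open>(1 + 2 * L / q)^2\<close>. For \<open>q\<close> up to \<open>L\<close> these factors
  multiply to the square of \<open>(3 * L) choose L\<close>, at most \<open>64 ^ L\<close>. The
  digraphs without defects contribute \<open>4 ^ L\<close>, and \<open>4 * 64 = 256\<close>.\<close>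

lemma card_regular_arcs_le:
  assumes V: "finite V" and ne: "pair_graphs V k \<noteq> {}"
  shows "real (card (regular_arcs V k)) \<le> 256 ^ (\<Sum>v\<in>V. k v) * real (card (pair_graphs V k)) ^ 2"
proof -
  define L where "L = (\<Sum>v\<in>V. k v)"
  define R where "R = regular_arcs V k"
  define dn where "dn A = defect_number (simple_arcs A)" for A :: "('a \<times> 'a) set"
  define s where "s q = real (card {A \<in> R. dn A \<le> q})" for q
  have finR: "finite R" unfolding R_def by (rule finite_regular_arcs[OF V])
  have finA: "finite A" and cardA: "card A = L" if "A \<in> R" for A
    using card_regular_arcs_member[OF V, of A k] that by (simp_all add: R_def L_def)
  \<comment> \<open>Parity matters: among \<open>q\<close> defects there are at least
    \<open>q^2 / 4\<close> pairs if \<open>q \<ge> 2\<close>, but none if \<open>q = 1\<close>, a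
    value that must be excluded.\<close>
  have dn_facts: "dn A \<le> L \<and> even (dn A)" if A: "A \<in> R" for A
  proof -
    define Z where "Z = simple_arcs A"
    have AR: "A \<in> regular_arcs V k" using A by (simp add: R_def)
    have fin: "finite Z" using finA[OF A] by (simp add: Z_def simple_arcs_def)
    obtain \<rho>0 where "arc_config Z \<rho>0"
      using ex_arc_config[OF fin] regular_arcs_balanced[OF V AR] by (auto simp: Z_def)
    then obtain \<rho> \<kappa> where m: "min_config Z \<rho> \<kappa>" "card (defects Z \<rho> \<kappa>) = dn A"
      using min_config_exists[of Z] unfolding dn_def Z_def by metis
    have "card (defects Z \<rho> \<kappa>) \<le> card A"
      using finA[OF A] defects_subset[of Z \<rho> \<kappa>] by (intro card_mono) (auto simp: Z_def simple_arcs_def)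
    moreover have "even (card (A - Z))"
    proof (rule even_card_symmetric)
      fix e assume e: "e \<in> A - Z"
      show "prod.swap e \<in> A - Z" using e by (auto simp: Z_def simple_arcs_def)
      show "fst e \<noteq> snd e" using e regular_arcsD(2)[OF AR] by auto
    qed (use finA[OF A] in auto)
    then have "even (card Z)"
    proof -
      have "card A = card (A - Z) + card Z"
        using card_Int_Diff[OF finA[OF A], of Z] by (simp add: Int_absorb1 Z_def simple_arcs_def Int_def conj_commute)
      then show ?thesis using \<open>even (card (A - Z))\<close> even_degree_sum[OF V ne] cardA[OF A] by (simp add: L_def)
    qed
    then have "even (card (defects Z \<rho> \<kappa>))"
      using m by (intro even_defects[OF fin]) (simp_all add: min_config_def)
    ultimately show ?thesis using cardA[OF A] m(2) by simp
  qed
  have step: "s (Suc q) \<le> s q * (1 + real (2 * L) / real (Suc q)) ^ 2" for q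
  proof -
    have "{A \<in> R. dn A \<le> Suc q} = {A \<in> R. dn A \<le> q} \<union> {A \<in> R. dn A = Suc q}" by auto
    also have "card \<dots> = card {A \<in> R. dn A \<le> q} + card {A \<in> R. dn A = Suc q}"
      using finR by (intro card_Un_disjoint) auto
    finally have s: "s (Suc q) = s q + real (card {A \<in> R. dn A = Suc q})" by (simp add: s_def)
    have "real (card {A \<in> R. dn A = Suc q}) \<le> s q * (real (2 * L) / real (Suc q)) ^ 2"
    proof (cases "even (Suc q)")
      case True
      have q2: "real (Suc q choose 2) \<ge> (real (Suc q)) ^ 2 / 4"
      proof -
        have "(Suc q choose 2) * 2 = Suc q * q" by (simp add: choose_two)
        then have "real (Suc q choose 2) * 2 = real (Suc q) * real q"
          by (metis of_nat_mult of_nat_numeral)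
        then have ch: "4 * real (Suc q choose 2) = real (Suc q) * (2 * real q)" by linarith
        have "real (Suc q) \<le> 2 * real q" using True by (cases q) auto
        then have "real (Suc q) * real (Suc q) \<le> real (Suc q) * (2 * real q)"
          by (rule mult_left_mono) simp
        then have "real (Suc q) ^ 2 \<le> 4 * real (Suc q choose 2)" unfolding power2_eq_square ch .
        then show ?thesis by simp
      qed
      have "real (card {A \<in> R. dn A = Suc q}) * ((real (Suc q)) ^ 2 / 4) \<le> real (card {A \<in> R. dn A = Suc q}) * real (Suc q choose 2)"
        using q2 by (intro mult_left_mono) auto
      also have "\<dots> \<le> real L ^ 2 * s q"
      proof -
        have "card {A \<in> R. dn A = Suc q} * (Suc q choose 2) \<le> L ^ 2 * card {A \<in> R. dn A \<le> q}"
          using card_defect_class[OF V, of "Suc q" k] by (simp only: R_def dn_def L_def less_Suc_eq_le zero_less_Suc)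
        then have "real (card {A \<in> R. dn A = Suc q} * (Suc q choose 2)) \<le> real (L ^ 2 * card {A \<in> R. dn A \<le> q})"
          by (rule of_nat_mono)
        then show ?thesis by (simp only: s_def of_nat_mult of_nat_power)
      qed
      finally show ?thesis by (simp add: power_divide field_simps del: of_nat_Suc)
    next
      case False
      have e: "{A \<in> R. dn A = Suc q} = {}"
      proof (rule ccontr)
        assume "{A \<in> R. dn A = Suc q} \<noteq> {}"
        then obtain A where "A \<in> R" "dn A = Suc q" by blast
        then show False using dn_facts[of A] False by simp
      qed
      show ?thesis unfolding e by (simp add: s_def)
    qed
    \<comment> \<open>Enlarging \<open>1 + x^2\<close> to \<open>(1 + x)^2\<close> is what makes the
      product of the factors a squared binomial coefficient.\<close>
    moreover have "s q * (1 + x ^ 2) \<le> s q * (1 + x) ^ 2" if "x \<ge> 0" for x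
      using that by (intro mult_left_mono) (auto simp: s_def power2_eq_square algebra_simps)
    from this[of "real (2 * L) / real (Suc q)"] have
      "s q * (1 + (real (2 * L) / real (Suc q)) ^ 2) \<le> s q * (1 + real (2 * L) / real (Suc q)) ^ 2" by simp
    ultimately show ?thesis using s by (simp add: distrib_left)
  qed
  have "s q \<le> s 0 * real ((2 * L + q) choose q) ^ 2" for q
  proof (induction q)
    case (Suc q)
    have b: "real ((2 * L + Suc q) choose Suc q) = real ((2 * L + q) choose q) * (1 + real (2 * L) / real (Suc q))"
    proof -
      have "Suc (2 * L + q) * ((2 * L + q) choose q) = (Suc (2 * L + q) choose Suc q) * Suc q"
        by (rule Suc_times_binomial_eq)
      then have "real (Suc (2 * L + q)) * real ((2 * L + q) choose q) = real (Suc (2 * L + q) choose Suc q) * real (Suc q)"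
        by (simp only: flip: of_nat_mult)
      then show ?thesis by (simp add: field_simps)
    qed
    have "s (Suc q) \<le> (s 0 * real ((2 * L + q) choose q) ^ 2) * (1 + real (2 * L) / real (Suc q)) ^ 2"
      by (rule order_trans[OF step mult_right_mono[OF Suc]]) simp
    then show ?case unfolding b by (simp add: power_mult_distrib mult.assoc)
  qed simp
  from this[of L] have "s L \<le> s 0 * real ((3 * L) choose L) ^ 2" by simp
  moreover have "real ((3 * L) choose L) ^ 2 \<le> 64 ^ L"
  proof -
    have "(3 * L) choose L \<le> 2 ^ (3 * L)" by (rule binomial_le_pow2)
    then have "real ((3 * L) choose L) \<le> 2 ^ (3 * L)" by (metis of_nat_le_iff of_nat_numeral of_nat_power)
    then have "real ((3 * L) choose L) ^ 2 \<le> (2 ^ (3 * L)) ^ 2" by (intro power_mono) auto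
    also have "\<dots> = (64::real) ^ L" by (simp add: power_mult flip: power_mult_distrib) (simp add: power2_eq_square flip: power_mult_distrib)
    finally show ?thesis .
  qed
  then have "s 0 * real ((3 * L) choose L) ^ 2 \<le> s 0 * 64 ^ L"
    by (intro mult_left_mono) (simp_all add: s_def)
  ultimately have sL: "s L \<le> s 0 * 64 ^ L" by (rule order_trans)
  have "s L = real (card R)"
  proof -
    have "{A \<in> R. dn A \<le> L} = R" using dn_facts by auto
    then show ?thesis by (simp add: s_def)
  qed
  moreover have "s 0 \<le> 4 ^ L * real (card (pair_graphs V k)) ^ 2"
  proof -
    have "real (card {A \<in> R. dn A = 0}) \<le> real (4 ^ L * card (pair_graphs V k) ^ 2)"
      using card_defect_free[OF V, of k] unfolding R_def dn_def L_def by (rule of_nat_mono)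
    then show ?thesis by (simp add: s_def)
  qed
  then have "s 0 * 64 ^ L \<le> 4 ^ L * real (card (pair_graphs V k)) ^ 2 * 64 ^ L"
    by (intro mult_right_mono) simp_all
  ultimately have "real (card R) \<le> 4 ^ L * real (card (pair_graphs V k)) ^ 2 * 64 ^ L"
    using sL by linarith
  also have "\<dots> = 256 ^ L * real (card (pair_graphs V k)) ^ 2"
  proof -
    have "(256::real) ^ L = 4 ^ L * 64 ^ L" by (simp flip: power_mult_distrib)
    then show ?thesis by simp
  qed
  finally show ?thesis by (simp only: R_def L_def)
qed

section \<open>Counting words and graphs\<close>

definition words :: "'p set \<Rightarrow> 'a set \<Rightarrow> ('a \<Rightarrow> nat) \<Rightarrow> ('p \<Rightarrow> 'a) set" where
  "words P V k = {W \<in> P \<rightarrow>\<^sub>E V. \<forall>v\<in>V. card {p \<in> P. W p = v} = k v}"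

lemma finite_words: "finite P \<Longrightarrow> finite V \<Longrightarrow> finite (words P V k)"
  unfolding words_def by (rule finite_subset[OF _ finite_PiE[of P "\<lambda>_. V"]]) auto

text \<open>Numbering the occurrences of each letter turns a word into a bijection from
  \<open>P\<close> to the set \<open>Q\<close> with \<open>k v\<close> copies of each letter
  \<open>v\<close>.\<close>

lemma card_words:
  assumes P: "finite P" and V: "finite V" and sum: "(\<Sum>v\<in>V. k v) = card P"
  shows "card (words P V k) * (\<Prod>v\<in>V. fact (k v)) = fact (card P)"
proof -
  define Q where "Q = (SIGMA v:V. {..<k v})"
  define F where "F W v = {p \<in> P. W p = v}" for W :: "'a \<Rightarrow> 'b" and v
  define S where "S = (SIGMA W:words P V k. block_labellings V (F W))"
  have cardF: "card (F W v) = k v" if "W \<in> words P V k" "v \<in> V" for W v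
    using that by (auto simp: words_def F_def)
  have UF: "(\<Union>v\<in>V. F W v) = P" if "W \<in> words P V k" for W
    using that by (auto simp: words_def F_def)
  have cardB: "card (block_labellings V (F W)) = (\<Prod>v\<in>V. fact (k v))" if W: "W \<in> words P V k" for W
  proof -
    have "card (block_labellings V (F W)) = (\<Prod>v\<in>V. fact (card (F W v)))"
      using P V by (intro card_block_labellings) (auto simp: F_def disjoint_family_on_def)
    then show ?thesis using cardF[OF W] by simp
  qed
  have finB: "finite (block_labellings V (F W))" if "W \<in> words P V k" for W
    by (rule card_ge_0_finite) (simp add: cardB[OF that] prod_pos)
  have finQ: "finite Q" "card Q = card P" using V sum by (auto simp: Q_def)
  define ph where "ph = (\<lambda>(W :: 'a \<Rightarrow> 'b, lab :: 'a \<Rightarrow> nat). \<lambda>p\<in>P. (W p, lab p))"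
  have "bij_betw ph S {f \<in> extensional P. bij_betw f P Q}"
  proof (rule bij_betwI')
    fix x y assume x: "x \<in> S" and y: "y \<in> S"
    obtain W lab W' lab' where xy: "x = (W, lab)" "y = (W', lab')" by (cases x; cases y)
    have ext: "W \<in> extensional P" "W' \<in> extensional P" "lab \<in> extensional P" "lab' \<in> extensional P"
      using x y UF by (auto simp: xy S_def words_def block_labellings_def PiE_def)
    show "(ph x = ph y) = (x = y)"
    proof
      assume eq: "ph x = ph y"
      have "W p = W' p \<and> lab p = lab' p" if "p \<in> P" for p
        using fun_cong[OF eq, of p] that by (simp add: ph_def xy)
      then show "x = y" using ext unfolding xy by (metis extensionalityI)
    qed simp
  next
    fix x assume x: "x \<in> S"
    obtain W lab where xW: "x = (W, lab)" by (cases x)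
    have W: "W \<in> words P V k" and lab: "lab \<in> block_labellings V (F W)" using x by (auto simp: S_def xW)
    have bl: "bij_betw lab (F W v) {..<k v}" if "v \<in> V" for v
      using lab that cardF[OF W that] by (auto simp: block_labellings_def)
    have WV: "W p \<in> V" if "p \<in> P" for p using W that by (auto simp: words_def)
    have "inj_on (ph x) P"
    proof (rule inj_onI)
      fix p q assume pq: "p \<in> P" "q \<in> P" "ph x p = ph x q"
      then have "W p = W q" "lab p = lab q" by (auto simp: ph_def xW)
      then show "p = q"
        using inj_onD[OF bij_betw_imp_inj_on[OF bl[OF WV[OF pq(1)]]], of p q] pq by (simp add: F_def)
    qed
    moreover have "ph x ` P \<subseteq> Q"
    proof
      fix z assume "z \<in> ph x ` P"
      then obtain p where p: "p \<in> P" "z = (W p, lab p)" by (auto simp: ph_def xW)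
      have "lab p \<in> {..<k (W p)}"
        using bij_betwE[OF bl[OF WV[OF p(1)]]] p(1) by (simp add: F_def)
      then show "z \<in> Q" using p WV by (auto simp: Q_def)
    qed
    ultimately have "bij_betw (ph x) P Q"
      using finQ P by (metis bij_betw_def card_image card_subset_eq)
    then show "ph x \<in> {f \<in> extensional P. bij_betw f P Q}" by (simp add: ph_def xW)
  next
    fix f assume f: "f \<in> {f \<in> extensional P. bij_betw f P Q}"
    define W where "W = (\<lambda>p\<in>P. fst (f p))"
    define lab where "lab = (\<lambda>p\<in>P. snd (f p))"
    have fQ: "f p \<in> Q" if "p \<in> P" for p using f that by (auto simp: bij_betw_def)
    have bF: "bij_betw lab (F W v) {..<k v}" if v: "v \<in> V" for v
    proof (rule bij_betw_imageI)
      show "inj_on lab (F W v)"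
      proof (rule inj_onI)
        fix p q assume "p \<in> F W v" "q \<in> F W v" "lab p = lab q"
        then have "p \<in> P" "q \<in> P" "f p = f q" by (auto simp: F_def W_def lab_def prod_eq_iff)
        then show "p = q" using f by (auto simp: bij_betw_def inj_on_def)
      qed
      show "lab ` F W v = {..<k v}"
      proof (intro equalityI subsetI)
        fix a assume "a \<in> lab ` F W v"
        then obtain p where "p \<in> P" "fst (f p) = v" "a = snd (f p)" by (auto simp: F_def W_def lab_def)
        then show "a \<in> {..<k v}" using fQ[of p] by (auto simp: Q_def)
      next
        fix a assume "a \<in> {..<k v}"
        then have "(v, a) \<in> f ` P" using f v by (auto simp: bij_betw_def Q_def)
        then obtain p where "p \<in> P" "f p = (v, a)" by force
        then show "a \<in> lab ` F W v" by (intro image_eqI[of _ _ p]) (auto simp: F_def W_def lab_def)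
      qed
    qed
    have WP: "W \<in> P \<rightarrow>\<^sub>E V"
      using fQ by (force simp: W_def Q_def)
    have W: "W \<in> words P V k"
      using WP bij_betw_same_card[OF bF] by (simp add: words_def F_def)
    moreover have "lab \<in> block_labellings V (F W)"
      using bF cardF[OF W] UF[OF W] by (simp add: block_labellings_def) (simp add: lab_def)
    ultimately have "(W, lab) \<in> S" by (simp add: S_def)
    moreover have "ph (W, lab) = f"
    proof
      fix p show "ph (W, lab) p = f p"
        using f by (cases "p \<in> P") (auto simp: ph_def W_def lab_def extensional_def)
    qed
    ultimately show "\<exists>x\<in>S. f = ph x" by force
  qed
  then have "card S = card {f \<in> extensional P. bij_betw f P Q}" by (rule bij_betw_same_card)
  also have "\<dots> = fact (card P)" by (rule card_ext_bij[OF P finQ])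
  also have "card S = (\<Sum>W\<in>words P V k. card (block_labellings V (F W)))"
    unfolding S_def using finite_words[OF P V] finB by (intro card_SigmaI) auto
  also have "\<dots> = card (words P V k) * (\<Prod>v\<in>V. fact (k v))" by (simp add: cardB)
  finally show ?thesis .
qed

text \<open>A list of the links of a graph spells a word of sources and a word of targets. As a link
  is determined by its ends, the \<open>n!\<close> lists of every graph give different pairs of
  words, and there are \<open>n! / \<Prod> k!\<close> words of one kind and
  \<open>n! / \<Prod> l!\<close> of the other.\<close>

lemma card_degree_graphs_le:
  fixes src :: "'e \<Rightarrow> 'u" and tgt :: "'e \<Rightarrow> 'v"
  assumes fin: "finite E" "finite U" "finite V" and st: "src ` E \<subseteq> U" "tgt ` E \<subseteq> V"
    and inj: "inj_on (\<lambda>e. (src e, tgt e)) E" and k: "(\<Sum>u\<in>U. k u) = n" and l: "(\<Sum>v\<in>V. l v) = n"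
  shows "card (degree_graphs E src tgt U k V l) * ((\<Prod>u\<in>U. fact (k u)) * (\<Prod>v\<in>V. fact (l v))) \<le> fact n"
proof -
  define R where "R = degree_graphs E src tgt U k V l"
  define Bj where "Bj G = {\<beta> \<in> extensional {..<n}. bij_betw \<beta> {..<n} G}" for G :: "'e set"
  define S where "S = (SIGMA G:R. Bj G)"
  define \<Phi> where "\<Phi> = (\<lambda>(G :: 'e set, \<beta>). (restrict (src \<circ> \<beta>) {..<n}, restrict (tgt \<circ> \<beta>) {..<n}))"
  have G: "G \<subseteq> E" "finite G" "card G = n" "\<And>u. u \<in> U \<Longrightarrow> card {e \<in> G. src e = u} = k u"
    "\<And>v. v \<in> V \<Longrightarrow> card {e \<in> G. tgt e = v} = l v" if "G \<in> R" for G
  proof -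
    show GE: "G \<subseteq> E" "\<And>u. u \<in> U \<Longrightarrow> card {e \<in> G. src e = u} = k u"
      "\<And>v. v \<in> V \<Longrightarrow> card {e \<in> G. tgt e = v} = l v" using that by (auto simp: R_def degree_graphs_def)
    show fG: "finite G" using GE fin finite_subset by blast
    have "src ` G \<subseteq> U" using GE(1) st(1) by blast
    then have "(\<Sum>u\<in>U. card {e \<in> G. src e = u}) = card G"
      using sum.group[of G U src "\<lambda>_. 1::nat"] fG fin by (simp add: card_eq_sum del: sum_constant)
    then show "card G = n" using GE k by simp
  qed
  have cardBj: "card (Bj G) = fact n" if "G \<in> R" for G
    unfolding Bj_def using card_ext_bij[of "{..<n}" G] G[OF that] by simp
  have finR: "finite R" unfolding R_def by (rule finite_degree_graphs[OF fin(1)])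
  have finBj: "finite (Bj G)" if "G \<in> R" for G
    by (rule card_ge_0_finite) (simp add: cardBj[OF that])
  have fibre: "card {p \<in> {..<n}. f (\<beta> p) = x} = card {e \<in> G. f e = x}"
    if "\<beta> \<in> Bj G" for \<beta> G and f :: "'e \<Rightarrow> 'c" and x
  proof -
    have "bij_betw \<beta> {p \<in> {..<n}. f (\<beta> p) = x} {e \<in> G. f e = x}"
      using that by (auto simp: Bj_def bij_betw_def inj_on_def)
    then show ?thesis by (rule bij_betw_same_card)
  qed
  have "\<Phi> ` S \<subseteq> words {..<n} U k \<times> words {..<n} V l"
  proof
    fix z assume "z \<in> \<Phi> ` S"
    then obtain G \<beta> where z: "G \<in> R" "\<beta> \<in> Bj G" "z = \<Phi> (G, \<beta>)" by (auto simp: S_def)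
    have \<beta>E: "\<beta> p \<in> E" if "p < n" for p
      using z(2) that G(1)[OF z(1)] unfolding Bj_def bij_betw_def by blast
    have c: "{p \<in> {..<n}. restrict (f \<circ> \<beta>) {..<n} p = x} = {p \<in> {..<n}. f (\<beta> p) = x}"
      for f :: "'e \<Rightarrow> 'c" and x by auto
    have "restrict (src \<circ> \<beta>) {..<n} \<in> words {..<n} U k"
      unfolding words_def mem_Collect_eq c fibre[OF z(2)] using \<beta>E st G[OF z(1)] by auto
    moreover have "restrict (tgt \<circ> \<beta>) {..<n} \<in> words {..<n} V l"
      unfolding words_def mem_Collect_eq c fibre[OF z(2)] using \<beta>E st G[OF z(1)] by auto
    ultimately show "z \<in> words {..<n} U k \<times> words {..<n} V l" by (simp add: z(3) \<Phi>_def)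
  qed
  moreover have "inj_on \<Phi> S"
  proof (rule inj_onI)
    fix x y assume x: "x \<in> S" and y: "y \<in> S" and eq: "\<Phi> x = \<Phi> y"
    obtain G \<beta> G' \<beta>' where xy: "x = (G, \<beta>)" "y = (G', \<beta>')" by (cases x; cases y)
    have R: "G \<in> R" "\<beta> \<in> Bj G" "G' \<in> R" "\<beta>' \<in> Bj G'" using x y by (auto simp: S_def xy)
    have img: "\<beta> ` {..<n} = G" "\<beta>' ` {..<n} = G'" using R by (auto simp: Bj_def bij_betw_def)
    have "\<beta> p = \<beta>' p" if p: "p \<in> {..<n}" for p
    proof -
      have "\<beta> p \<in> E" "\<beta>' p \<in> E" using img p G(1)[OF R(1)] G(1)[OF R(3)] by auto
      moreover have "src (\<beta> p) = src (\<beta>' p)" "tgt (\<beta> p) = tgt (\<beta>' p)"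
        using eq p by (auto simp: \<Phi>_def xy fun_eq_iff restrict_def split: if_splits)
      ultimately show ?thesis using inj by (simp add: inj_on_def)
    qed
    then have "\<beta> = \<beta>'" using R by (auto simp: Bj_def intro: extensionalityI)
    then show "x = y" using img by (simp add: xy)
  qed
  ultimately have "card S \<le> card (words {..<n} U k \<times> words {..<n} V l)"
    using finite_words[OF finite_lessThan fin(2), of n k] finite_words[OF finite_lessThan fin(3), of n l]
    by (intro card_inj_on_le) auto
  moreover have "card S = card R * fact n"
    unfolding S_def using finR finBj cardBj by (subst card_SigmaI) auto
  ultimately have "card R * fact n \<le> card (words {..<n} U k) * card (words {..<n} V l)"
    by (simp add: card_cartesian_product)
  then have "(card R * fact n) * ((\<Prod>u\<in>U. fact (k u)) * (\<Prod>v\<in>V. fact (l v))) \<le>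
      (card (words {..<n} U k) * card (words {..<n} V l)) * ((\<Prod>u\<in>U. fact (k u)) * (\<Prod>v\<in>V. fact (l v)))"
    by (rule mult_le_mono1)
  also have "\<dots> = (card (words {..<n} U k) * (\<Prod>u\<in>U. fact (k u))) * (card (words {..<n} V l) * (\<Prod>v\<in>V. fact (l v)))"
    by (simp only: mult_ac)
  also have "\<dots> = fact n * fact n"
    using card_words[of "{..<n}" U k] card_words[of "{..<n}" V l] fin k l by simp
  finally have "fact n * (card R * ((\<Prod>u\<in>U. fact (k u)) * (\<Prod>v\<in>V. fact (l v)))) \<le> (fact n * fact n :: nat)"
    by (simp only: mult_ac)
  then have "card R * ((\<Prod>u\<in>U. fact (k u)) * (\<Prod>v\<in>V. fact (l v))) \<le> fact n"
    by (simp only: mult_le_cancel1 fact_gt_zero simp_thms)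
  then show ?thesis by (simp add: R_def)
qed

section \<open>Undirected graphs as words of pairs\<close>

abbreviation pair_positions :: "nat \<Rightarrow> (nat \<times> bool) set" where
  "pair_positions h \<equiv> {..<h} \<times> UNIV"

definition word_edge :: "(nat \<times> bool \<Rightarrow> 'a) \<Rightarrow> nat \<Rightarrow> 'a set" where
  "word_edge W i = {W (i, True), W (i, False)}"

definition simple_word :: "nat \<Rightarrow> (nat \<times> bool \<Rightarrow> 'a) \<Rightarrow> bool" where
  "simple_word h W \<longleftrightarrow> inj_on (word_edge W) {..<h} \<and> (\<forall>i<h. W (i, True) \<noteq> W (i, False))"

definition graph_words :: "nat \<Rightarrow> 'a set \<Rightarrow> 'a set set \<Rightarrow> (nat \<times> bool \<Rightarrow> 'a) set" where
  "graph_words h V G = {W \<in> pair_positions h \<rightarrow>\<^sub>E V. bij_betw (word_edge W) {..<h} G}"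

text \<open>A word that spells \<open>G\<close> is an order of its links and, for each link, a
  choice of the end to be written at \<open>True\<close>.\<close>

lemma card_graph_words:
  assumes G: "G \<subseteq> {e. e \<subseteq> V \<and> card e = 2}" "finite G" "card G = h"
  shows "card (graph_words h V G) = fact h * 2 ^ h"
proof -
  define Bj where "Bj = {\<beta> \<in> extensional {..<h}. bij_betw \<beta> {..<h} G}"
  define S where "S = (SIGMA \<beta>:Bj. PiE {..<h} \<beta>)"
  define \<Phi> where "\<Phi> W = (restrict (word_edge W) {..<h}, \<lambda>i\<in>{..<h}. W (i, True))" for W :: "nat \<times> bool \<Rightarrow> 'a"
  have Bj: "card Bj = fact h" unfolding Bj_def using card_ext_bij[of "{..<h}" G] G by simp
  have finBj: "finite Bj" by (rule card_ge_0_finite) (simp add: Bj)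
  have \<beta>2: "card (\<beta> i) = 2" "\<beta> i \<subseteq> V" if "\<beta> \<in> Bj" "i < h" for \<beta> i
  proof -
    have "\<beta> i \<in> G" using that by (auto simp: Bj_def bij_betw_def)
    then show "card (\<beta> i) = 2" "\<beta> i \<subseteq> V" using G(1) by auto
  qed
  have fin: "finite (\<beta> i)" if "\<beta> \<in> Bj" "i < h" for \<beta> i
    using \<beta>2(1)[OF that] by (intro card_ge_0_finite) simp
  have "bij_betw \<Phi> (graph_words h V G) S"
  proof (rule bij_betwI')
    fix W W' assume W: "W \<in> graph_words h V G" and W': "W' \<in> graph_words h V G"
    show "(\<Phi> W = \<Phi> W') = (W = W')"
    proof
      assume eq: "\<Phi> W = \<Phi> W'"
      have "W (i, True) = W' (i, True) \<and> W (i, False) = W' (i, False)" if "i < h" for i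
      proof -
        have "word_edge W i = word_edge W' i" "W (i, True) = W' (i, True)"
          using eq that by (auto simp: \<Phi>_def fun_eq_iff restrict_def split: if_splits)
        then show ?thesis by (auto simp: word_edge_def doubleton_eq_iff)
      qed
      then have "W p = W' p" if "p \<in> pair_positions h" for p
        using that by (cases p; cases "snd p") auto
      then show "W = W'" using W W' by (intro extensionalityI) (auto simp: graph_words_def PiE_def)
    qed simp
  next
    fix W assume W: "W \<in> graph_words h V G"
    have "bij_betw (word_edge W) {..<h} G" using W by (simp add: graph_words_def)
    then have "bij_betw (restrict (word_edge W) {..<h}) {..<h} G"
      by (rule bij_betw_cong[THEN iffD1, rotated]) simp
    then show "\<Phi> W \<in> S" by (auto simp: S_def Bj_def \<Phi>_def word_edge_def)
  next
    fix x assume "x \<in> S"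
    then obtain \<beta> a where x: "x = (\<beta>, a)" "\<beta> \<in> Bj" "a \<in> PiE {..<h} \<beta>" by (auto simp: S_def)
    have "\<exists>b. \<beta> i = {a i, b}" if "i < h" for i
    proof -
      have "a i \<in> \<beta> i" using x(3) that by auto
      moreover have "card (\<beta> i) = 2" by (rule \<beta>2(1)[OF x(2) that])
      then obtain y z where "\<beta> i = {y, z}" by (auto simp: card_2_iff)
      ultimately show ?thesis by auto
    qed
    then obtain b where b: "\<And>i. i < h \<Longrightarrow> \<beta> i = {a i, b i}" by metis
    define W where "W = (\<lambda>(i, c)\<in>pair_positions h. if c then a i else b i)"
    have we: "word_edge W i = \<beta> i" if "i < h" for i using b[OF that] that by (simp add: word_edge_def W_def)
    have "bij_betw \<beta> {..<h} G" using x(2) by (simp add: Bj_def)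
    then have "bij_betw (word_edge W) {..<h} G"
      by (rule bij_betw_cong[THEN iffD1, rotated]) (use we in simp)
    moreover have "W \<in> pair_positions h \<rightarrow>\<^sub>E V"
    proof (rule PiE_I)
      fix p assume "p \<in> pair_positions h"
      then obtain i c where p: "p = (i, c)" "i < h" by auto
      have "{a i, b i} \<subseteq> V" using \<beta>2(2)[OF x(2) p(2)] b[OF p(2)] by simp
      then show "W p \<in> V" using p by (simp add: W_def)
    qed (simp add: W_def)
    ultimately have "W \<in> graph_words h V G" by (simp add: graph_words_def)
    moreover have "\<Phi> W = x"
      using we x by (auto simp: \<Phi>_def W_def fun_eq_iff restrict_def Bj_def extensional_def PiE_def)
    ultimately show "\<exists>W\<in>graph_words h V G. x = \<Phi> W" by blast
  qed
  then have "card (graph_words h V G) = card S" by (rule bij_betw_same_card)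
  also have "\<dots> = (\<Sum>\<beta>\<in>Bj. card (PiE {..<h} \<beta>))"
    unfolding S_def using finBj fin by (intro card_SigmaI) (auto intro!: finite_PiE)
  also have "\<dots> = (\<Sum>\<beta>\<in>Bj. 2 ^ h)"
    using \<beta>2(1) by (intro sum.cong) (auto simp: card_PiE)
  finally show ?thesis by (simp add: Bj)
qed

text \<open>In a simple word the occurrences of a letter belong to different links, so the letter
  counts are the degrees of the graph that is spelled.\<close>

lemma card_simple_words:
  assumes V: "finite V" and sum: "(\<Sum>v\<in>V. k v) = 2 * h"
  shows "card {W \<in> words (pair_positions h) V k. simple_word h W} = card (pair_graphs V k) * (fact h * 2 ^ h)"
proof -
  have other: "card {p \<in> pair_positions h. W p = v} = card {e \<in> word_edge W ` {..<h}. v \<in> e}"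
    if W: "simple_word h W" for W :: "nat \<times> bool \<Rightarrow> 'a" and v
  proof -
    have "bij_betw (\<lambda>p. word_edge W (fst p)) {p \<in> pair_positions h. W p = v} {e \<in> word_edge W ` {..<h}. v \<in> e}"
    proof (rule bij_betw_imageI)
      show "inj_on (\<lambda>p. word_edge W (fst p)) {p \<in> pair_positions h. W p = v}"
      proof (rule inj_onI)
        fix p q assume pq: "p \<in> {p \<in> pair_positions h. W p = v}" "q \<in> {p \<in> pair_positions h. W p = v}"
          "word_edge W (fst p) = word_edge W (fst q)"
        then have f: "fst p = fst q" "fst p < h" using W by (auto simp: simple_word_def inj_on_def)
        then have "W (fst p, True) \<noteq> W (fst p, False)" using W by (simp add: simple_word_def)
        then show "p = q" using pq f by (cases p; cases q; cases "snd p"; cases "snd q") auto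
      qed
      show "(\<lambda>p. word_edge W (fst p)) ` {p \<in> pair_positions h. W p = v} = {e \<in> word_edge W ` {..<h}. v \<in> e}"
      proof (intro equalityI subsetI)
        fix e assume "e \<in> (\<lambda>p. word_edge W (fst p)) ` {p \<in> pair_positions h. W p = v}"
        then obtain i c where "i < h" "W (i, c) = v" "e = word_edge W i" by auto
        then show "e \<in> {e \<in> word_edge W ` {..<h}. v \<in> e}" by (cases c) (auto simp: word_edge_def)
      next
        fix e assume "e \<in> {e \<in> word_edge W ` {..<h}. v \<in> e}"
        then obtain i c where "i < h" "e = word_edge W i" "W (i, c) = v" by (auto simp: word_edge_def)
        then show "e \<in> (\<lambda>p. word_edge W (fst p)) ` {p \<in> pair_positions h. W p = v}"
          by (intro image_eqI[of _ _ "(i, c)"]) auto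
      qed
    qed
    then show ?thesis by (rule bij_betw_same_card)
  qed
  have GR: "finite G" "card G = h" "G \<subseteq> {e. e \<subseteq> V \<and> card e = 2}" if G: "G \<in> pair_graphs V k" for G
  proof -
    show sub: "G \<subseteq> {e. e \<subseteq> V \<and> card e = 2}" using G by (simp add: pair_graphs_def)
    show fin: "finite G" by (rule finite_subset[of _ "Pow V"]) (use sub V in auto)
    have "(\<Sum>v\<in>V. card {e \<in> G. v \<in> e}) = (\<Sum>e\<in>G. card {v \<in> V. v \<in> e})"
      using sum.swap_restrict[of V G "\<lambda>_ _. 1::nat" "\<lambda>v e. v \<in> e"] V fin by (simp add: card_eq_sum del: sum_constant)
    also have "\<dots> = (\<Sum>e\<in>G. 2)"
    proof (rule sum.cong)
      fix e assume "e \<in> G"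
      then have "e \<subseteq> V" "card e = 2" using sub by auto
      moreover have "{v \<in> V. v \<in> e} = e" using \<open>e \<subseteq> V\<close> by auto
      ultimately show "card {v \<in> V. v \<in> e} = 2" by simp
    qed simp
    finally show "card G = h" using G sum by (simp add: pair_graphs_def)
  qed
  have "{W \<in> words (pair_positions h) V k. simple_word h W} = (\<Union>G\<in>pair_graphs V k. graph_words h V G)"
  proof (intro equalityI subsetI)
    fix W assume "W \<in> {W \<in> words (pair_positions h) V k. simple_word h W}"
    then have W: "W \<in> words (pair_positions h) V k" "simple_word h W" by auto
    define G where "G = word_edge W ` {..<h}"
    have WV: "W (i, c) \<in> V" if "i < h" for i c using W that by (auto simp: words_def)
    have "G \<subseteq> {e. e \<subseteq> V \<and> card e = 2}"
      using W(2) WV by (auto simp: G_def word_edge_def simple_word_def)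
    moreover have "card {e \<in> G. v \<in> e} = k v" if "v \<in> V" for v
      using other[OF W(2), of v] W(1) that by (simp add: G_def words_def)
    ultimately have "G \<in> pair_graphs V k" by (simp add: pair_graphs_def)
    moreover have "W \<in> graph_words h V G"
      using W by (auto simp: graph_words_def words_def simple_word_def G_def bij_betw_def)
    ultimately show "W \<in> (\<Union>G\<in>pair_graphs V k. graph_words h V G)" by blast
  next
    fix W assume "W \<in> (\<Union>G\<in>pair_graphs V k. graph_words h V G)"
    then obtain G where G: "G \<in> pair_graphs V k" and W: "W \<in> graph_words h V G" by blast
    have img: "word_edge W ` {..<h} = G" and inj: "inj_on (word_edge W) {..<h}"
      using W by (auto simp: graph_words_def bij_betw_def)
    have "W (i, True) \<noteq> W (i, False)" if "i < h" for i
    proof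
      assume "W (i, True) = W (i, False)"
      then have "card (word_edge W i) = 1" by (simp add: word_edge_def)
      moreover have "word_edge W i \<in> G" using img that by auto
      ultimately show False using GR(3)[OF G] by auto
    qed
    then have s: "simple_word h W" using inj by (simp add: simple_word_def)
    moreover have "W \<in> words (pair_positions h) V k"
      using W G other[OF s] by (simp add: words_def graph_words_def img pair_graphs_def)
    ultimately show "W \<in> {W \<in> words (pair_positions h) V k. simple_word h W}" by simp
  qed
  also have "card \<dots> = (\<Sum>G\<in>pair_graphs V k. card (graph_words h V G))"
  proof (rule card_UN_disjoint)
    show "\<forall>G\<in>pair_graphs V k. finite (graph_words h V G)"
      using card_graph_words[OF GR(3,1,2)] by (auto intro!: card_ge_0_finite)
    show "\<forall>G\<in>pair_graphs V k. \<forall>G'\<in>pair_graphs V k. G \<noteq> G' \<longrightarrow> graph_words h V G \<inter> graph_words h V G' = {}"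
      by (auto simp: graph_words_def bij_betw_def)
  qed (rule finite_pair_graphs[OF V])
  also have "\<dots> = card (pair_graphs V k) * (fact h * 2 ^ h)"
    using card_graph_words[OF GR(3,1,2)] by simp
  finally show ?thesis .
qed

section \<open>Switchings of words\<close>

definition partner :: "nat \<times> bool \<Rightarrow> nat \<times> bool" where
  "partner p = (fst p, \<not> snd p)"

lemma partner_simps [simp]: "partner (partner p) = p" "partner p \<noteq> p" "p \<noteq> partner p"
    "partner p \<in> pair_positions h \<longleftrightarrow> p \<in> pair_positions h" "partner p = partner q \<longleftrightarrow> p = q"
  by (cases p; cases q; auto simp: partner_def)+

lemma partner_swap: "partner p = q \<longleftrightarrow> p = partner q"
  by (cases p; cases q) (auto simp: partner_def)

definition loop_at :: "(nat \<times> bool \<Rightarrow> 'a) \<Rightarrow> nat \<times> bool \<Rightarrow> bool" where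
  "loop_at W p \<longleftrightarrow> W p = W (partner p)"

definition repeated_at :: "nat \<Rightarrow> (nat \<times> bool \<Rightarrow> 'a) \<Rightarrow> nat \<times> bool \<Rightarrow> bool" where
  "repeated_at h W p \<longleftrightarrow> (\<exists>q\<in>pair_positions h. q \<noteq> p \<and> q \<noteq> partner p \<and> W q = W p \<and> W (partner q) = W (partner p))"

text \<open>Loops weigh more than repetitions, because switching two loops with each other yields a double
  edge.\<close>

definition flaw :: "nat \<Rightarrow> (nat \<times> bool \<Rightarrow> 'a) \<Rightarrow> nat \<times> bool \<Rightarrow> nat" where
  "flaw h W p = (if loop_at W p then 2 else if repeated_at h W p then 1 else 0)"

definition flaws :: "nat \<Rightarrow> (nat \<times> bool \<Rightarrow> 'a) \<Rightarrow> nat" where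
  "flaws h W = (\<Sum>p\<in>pair_positions h. flaw h W p)"

definition word_nbrs :: "nat \<Rightarrow> (nat \<times> bool \<Rightarrow> 'a) \<Rightarrow> 'a \<Rightarrow> 'a set" where
  "word_nbrs h W x = {W (partner q) | q. q \<in> pair_positions h \<and> W q = x}"

text \<open>If the pair at \<open>p\<close> reads \<open>x y\<close> and the pair at
  \<open>r\<close> reads \<open>z z'\<close>, the switch produces \<open>x z\<close> and
  \<open>y z'\<close>. The conditions make both new pairs loop-free and new to the word.\<close>

definition good_switch :: "nat \<Rightarrow> (nat \<times> bool \<Rightarrow> 'a) \<Rightarrow> nat \<times> bool \<Rightarrow> nat \<times> bool \<Rightarrow> bool" where
  "good_switch h W p r \<longleftrightarrow> p \<in> pair_positions h \<and> r \<in> pair_positions h \<and> flaw h W p > 0 \<and>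
     W r \<notin> insert (W p) (word_nbrs h W (W p)) \<and>
     W (partner r) \<notin> insert (W (partner p)) (word_nbrs h W (W (partner p)))"

definition switch :: "(nat \<times> bool \<Rightarrow> 'a) \<Rightarrow> nat \<times> bool \<Rightarrow> nat \<times> bool \<Rightarrow> nat \<times> bool \<Rightarrow> 'a" where
  "switch W p r = W \<circ> Transposition.transpose (partner p) r"

lemma word_nbrsI: "q \<in> pair_positions h \<Longrightarrow> W q = x \<Longrightarrow> W (partner q) = y \<Longrightarrow> y \<in> word_nbrs h W x"
  by (auto simp: word_nbrs_def)

lemma good_switch_facts:
  assumes g: "good_switch h W p r"
  shows "r \<noteq> p" "r \<noteq> partner p" "partner r \<noteq> p" "partner r \<noteq> partner p"
    "switch W p r p = W p" "switch W p r (partner p) = W r" "switch W p r r = W (partner p)"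
    "switch W p r (partner r) = W (partner r)"
    "\<And>q. q \<notin> {p, partner p, r, partner r} \<Longrightarrow> switch W p r q = W q \<and> switch W p r (partner q) = W (partner q)"
proof -
  have p: "p \<in> pair_positions h" and r: "r \<in> pair_positions h"
    and nr: "W r \<noteq> W p" "W r \<notin> word_nbrs h W (W p)" using g by (auto simp: good_switch_def)
  show 1: "r \<noteq> p" using nr(1) by auto
  show 2: "r \<noteq> partner p" using nr(2) word_nbrsI[OF p, of W "W p" "W (partner p)"] by auto
  show 3: "partner r \<noteq> p" using 2 partner_swap by metis
  show 4: "partner r \<noteq> partner p" using 1 by simp
  show "switch W p r p = W p" "switch W p r (partner p) = W r" "switch W p r r = W (partner p)"
    "switch W p r (partner r) = W (partner r)"
    using 1 2 3 4 by (auto simp: switch_def Transposition.transpose_def)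
  show "switch W p r q = W q \<and> switch W p r (partner q) = W (partner q)"
    if "q \<notin> {p, partner p, r, partner r}" for q
  proof -
    have "partner q \<noteq> partner p" "partner q \<noteq> r" "q \<noteq> partner p" "q \<noteq> r"
      using that partner_swap[of q r] by auto
    then show ?thesis by (simp add: switch_def)
  qed
qed

lemma flaw_partner: "flaw h W (partner p) = flaw h W p"
proof -
  have "repeated_at h W (partner p) \<Longrightarrow> repeated_at h W p" for p
  proof -
    assume "repeated_at h W (partner p)"
    then obtain q where "q \<in> pair_positions h" "q \<noteq> partner p" "q \<noteq> p" "W q = W (partner p)" "W (partner q) = W p"
      by (auto simp: repeated_at_def)
    then show "repeated_at h W p"
      unfolding repeated_at_def by (intro bexI[of _ "partner q"]) (auto simp: partner_swap)
  qed
  from this[of p] this[of "partner p"] show ?thesis by (auto simp: flaw_def loop_at_def)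
qed

text \<open>The new pairs occur nowhere else, so untouched pairs gain no repetition. They can
  coincide with each other only if both old pairs were loops, and then two loops are traded for two
  repetitions of smaller weight.\<close>

lemma flaws_switch_less:
  assumes g: "good_switch h W p r"
  shows "flaws h (switch W p r) < flaws h W"
proof -
  define W' where "W' = switch W p r"
  note f = good_switch_facts[OF g]
  define x where "x = W p"
  define y where "y = W (partner p)"
  define z where "z = W r"
  define z' where "z' = W (partner r)"
  have pos: "p \<in> pair_positions h" "r \<in> pair_positions h" and bad: "flaw h W p > 0"
    and zx: "z \<noteq> x" "z \<notin> word_nbrs h W x" and zy: "z' \<noteq> y" "z' \<notin> word_nbrs h W y"
    using g by (auto simp: good_switch_def x_def y_def z_def z'_def)
  have W': "W' p = x" "W' (partner p) = z" "W' r = y" "W' (partner r) = z'"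
    using f by (simp_all add: W'_def x_def y_def z_def z'_def)
  have nb: "y \<in> word_nbrs h W x" "x \<in> word_nbrs h W y"
    using word_nbrsI[OF pos(1), of W x y] word_nbrsI[of "partner p" h W y x] pos by (auto simp: x_def y_def)
  define F where "F = {p, partner p, r, partner r}"
  have FP: "F \<subseteq> pair_positions h" unfolding F_def using pos by (simp only: insert_subset partner_simps empty_subsetI simp_thms)
  have out: "flaw h W' q \<le> flaw h W q" if q: "q \<in> pair_positions h - F" for q
  proof -
    have qq: "W' q = W q" "W' (partner q) = W (partner q)" using f(9)[of q] q by (auto simp: F_def W'_def)
    have qP: "q \<in> pair_positions h" using q by simp
    have "repeated_at h W q" if rep: "repeated_at h W' q"
    proof -
      obtain s where s: "s \<in> pair_positions h" "s \<noteq> q" "s \<noteq> partner q" "W' s = W q" "W' (partner s) = W (partner q)"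
        using rep qq by (auto simp: repeated_at_def)
      have "s \<notin> F"
      proof
        assume "s \<in> F"
        then consider "s = p" | "s = partner p" | "s = r" | "s = partner r" by (auto simp: F_def)
        then show False
        proof cases
          case 1 then show ?thesis using s W' zx(2) word_nbrsI[OF qP, of W x z] by auto
        next
          case 2 then show ?thesis using s W' zx(2) word_nbrsI[of "partner q" h W x z] qP by auto
        next
          case 3 then show ?thesis using s W' zy(2) word_nbrsI[OF qP, of W y z'] by auto
        next
          case 4 then show ?thesis using s W' zy(2) word_nbrsI[of "partner q" h W y z'] qP by auto
        qed
      qed
      then have "W' s = W s" "W' (partner s) = W (partner s)" using f(9)[of s] by (auto simp: F_def W'_def)
      then show ?thesis using s unfolding repeated_at_def by (intro bexI[of _ s]) auto
    qed
    then show ?thesis using qq by (auto simp: flaw_def loop_at_def)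
  qed
  have cF: "(\<Sum>q\<in>F. u q) = u p + u (partner p) + u r + u (partner r)" for u :: "nat \<times> bool \<Rightarrow> nat"
  proof -
    have "p \<noteq> r" "p \<noteq> partner r" "partner p \<noteq> r" "partner p \<noteq> partner r"
      using f(1-4) by auto
    then show ?thesis unfolding F_def by (simp add: add.assoc)
  qed
  have inside: "(\<Sum>q\<in>F. flaw h W' q) < (\<Sum>q\<in>F. flaw h W q)"
  proof -
    have nl: "\<not> loop_at W' p" "\<not> loop_at W' r" using W' zx zy by (auto simp: loop_at_def)
    show ?thesis
    proof (cases "x = y \<and> z = z'")
      case True
      then have "loop_at W p" "loop_at W r" by (auto simp: loop_at_def x_def y_def z_def z'_def)
      then have "flaw h W p = 2" "flaw h W r = 2" by (auto simp: flaw_def)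
      moreover have "flaw h W' p \<le> 1" "flaw h W' r \<le> 1" using nl by (auto simp: flaw_def)
      ultimately show ?thesis by (simp add: cF flaw_partner)
    next
      case False
      have "\<not> repeated_at h W' p"
      proof
        assume "repeated_at h W' p"
        then obtain s where s: "s \<in> pair_positions h" "s \<noteq> p" "s \<noteq> partner p" "W' s = x" "W' (partner s) = z"
          using W' by (auto simp: repeated_at_def)
        consider "s = r" | "s = partner r" | "s \<notin> F" using s by (auto simp: F_def)
        then show False
        proof cases
          case 1 then show ?thesis using s W' False by auto
        next
          \<comment> \<open>The crossed coincidence would mean \<open>z = y\<close>, but
            \<open>y\<close> is a neighbour of \<open>x\<close> through the pair at
            \<open>p\<close>, and \<open>z\<close> is not.\<close>
          case 2 then show ?thesis using s W' nb zx by auto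
        next
          case 3
          then have "W s = x" "W (partner s) = z" using f(9)[of s] s by (auto simp: F_def W'_def)
          then show ?thesis using zx(2) word_nbrsI[OF s(1), of W x z] by auto
        qed
      qed
      moreover have "\<not> repeated_at h W' r"
      proof
        assume "repeated_at h W' r"
        then obtain s where s: "s \<in> pair_positions h" "s \<noteq> r" "s \<noteq> partner r" "W' s = y" "W' (partner s) = z'"
          using W' by (auto simp: repeated_at_def)
        consider "s = p" | "s = partner p" | "s \<notin> F" using s by (auto simp: F_def)
        then show False
        proof cases
          case 1 then show ?thesis using s W' False by auto
        next
          case 2 then show ?thesis using s W' nb zx by auto
        next
          case 3
          then have "W s = y" "W (partner s) = z'" using f(9)[of s] s by (auto simp: F_def W'_def)
          then show ?thesis using zy(2) word_nbrsI[OF s(1), of W y z'] by auto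
        qed
      qed
      ultimately have "flaw h W' p = 0" "flaw h W' r = 0" using nl by (auto simp: flaw_def)
      then show ?thesis using bad by (simp add: cF flaw_partner)
    qed
  qed
  have split: "flaws h U = (\<Sum>q\<in>F. flaw h U q) + (\<Sum>q\<in>pair_positions h - F. flaw h U q)" for U :: "nat \<times> bool \<Rightarrow> 'a"
    unfolding flaws_def using FP by (subst sum.subset_diff[OF FP]) auto
  have "(\<Sum>q\<in>pair_positions h - F. flaw h W' q) \<le> (\<Sum>q\<in>pair_positions h - F. flaw h W q)"
    using out by (intro sum_mono) auto
  then show ?thesis using inside split[of W'] split[of W] by (simp add: W'_def)
qed

lemma switch_words:
  assumes W: "W \<in> words (pair_positions h) V k" and p: "p \<in> pair_positions h" "r \<in> pair_positions h"
  shows "switch W p r \<in> words (pair_positions h) V k"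
proof -
  define \<pi> where "\<pi> = Transposition.transpose (partner p) r"
  have \<pi>: "\<pi> permutes pair_positions h" unfolding \<pi>_def using p by (intro permutes_swap_id) simp_all
  have "card {q \<in> pair_positions h. W (\<pi> q) = v} = card {q \<in> pair_positions h. W q = v}" for v
  proof -
    have "bij_betw \<pi> {q \<in> pair_positions h. W (\<pi> q) = v} {q \<in> pair_positions h. W q = v}"
    proof (rule bij_betw_imageI)
      show "inj_on \<pi> {q \<in> pair_positions h. W (\<pi> q) = v}" using permutes_inj[OF \<pi>] by (rule inj_on_subset) simp
      show "\<pi> ` {q \<in> pair_positions h. W (\<pi> q) = v} = {q \<in> pair_positions h. W q = v}"
      proof (intro equalityI subsetI)
        fix x assume x: "x \<in> {q \<in> pair_positions h. W q = v}"
        then have "x \<in> \<pi> ` pair_positions h" using permutes_image[OF \<pi>] by simp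
        then show "x \<in> \<pi> ` {q \<in> pair_positions h. W (\<pi> q) = v}" using x by blast
      next
        fix x assume "x \<in> \<pi> ` {q \<in> pair_positions h. W (\<pi> q) = v}"
        then show "x \<in> {q \<in> pair_positions h. W q = v}" using permutes_in_image[OF \<pi>] by blast
      qed
    qed
    then show ?thesis by (rule bij_betw_same_card)
  qed
  moreover have "W \<circ> \<pi> \<in> pair_positions h \<rightarrow>\<^sub>E V"
  proof (rule PiE_I)
    fix q assume "q \<in> pair_positions h"
    then have "\<pi> q \<in> pair_positions h" using permutes_in_image[OF \<pi>] by blast
    then show "(W \<circ> \<pi>) q \<in> V" using W by (auto simp: words_def)
  next
    fix q assume q: "q \<notin> pair_positions h"
    then have "\<pi> q = q" using \<pi> by (simp add: permutes_not_in)
    moreover have "W q = undefined" using W q unfolding words_def by (intro PiE_arb[of W _ "\<lambda>_. V"]) auto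
    ultimately show "(W \<circ> \<pi>) q = undefined" by simp
  qed
  ultimately show ?thesis using W by (simp add: words_def switch_def \<pi>_def)
qed

lemma flawless_simple:
  assumes "flaws h W = 0"
  shows "simple_word h W"
proof -
  have 0: "flaw h W p = 0" if "p \<in> pair_positions h" for p
    using assms that unfolding flaws_def by (subst (asm) sum_eq_0_iff) auto
  have nl: "W (i, True) \<noteq> W (i, False)" if "i < h" for i
    using 0[of "(i, True)"] that by (auto simp: flaw_def loop_at_def partner_def split: if_splits)
  have "i = j" if ij: "i < h" "j < h" "word_edge W i = word_edge W j" for i j
  proof (rule ccontr)
    assume "i \<noteq> j"
    from ij(3) consider "W (i, True) = W (j, True)" "W (i, False) = W (j, False)"
      | "W (i, True) = W (j, False)" "W (i, False) = W (j, True)"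
      by (auto simp: word_edge_def doubleton_eq_iff)
    then have "repeated_at h W (i, True)"
    proof cases
      case 1
      then show ?thesis unfolding repeated_at_def using ij \<open>i \<noteq> j\<close>
        by (intro bexI[of _ "(j, True)"]) (auto simp: partner_def)
    next
      case 2
      then show ?thesis unfolding repeated_at_def using ij \<open>i \<noteq> j\<close>
        by (intro bexI[of _ "(j, False)"]) (auto simp: partner_def)
    qed
    then show False using 0[of "(i, True)"] ij nl[OF ij(1)] by (auto simp: flaw_def split: if_splits)
  qed
  then show ?thesis using nl by (auto simp: simple_word_def inj_on_def)
qed

text \<open>\<open>x\<close> has at most \<open>m\<close> neighbours, and each of the at most
  \<open>m + 1\<close> letters in question occurs at most \<open>m\<close> times.\<close>

lemma card_letters_in:
  assumes W: "W \<in> words (pair_positions h) V k" and k: "\<And>v. v \<in> V \<Longrightarrow> k v \<le> m" and V: "finite V"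
    and x: "x \<in> V"
  shows "card {r \<in> pair_positions h. W r \<in> insert x (word_nbrs h W x)} \<le> (m + 1) * m"
proof -
  define S where "S = insert x (word_nbrs h W x)"
  have WV: "W q \<in> V" if "q \<in> pair_positions h" for q using W that by (auto simp: words_def)
  have SV: "S \<subseteq> V"
  proof
    fix y assume "y \<in> S"
    then consider "y = x" | q where "q \<in> pair_positions h" "y = W (partner q)"
      unfolding S_def word_nbrs_def by blast
    then show "y \<in> V"
    proof cases
      case 2
      then show ?thesis using WV[of "partner q"] by (simp only: partner_simps)
    qed (use x in simp)
  qed
  have finS: "finite S" using SV V by (rule finite_subset)
  have "word_nbrs h W x = (\<lambda>q. W (partner q)) ` {q \<in> pair_positions h. W q = x}"
    by (auto simp: word_nbrs_def)
  then have "card (word_nbrs h W x) \<le> card {q \<in> pair_positions h. W q = x}"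
    by (simp add: card_image_le)
  also have "\<dots> \<le> m" using W k[OF x] x by (simp add: words_def)
  finally have "card (word_nbrs h W x) \<le> m" .
  moreover have "card S \<le> Suc (card (word_nbrs h W x))"
    unfolding S_def by (cases "finite (word_nbrs h W x)") (auto simp: card_insert_if)
  ultimately have cS: "card S \<le> m + 1" by simp
  have "{r \<in> pair_positions h. W r \<in> S} = (\<Union>v\<in>S. {r \<in> pair_positions h. W r = v})" by auto
  then have "card {r \<in> pair_positions h. W r \<in> S} \<le> (\<Sum>v\<in>S. card {r \<in> pair_positions h. W r = v})"
    using card_UN_le[OF finS, of "\<lambda>v. {r \<in> pair_positions h. W r = v}"] by simp
  also have "\<dots> \<le> (\<Sum>v\<in>S. m)"
    using W k SV by (intro sum_mono) (auto simp: words_def)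
  also have "\<dots> \<le> (m + 1) * m" using mult_le_mono1[OF cS, of m] by simp
  finally show ?thesis by (simp add: S_def)
qed

text \<open>Of the \<open>2 * h\<close> candidates for \<open>r\<close>, each of the two conditions
  on neighbours rules out at most \<open>(m + 1) * m\<close>.\<close>

lemma many_good_switches:
  assumes W: "W \<in> words (pair_positions h) V k" and k: "\<And>v. v \<in> V \<Longrightarrow> k v \<le> m" and V: "finite V"
    and p: "p \<in> pair_positions h" "flaw h W p > 0"
  shows "2 * h \<le> card {r. good_switch h W p r} + 2 * ((m + 1) * m)"
proof -
  define A where "A = {r \<in> pair_positions h. W r \<in> insert (W p) (word_nbrs h W (W p))}"
  define B where "B = {r \<in> pair_positions h. W (partner r) \<in> insert (W (partner p)) (word_nbrs h W (W (partner p)))}"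
  define B' where "B' = {r \<in> pair_positions h. W r \<in> insert (W (partner p)) (word_nbrs h W (W (partner p)))}"
  have WV: "W q \<in> V" if "q \<in> pair_positions h" for q using W that by (auto simp: words_def)
  have "card A \<le> (m + 1) * m" unfolding A_def by (rule card_letters_in[OF W k V WV[OF p(1)]])
  moreover have "card B \<le> (m + 1) * m"
  proof -
    have "B = partner ` B'"
    proof (intro equalityI subsetI)
      fix r assume "r \<in> B"
      then have "partner r \<in> B'" by (simp add: B_def B'_def)
      then show "r \<in> partner ` B'" by (intro image_eqI[of _ _ "partner r"]) simp_all
    next
      fix r assume "r \<in> partner ` B'"
      then obtain s where "s \<in> B'" "r = partner s" by blast
      then show "r \<in> B" by (simp add: B_def B'_def)
    qed
    then have "card B \<le> card B'" by (simp add: card_image_le B'_def)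
    also have "\<dots> \<le> (m + 1) * m" unfolding B'_def
      by (rule card_letters_in[OF W k V]) (use WV p in simp_all)
    finally show ?thesis .
  qed
  moreover have "pair_positions h \<subseteq> {r. good_switch h W p r} \<union> A \<union> B"
    using p by (auto simp: good_switch_def A_def B_def)
  then have "card (pair_positions h) \<le> card ({r. good_switch h W p r} \<union> A \<union> B)"
    by (intro card_mono) (auto simp: A_def B_def good_switch_def intro: finite_subset[of _ "pair_positions h"])
  then have "2 * h \<le> card {r. good_switch h W p r} + card A + card B"
    using card_Un_le[of "{r. good_switch h W p r} \<union> A" B] card_Un_le[of "{r. good_switch h W p r}" A]
    by (simp add: card_cartesian_product)
  ultimately show ?thesis by linarith
qed

text \<open>The letter \<open>y\<close> that stood next to \<open>p\<close> is found at
  \<open>r\<close> after the switch. As the old pair \<open>x y\<close> was flawed, either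
  \<open>y = x\<close> or another copy of the pair survives; in both cases few letters, and so few
  positions \<open>r\<close>, are possible in \<open>W'\<close>.\<close>

lemma few_reverse_switches:
  assumes W': "W' \<in> words (pair_positions h) V k" and k: "\<And>v. v \<in> V \<Longrightarrow> k v \<le> m" and V: "finite V"
    and p: "p \<in> pair_positions h"
  shows "card {r. \<exists>W. good_switch h W p r \<and> switch W p r = W'} \<le> (m + 1) * m"
proof -
  have "{r. \<exists>W. good_switch h W p r \<and> switch W p r = W'} \<subseteq>
      {r \<in> pair_positions h. W' r \<in> insert (W' p) (word_nbrs h W' (W' p))}"
  proof
    fix r assume "r \<in> {r. \<exists>W. good_switch h W p r \<and> switch W p r = W'}"
    then obtain W where g: "good_switch h W p r" and W'eq: "W' = switch W p r" by blast
    note f = good_switch_facts[OF g]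
    have pos: "p \<in> pair_positions h" "r \<in> pair_positions h" and bad: "flaw h W p > 0"
      and nz: "W r \<noteq> W p" "W r \<notin> word_nbrs h W (W p)" and nz': "W (partner r) \<notin> word_nbrs h W (W (partner p))"
      using g by (auto simp: good_switch_def)
    have "W (partner p) \<in> insert (W p) (word_nbrs h W' (W p))"
    proof (cases "loop_at W p")
      case True
      then show ?thesis by (simp add: loop_at_def)
    next
      case False
      then have "repeated_at h W p" using bad by (auto simp: flaw_def split: if_splits)
      then obtain s where s: "s \<in> pair_positions h" "s \<noteq> p" "s \<noteq> partner p" "W s = W p" "W (partner s) = W (partner p)"
        by (auto simp: repeated_at_def)
      have "s \<noteq> r" using s nz by auto
      moreover have "s \<noteq> partner r"
      proof
        assume "s = partner r"
        then have "W (partner r) = W p" using s by simp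
        moreover have "W p \<in> word_nbrs h W (W (partner p))"
          using word_nbrsI[of "partner p" h W "W (partner p)" "W p"] pos by simp
        ultimately show False using nz' by simp
      qed
      ultimately have "W' s = W s" "W' (partner s) = W (partner s)"
        using f(9)[of s] s by (auto simp: W'eq)
      then show ?thesis using word_nbrsI[OF s(1), of W' "W p" "W (partner p)"] s by simp
    qed
    then show "r \<in> {r \<in> pair_positions h. W' r \<in> insert (W' p) (word_nbrs h W' (W' p))}"
      using f pos by (simp add: W'eq)
  qed
  then have "card {r. \<exists>W. good_switch h W p r \<and> switch W p r = W'} \<le>
      card {r \<in> pair_positions h. W' r \<in> insert (W' p) (word_nbrs h W' (W' p))}"
    by (intro card_mono) auto
  also have "\<dots> \<le> (m + 1) * m"
    by (rule card_letters_in[OF W' k V]) (use W' p in \<open>auto simp: words_def\<close>)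
  finally show ?thesis .
qed

text \<open>With \<open>f z = (\<Sum>W. z ^ flaws h W)\<close>, the two counts give \<open>f' \<le> 4 m (m + 1) f\<close> on \<open>[0, 1]\<close>;
  \<open>f 1\<close> counts all words and \<open>f 0\<close> the flawless ones.\<close>

lemma card_words_le_simple:
  assumes V: "finite V" and k: "\<And>v. v \<in> V \<Longrightarrow> k v \<le> m" and large: "4 * (m * (m + 1)) \<le> 2 * h"
  shows "real (card (words (pair_positions h) V k)) \<le>
    exp (4 * real m * (real m + 1)) * real (card {W \<in> words (pair_positions h) V k. simple_word h W})"
proof (cases "h = 0")
  case True
  have "simple_word h W" for W :: "nat \<times> bool \<Rightarrow> 'a" using True by (simp add: simple_word_def)
  then show ?thesis by (simp add: mult_le_cancel_right1)
next
  case False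
  define P where "P = pair_positions h"
  define \<W> where "\<W> = words P V k"
  define B where "B = m * (m + 1)"
  define \<Lambda> where "\<Lambda> = 4 * real B"
  define f where "f z = (\<Sum>W\<in>\<W>. z ^ flaws h W)" for z :: real
  define f' where "f' z = (\<Sum>W\<in>\<W>. real (flaws h W) * z ^ (flaws h W - 1))" for z :: real
  have finP: "finite P" and cP: "card P = 2 * h" by (auto simp: P_def card_cartesian_product)
  have fin\<W>: "finite \<W>" unfolding \<W>_def by (rule finite_words[OF finP V])
  have goodP: "p \<in> P \<and> r \<in> P" if "good_switch h W p r" for W :: "nat \<times> bool \<Rightarrow> 'a" and p r
    using that by (auto simp: good_switch_def P_def)
  define T where "T = {(W, p, r). W \<in> \<W> \<and> good_switch h W p r}"
  have finT: "finite T"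
    by (rule finite_subset[of _ "\<W> \<times> P \<times> P"]) (use goodP fin\<W> finP in \<open>auto simp: T_def\<close>)
  have flaws_le: "real (flaws h W) * real h \<le> 2 * real (card {(p, r). good_switch h W p r})" if W: "W \<in> \<W>" for W
  proof -
    define D where "D = {p \<in> P. flaw h W p > 0}"
    have "flaws h W \<le> (\<Sum>p\<in>P. if flaw h W p > 0 then 2 else 0)"
      unfolding flaws_def P_def by (intro sum_mono) (auto simp: flaw_def)
    also have "\<dots> = 2 * card D" using finP by (simp add: D_def sum.If_cases Int_def)
    finally have 1: "flaws h W \<le> 2 * card D" .
    \<comment> \<open>By \<open>large\<close> at least half of the \<open>2 * h\<close> candidates
      remain for every flawed position.\<close>
    have "h \<le> card {r. good_switch h W p r}" if "p \<in> D" for p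
    proof -
      have "W \<in> words (pair_positions h) V k" using W by (simp add: \<W>_def P_def)
      then have "2 * h \<le> card {r. good_switch h W p r} + 2 * ((m + 1) * m)"
        using that by (intro many_good_switches[OF _ k V]) (simp_all add: D_def P_def)
      then show ?thesis using large by (simp add: mult.commute)
    qed
    then have "card D * h \<le> (\<Sum>p\<in>D. card {r. good_switch h W p r})"
      using sum_mono[of D "\<lambda>_. h" "\<lambda>p. card {r. good_switch h W p r}"] by simp
    also have "\<dots> = card (SIGMA p:D. {r. good_switch h W p r})"
      using finP goodP by (intro card_SigmaI[symmetric]) (auto simp: D_def intro: finite_subset[of _ P])
    also have "(SIGMA p:D. {r. good_switch h W p r}) = {(p, r). good_switch h W p r}"
      using goodP by (auto simp: D_def good_switch_def)
    finally have "card D * h \<le> card {(p, r). good_switch h W p r}" .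
    then have "flaws h W * h \<le> 2 * card {(p, r). good_switch h W p r}"
    proof -
      have "flaws h W * h \<le> 2 * (card D * h)" using mult_le_mono1[OF 1, of h] by (simp only: mult.assoc)
      then show ?thesis using \<open>card D * h \<le> card {(p, r). good_switch h W p r}\<close> by linarith
    qed
    then have "real (flaws h W * h) \<le> real (2 * card {(p, r). good_switch h W p r})" by (rule of_nat_mono)
    then show ?thesis by simp
  qed
  \<comment> \<open>Triples \<open>(W, p, r)\<close> are counted in two ways: at least
    \<open>h / 2\<close> of them for each unit of \<open>flaws h W\<close>, and at most
    \<open>B\<close> for each resulting word and each of the \<open>2 * h\<close> positions
    \<open>p\<close>. A switch lowers \<open>flaws\<close> by at least 1, which matches the exponent
    in the derivative.\<close>
  have der_le: "f' z \<le> \<Lambda> * f z" if z: "0 \<le> z" "z \<le> 1" for z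
  proof -
    have "real h * f' z = (\<Sum>W\<in>\<W>. real (flaws h W) * real h * z ^ (flaws h W - 1))"
      by (simp add: f'_def sum_distrib_left mult_ac)
    also have "\<dots> \<le> (\<Sum>W\<in>\<W>. 2 * real (card {(p, r). good_switch h W p r}) * z ^ (flaws h W - 1))"
      using flaws_le z by (intro sum_mono mult_right_mono) auto
    also have "\<dots> = (\<Sum>W\<in>\<W>. \<Sum>(p, r)\<in>{(p, r). good_switch h W p r}. 2 * z ^ (flaws h W - 1))"
      by (simp add: mult_ac)
    also have "\<dots> = (\<Sum>(W, p, r)\<in>T. 2 * z ^ (flaws h W - 1))"
    proof -
      have Teq: "T = (SIGMA W:\<W>. {(p, r). good_switch h W p r})" by (auto simp: T_def)
      have "finite {(p, r). good_switch h W p r}" for W :: "nat \<times> bool \<Rightarrow> 'a"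
        by (rule finite_subset[of _ "P \<times> P"]) (use goodP finP in auto)
      then show ?thesis unfolding Teq using fin\<W> by (intro sum.Sigma) auto
    qed
    also have "\<dots> \<le> (\<Sum>(W, p, r)\<in>T. 2 * z ^ flaws h (switch W p r))"
    proof (rule sum_mono)
      fix t assume "t \<in> T"
      then obtain W p r where t: "t = (W, p, r)" "good_switch h W p r" by (auto simp: T_def)
      have "z ^ (flaws h W - 1) \<le> z ^ flaws h (switch W p r)"
        using flaws_switch_less[OF t(2)] z by (intro power_decreasing) auto
      then show "(case t of (W, p, r) \<Rightarrow> 2 * z ^ (flaws h W - 1)) \<le> (case t of (W, p, r) \<Rightarrow> 2 * z ^ flaws h (switch W p r))"
        by (simp add: t)
    qed
    also have "\<dots> = (\<Sum>(W', p, r)\<in>(\<lambda>(W, p, r). (switch W p r, p, r)) ` T. 2 * z ^ flaws h W')"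
    proof -
      have "inj_on (\<lambda>(W, p, r). (switch W p r, p, r)) T"
      proof (rule inj_onI)
        fix s t assume "s \<in> T" "t \<in> T"
        assume "(\<lambda>(W, p, r). (switch W p r, p, r)) s = (\<lambda>(W, p, r). (switch W p r, p, r)) t"
        moreover obtain W p r where s: "s = (W, p, r)" by (cases s)
        moreover obtain W' p' r' where t: "t = (W', p', r')" by (cases t)
        ultimately have eq: "p' = p" "r' = r" "switch W p r = switch W' p r" by auto
        have "switch (switch U p r) p r = U" for U :: "nat \<times> bool \<Rightarrow> 'a"
          by (simp add: switch_def comp_assoc)
        then have "W = W'" using eq(3) by metis
        then show "s = t" using eq s t by simp
      qed
      then show ?thesis by (simp add: sum.reindex case_prod_unfold)
    qed
    also have "\<dots> \<le> (\<Sum>(W', p, r)\<in>(SIGMA W':\<W>. SIGMA p:P. {r. \<exists>W. good_switch h W p r \<and> switch W p r = W'}). 2 * z ^ flaws h W')"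
    proof (rule sum_mono2)
      have finS: "finite {r. \<exists>W. good_switch h W p r \<and> switch W p r = W'}" for p and W' :: "nat \<times> bool \<Rightarrow> 'a"
        by (rule finite_subset[OF _ finP]) (use goodP in blast)
      show "finite (SIGMA W':\<W>. SIGMA p:P. {r. \<exists>W. good_switch h W p r \<and> switch W p r = W'})"
        using fin\<W> finP finS by (intro finite_SigmaI) auto
      show "(\<lambda>(W, p, r). (switch W p r, p, r)) ` T \<subseteq> (SIGMA W':\<W>. SIGMA p:P. {r. \<exists>W. good_switch h W p r \<and> switch W p r = W'})"
      proof
        fix t assume "t \<in> (\<lambda>(W, p, r). (switch W p r, p, r)) ` T"
        then obtain W p r where t: "W \<in> \<W>" "good_switch h W p r" "t = (switch W p r, p, r)" by (auto simp: T_def)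
        have "switch W p r \<in> \<W>" using switch_words[of W h V k p r] t(1) goodP[OF t(2)] by (simp add: \<W>_def P_def)
        then show "t \<in> (SIGMA W':\<W>. SIGMA p:P. {r. \<exists>W. good_switch h W p r \<and> switch W p r = W'})"
          using t goodP[OF t(2)] by blast
      qed
    qed (use z in auto)
    also have "\<dots> = (\<Sum>W'\<in>\<W>. \<Sum>p\<in>P. real (card {r. \<exists>W. good_switch h W p r \<and> switch W p r = W'}) * (2 * z ^ flaws h W'))"
    proof -
      have finS: "finite {r. \<exists>W. good_switch h W p r \<and> switch W p r = W'}" for p and W' :: "nat \<times> bool \<Rightarrow> 'a"
        by (rule finite_subset[OF _ finP]) (use goodP in blast)
      have "(\<Sum>(W', p, r)\<in>(SIGMA W':\<W>. SIGMA p:P. {r. \<exists>W. good_switch h W p r \<and> switch W p r = W'}). 2 * z ^ flaws h W') =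
          (\<Sum>W'\<in>\<W>. \<Sum>(p, r)\<in>(SIGMA p:P. {r. \<exists>W. good_switch h W p r \<and> switch W p r = W'}). 2 * z ^ flaws h W')"
        using fin\<W> finP finS by (intro sum.Sigma[symmetric]) (auto intro!: finite_SigmaI)
      also have "\<dots> = (\<Sum>W'\<in>\<W>. \<Sum>p\<in>P. \<Sum>r\<in>{r. \<exists>W. good_switch h W p r \<and> switch W p r = W'}. 2 * z ^ flaws h W')"
        using finP finS by (intro sum.cong[OF refl] sum.Sigma[symmetric]) auto
      finally show ?thesis by simp
    qed
    also have "\<dots> \<le> (\<Sum>W'\<in>\<W>. \<Sum>p\<in>P. real B * (2 * z ^ flaws h W'))"
    proof (intro sum_mono mult_right_mono)
      fix W' p assume "W' \<in> \<W>" "p \<in> P"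
      then have "card {r. \<exists>W. good_switch h W p r \<and> switch W p r = W'} \<le> B"
        unfolding \<W>_def P_def B_def mult.commute[of m] add.commute[of 1] by (intro few_reverse_switches[OF _ k V])
      then show "real (card {r. \<exists>W. good_switch h W p r \<and> switch W p r = W'}) \<le> real B" by simp
    qed (use z in auto)
    also have "\<dots> = real h * (\<Lambda> * f z)"
      by (simp add: cP f_def \<Lambda>_def sum_distrib_left mult_ac)
    finally show ?thesis using False by simp
  qed
  have der: "(f has_real_derivative f' z) (at z)" for z
    unfolding f_def f'_def by (intro DERIV_sum) (auto intro!: derivative_eq_intros)
  \<comment> \<open>The integrating factor of the differential inequality: \<open>g\<close> is
    nonincreasing on \<open>[0, 1]\<close>.\<close>
  define g where "g z = f z * exp (- \<Lambda> * z)" for z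
  have "(g has_real_derivative (f' z - \<Lambda> * f z) * exp (- \<Lambda> * z)) (at z)" for z
    unfolding g_def by (auto intro!: derivative_eq_intros der simp: algebra_simps)
  moreover have "(f' z - \<Lambda> * f z) * exp (- \<Lambda> * z) \<le> 0" if "0 \<le> z" "z \<le> 1" for z
    using der_le[OF that] by (intro mult_nonpos_nonneg) auto
  ultimately have "g 1 \<le> g 0" by (intro DERIV_nonpos_imp_nonincreasing[of 0 1]) auto
  then have "f 1 \<le> exp \<Lambda> * f 0" by (simp add: g_def exp_minus field_simps)
  moreover have "f 1 = real (card \<W>)" by (simp add: f_def)
  moreover have "f 0 \<le> real (card {W \<in> \<W>. simple_word h W})"
  proof -
    have "f 0 = real (card {W \<in> \<W>. flaws h W = 0})"
      using fin\<W> by (simp add: f_def power_0_left sum.If_cases Int_def)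
    also have "\<dots> \<le> real (card {W \<in> \<W>. simple_word h W})"
      using fin\<W> flawless_simple by (intro of_nat_mono card_mono) auto
    finally show ?thesis .
  qed
  then have "exp \<Lambda> * f 0 \<le> exp \<Lambda> * real (card {W \<in> \<W>. simple_word h W})" by (intro mult_left_mono) auto
  ultimately have "real (card \<W>) \<le> exp \<Lambda> * real (card {W \<in> \<W>. simple_word h W})" by linarith
  moreover have "\<Lambda> = 4 * real m * (real m + 1)" by (simp add: \<Lambda>_def B_def algebra_simps)
  ultimately show ?thesis by (simp add: \<W>_def P_def)
qed

section \<open>The canonical ensemble\<close>

text \<open>The constraints are linear, so they hold on the whole line through \<open>P\<close> and
  \<open>Q\<close>, also beyond \<open>P\<close>, as long as no mass becomes negative.\<close>

lemma soft_constrained_line: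
  assumes fin: "finite \<G>" and P: "P \<in> soft_constrained \<G> I C c" and Q: "Q \<in> soft_constrained \<G> I C c"
    and nonneg: "\<And>G. pmf P G + \<epsilon> * (pmf Q G - pmf P G) \<ge> 0"
  obtains R where "R \<in> soft_constrained \<G> I C c" "pmf R = (\<lambda>G. pmf P G + \<epsilon> * (pmf Q G - pmf P G))"
proof -
  have PQ: "(\<Sum>G\<in>\<G>. pmf P G) = 1" "(\<Sum>G\<in>\<G>. pmf Q G) = 1"
    using P Q fin by (auto intro!: sum_pmf_1 simp: soft_constrained_def)
  have out: "pmf P G = 0" "pmf Q G = 0" if "G \<notin> \<G>" for G
    using that P Q by (auto simp: soft_constrained_def set_pmf_iff)
  have "(\<Sum>G\<in>\<G>. pmf P G + \<epsilon> * (pmf Q G - pmf P G)) = 1"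
    using PQ by (simp add: sum.distrib sum_subtractf flip: sum_distrib_left)
  then obtain R where R: "pmf R = (\<lambda>G. pmf P G + \<epsilon> * (pmf Q G - pmf P G))" "set_pmf R \<subseteq> \<G>"
    using ex_pmf_of_weights[OF fin, of "\<lambda>G. pmf P G + \<epsilon> * (pmf Q G - pmf P G)"] nonneg out by auto
  have "(\<Sum>G\<in>\<G>. pmf R G * C G x) = c x" if "x \<in> I" for x
  proof -
    have "(\<Sum>G\<in>\<G>. pmf R G * C G x) = (\<Sum>G\<in>\<G>. pmf P G * C G x) +
        \<epsilon> * ((\<Sum>G\<in>\<G>. pmf Q G * C G x) - (\<Sum>G\<in>\<G>. pmf P G * C G x))"
      by (simp add: R(1) distrib_right left_diff_distrib right_diff_distrib sum.distrib sum_subtractf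
          sum_distrib_left mult.assoc)
    then show ?thesis using P Q that by (simp add: soft_constrained_def)
  qed
  then have "R \<in> soft_constrained \<G> I C c" using R(2) by (simp add: soft_constrained_def)
  then show ?thesis using that R(1) by blast
qed

text \<open>Mixing in a little mass where \<open>P\<close> vanishes would increase the entropy at infinite rate.\<close>

lemma canonical_support:
  assumes fin: "finite \<G>" and P: "is_canonical \<G> I C c P" and Q: "Q \<in> soft_constrained \<G> I C c"
    and G0: "pmf P G0 = 0"
  shows "pmf Q G0 = 0"
proof (rule ccontr)
  assume "pmf Q G0 \<noteq> 0"
  then have q0: "pmf Q G0 > 0" using pmf_nonneg[of Q G0] by linarith
  have sP: "P \<in> soft_constrained \<G> I C c" using P by (simp add: is_canonical_def)
  have G0G: "G0 \<in> \<G>" using Q \<open>pmf Q G0 \<noteq> 0\<close> by (auto simp: soft_constrained_def set_pmf_iff)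
  define K where "K = \<bar>shannon_entropy \<G> P\<bar> + \<bar>shannon_entropy \<G> Q\<bar> + 1"
  \<comment> \<open>Chosen so that the gain \<open>- \<epsilon> * pmf Q G0 * ln \<epsilon>\<close>
    equals \<open>\<epsilon> * K\<close>, more than the change of order \<open>\<epsilon>\<close> in
    the other terms can take away.\<close>
  define \<epsilon> where "\<epsilon> = exp (- K / pmf Q G0)"
  have K: "K > 0" by (simp add: K_def)
  have \<epsilon>: "0 < \<epsilon>" "\<epsilon> < 1" using K q0 by (auto simp: \<epsilon>_def)
  define r where "r G = pmf P G + \<epsilon> * (pmf Q G - pmf P G)" for G
  have r_eq: "r G = (1 - \<epsilon>) * pmf P G + \<epsilon> * pmf Q G" for G by (simp add: r_def algebra_simps)
  have r0: "r G \<ge> 0" for G using \<epsilon> by (simp add: r_eq)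
  obtain R where R: "R \<in> soft_constrained \<G> I C c" "pmf R = r"
    using soft_constrained_line[OF fin sP Q, of \<epsilon>] r0 unfolding r_def by blast
  have conv: "r G * ln (r G) \<le> (1 - \<epsilon>) * (pmf P G * ln (pmf P G)) + \<epsilon> * (pmf Q G * ln (pmf Q G))" for G
  proof (cases "r G = 0")
    case True
    then have "pmf P G = 0" "pmf Q G = 0"
      using \<epsilon> unfolding r_eq by (auto simp: add_nonneg_eq_0_iff)
    then show ?thesis using True by simp
  next
    case False
    then have rp: "r G > 0" using r0[of G] by linarith
    have "(1 - \<epsilon>) * (pmf P G * ln (r G) + (pmf P G - r G)) + \<epsilon> * (pmf Q G * ln (r G) + (pmf Q G - r G))
      \<le> (1 - \<epsilon>) * (pmf P G * ln (pmf P G)) + \<epsilon> * (pmf Q G * ln (pmf Q G))"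
      using \<epsilon> rp by (intro add_mono mult_left_mono xlnx_ge) auto
    moreover have "(1 - \<epsilon>) * (pmf P G * ln (r G) + (pmf P G - r G)) + \<epsilon> * (pmf Q G * ln (r G) + (pmf Q G - r G))
      = r G * ln (r G)" by (simp add: r_eq algebra_simps)
    ultimately show ?thesis by simp
  qed
  have special: "r G0 * ln (r G0) = (1 - \<epsilon>) * (pmf P G0 * ln (pmf P G0)) + \<epsilon> * (pmf Q G0 * ln (pmf Q G0)) - \<epsilon> * K"
  proof -
    have "ln (\<epsilon> * pmf Q G0) = - K / pmf Q G0 + ln (pmf Q G0)"
      using \<epsilon> q0 by (simp add: ln_mult \<epsilon>_def)
    moreover have "r G0 = \<epsilon> * pmf Q G0" by (simp add: r_eq G0)
    ultimately have "r G0 * ln (r G0) = \<epsilon> * pmf Q G0 * (- K / pmf Q G0 + ln (pmf Q G0))" by simp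
    also have "\<dots> = \<epsilon> * (pmf Q G0 * ln (pmf Q G0)) - \<epsilon> * K" using q0 by (simp add: field_simps)
    finally show ?thesis by (simp add: G0)
  qed
  have "(\<Sum>G\<in>\<G>. r G * ln (r G)) \<le> (\<Sum>G\<in>\<G>. (1 - \<epsilon>) * (pmf P G * ln (pmf P G)) + \<epsilon> * (pmf Q G * ln (pmf Q G))
      - (if G = G0 then \<epsilon> * K else 0))"
    using conv special by (intro sum_mono) auto
  also have "\<dots> = - (1 - \<epsilon>) * shannon_entropy \<G> P - \<epsilon> * shannon_entropy \<G> Q - \<epsilon> * K"
    using fin G0G by (simp add: shannon_entropy_def sum.distrib sum_subtractf flip: sum_distrib_left)
      (simp add: algebra_simps)
  finally have "shannon_entropy \<G> R \<ge> (1 - \<epsilon>) * shannon_entropy \<G> P + \<epsilon> * shannon_entropy \<G> Q + \<epsilon> * K"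
    by (simp add: shannon_entropy_def R(2) algebra_simps)
  moreover have "shannon_entropy \<G> R \<le> shannon_entropy \<G> P" using P R by (auto simp: is_canonical_def)
  ultimately have "\<epsilon> * (shannon_entropy \<G> Q - shannon_entropy \<G> P + K) \<le> 0" by (simp add: algebra_simps)
  moreover have "shannon_entropy \<G> Q - shannon_entropy \<G> P + K > 0" by (simp add: K_def)
  ultimately show False using \<epsilon>(1) by (simp add: mult_le_0_iff)
qed

text \<open>By \<open>canonical_support\<close> the segment from \<open>P\<close> to
  \<open>Q\<close> extends a little beyond \<open>P\<close>, so the derivative of the entropy at its
  maximum vanishes in this direction. Hence \<open>ln (pmf P G)\<close> has the same mean under all
  distributions that meet the constraints, as the Gibbs form would give, but without
  multipliers.\<close>

lemma canonical_cross_entropy: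
  assumes fin: "finite \<G>" and P: "is_canonical \<G> I C c P" and Q: "Q \<in> soft_constrained \<G> I C c"
  shows "(\<Sum>G\<in>\<G>. pmf Q G * ln (pmf P G)) = - shannon_entropy \<G> P"
proof -
  have sP: "P \<in> soft_constrained \<G> I C c" using P by (simp add: is_canonical_def)
  have PQ: "(\<Sum>G\<in>\<G>. pmf P G) = 1" "(\<Sum>G\<in>\<G>. pmf Q G) = 1"
    using sP Q fin by (auto intro!: sum_pmf_1 simp: soft_constrained_def)
  have supp: "pmf Q G = 0" if "pmf P G = 0" for G by (rule canonical_support[OF fin P Q that])
  \<comment> \<open>The smallest positive mass of \<open>P\<close> bounds the step that is possible
    in either direction; the inserted 1 makes the set visibly nonempty.\<close>
  define d where "d = Min (insert 1 (pmf P ` {G \<in> \<G>. pmf P G > 0}))"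
  have d: "d > 0" unfolding d_def using fin by (subst Min_gr_iff) auto
  have dle: "d \<le> pmf P G" if "G \<in> \<G>" "pmf P G > 0" for G
    unfolding d_def using fin that by (intro Min_le) auto
  define r where "r G \<epsilon> = pmf P G + \<epsilon> * (pmf Q G - pmf P G)" for G \<epsilon>
  define \<phi> where "\<phi> \<epsilon> = - (\<Sum>G\<in>\<G>. r G \<epsilon> * ln (r G \<epsilon>))" for \<epsilon>
  have r0: "r G \<epsilon> \<ge> 0" if "\<bar>\<epsilon>\<bar> < d" for G \<epsilon>
  proof (cases "G \<in> \<G> \<and> pmf P G > 0")
    case True
    have "\<bar>\<epsilon> * (pmf Q G - pmf P G)\<bar> \<le> \<bar>\<epsilon>\<bar> * 1"
    proof -
      have "\<bar>pmf Q G - pmf P G\<bar> \<le> 1"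
        using pmf_le_1[of Q G] pmf_le_1[of P G] pmf_nonneg[of Q G] pmf_nonneg[of P G]
        unfolding abs_le_iff by linarith
      then show ?thesis unfolding abs_mult by (intro mult_left_mono) auto
    qed
    then show ?thesis using dle[of G] True that by (simp add: r_def)
  next
    case False
    then have "pmf P G = 0"
      using sP pmf_nonneg[of P G] by (auto simp: soft_constrained_def set_pmf_iff)
    then show ?thesis using supp[of G] by (simp add: r_def)
  qed
  have max: "\<phi> \<epsilon> \<le> \<phi> 0" if \<epsilon>: "\<bar>\<epsilon>\<bar> < d" for \<epsilon>
  proof -
    obtain R where R: "R \<in> soft_constrained \<G> I C c" "pmf R = (\<lambda>G. r G \<epsilon>)"
      using soft_constrained_line[OF fin sP Q, of \<epsilon>] r0[OF \<epsilon>] unfolding r_def by blast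
    then have "shannon_entropy \<G> R \<le> shannon_entropy \<G> P" using P by (auto simp: is_canonical_def)
    then show ?thesis by (simp add: \<phi>_def shannon_entropy_def R(2)) (simp add: r_def)
  qed
  define D where "D = - (\<Sum>G\<in>\<G>. (pmf Q G - pmf P G) * (ln (pmf P G) + 1))"
  have "((\<lambda>\<epsilon>. r G \<epsilon> * ln (r G \<epsilon>)) has_real_derivative (pmf Q G - pmf P G) * (ln (pmf P G) + 1)) (at 0)" for G
  proof (cases "pmf P G = 0")
    case True
    then show ?thesis using supp[OF True] by (simp add: r_def)
  next
    case False
    then have "pmf P G > 0" using pmf_nonneg[of P G] by linarith
    then show ?thesis unfolding r_def
      by (auto intro!: derivative_eq_intros simp: field_simps)
  qed
  then have der: "(\<phi> has_real_derivative D) (at 0)"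
    unfolding \<phi>_def D_def by (intro DERIV_minus DERIV_sum)
  have "D = 0"
    by (rule DERIV_local_max[OF der d]) (use max in auto)
  then have "(\<Sum>G\<in>\<G>. pmf Q G * ln (pmf P G)) - (\<Sum>G\<in>\<G>. pmf P G * ln (pmf P G)) + ((\<Sum>G\<in>\<G>. pmf Q G) - (\<Sum>G\<in>\<G>. pmf P G)) = 0"
    by (simp add: D_def left_diff_distrib distrib_left sum.distrib sum_subtractf)
  then show ?thesis using PQ by (simp add: shannon_entropy_def)
qed

text \<open>The microcanonical distribution meets the constraints on average, so its cross entropy
  with the canonical one is the canonical entropy.\<close>

lemma relative_entropy_microcanonical:
  assumes fin: "finite \<G>" and ne: "realisations \<G> I C c \<noteq> {}"
  shows "relative_entropy \<G> (microcanonical \<G> I C c) (canonical \<G> I C c) =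
    shannon_entropy \<G> (canonical \<G> I C c) - ln (card (realisations \<G> I C c))"
    and "is_canonical \<G> I C c (canonical \<G> I C c)"
proof -
  define R where "R = realisations \<G> I C c"
  define Q where "Q = microcanonical \<G> I C c"
  define P where "P = canonical \<G> I C c"
  have RG: "R \<subseteq> \<G>" "finite R" "R \<noteq> {}"
    using fin ne by (auto simp: R_def realisations_def)
  then have card: "card R > 0" by (simp add: card_gt_0_iff)
  show "is_canonical \<G> I C c (canonical \<G> I C c)"
    unfolding canonical_def by (rule theI'[OF canonical_ex1[OF fin ne]])
  then have P: "is_canonical \<G> I C c P" by (simp add: P_def)
  have pQ: "pmf Q G = (if G \<in> R then 1 / card R else 0)" for G
    using RG by (simp add: Q_def microcanonical_def R_def pmf_of_set indicator_def)
  have Q: "Q \<in> soft_constrained \<G> I C c"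
  proof -
    have "(\<Sum>G\<in>\<G>. pmf Q G * C G x) = c x" if "x \<in> I" for x
    proof -
      have "(\<Sum>G\<in>\<G>. pmf Q G * C G x) = (\<Sum>G\<in>R. 1 / card R * C G x)"
        using RG fin by (intro sum.mono_neutral_cong_right) (auto simp: pQ)
      also have "\<dots> = (\<Sum>G\<in>R. 1 / card R * c x)"
        using that by (intro sum.cong) (auto simp: R_def realisations_def)
      finally show ?thesis using card by simp
    qed
    moreover have "set_pmf Q \<subseteq> \<G>" using RG by (auto simp: set_pmf_iff pQ split: if_splits)
    ultimately show ?thesis by (simp add: soft_constrained_def)
  qed
  have Ppos: "pmf P G > 0" if "G \<in> R" for G
    using canonical_support[OF fin P Q, of G] that card pmf_nonneg[of P G] by (fastforce simp: pQ)
  have "relative_entropy \<G> Q P = (\<Sum>G\<in>\<G>. - pmf Q G * ln (card R) - pmf Q G * ln (pmf P G))"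
    unfolding relative_entropy_def
  proof (intro sum.cong)
    fix G
    show "pmf Q G * ln (pmf Q G / pmf P G) = - pmf Q G * ln (card R) - pmf Q G * ln (pmf P G)"
    proof (cases "G \<in> R")
      case True
      then show ?thesis using Ppos[OF True] card by (simp add: pQ ln_div ln_mult diff_divide_distrib)
    qed (simp add: pQ)
  qed simp
  also have "\<dots> = - ln (card R) * (\<Sum>G\<in>\<G>. pmf Q G) - (\<Sum>G\<in>\<G>. pmf Q G * ln (pmf P G))"
    by (simp add: sum_subtractf sum_negf mult.commute flip: sum_distrib_right)
  also have "(\<Sum>G\<in>\<G>. pmf Q G) = 1" using Q fin by (intro sum_pmf_1) (auto simp: soft_constrained_def)
  finally show "relative_entropy \<G> (microcanonical \<G> I C c) (canonical \<G> I C c) =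
    shannon_entropy \<G> (canonical \<G> I C c) - ln (card (realisations \<G> I C c))"
    using canonical_cross_entropy[OF fin P Q] by (simp add: P_def Q_def R_def)
qed

section \<open>Entropy of independent links\<close>

definition edge_prob :: "'e set \<Rightarrow> 'e set pmf \<Rightarrow> 'e \<Rightarrow> real" where
  "edge_prob E P e = (\<Sum>G\<in>{G \<in> Pow E. e \<in> G}. pmf P G)"

definition binary_entropy :: "real \<Rightarrow> real" where
  "binary_entropy p = - p * ln p - (1 - p) * ln (1 - p)"

lemma expectation_edge_sum:
  assumes E: "finite E"
  shows "(\<Sum>G\<in>Pow E. pmf P G * (\<Sum>e\<in>G. a e)) = (\<Sum>e\<in>E. edge_prob E P e * a e)"
proof -
  have "(\<Sum>G\<in>Pow E. pmf P G * (\<Sum>e\<in>G. a e)) = (\<Sum>G\<in>Pow E. \<Sum>e | e \<in> E \<and> e \<in> G. pmf P G * a e)"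
  proof (intro sum.cong refl)
    fix G assume "G \<in> Pow E"
    then have "{e. e \<in> E \<and> e \<in> G} = G" by auto
    then show "pmf P G * (\<Sum>e\<in>G. a e) = (\<Sum>e | e \<in> E \<and> e \<in> G. pmf P G * a e)"
      by (simp add: sum_distrib_left)
  qed
  also have "\<dots> = (\<Sum>e\<in>E. \<Sum>G | G \<in> Pow E \<and> e \<in> G. pmf P G * a e)"
    using E by (intro sum.swap_restrict) auto
  also have "\<dots> = (\<Sum>e\<in>E. edge_prob E P e * a e)"
    by (simp only: edge_prob_def sum_distrib_right)
  finally show ?thesis .
qed

lemma edge_prob_bounds:
  assumes E: "finite E" and P: "set_pmf P \<subseteq> Pow E"
  shows "0 \<le> edge_prob E P e" "edge_prob E P e \<le> 1"
proof -
  show "0 \<le> edge_prob E P e" by (simp add: edge_prob_def sum_nonneg)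
  have "edge_prob E P e \<le> (\<Sum>G\<in>Pow E. pmf P G)"
    unfolding edge_prob_def using E by (intro sum_mono2) auto
  also have "\<dots> = 1" using E P by (intro sum_pmf_1) auto
  finally show "edge_prob E P e \<le> 1" .
qed

text \<open>\<open>P\<close> is compared with independent links of odds \<open>\<omega> e\<close>;
  the cross entropy depends on \<open>P\<close> only through the link probabilities.\<close>

lemma entropy_le_gibbs:
  assumes E: "finite E" and P: "set_pmf P \<subseteq> Pow E" and \<omega>: "\<And>e. e \<in> E \<Longrightarrow> \<omega> e > 0"
  shows "shannon_entropy (Pow E) P \<le> (\<Sum>e\<in>E. ln (1 + \<omega> e) - edge_prob E P e * ln (\<omega> e))"
proof -
  define Z where "Z = (\<Prod>e\<in>E. 1 + \<omega> e)"
  define q where "q G = (\<Prod>e\<in>G. \<omega> e) / Z" for G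
  have \<omega>nz: "\<omega> e \<noteq> 0" "1 + \<omega> e \<noteq> 0" if "e \<in> E" for e using \<omega>[OF that] by linarith+
  have Z: "Z > 0" unfolding Z_def using \<omega> by (intro prod_pos) (auto intro: add_pos_pos)
  have qpos: "q G > 0" if "G \<in> Pow E" for G
    unfolding q_def using \<omega> Z that by (intro divide_pos_pos prod_pos) auto
  have "Z = (\<Sum>G\<in>Pow E. \<Prod>e\<in>G. \<omega> e)"
    using prod_add[OF E, of \<omega> "\<lambda>_. 1"] by (simp add: Z_def add.commute)
  then have q1: "(\<Sum>G\<in>Pow E. q G) = 1" using Z by (simp add: q_def flip: sum_divide_distrib)
  have P1: "(\<Sum>G\<in>Pow E. pmf P G) = 1" using E P by (intro sum_pmf_1) auto
  have lnq: "ln (q G) = (\<Sum>e\<in>G. ln (\<omega> e)) - ln Z" if "G \<in> Pow E" for G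
  proof -
    have "(\<Prod>e\<in>G. \<omega> e) > 0" using \<omega> that by (intro prod_pos) auto
    moreover have "ln (\<Prod>e\<in>G. \<omega> e) = (\<Sum>e\<in>G. ln (\<omega> e))"
      using \<omega>nz(1) that finite_subset[OF _ E, of G] by (intro ln_prod) auto
    ultimately show ?thesis using Z by (simp add: q_def ln_div)
  qed
  have "(\<Sum>G\<in>Pow E. pmf P G * ln (q G) + (pmf P G - q G)) \<le> (\<Sum>G\<in>Pow E. pmf P G * ln (pmf P G))"
    using qpos by (intro sum_mono xlnx_ge) auto
  then have "shannon_entropy (Pow E) P \<le> - (\<Sum>G\<in>Pow E. pmf P G * ln (q G))"
    by (simp add: shannon_entropy_def sum.distrib sum_subtractf P1 q1)
  also have "(\<Sum>G\<in>Pow E. pmf P G * ln (q G)) = (\<Sum>G\<in>Pow E. pmf P G * (\<Sum>e\<in>G. ln (\<omega> e)) - pmf P G * ln Z)"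
    by (intro sum.cong) (auto simp: lnq right_diff_distrib)
  also have "\<dots> = (\<Sum>G\<in>Pow E. pmf P G * (\<Sum>e\<in>G. ln (\<omega> e))) - (\<Sum>G\<in>Pow E. pmf P G) * ln Z"
    by (simp add: sum_subtractf sum_distrib_right)
  also have "\<dots> = (\<Sum>e\<in>E. edge_prob E P e * ln (\<omega> e)) - ln Z"
    by (simp add: P1 expectation_edge_sum[OF E])
  also have "ln Z = (\<Sum>e\<in>E. ln (1 + \<omega> e))"
    unfolding Z_def by (intro ln_prod \<omega>nz(2) E)
  finally show ?thesis by (simp add: sum_subtractf)
qed

text \<open>The minimising weight is the odds \<open>p / (1 - p)\<close>. For \<open>p = 0\<close>
  and \<open>p = 1\<close> the infimum is only approached, hence the slack
  \<open>\<delta>\<close>.\<close>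

lemma binary_entropy_dual:
  assumes p: "0 \<le> p" "p \<le> 1" and \<delta>: "\<delta> > 0"
  obtains \<omega> where "\<omega> > 0" "ln (1 + \<omega>) - p * ln \<omega> \<le> binary_entropy p + \<delta>"
proof -
  consider "p = 0" | "p = 1" | "0 < p" "p < 1" using p by linarith
  then show ?thesis
  proof cases
    case 1
    then show ?thesis using that[of "exp \<delta> - 1"] \<delta> by (simp add: binary_entropy_def)
  next
    case 2
    define \<omega> where "\<omega> = 1 / (exp \<delta> - 1)"
    have "exp \<delta> > 1" using \<delta> by simp
    then have \<omega>: "\<omega> > 0" "(1 + \<omega>) / \<omega> = exp \<delta>" by (auto simp: \<omega>_def field_simps)
    then have "1 + \<omega> = exp \<delta> * \<omega>" by (simp add: field_simps)
    then have "ln (1 + \<omega>) = \<delta> + ln \<omega>" using \<omega>(1) by (simp add: ln_mult)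
    then have "ln (1 + \<omega>) - ln \<omega> = \<delta>" by simp
    then show ?thesis using that[of \<omega>] \<omega> 2 by (simp add: binary_entropy_def)
  next
    case 3
    have "1 + p / (1 - p) = 1 / (1 - p)" using 3 by (simp add: field_simps)
    then have "ln (1 + p / (1 - p)) - p * ln (p / (1 - p)) = binary_entropy p"
      using 3 by (simp add: binary_entropy_def ln_div algebra_simps)
    then show ?thesis using that[of "p / (1 - p)"] 3 \<delta> by simp
  qed
qed

text \<open>The Gibbs bound with weights that are almost optimal for each link separately.\<close>

lemma entropy_subadditive:
  assumes E: "finite E" and P: "set_pmf P \<subseteq> Pow E"
  shows "shannon_entropy (Pow E) P \<le> (\<Sum>e\<in>E. binary_entropy (edge_prob E P e))"
proof (rule field_le_epsilon)
  fix \<epsilon> :: real assume \<epsilon>: "\<epsilon> > 0"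
  define \<delta> where "\<delta> = \<epsilon> / (real (card E) + 1)"
  have \<delta>: "\<delta> > 0" using \<epsilon> by (simp add: \<delta>_def)
  have "\<exists>\<omega>>0. ln (1 + \<omega>) - edge_prob E P e * ln \<omega> \<le> binary_entropy (edge_prob E P e) + \<delta>" for e
    using binary_entropy_dual[OF edge_prob_bounds[OF E P] \<delta>] by blast
  then obtain \<omega> where \<omega>: "\<And>e. \<omega> e > 0"
    "\<And>e. ln (1 + \<omega> e) - edge_prob E P e * ln (\<omega> e) \<le> binary_entropy (edge_prob E P e) + \<delta>" by metis
  have "shannon_entropy (Pow E) P \<le> (\<Sum>e\<in>E. ln (1 + \<omega> e) - edge_prob E P e * ln (\<omega> e))"
    by (rule entropy_le_gibbs[OF E P \<omega>(1)])
  also have "\<dots> \<le> (\<Sum>e\<in>E. binary_entropy (edge_prob E P e) + \<delta>)" by (intro sum_mono \<omega>(2))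
  also have "\<dots> = (\<Sum>e\<in>E. binary_entropy (edge_prob E P e)) + real (card E) * \<delta>" by (simp add: sum.distrib)
  also have "real (card E) * \<delta> \<le> \<epsilon>" using \<epsilon> by (simp add: \<delta>_def field_simps)
  finally show "shannon_entropy (Pow E) P \<le> (\<Sum>e\<in>E. binary_entropy (edge_prob E P e)) + \<epsilon>" by simp
qed

lemma ex_product_pmf:
  fixes E :: "'e set"
  assumes E: "finite E" and p: "\<And>e. e \<in> E \<Longrightarrow> 0 \<le> p e \<and> p e \<le> 1"
  obtains P where "set_pmf P \<subseteq> Pow E" "\<And>e. e \<in> E \<Longrightarrow> edge_prob E P e = p e"
    "shannon_entropy (Pow E) P = (\<Sum>e\<in>E. binary_entropy (p e))"
proof -
  define w where "w G = (if G \<subseteq> E then (\<Prod>e\<in>G. p e) * (\<Prod>e\<in>E - G. 1 - p e) else 0)" for G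
  have w0: "w G \<ge> 0" for G unfolding w_def using p by (auto intro!: mult_nonneg_nonneg prod_nonneg)
  have "(\<Sum>G\<in>Pow E. w G) = (\<Prod>e\<in>E. p e + (1 - p e))"
    unfolding prod_add[OF E] by (intro sum.cong) (auto simp: w_def)
  then have w1: "(\<Sum>G\<in>Pow E. w G) = 1" by simp
  obtain P where P: "pmf P = w" "set_pmf P \<subseteq> Pow E"
    by (rule ex_pmf_of_weights[of "Pow E" w]) (use E w0 w1 in \<open>auto simp: w_def\<close>)
  have prob: "edge_prob E P e0 = p e0" if e0: "e0 \<in> E" for e0
  proof -
    \<comment> \<open>Giving the absence of \<open>e0\<close> the factor 0 removes from the
      expansion exactly the graphs that lack \<open>e0\<close>.\<close>
    have "(\<Prod>e\<in>E. p e + (if e = e0 then 0 else 1 - p e)) =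
        (\<Sum>G\<in>Pow E. (\<Prod>e\<in>G. p e) * (\<Prod>e\<in>E - G. if e = e0 then 0 else 1 - p e))"
      by (rule prod_add[OF E])
    also have "\<dots> = (\<Sum>G\<in>Pow E. if e0 \<in> G then w G else 0)"
    proof (intro sum.cong refl)
      fix G assume G: "G \<in> Pow E"
      show "(\<Prod>e\<in>G. p e) * (\<Prod>e\<in>E - G. if e = e0 then 0 else 1 - p e) = (if e0 \<in> G then w G else 0)"
      proof (cases "e0 \<in> G")
        case True
        then have "(\<Prod>e\<in>E - G. if e = e0 then 0 else 1 - p e) = (\<Prod>e\<in>E - G. 1 - p e)" by (intro prod.cong) auto
        then show ?thesis using True G by (simp add: w_def)
      next
        case False
        have "(\<Prod>e\<in>E - G. if e = e0 then 0 else 1 - p e) = 0"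
          using False e0 E by (intro prod_zero) auto
        then show ?thesis using False by simp
      qed
    qed
    also have "\<dots> = edge_prob E P e0"
      unfolding edge_prob_def P(1) using E by (subst sum.inter_filter) auto
    finally have "edge_prob E P e0 = (\<Prod>e\<in>E. p e + (if e = e0 then 0 else 1 - p e))" by simp
    also have "\<dots> = (\<Prod>e\<in>E. if e = e0 then p e else 1)" by (intro prod.cong) auto
    also have "\<dots> = p e0" using E e0 by (simp add: prod.delta)
    finally show ?thesis .
  qed
  have "(\<Sum>G\<in>Pow E. pmf P G * ln (pmf P G)) =
      (\<Sum>G\<in>Pow E. pmf P G * (\<Sum>e\<in>E. ln (1 - p e)) + pmf P G * (\<Sum>e\<in>G. ln (p e) - ln (1 - p e)))"
  proof (intro sum.cong refl)
    fix G assume G: "G \<in> Pow E"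
    then have GE: "G \<subseteq> E" "finite G" using E by (auto intro: finite_subset)
    show "pmf P G * ln (pmf P G) = pmf P G * (\<Sum>e\<in>E. ln (1 - p e)) + pmf P G * (\<Sum>e\<in>G. ln (p e) - ln (1 - p e))"
    proof (cases "w G = 0")
      case False
      then have nz: "(\<Prod>e\<in>G. p e) \<noteq> 0" "(\<Prod>e\<in>E - G. 1 - p e) \<noteq> 0" using GE by (auto simp: w_def)
      have pos: "p e > 0" if "e \<in> G" for e
        using nz(1) p[of e] that GE by (auto simp: less_le)
      have pos': "1 - p e > 0" if "e \<in> E - G" for e
        using nz(2) p[of e] that E by (auto simp: less_le)
      have "ln (w G) = ln (\<Prod>e\<in>G. p e) + ln (\<Prod>e\<in>E - G. 1 - p e)"
        using GE nz by (simp add: w_def ln_mult)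
      also have "\<dots> = (\<Sum>e\<in>G. ln (p e)) + (\<Sum>e\<in>E - G. ln (1 - p e))"
        using pos pos' GE E by (intro arg_cong2[of _ _ _ _ "(+)"] ln_prod) (auto simp: less_imp_neq[THEN not_sym])
      also have "(\<Sum>e\<in>E - G. ln (1 - p e)) = (\<Sum>e\<in>E. ln (1 - p e)) - (\<Sum>e\<in>G. ln (1 - p e))"
        using E GE by (simp add: sum_diff)
      finally have "ln (pmf P G) = (\<Sum>e\<in>E. ln (1 - p e)) + (\<Sum>e\<in>G. ln (p e) - ln (1 - p e))"
        by (simp add: P(1) sum_subtractf)
      then show ?thesis by (simp add: distrib_left)
    qed (simp add: P(1))
  qed
  also have "\<dots> = (\<Sum>G\<in>Pow E. pmf P G) * (\<Sum>e\<in>E. ln (1 - p e)) + (\<Sum>e\<in>E. edge_prob E P e * (ln (p e) - ln (1 - p e)))"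
    by (simp only: sum.distrib sum_distrib_right expectation_edge_sum[OF E])
  also have "\<dots> = (\<Sum>e\<in>E. ln (1 - p e) + p e * (ln (p e) - ln (1 - p e)))"
    using w1 prob by (simp add: P(1) sum.distrib)
  also have "\<dots> = - (\<Sum>e\<in>E. binary_entropy (p e))"
    by (simp add: binary_entropy_def sum_negf[symmetric] algebra_simps)
  finally have "shannon_entropy (Pow E) P = (\<Sum>e\<in>E. binary_entropy (p e))" by (simp add: shannon_entropy_def)
  then show ?thesis using that P(2) prob by blast
qed

text \<open>Linear constraints \<open>\<Sum>e\<in>G. \<alpha> x e = c x\<close> on the graphs \<open>G \<subseteq> E\<close>, and their relaxation to link
  probabilities.\<close>

definition linear_graphs :: "'e set \<Rightarrow> 'c set \<Rightarrow> ('c \<Rightarrow> 'e \<Rightarrow> real) \<Rightarrow> ('c \<Rightarrow> real) \<Rightarrow> 'e set set" where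
  "linear_graphs E I \<alpha> c = {G. G \<subseteq> E \<and> (\<forall>x\<in>I. (\<Sum>e\<in>G. \<alpha> x e) = c x)}"

definition feasible :: "'e set \<Rightarrow> 'c set \<Rightarrow> ('c \<Rightarrow> 'e \<Rightarrow> real) \<Rightarrow> ('c \<Rightarrow> real) \<Rightarrow> ('e \<Rightarrow> real) \<Rightarrow> bool" where
  "feasible E I \<alpha> c p \<longleftrightarrow> (\<forall>e\<in>E. 0 \<le> p e \<and> p e \<le> 1) \<and> (\<forall>x\<in>I. (\<Sum>e\<in>E. \<alpha> x e * p e) = c x)"

text \<open>The canonical entropy is maximal, hence at least that of independent links with any
  feasible probabilities; one feasible \<open>p\<close> certifies a lower bound.\<close>

definition gap_ge :: "'e set \<Rightarrow> 'c set \<Rightarrow> ('c \<Rightarrow> 'e \<Rightarrow> real) \<Rightarrow> ('c \<Rightarrow> real) \<Rightarrow> real \<Rightarrow> bool" where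
  "gap_ge E I \<alpha> c a \<longleftrightarrow> (\<exists>p. feasible E I \<alpha> c p \<and>
     a \<le> (\<Sum>e\<in>E. binary_entropy (p e)) - ln (card (linear_graphs E I \<alpha> c)))"

text \<open>Of the canonical link probabilities only feasibility is known, so one weight vector has
  to bound the Gibbs expression for all feasible \<open>p\<close>.\<close>

definition gap_le :: "'e set \<Rightarrow> 'c set \<Rightarrow> ('c \<Rightarrow> 'e \<Rightarrow> real) \<Rightarrow> ('c \<Rightarrow> real) \<Rightarrow> real \<Rightarrow> bool" where
  "gap_le E I \<alpha> c a \<longleftrightarrow> (\<exists>\<omega>. (\<forall>e\<in>E. \<omega> e > 0) \<and> (\<forall>p. feasible E I \<alpha> c p \<longrightarrow>
     (\<Sum>e\<in>E. ln (1 + \<omega> e) - p e * ln (\<omega> e)) - ln (card (linear_graphs E I \<alpha> c)) \<le> a))"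

text \<open>The uniform distribution on the graphs has the logarithm of their number as entropy, and
  independent links with the same link probabilities have at least as much.\<close>

lemma gap_ge_0:
  assumes E: "finite E" and ne: "linear_graphs E I \<alpha> c \<noteq> {}"
  shows "gap_ge E I \<alpha> c 0"
proof -
  define R where "R = linear_graphs E I \<alpha> c"
  have R: "R \<subseteq> Pow E" "finite R" "R \<noteq> {}"
    using E ne by (auto simp: R_def linear_graphs_def intro: finite_subset[of _ "Pow E"])
  define Q where "Q = pmf_of_set R"
  have pQ: "pmf Q G = (if G \<in> R then 1 / card R else 0)" for G
    using R by (simp add: Q_def indicator_def)
  have card: "card R > 0" using R by (simp add: card_gt_0_iff)
  have QE: "set_pmf Q \<subseteq> Pow E" using R by (simp add: Q_def)
  have ent: "shannon_entropy (Pow E) Q = ln (card R)"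
  proof -
    have "(\<Sum>G\<in>Pow E. pmf Q G * ln (pmf Q G)) = (\<Sum>G\<in>R. 1 / card R * ln (1 / card R))"
      using R E by (intro sum.mono_neutral_cong_right) (auto simp: pQ)
    then show ?thesis using card by (simp add: shannon_entropy_def ln_div)
  qed
  have "(\<Sum>e\<in>E. \<alpha> x e * edge_prob E Q e) = c x" if x: "x \<in> I" for x
  proof -
    have "(\<Sum>e\<in>E. \<alpha> x e * edge_prob E Q e) = (\<Sum>G\<in>Pow E. pmf Q G * (\<Sum>e\<in>G. \<alpha> x e))"
      by (simp add: expectation_edge_sum[OF E] mult.commute)
    also have "\<dots> = (\<Sum>G\<in>R. 1 / card R * c x)"
      using R E x by (intro sum.mono_neutral_cong_right) (auto simp: pQ R_def linear_graphs_def)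
    finally show ?thesis using card by simp
  qed
  then have "feasible E I \<alpha> c (edge_prob E Q)" using edge_prob_bounds[OF E QE] by (simp add: feasible_def)
  then show ?thesis using entropy_subadditive[OF E QE] ent unfolding gap_ge_def R_def by (intro exI) auto
qed

text \<open>The number of realisations is a product over the blocks. For the lower bound,
  independent links with the probabilities chosen in the blocks compete with the canonical
  distribution. For the upper bound, the weights of the blocks together give one Gibbs bound,
  evaluated at the canonical link probabilities, which are feasible in each block.\<close>

theorem relative_entropy_blocks:
  fixes E :: "'b \<Rightarrow> 'e set" and I :: "'b \<Rightarrow> 'c set"
  assumes fin: "finite B" "\<And>b. b \<in> B \<Longrightarrow> finite (E b)" and disj: "disjoint_family_on E B"
    and local: "\<And>b x e. b \<in> B \<Longrightarrow> x \<in> I b \<Longrightarrow> e \<in> (\<Union>b\<in>B. E b) - E b \<Longrightarrow> \<alpha> x e = 0"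
    and ne: "\<And>b. b \<in> B \<Longrightarrow> linear_graphs (E b) (I b) \<alpha> c \<noteq> {}"
    and lo: "\<And>b. b \<in> B \<Longrightarrow> gap_ge (E b) (I b) \<alpha> c (lo b)"
    and up: "\<And>b. b \<in> B \<Longrightarrow> gap_le (E b) (I b) \<alpha> c (up b)"
    and C: "\<And>G x. G \<subseteq> (\<Union>b\<in>B. E b) \<Longrightarrow> x \<in> (\<Union>b\<in>B. I b) \<Longrightarrow> C G x = (\<Sum>e\<in>G. \<alpha> x e)"
  defines "\<G> \<equiv> Pow (\<Union>b\<in>B. E b)" and "II \<equiv> (\<Union>b\<in>B. I b)"
  shows "(\<Sum>b\<in>B. lo b) \<le> relative_entropy \<G> (microcanonical \<G> II C c) (canonical \<G> II C c)"
    and "relative_entropy \<G> (microcanonical \<G> II C c) (canonical \<G> II C c) \<le> (\<Sum>b\<in>B. up b)"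
proof -
  define F where "F = (\<Union>b\<in>B. E b)"
  have finF: "finite F" using fin by (simp add: F_def)
  have fin\<G>: "finite \<G>" using finF by (simp add: \<G>_def F_def)
  define R where "R b = linear_graphs (E b) (I b) \<alpha> c" for b
  have finR: "finite (R b)" if "b \<in> B" for b
    by (rule finite_subset[of _ "Pow (E b)"]) (use fin(2)[OF that] in \<open>auto simp: R_def linear_graphs_def\<close>)
  have loc_sum: "(\<Sum>e\<in>G. \<alpha> x e * a e) = (\<Sum>e\<in>G \<inter> E b. \<alpha> x e * a e)"
    if "G \<subseteq> F" "b \<in> B" "x \<in> I b" for G b x and a :: "'e \<Rightarrow> real"
    using that finF local[OF that(2,3)]
    by (intro sum.mono_neutral_right) (auto simp: F_def intro: finite_subset)
  have loc_sum1: "(\<Sum>e\<in>G. \<alpha> x e) = (\<Sum>e\<in>G \<inter> E b. \<alpha> x e)" if "G \<subseteq> F" "b \<in> B" "x \<in> I b" for G b x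
    using loc_sum[OF that, of "\<lambda>_. 1"] by simp
  have real: "realisations \<G> II C c = {G. G \<subseteq> F \<and> (\<forall>b\<in>B. G \<inter> E b \<in> R b)}"
  proof (intro equalityI subsetI)
    fix G assume G: "G \<in> realisations \<G> II C c"
    then have GF: "G \<subseteq> F" by (auto simp: realisations_def \<G>_def F_def)
    have "G \<inter> E b \<in> R b" if b: "b \<in> B" for b
    proof -
      have "(\<Sum>e\<in>G \<inter> E b. \<alpha> x e) = c x" if x: "x \<in> I b" for x
        using G C[OF GF[unfolded F_def], of x] b x loc_sum1[OF GF b x] by (fastforce simp: realisations_def II_def)
      then show ?thesis by (simp add: R_def linear_graphs_def)
    qed
    then show "G \<in> {G. G \<subseteq> F \<and> (\<forall>b\<in>B. G \<inter> E b \<in> R b)}" using GF by simp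
  next
    fix G assume "G \<in> {G. G \<subseteq> F \<and> (\<forall>b\<in>B. G \<inter> E b \<in> R b)}"
    then have GF: "G \<subseteq> F" and GR: "\<And>b. b \<in> B \<Longrightarrow> G \<inter> E b \<in> R b" by auto
    have "C G x = c x" if x: "x \<in> II" for x
    proof -
      obtain b where b: "b \<in> B" "x \<in> I b" using x by (auto simp: II_def)
      have "C G x = (\<Sum>e\<in>G. \<alpha> x e)" using C GF x by (simp add: F_def II_def)
      also have "\<dots> = c x" using loc_sum1[OF GF b] GR[OF b(1)] b(2) by (simp add: R_def linear_graphs_def)
      finally show ?thesis .
    qed
    then show "G \<in> realisations \<G> II C c" using GF by (simp add: realisations_def \<G>_def F_def)
  qed
  define \<Phi> where "\<Phi> G = (\<lambda>b\<in>B. G \<inter> E b)" for G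
  have "bij_betw \<Phi> {G. G \<subseteq> F \<and> (\<forall>b\<in>B. G \<inter> E b \<in> R b)} (PiE B R)"
  proof (rule bij_betwI')
    fix G H assume "G \<in> {G. G \<subseteq> F \<and> (\<forall>b\<in>B. G \<inter> E b \<in> R b)}" "H \<in> {G. G \<subseteq> F \<and> (\<forall>b\<in>B. G \<inter> E b \<in> R b)}"
    then have GH: "G \<subseteq> F" "H \<subseteq> F" by auto
    show "(\<Phi> G = \<Phi> H) = (G = H)"
    proof
      assume eq: "\<Phi> G = \<Phi> H"
      have "G \<inter> E b = H \<inter> E b" if "b \<in> B" for b using fun_cong[OF eq, of b] that by (simp add: \<Phi>_def)
      then show "G = H" using GH unfolding F_def by blast
    qed simp
  next
    fix G assume "G \<in> {G. G \<subseteq> F \<and> (\<forall>b\<in>B. G \<inter> E b \<in> R b)}"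
    then show "\<Phi> G \<in> PiE B R" by (simp add: \<Phi>_def)
  next
    fix f assume f: "f \<in> PiE B R"
    define G where "G = (\<Union>b\<in>B. f b)"
    have fE: "f b \<subseteq> E b" if "b \<in> B" for b using f that by (auto simp: R_def linear_graphs_def PiE_iff)
    have GE: "G \<inter> E b = f b" if b: "b \<in> B" for b
    proof (intro equalityI subsetI)
      fix e assume e: "e \<in> G \<inter> E b"
      then obtain b' where b': "b' \<in> B" "e \<in> f b'" by (auto simp: G_def)
      have "b' = b" using disj b b' fE[OF b'(1)] e by (auto simp: disjoint_family_on_def)
      then show "e \<in> f b" using b' by simp
    qed (use fE b in \<open>auto simp: G_def\<close>)
    have "\<Phi> G = f" using f GE by (auto simp: \<Phi>_def PiE_def extensional_def fun_eq_iff)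
    moreover have "G \<in> {G. G \<subseteq> F \<and> (\<forall>b\<in>B. G \<inter> E b \<in> R b)}"
      using fE f GE by (auto simp: G_def F_def PiE_iff)
    ultimately show "\<exists>G\<in>{G. G \<subseteq> F \<and> (\<forall>b\<in>B. G \<inter> E b \<in> R b)}. f = \<Phi> G" by blast
  qed
  then have cardR: "card (realisations \<G> II C c) = (\<Prod>b\<in>B. card (R b))"
    unfolding real using fin(1) by (simp add: bij_betw_same_card card_PiE)
  have cpos: "card (R b) > 0" if "b \<in> B" for b
    using finR[OF that] ne[OF that] by (simp add: R_def card_gt_0_iff)
  have ner: "realisations \<G> II C c \<noteq> {}"
  proof
    assume "realisations \<G> II C c = {}"
    then have "(\<Prod>b\<in>B. card (R b)) = 0" using cardR by simp
    then show False using cpos fin(1) by (metis less_irrefl prod_zero_iff)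
  qed
  have lncard: "ln (card (realisations \<G> II C c)) = (\<Sum>b\<in>B. ln (card (R b)))"
    unfolding cardR of_nat_prod using cpos fin(1) by (intro ln_prod) auto
  define P where "P = canonical \<G> II C c"
  have S: "relative_entropy \<G> (microcanonical \<G> II C c) (canonical \<G> II C c) =
      shannon_entropy \<G> P - (\<Sum>b\<in>B. ln (card (R b)))"
    using relative_entropy_microcanonical(1)[OF fin\<G> ner] lncard by (simp add: P_def)
  have P: "is_canonical \<G> II C c P" unfolding P_def by (rule relative_entropy_microcanonical(2)[OF fin\<G> ner])
  then have PF: "set_pmf P \<subseteq> Pow F" by (auto simp: is_canonical_def soft_constrained_def \<G>_def F_def)
  have sumF: "(\<Sum>e\<in>F. a e) = (\<Sum>b\<in>B. \<Sum>e\<in>E b. a e)" for a :: "'e \<Rightarrow> real"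
    unfolding F_def using fin disj by (intro sum.UNION_disjoint) (auto simp: disjoint_family_on_def)
  have soft: "(\<Sum>G\<in>\<G>. pmf Q G * C G x) = (\<Sum>e\<in>E b. \<alpha> x e * edge_prob F Q e)" if "b \<in> B" "x \<in> I b" for Q b x
  proof -
    have "(\<Sum>G\<in>\<G>. pmf Q G * C G x) = (\<Sum>G\<in>Pow F. pmf Q G * (\<Sum>e\<in>G. \<alpha> x e))"
      unfolding \<G>_def F_def using that C by (intro sum.cong) auto
    also have "\<dots> = (\<Sum>e\<in>F. \<alpha> x e * edge_prob F Q e)" by (simp add: expectation_edge_sum[OF finF] mult.commute)
    also have "\<dots> = (\<Sum>e\<in>F \<inter> E b. \<alpha> x e * edge_prob F Q e)" by (rule loc_sum[OF subset_refl that])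
    also have "F \<inter> E b = E b" using that by (auto simp: F_def)
    finally show ?thesis .
  qed
  \<comment> \<open>By disjointness this is the only block that contains \<open>e\<close>; it glues
    the choices made for the blocks into functions on all links.\<close>
  define blk where "blk e = (SOME b. b \<in> B \<and> e \<in> E b)" for e
  have blk: "blk e = b" if "b \<in> B" "e \<in> E b" for b e
  proof -
    have "blk e \<in> B \<and> e \<in> E (blk e)" unfolding blk_def by (rule someI[of _ b]) (use that in simp)
    then show ?thesis using that disj by (auto simp: disjoint_family_on_def)
  qed
  have "\<forall>b\<in>B. \<exists>p. feasible (E b) (I b) \<alpha> c p \<and> lo b \<le> (\<Sum>e\<in>E b. binary_entropy (p e)) - ln (card (R b))"
    using lo by (simp add: gap_ge_def R_def)
  from bchoice[OF this] obtain p where p: "\<And>b. b \<in> B \<Longrightarrow> feasible (E b) (I b) \<alpha> c (p b)"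
    "\<And>b. b \<in> B \<Longrightarrow> lo b \<le> (\<Sum>e\<in>E b. binary_entropy (p b e)) - ln (card (R b))" by blast
  define p' where "p' e = p (blk e) e" for e
  have p'01: "0 \<le> p' e \<and> p' e \<le> 1" if "e \<in> F" for e
  proof -
    obtain b where b: "b \<in> B" "e \<in> E b" using \<open>e \<in> F\<close> by (auto simp: F_def)
    then show ?thesis using p(1)[OF b(1)] blk[OF b] by (simp add: p'_def feasible_def)
  qed
  obtain Q where Q: "set_pmf Q \<subseteq> Pow F" "\<And>e. e \<in> F \<Longrightarrow> edge_prob F Q e = p' e"
    "shannon_entropy (Pow F) Q = (\<Sum>e\<in>F. binary_entropy (p' e))"
    using ex_product_pmf[OF finF, of p'] p'01 by blast
  have "Q \<in> soft_constrained \<G> II C c"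
  proof -
    have "(\<Sum>G\<in>\<G>. pmf Q G * C G x) = c x" if "x \<in> II" for x
    proof -
      obtain b where b: "b \<in> B" "x \<in> I b" using \<open>x \<in> II\<close> by (auto simp: II_def)
      have "(\<Sum>e\<in>E b. \<alpha> x e * edge_prob F Q e) = (\<Sum>e\<in>E b. \<alpha> x e * p b e)"
        using b(1) Q(2) blk[OF b(1)] by (intro sum.cong) (auto simp: p'_def F_def)
      then show ?thesis using soft[OF b, of Q] p(1)[OF b(1)] b(2) by (simp add: feasible_def)
    qed
    then show ?thesis using Q(1) by (auto simp: soft_constrained_def \<G>_def F_def)
  qed
  then have "shannon_entropy \<G> Q \<le> shannon_entropy \<G> P" using P by (simp add: is_canonical_def)
  moreover have "shannon_entropy \<G> Q = (\<Sum>b\<in>B. \<Sum>e\<in>E b. binary_entropy (p b e))"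
  proof -
    have "shannon_entropy \<G> Q = (\<Sum>e\<in>F. binary_entropy (p' e))" using Q(3) by (simp add: \<G>_def F_def)
    also have "\<dots> = (\<Sum>b\<in>B. \<Sum>e\<in>E b. binary_entropy (p' e))" by (rule sumF)
    also have "\<dots> = (\<Sum>b\<in>B. \<Sum>e\<in>E b. binary_entropy (p b e))"
      by (intro sum.cong refl) (simp add: p'_def blk)
    finally show ?thesis .
  qed
  moreover have "(\<Sum>b\<in>B. lo b) \<le> (\<Sum>b\<in>B. (\<Sum>e\<in>E b. binary_entropy (p b e)) - ln (card (R b)))"
    by (intro sum_mono p(2))
  ultimately show "(\<Sum>b\<in>B. lo b) \<le> relative_entropy \<G> (microcanonical \<G> II C c) (canonical \<G> II C c)"
    unfolding S by (simp add: sum_subtractf)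
  have "\<forall>b\<in>B. \<exists>\<omega>. (\<forall>e\<in>E b. \<omega> e > 0) \<and> (\<forall>p. feasible (E b) (I b) \<alpha> c p \<longrightarrow>
     (\<Sum>e\<in>E b. ln (1 + \<omega> e) - p e * ln (\<omega> e)) - ln (card (R b)) \<le> up b)"
    using up by (simp add: gap_le_def R_def)
  from bchoice[OF this] obtain \<omega> where \<omega>: "\<And>b e. b \<in> B \<Longrightarrow> e \<in> E b \<Longrightarrow> \<omega> b e > 0"
    "\<And>b p. b \<in> B \<Longrightarrow> feasible (E b) (I b) \<alpha> c p \<Longrightarrow>
     (\<Sum>e\<in>E b. ln (1 + \<omega> b e) - p e * ln (\<omega> b e)) - ln (card (R b)) \<le> up b" by blast
  define \<omega>' where "\<omega>' e = \<omega> (blk e) e" for e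
  have \<omega>'pos: "\<omega>' e > 0" if "e \<in> F" for e
  proof -
    obtain b where b: "b \<in> B" "e \<in> E b" using \<open>e \<in> F\<close> by (auto simp: F_def)
    then show ?thesis using \<omega>(1)[OF b] blk[OF b] by (simp add: \<omega>'_def)
  qed
  have feas: "feasible (E b) (I b) \<alpha> c (edge_prob F P)" if b: "b \<in> B" for b
    using edge_prob_bounds[OF finF PF] soft[OF b, of _ P] P b
    by (auto simp: feasible_def is_canonical_def soft_constrained_def II_def)
  have "shannon_entropy \<G> P \<le> (\<Sum>e\<in>F. ln (1 + \<omega>' e) - edge_prob F P e * ln (\<omega>' e))"
    using entropy_le_gibbs[OF finF PF \<omega>'pos] by (simp add: \<G>_def F_def)
  also have "\<dots> = (\<Sum>b\<in>B. \<Sum>e\<in>E b. ln (1 + \<omega>' e) - edge_prob F P e * ln (\<omega>' e))" by (rule sumF)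
  also have "\<dots> = (\<Sum>b\<in>B. \<Sum>e\<in>E b. ln (1 + \<omega> b e) - edge_prob F P e * ln (\<omega> b e))"
    by (intro sum.cong refl) (simp add: \<omega>'_def blk)
  finally have "shannon_entropy \<G> P - (\<Sum>b\<in>B. ln (card (R b))) \<le>
      (\<Sum>b\<in>B. (\<Sum>e\<in>E b. ln (1 + \<omega> b e) - edge_prob F P e * ln (\<omega> b e)) - ln (card (R b)))"
    by (simp add: sum_subtractf)
  also have "\<dots> \<le> (\<Sum>b\<in>B. up b)" by (intro sum_mono \<omega>(2) feas)
  finally show "relative_entropy \<G> (microcanonical \<G> II C c) (canonical \<G> II C c) \<le> (\<Sum>b\<in>B. up b)"
    unfolding S .
qed

section \<open>Entropy gap of a single block\<close>

text \<open>From \<open>ln (1 - p) \<le> - p\<close>. The error \<open>p^2\<close> is what makes the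
  sparseness of the links count.\<close>

lemma binary_entropy_ge:
  assumes "0 \<le> p" "p \<le> 1"
  shows "binary_entropy p \<ge> - p * ln p + p - p\<^sup>2"
proof (cases "p = 1")
  case False
  then have "ln (1 - p) \<le> - p" using assms ln_add_one_self_le_self2[of "- p"] by simp
  then have "(1 - p) * ln (1 - p) \<le> (1 - p) * (- p)" using assms by (intro mult_left_mono) auto
  then show ?thesis by (simp add: binary_entropy_def power2_eq_square algebra_simps)
qed (simp add: binary_entropy_def)

lemma linear_graphs_feasible:
  assumes E: "finite E"
  shows "G \<in> linear_graphs E I \<alpha> c \<longleftrightarrow> G \<subseteq> E \<and> feasible E I \<alpha> c (\<lambda>e. of_bool (e \<in> G))"
proof (cases "G \<subseteq> E")
  case True
  have "(\<Sum>e\<in>E. \<alpha> x e * of_bool (e \<in> G)) = (\<Sum>e\<in>G. \<alpha> x e)" for x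
    using E True by (intro sum.mono_neutral_cong_right) auto
  then show ?thesis using True by (simp add: linear_graphs_def feasible_def)
qed (simp add: linear_graphs_def)

text \<open>If \<open>ln \<omega>\<close> is a combination of the constraints, its mean
  \<open>B\<close> is the same for all feasible \<open>p\<close>, and a capacity bound turns into a
  bound on the gap.\<close>

lemma gap_leI:
  assumes E: "finite E" and ne: "linear_graphs E I \<alpha> c \<noteq> {}" and \<omega>: "\<And>e. e \<in> E \<Longrightarrow> \<omega> e > 0"
    and B: "\<And>p. feasible E I \<alpha> c p \<Longrightarrow> (\<Sum>e\<in>E. p e * ln (\<omega> e)) = B"
    and le: "(\<Prod>e\<in>E. 1 + \<omega> e) \<le> card (linear_graphs E I \<alpha> c) * exp (B + a)"
  shows "gap_le E I \<alpha> c a"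
  unfolding gap_le_def
proof (intro exI[of _ \<omega>] conjI allI impI ballI)
  fix p assume p: "feasible E I \<alpha> c p"
  have "finite (linear_graphs E I \<alpha> c)"
    by (rule finite_subset[of _ "Pow E"]) (use E in \<open>auto simp: linear_graphs_def\<close>)
  then have card: "card (linear_graphs E I \<alpha> c) > 0" using ne by (simp add: card_gt_0_iff)
  have nz: "1 + \<omega> e > 0" if "e \<in> E" for e using \<omega>[OF that] by simp
  have "(\<Sum>e\<in>E. ln (1 + \<omega> e)) = ln (\<Prod>e\<in>E. 1 + \<omega> e)"
    using nz E by (intro ln_prod[symmetric]) (auto simp: less_imp_neq[THEN not_sym])
  also have "\<dots> \<le> ln (card (linear_graphs E I \<alpha> c) * exp (B + a))"
    using nz le card by (subst ln_le_cancel_iff) (auto intro: prod_pos)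
  also have "\<dots> = ln (card (linear_graphs E I \<alpha> c)) + B + a" using card by (simp add: ln_mult)
  finally show "(\<Sum>e\<in>E. ln (1 + \<omega> e) - p e * ln (\<omega> e)) - ln (card (linear_graphs E I \<alpha> c)) \<le> a"
    by (simp add: sum_subtractf B[OF p])
qed (rule \<omega>)

lemma card_indicator_sum:
  assumes "finite E" "G \<subseteq> E"
  shows "(\<Sum>e | e \<in> E \<and> Q e. of_bool (e \<in> G)) = real (card {e \<in> G. Q e})"
proof -
  have "(\<Sum>e | e \<in> E \<and> Q e. of_bool (e \<in> G)) = (\<Sum>e\<in>{e \<in> G. Q e}. 1::real)"
    using assms by (intro sum.mono_neutral_cong_right) auto
  then show ?thesis by simp
qed

lemma sum_fibres:
  fixes p :: "'e \<Rightarrow> real"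
  assumes "finite E" "finite U" "src ` E \<subseteq> U"
  shows "(\<Sum>e\<in>E. p e * a (src e)) = (\<Sum>u\<in>U. (\<Sum>e | e \<in> E \<and> src e = u. p e) * a u)"
proof -
  have "(\<Sum>e\<in>E. p e * a (src e)) = (\<Sum>u\<in>U. \<Sum>e | e \<in> E \<and> src e = u. p e * a (src e))"
    using assms by (rule sum.group[symmetric])
  also have "\<dots> = (\<Sum>u\<in>U. (\<Sum>e | e \<in> E \<and> src e = u. p e) * a u)"
    by (simp add: sum_distrib_right)
  finally show ?thesis .
qed

text \<open>A total number of links is a single degree, so it costs one \<open>g_fun\<close>, a
  logarithmic amount.\<close>

lemma single_gap_le:
  assumes E: "finite E" and ne: "linear_graphs E I \<alpha> c \<noteq> {}"
    and feas: "\<And>p. feasible E I \<alpha> c p \<longleftrightarrow> (\<forall>e\<in>E. 0 \<le> p e \<and> p e \<le> 1) \<and> (\<Sum>e\<in>E. p e) = real l"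
  shows "gap_le E I \<alpha> c (g_fun l + 1)"
proof -
  have R: "linear_graphs E I \<alpha> c = {G. G \<subseteq> E \<and> card G = l}"
  proof (rule set_eqI)
    fix G
    show "G \<in> linear_graphs E I \<alpha> c \<longleftrightarrow> G \<in> {G. G \<subseteq> E \<and> card G = l}"
      using card_indicator_sum[OF E, of G "\<lambda>_. True"] by (auto simp: linear_graphs_feasible[OF E] feas)
  qed
  have "{G. G \<subseteq> E \<and> card G = l} \<noteq> {}" using ne unfolding R .
  then obtain t :: real where t: "t > 0"
    "(\<Prod>e\<in>E. 1 + t) \<le> card {G. G \<subseteq> E \<and> card G = l} * t ^ l * exp (g_fun l + 1)"
    using single_capacity[OF E zero_less_one] by blast
  have "t ^ l = exp (l * ln t)" using t(1) by (simp add: exp_of_nat_mult)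
  then have "(\<Prod>e\<in>E. 1 + t) \<le> card (linear_graphs E I \<alpha> c) * exp (l * ln t + (g_fun l + 1))"
    using t(2) unfolding R exp_add[of "l * ln t"] by (simp add: mult.assoc)
  then show ?thesis
    by (intro gap_leI[where \<omega> = "\<lambda>_. t" and B = "l * ln t"] E ne t(1))
      (auto simp: feas simp flip: sum_distrib_right)
qed

section \<open>Blocks between two layers\<close>

locale bipartite_block =
  fixes E :: "'e set" and I :: "'c set" and \<alpha> :: "'c \<Rightarrow> 'e \<Rightarrow> real" and c :: "'c \<Rightarrow> real"
    and src :: "'e \<Rightarrow> 'u" and tgt :: "'e \<Rightarrow> 'v" and U V and k :: "'u \<Rightarrow> nat" and l :: "'v \<Rightarrow> nat"
  assumes UV: "finite U" "finite V" and bij: "bij_betw (\<lambda>e. (src e, tgt e)) E (U \<times> V)"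
    and ne: "linear_graphs E I \<alpha> c \<noteq> {}"
    and feas: "\<And>p. feasible E I \<alpha> c p \<longleftrightarrow> (\<forall>e\<in>E. 0 \<le> p e \<and> p e \<le> 1) \<and>
      (\<forall>u\<in>U. (\<Sum>e | e \<in> E \<and> src e = u. p e) = real (k u)) \<and>
      (\<forall>v\<in>V. (\<Sum>e | e \<in> E \<and> tgt e = v. p e) = real (l v))"
begin

lemma E: "finite E"
  using bij_betw_finite[OF bij] UV by simp

lemma src_tgt: "src ` E \<subseteq> U" "tgt ` E \<subseteq> V"
  using bij by (auto simp: bij_betw_def)

lemma graphs_eq: "linear_graphs E I \<alpha> c = degree_graphs E src tgt U k V l"
proof (rule set_eqI)
  fix G
  show "G \<in> linear_graphs E I \<alpha> c \<longleftrightarrow> G \<in> degree_graphs E src tgt U k V l"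
    by (cases "G \<subseteq> E")
      (auto simp: linear_graphs_feasible[OF E] feas card_indicator_sum[OF E] degree_graphs_def)
qed

lemma sum_degrees:
  fixes p :: "'e \<Rightarrow> real" and a :: "'u \<Rightarrow> real" and b :: "'v \<Rightarrow> real"
  assumes p: "feasible E I \<alpha> c p"
  shows "(\<Sum>e\<in>E. p e * a (src e)) = (\<Sum>u\<in>U. k u * a u)" "(\<Sum>e\<in>E. p e * b (tgt e)) = (\<Sum>v\<in>V. l v * b v)"
  using p unfolding feas by (simp_all add: sum_fibres[OF E UV(1) src_tgt(1)] sum_fibres[OF E UV(2) src_tgt(2)])

text \<open>The weights \<open>x (src e) * y (tgt e)\<close> come from freeing all degrees, and
  their logarithm is a combination of the degree constraints. The slack \<open>\<delta>\<close> is
  so small that it adds up to at most 1.\<close>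

lemma gap_le: "gap_le E I \<alpha> c ((\<Sum>u\<in>U. g_fun (k u)) + (\<Sum>v\<in>V. g_fun (l v)) + 1)"
proof -
  define \<delta> where "\<delta> = 1 / (real (card U) + real (card V) + 1)"
  have \<delta>: "\<delta> > 0" unfolding \<delta>_def by (intro divide_pos_pos) auto
  have \<delta>1: "card U * \<delta> + card V * \<delta> \<le> 1"
    by (simp add: \<delta>_def add_divide_distrib[symmetric])
  have "degree_graphs E src tgt U k V l \<noteq> {}" using ne unfolding graphs_eq .
  then obtain x y where x: "\<And>u. x u > (0::real)" and y: "\<And>v. y v > (0::real)" and cap:
    "(\<Prod>e\<in>E. 1 + x (src e) * y (tgt e)) \<le> card (degree_graphs E src tgt U k V l) *
      (\<Prod>u\<in>U. x u ^ k u * exp (g_fun (k u) + \<delta>)) * (\<Prod>v\<in>V. y v ^ l v * exp (g_fun (l v) + \<delta>))"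
    using bipartite_capacity[OF E UV \<delta>] by blast
  define B where "B = (\<Sum>u\<in>U. k u * ln (x u)) + (\<Sum>v\<in>V. l v * ln (y v))"
  have pow: "x u ^ k u = exp (k u * ln (x u))" "y v ^ l v = exp (l v * ln (y v))" for u v
    using x y by (simp_all add: exp_of_nat_mult)
  have "(\<Prod>u\<in>U. x u ^ k u * exp (g_fun (k u) + \<delta>)) * (\<Prod>v\<in>V. y v ^ l v * exp (g_fun (l v) + \<delta>))
     = exp (B + ((\<Sum>u\<in>U. g_fun (k u)) + (\<Sum>v\<in>V. g_fun (l v))) + (card U * \<delta> + card V * \<delta>))"
    unfolding pow B_def by (simp add: exp_sum[symmetric] UV sum.distrib flip: exp_add)
  also have "\<dots> \<le> exp (B + ((\<Sum>u\<in>U. g_fun (k u)) + (\<Sum>v\<in>V. g_fun (l v)) + 1))" using \<delta>1 by simp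
  finally have le: "(\<Prod>u\<in>U. x u ^ k u * exp (g_fun (k u) + \<delta>)) * (\<Prod>v\<in>V. y v ^ l v * exp (g_fun (l v) + \<delta>)) \<le>
    exp (B + ((\<Sum>u\<in>U. g_fun (k u)) + (\<Sum>v\<in>V. g_fun (l v)) + 1))" .
  show ?thesis
  proof (rule gap_leI[OF E ne, where \<omega> = "\<lambda>e. x (src e) * y (tgt e)" and B = B])
    show "(\<Prod>e\<in>E. 1 + x (src e) * y (tgt e)) \<le> card (linear_graphs E I \<alpha> c) *
        exp (B + ((\<Sum>u\<in>U. g_fun (k u)) + (\<Sum>v\<in>V. g_fun (l v)) + 1))"
      using order_trans[OF cap[unfolded mult.assoc] mult_left_mono[OF le]] by (simp add: graphs_eq)
    fix p assume p: "feasible E I \<alpha> c p"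
    have "(\<Sum>e\<in>E. p e * ln (x (src e) * y (tgt e))) = (\<Sum>e\<in>E. p e * ln (x (src e)) + p e * ln (y (tgt e)))"
      using x y by (simp add: ln_mult_pos distrib_left)
    also have "\<dots> = B" 
      unfolding sum.distrib B_def sum_degrees(1)[OF p, of "\<lambda>u. ln (x u)"] sum_degrees(2)[OF p, of "\<lambda>v. ln (y v)"] ..
    finally show "(\<Sum>e\<in>E. p e * ln (x (src e) * y (tgt e))) = B" .
  qed (use x y in auto)
qed

text \<open>The probabilities \<open>k * l / L\<close> have the right mean degrees, and
  \<open>m * m' \<le> L\<close> keeps them at most 1. As they sum to \<open>L\<close> and are at
  most \<open>m * m' / L\<close>, their squares sum to at most \<open>m * m'\<close>. The terms
  \<open>k * ln k\<close> of the entropy and \<open>ln (fact k)\<close> of the counting bound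
  combine into \<open>g_fun k\<close>.\<close>

lemma gap_ge:
  assumes L: "(\<Sum>u\<in>U. k u) = L" "(\<Sum>v\<in>V. l v) = L"
    and m: "\<And>u. u \<in> U \<Longrightarrow> k u \<le> m" "\<And>v. v \<in> V \<Longrightarrow> l v \<le> m'" and small: "m * m' \<le> L"
  shows "gap_ge E I \<alpha> c ((\<Sum>u\<in>U. g_fun (k u)) + (\<Sum>v\<in>V. g_fun (l v)) - g_fun L - m * m')"
proof -
  have kl: "real (\<Sum>u\<in>U. k u) = L" "real (\<Sum>v\<in>V. l v) = L" using L by simp_all
  define p where "p e = real (k (src e)) * real (l (tgt e)) / real L" for e
  have kmem: "src e \<in> U" "tgt e \<in> V" if "e \<in> E" for e using src_tgt that by auto
  have klm: "real (k (src e)) * real (l (tgt e)) \<le> real m * real m'" if "e \<in> E" for e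
    using m(1)[OF kmem(1)[OF that]] m(2)[OF kmem(2)[OF that]] by (intro mult_mono) auto
  have p0: "0 \<le> p e" for e by (simp add: p_def)
  have small': "real m * real m' \<le> real L" using small by (metis of_nat_le_iff of_nat_mult)
  have pm: "p e \<le> m * m' / L" if "e \<in> E" for e
    unfolding p_def using klm[OF that] by (simp add: divide_right_mono)
  have p1: "p e \<le> 1" if "e \<in> E" for e
    using order_trans[OF pm[OF that], of 1] small' by (cases "L = 0") (auto simp: divide_le_eq_1)
  have inj: "inj_on (\<lambda>e. (src e, tgt e)) E" and surj: "(\<lambda>e. (src e, tgt e)) ` E = U \<times> V"
    using bij by (auto simp: bij_betw_def)
  have rowsum: "(\<Sum>e | e \<in> E \<and> src e = u. F (tgt e)) = (\<Sum>v\<in>V. F v)" if "u \<in> U" for u and F :: "'v \<Rightarrow> real"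
  proof -
    have "bij_betw tgt {e. e \<in> E \<and> src e = u} V"
      unfolding bij_betw_def
    proof
      show "inj_on tgt {e. e \<in> E \<and> src e = u}"
        using inj by (auto simp: inj_on_def)
      show "tgt ` {e. e \<in> E \<and> src e = u} = V"
      proof (intro equalityI subsetI)
        fix w assume "w \<in> V"
        then have "(u, w) \<in> (\<lambda>e. (src e, tgt e)) ` E" using that by (simp add: surj)
        then show "w \<in> tgt ` {e. e \<in> E \<and> src e = u}" by auto
      qed (use kmem in auto)
    qed
    then show ?thesis by (rule sum.reindex_bij_betw)
  qed
  have colsum: "(\<Sum>e | e \<in> E \<and> tgt e = v. F (src e)) = (\<Sum>u\<in>U. F u)" if "v \<in> V" for v and F :: "'u \<Rightarrow> real"
  proof -
    have "bij_betw src {e. e \<in> E \<and> tgt e = v} U"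
      unfolding bij_betw_def
    proof
      show "inj_on src {e. e \<in> E \<and> tgt e = v}"
        using inj by (auto simp: inj_on_def)
      show "src ` {e. e \<in> E \<and> tgt e = v} = U"
      proof (intro equalityI subsetI)
        fix w assume "w \<in> U"
        then have "(w, v) \<in> (\<lambda>e. (src e, tgt e)) ` E" using that by (simp add: surj)
        then show "w \<in> src ` {e. e \<in> E \<and> tgt e = v}" by auto
      qed (use kmem in auto)
    qed
    then show ?thesis by (rule sum.reindex_bij_betw)
  qed
  have feas_p: "feasible E I \<alpha> c p"
  proof -
    have "(\<Sum>e | e \<in> E \<and> src e = u. p e) = k u" if u: "u \<in> U" for u
    proof -
      have "(\<Sum>e | e \<in> E \<and> src e = u. p e) = (\<Sum>e | e \<in> E \<and> src e = u. real (k u) * real (l (tgt e)) / L)"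
        by (intro sum.cong) (auto simp: p_def)
      also have "\<dots> = (\<Sum>v\<in>V. real (k u) * real (l v) / L)" by (rule rowsum[OF u])
      also have "\<dots> = real (k u) * real L / L"
        by (simp only: kl(2)[symmetric] of_nat_sum sum_distrib_left sum_divide_distrib)
      also have "\<dots> = k u" using L(1) u UV(1) by (cases "L = 0") auto
      finally show ?thesis .
    qed
    moreover have "(\<Sum>e | e \<in> E \<and> tgt e = v. p e) = l v" if v: "v \<in> V" for v
    proof -
      have "(\<Sum>e | e \<in> E \<and> tgt e = v. p e) = (\<Sum>e | e \<in> E \<and> tgt e = v. real (k (src e)) * real (l v) / L)"
        by (intro sum.cong) (auto simp: p_def)
      also have "\<dots> = (\<Sum>u\<in>U. real (k u) * real (l v) / L)" by (rule colsum[OF v])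
      also have "\<dots> = real L * real (l v) / L"
        by (simp only: kl(1)[symmetric] of_nat_sum sum_distrib_right sum_divide_distrib)
      also have "\<dots> = l v" using L(2) v UV(2) by (cases "L = 0") auto
      finally show ?thesis .
    qed
    ultimately show ?thesis unfolding feas using p0 p1 by simp
  qed
  have plnp: "p e * ln (p e) = p e * ln (k (src e)) + p e * ln (l (tgt e)) - p e * ln L" for e
  proof (cases "p e = 0")
    case False
    then have "k (src e) > 0" "l (tgt e) > 0" "L > 0" by (auto simp: p_def)
    then have "ln (p e) = ln (k (src e)) + ln (l (tgt e)) - ln L" by (simp add: p_def ln_mult ln_div)
    then show ?thesis by (simp only: distrib_left right_diff_distrib)
  qed simp
  have sump: "(\<Sum>e\<in>E. p e * b) = L * b" for b :: real
    using sum_degrees(1)[OF feas_p, of "\<lambda>_. b"] by (simp flip: sum_distrib_right add: L of_nat_sum[symmetric] del: of_nat_sum)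
  have "(\<Sum>e\<in>E. (p e)\<^sup>2) \<le> (\<Sum>e\<in>E. p e * (m * m' / L))"
    unfolding power2_eq_square using p0 pm by (intro sum_mono mult_left_mono) auto
  also have "\<dots> = L * (m * m' / L)" by (rule sump)
  also have "\<dots> \<le> m * m'" by (cases "L = 0") auto
  finally have psq: "(\<Sum>e\<in>E. (p e)\<^sup>2) \<le> m * m'" by simp
  have "(\<Sum>e\<in>E. binary_entropy (p e)) \<ge> (\<Sum>e\<in>E. - p e * ln (p e) + p e - (p e)\<^sup>2)"
    using p0 p1 by (intro sum_mono binary_entropy_ge) auto
  also have "(\<Sum>e\<in>E. - p e * ln (p e) + p e - (p e)\<^sup>2) =
    - (\<Sum>u\<in>U. k u * ln (k u)) - (\<Sum>v\<in>V. l v * ln (l v)) + L * ln L + L - (\<Sum>e\<in>E. (p e)\<^sup>2)"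
    using sump[of 1]
    by (simp add: sum.distrib sum_subtractf sum_negf plnp sump sum_degrees(1)[OF feas_p, of "\<lambda>u. ln (k u)"]
        sum_degrees(2)[OF feas_p, of "\<lambda>v. ln (l v)"])
  finally have ent: "(\<Sum>e\<in>E. binary_entropy (p e)) \<ge>
    - (\<Sum>u\<in>U. k u * ln (k u)) - (\<Sum>v\<in>V. l v * ln (l v)) + L * ln L + L - m * m'" using psq by linarith
  have card: "card (degree_graphs E src tgt U k V l) > 0"
    using ne finite_degree_graphs[OF E] by (simp add: graphs_eq card_gt_0_iff)
  have "card (degree_graphs E src tgt U k V l) * ((\<Prod>u\<in>U. fact (k u)) * (\<Prod>v\<in>V. fact (l v))) \<le> (fact L :: nat)"
    by (rule card_degree_graphs_le[OF E UV src_tgt _ L]) (use bij in \<open>simp add: bij_betw_def\<close>)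
  then have "real (card (degree_graphs E src tgt U k V l) * ((\<Prod>u\<in>U. fact (k u)) * (\<Prod>v\<in>V. fact (l v)))) \<le> real (fact L)"
    by (simp only: of_nat_le_iff)
  then have "real (card (degree_graphs E src tgt U k V l)) * ((\<Prod>u\<in>U. fact (k u)) * (\<Prod>v\<in>V. fact (l v))) \<le> fact L"
    by simp
  then have "ln (real (card (degree_graphs E src tgt U k V l)) * ((\<Prod>u\<in>U. fact (k u)) * (\<Prod>v\<in>V. fact (l v)))) \<le> ln (fact L)"
    using card by (subst ln_le_cancel_iff) (auto intro!: mult_pos_pos prod_pos)
  also have "ln (real (card (degree_graphs E src tgt U k V l)) * ((\<Prod>u\<in>U. fact (k u)) * (\<Prod>v\<in>V. fact (l v))))
    = ln (card (degree_graphs E src tgt U k V l)) + ((\<Sum>u\<in>U. ln (fact (k u))) + (\<Sum>v\<in>V. ln (fact (l v))))"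
    using card UV by (simp add: ln_mult ln_prod)
  finally have "ln (card (degree_graphs E src tgt U k V l)) \<le> ln (fact L) -
    (\<Sum>u\<in>U. ln (fact (k u))) - (\<Sum>v\<in>V. ln (fact (l v)))" by linarith
  moreover have "(\<Sum>u\<in>U. g_fun (k u)) = (\<Sum>u\<in>U. ln (fact (k u))) - (\<Sum>u\<in>U. k u * ln (k u)) + L"
    "(\<Sum>v\<in>V. g_fun (l v)) = (\<Sum>v\<in>V. ln (fact (l v))) - (\<Sum>v\<in>V. l v * ln (l v)) + L"
    using kl by (simp_all add: g_fun_eq sum.distrib sum_subtractf)
  moreover have "g_fun L = ln (fact L) - L * ln L + L" by (rule g_fun_eq)
  ultimately have "(\<Sum>u\<in>U. g_fun (k u)) + (\<Sum>v\<in>V. g_fun (l v)) - g_fun L - m * m' \<le>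
    (\<Sum>e\<in>E. binary_entropy (p e)) - ln (card (linear_graphs E I \<alpha> c))" using ent unfolding graphs_eq by linarith
  then show ?thesis unfolding gap_ge_def using feas_p by blast
qed

end

section \<open>Blocks inside one layer\<close>

lemma sum_pairs:
  fixes F :: "'a set \<Rightarrow> real"
  assumes V: "finite V"
  shows "(\<Sum>v\<in>V. \<Sum>u\<in>V - {v}. F {v, u}) = 2 * (\<Sum>e | e \<subseteq> V \<and> card e = 2. F e)"
    and "v \<in> V \<Longrightarrow> (\<Sum>e | e \<in> {e. e \<subseteq> V \<and> card e = 2} \<and> v \<in> e. F e) = (\<Sum>u\<in>V - {v}. F {v, u})"
proof -
  have inner: "(\<Sum>e | e \<in> {e. e \<subseteq> V \<and> card e = 2} \<and> v \<in> e. F e) = (\<Sum>u\<in>V - {v}. F {v, u})"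
    if v: "v \<in> V" for v
  proof (rule sum.reindex_bij_betw[symmetric])
    show "bij_betw (\<lambda>u. {v, u}) (V - {v}) {e. e \<in> {e. e \<subseteq> V \<and> card e = 2} \<and> v \<in> e}"
      unfolding bij_betw_def
    proof
      show "inj_on (\<lambda>u. {v, u}) (V - {v})" by (auto simp: inj_on_def doubleton_eq_iff)
      show "(\<lambda>u. {v, u}) ` (V - {v}) = {e. e \<in> {e. e \<subseteq> V \<and> card e = 2} \<and> v \<in> e}"
      proof (intro equalityI subsetI)
        fix e assume "e \<in> {e. e \<in> {e. e \<subseteq> V \<and> card e = 2} \<and> v \<in> e}"
        then have e: "e \<subseteq> V" "card e = 2" "v \<in> e" by auto
        then obtain x y where xy: "e = {x, y}" "x \<noteq> y" by (auto simp: card_2_iff)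
        define u where "u = (if v = x then y else x)"
        have "e = {v, u}" "u \<noteq> v" using xy e(3) by (auto simp: u_def)
        then show "e \<in> (\<lambda>u. {v, u}) ` (V - {v})" using e(1) by blast
      qed (use v in auto)
    qed
  qed
  then show "v \<in> V \<Longrightarrow> (\<Sum>e | e \<in> {e. e \<subseteq> V \<and> card e = 2} \<and> v \<in> e. F e) = (\<Sum>u\<in>V - {v}. F {v, u})" .
  have fin: "finite {e. e \<subseteq> V \<and> card e = 2}" using V by simp
  have "(\<Sum>v\<in>V. \<Sum>u\<in>V - {v}. F {v, u}) = (\<Sum>v\<in>V. \<Sum>e | e \<in> {e. e \<subseteq> V \<and> card e = 2} \<and> v \<in> e. F e)"
    by (intro sum.cong inner[symmetric]) auto
  also have "\<dots> = (\<Sum>e | e \<subseteq> V \<and> card e = 2. \<Sum>v | v \<in> V \<and> v \<in> e. F e)"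
    by (rule sum.swap_restrict[OF V fin])
  also have "\<dots> = (\<Sum>e | e \<subseteq> V \<and> card e = 2. 2 * F e)"
  proof (intro sum.cong refl)
    fix e assume "e \<in> {e. e \<subseteq> V \<and> card e = 2}"
    then have "{v. v \<in> V \<and> v \<in> e} = e" "card e = 2" by auto
    then show "(\<Sum>v | v \<in> V \<and> v \<in> e. F e) = 2 * F e" by simp
  qed
  finally show "(\<Sum>v\<in>V. \<Sum>u\<in>V - {v}. F {v, u}) = 2 * (\<Sum>e | e \<subseteq> V \<and> card e = 2. F e)"
    by (simp add: sum_distrib_left)
qed

lemma prod_pairs:
  fixes F :: "'a set \<Rightarrow> real"
  assumes V: "finite V" and F: "\<And>e. F e > 0"
  shows "(\<Prod>a | a \<in> V \<times> V \<and> fst a \<noteq> snd a. F {fst a, snd a}) = (\<Prod>e | e \<subseteq> V \<and> card e = 2. F e)\<^sup>2"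
proof -
  have fin: "finite {e. e \<subseteq> V \<and> card e = 2}" "finite {a. a \<in> V \<times> V \<and> fst a \<noteq> snd a}" using V by auto
  have eq: "{a. a \<in> V \<times> V \<and> fst a \<noteq> snd a} = (SIGMA v:V. V - {v})" by auto
  have "ln (\<Prod>a | a \<in> V \<times> V \<and> fst a \<noteq> snd a. F {fst a, snd a}) = (\<Sum>a | a \<in> V \<times> V \<and> fst a \<noteq> snd a. ln (F {fst a, snd a}))"
    using F by (intro ln_prod fin) (metis less_irrefl)
  also have "\<dots> = (\<Sum>v\<in>V. \<Sum>u\<in>V - {v}. ln (F {v, u}))"
    unfolding eq using V by (simp add: sum.Sigma case_prod_beta)
  also have "\<dots> = 2 * (\<Sum>e | e \<subseteq> V \<and> card e = 2. ln (F e))" by (rule sum_pairs(1)[OF V])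
  also have "(\<Sum>e | e \<subseteq> V \<and> card e = 2. ln (F e)) = ln (\<Prod>e | e \<subseteq> V \<and> card e = 2. F e)"
    using F by (intro ln_prod[symmetric] fin) (metis less_irrefl)
  finally have "ln (\<Prod>a | a \<in> V \<times> V \<and> fst a \<noteq> snd a. F {fst a, snd a}) = ln ((\<Prod>e | e \<subseteq> V \<and> card e = 2. F e)\<^sup>2)"
    using F by (simp add: ln_realpow prod_pos)
  moreover have "(\<Prod>a | a \<in> V \<times> V \<and> fst a \<noteq> snd a. F {fst a, snd a}) > 0" "(\<Prod>e | e \<subseteq> V \<and> card e = 2. F e)\<^sup>2 > 0"
    by (intro prod_pos zero_less_power F)+
  ultimately show ?thesis by (simp only: ln_inj_iff)
qed

text \<open>Cauchy-Schwarz; it allows the weights of an arc and of its reverse to be replaced by a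
  common one.\<close>

lemma geometric_mean_le:
  fixes a b :: real
  assumes "a > 0" "b > 0"
  shows "(1 + sqrt (a * b))\<^sup>2 \<le> (1 + a) * (1 + b)"
proof -
  have "2 * sqrt (a * b) \<le> a + b" using arith_geo_mean_sqrt[of a b] assms by simp
  then show ?thesis using assms by (simp add: power2_sum algebra_simps)
qed

text \<open>\<open>L\<close> is the sum of the degrees, twice the number of links, in accordance
  with the convention for links inside a layer.\<close>

locale symmetric_block =
  fixes E :: "'a set set" and I :: "'c set" and \<alpha> :: "'c \<Rightarrow> 'a set \<Rightarrow> real" and c :: "'c \<Rightarrow> real"
    and V and k :: "'a \<Rightarrow> nat" and L :: nat
  assumes V: "finite V" and E_def: "E = {e. e \<subseteq> V \<and> card e = 2}"
    and ne: "linear_graphs E I \<alpha> c \<noteq> {}" and L: "(\<Sum>v\<in>V. k v) = L"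
    and feas: "\<And>p. feasible E I \<alpha> c p \<longleftrightarrow> (\<forall>e\<in>E. 0 \<le> p e \<and> p e \<le> 1) \<and>
      (\<forall>v\<in>V. (\<Sum>e | e \<in> E \<and> v \<in> e. p e) = real (k v))"
begin

lemma E: "finite E"
  using V by (simp add: E_def)

lemma graphs_eq: "linear_graphs E I \<alpha> c = pair_graphs V k"
proof (rule set_eqI)
  fix G
  show "G \<in> linear_graphs E I \<alpha> c \<longleftrightarrow> G \<in> pair_graphs V k"
    by (cases "G \<subseteq> E")
      (auto simp: linear_graphs_feasible[OF E] feas card_indicator_sum[OF E] pair_graphs_def E_def[symmetric])
qed

lemma pair_graphs_ne: "pair_graphs V k \<noteq> {}"
  using ne by (simp add: graphs_eq)

lemma card_pos: "card (pair_graphs V k) > 0"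
  using pair_graphs_ne finite_pair_graphs[OF V] by (simp add: card_gt_0_iff)

lemma sum_degrees:
  fixes p a :: "_ \<Rightarrow> real"
  assumes p: "feasible E I \<alpha> c p"
  shows "(\<Sum>e\<in>E. p e * (\<Sum>v\<in>e. a v)) = (\<Sum>v\<in>V. k v * a v)"
proof -
  have "(\<Sum>e\<in>E. p e * (\<Sum>v\<in>e. a v)) = (\<Sum>e\<in>E. \<Sum>v | v \<in> V \<and> v \<in> e. p e * a v)"
  proof (intro sum.cong refl)
    fix e assume "e \<in> E"
    then have "{v. v \<in> V \<and> v \<in> e} = e" by (auto simp: E_def)
    then show "p e * (\<Sum>v\<in>e. a v) = (\<Sum>v | v \<in> V \<and> v \<in> e. p e * a v)" by (simp add: sum_distrib_left)
  qed
  also have "\<dots> = (\<Sum>v\<in>V. \<Sum>e | e \<in> E \<and> v \<in> e. p e * a v)" by (rule sum.swap_restrict[OF E V])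
  also have "\<dots> = (\<Sum>v\<in>V. k v * a v)" using p unfolding feas by (simp flip: sum_distrib_right)
  finally show ?thesis .
qed

lemma edge_finite: "e \<in> E \<Longrightarrow> finite e"
  using finite_subset[OF _ V] by (auto simp: E_def)

lemma ln_edge_weight:
  assumes "\<And>v. y v > (0::real)"
  shows "e \<in> E \<Longrightarrow> ln (\<Prod>v\<in>e. y v) = (\<Sum>v\<in>e. ln (y v))"
  using assms edge_finite by (intro ln_prod) (auto simp: less_imp_neq[THEN not_sym])

text \<open>Each link of a realising graph is replaced by its two arcs.\<close>

lemma regular_arcs_ne: "regular_arcs V k \<noteq> {}"
proof -
  obtain G where G: "G \<in> pair_graphs V k" using pair_graphs_ne by blast
  then have GV: "e \<subseteq> V" "card e = 2" if "e \<in> G" for e using that by (auto simp: pair_graphs_def)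
  define Z where "Z = {a. {fst a, snd a} \<in> G}"
  have deg: "card {a \<in> Z. fst a = v} = k v" "card {a \<in> Z. snd a = v} = k v" if v: "v \<in> V" for v
  proof -
    have edges: "card {e \<in> G. v \<in> e} = k v" using G v by (simp add: pair_graphs_def)
    have other: "\<exists>u. e = {v, u} \<and> v \<noteq> u" if "e \<in> G" "v \<in> e" for e
      using GV(2)[OF that(1)] that(2) by (auto simp: card_2_iff)
    have "bij_betw (\<lambda>a. {fst a, snd a}) {a \<in> Z. fst a = v} {e \<in> G. v \<in> e}"
      unfolding bij_betw_def
    proof
      show "inj_on (\<lambda>a. {fst a, snd a}) {a \<in> Z. fst a = v}" by (auto simp: inj_on_def doubleton_eq_iff)
      show "(\<lambda>a. {fst a, snd a}) ` {a \<in> Z. fst a = v} = {e \<in> G. v \<in> e}"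
      proof (intro equalityI subsetI)
        fix e assume e: "e \<in> {e \<in> G. v \<in> e}"
        then obtain u where "e = {v, u}" using other by blast
        then show "e \<in> (\<lambda>a. {fst a, snd a}) ` {a \<in> Z. fst a = v}"
          using e by (intro image_eqI[of _ _ "(v, u)"]) (auto simp: Z_def)
      qed (auto simp: Z_def)
    qed
    then show "card {a \<in> Z. fst a = v} = k v" using edges by (simp add: bij_betw_same_card)
    have "bij_betw (\<lambda>a. {fst a, snd a}) {a \<in> Z. snd a = v} {e \<in> G. v \<in> e}"
      unfolding bij_betw_def
    proof
      show "inj_on (\<lambda>a. {fst a, snd a}) {a \<in> Z. snd a = v}" by (auto simp: inj_on_def doubleton_eq_iff)
      show "(\<lambda>a. {fst a, snd a}) ` {a \<in> Z. snd a = v} = {e \<in> G. v \<in> e}"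
      proof (intro equalityI subsetI)
        fix e assume e: "e \<in> {e \<in> G. v \<in> e}"
        then obtain u where "e = {u, v}" using other by (metis insert_commute mem_Collect_eq)
        then show "e \<in> (\<lambda>a. {fst a, snd a}) ` {a \<in> Z. snd a = v}"
          using e by (intro image_eqI[of _ _ "(u, v)"]) (auto simp: Z_def)
      qed (auto simp: Z_def)
    qed
    then show "card {a \<in> Z. snd a = v} = k v" using edges by (simp add: bij_betw_same_card)
  qed
  have "a \<in> V \<times> V" "fst a \<noteq> snd a" if "a \<in> Z" for a
    using GV[of "{fst a, snd a}"] that by (auto simp: Z_def mem_Times_iff)
  then have "Z \<in> regular_arcs V k" using deg by (auto simp: regular_arcs_def degree_graphs_def)
  then show ?thesis by blast
qed

text \<open>The bipartite capacity bound gives weights \<open>x\<close> for tails and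
  \<open>z\<close> for heads. Their geometric mean \<open>y\<close> is symmetric and loses nothing.
  Comparing digraphs with pairs of graphs contributes \<open>256 ^ L\<close>, of which the square
  root \<open>16 ^ L\<close> remains.\<close>

lemma gap_le_any: "gap_le E I \<alpha> c ((\<Sum>v\<in>V. g_fun (k v)) + 1 + L * ln 16)"
proof -
  define \<delta> where "\<delta> = 1 / (real (card V) + 1)"
  have \<delta>: "\<delta> > 0" unfolding \<delta>_def by (intro divide_pos_pos) auto
  have \<delta>1: "card V * \<delta> \<le> 1" by (simp add: \<delta>_def)
  define Z where "Z = {e \<in> V \<times> V. fst e \<noteq> snd e}"
  have finZ: "finite Z" using V by (simp add: Z_def)
  have "degree_graphs Z fst snd V k V k \<noteq> {}" using regular_arcs_ne by (simp add: regular_arcs_def Z_def)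
  then obtain x z where x: "\<And>u. x u > (0::real)" and z: "\<And>v. z v > (0::real)" and cap:
    "(\<Prod>e\<in>Z. 1 + x (fst e) * z (snd e)) \<le> card (degree_graphs Z fst snd V k V k) *
      (\<Prod>u\<in>V. x u ^ k u * exp (g_fun (k u) + \<delta>)) * (\<Prod>v\<in>V. z v ^ k v * exp (g_fun (k v) + \<delta>))"
    using bipartite_capacity[OF finZ V V \<delta>] by blast
  define y where "y v = sqrt (x v * z v)" for v
  have y: "y v > 0" for v using x z by (simp add: y_def)
  define B where "B = (\<Sum>v\<in>V. k v * ln (y v))"
  define S where "S = (\<Sum>v\<in>V. g_fun (k v))"
  define T where "T = exp (B + (S + card V * \<delta>))"
  have pow: "x u ^ k u = exp (k u * ln (x u))" "z u ^ k u = exp (k u * ln (z u))" for u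
    using x z by (simp_all add: exp_of_nat_mult)
  have lny: "ln (x v) + ln (z v) = 2 * ln (y v)" for v
    using x[of v] z[of v] by (simp add: y_def ln_sqrt ln_mult)
  have "(\<Prod>u\<in>V. x u ^ k u * exp (g_fun (k u) + \<delta>)) * (\<Prod>v\<in>V. z v ^ k v * exp (g_fun (k v) + \<delta>))
      = (\<Prod>v\<in>V. exp (2 * (k v * ln (y v) + (g_fun (k v) + \<delta>))))"
    unfolding prod.distrib[symmetric] pow
  proof (intro prod.cong refl)
    fix v
    have "k v * ln (x v) + k v * ln (z v) = k v * (2 * ln (y v))" by (simp only: lny[symmetric] distrib_left)
    then show "exp (k v * ln (x v)) * exp (g_fun (k v) + \<delta>) * (exp (k v * ln (z v)) * exp (g_fun (k v) + \<delta>)) =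
      exp (2 * (k v * ln (y v) + (g_fun (k v) + \<delta>)))"
      by (simp flip: exp_add)
  qed
  also have "\<dots> = T\<^sup>2"
    unfolding T_def B_def S_def
    by (simp add: exp_sum[symmetric] V sum.distrib flip: sum_distrib_left exp_double)
  finally have RHS: "(\<Prod>u\<in>V. x u ^ k u * exp (g_fun (k u) + \<delta>)) * (\<Prod>v\<in>V. z v ^ k v * exp (g_fun (k v) + \<delta>)) = T\<^sup>2" .
  have swap: "(\<Prod>e\<in>Z. 1 + x (snd e) * z (fst e)) = (\<Prod>e\<in>Z. 1 + x (fst e) * z (snd e))"
    by (rule prod.reindex_bij_witness[of _ prod.swap prod.swap]) (auto simp: Z_def)
  \<comment> \<open>One square because each link corresponds to two arcs, another because each arc
    is paired with its reverse.\<close>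
  have "((\<Prod>e\<in>E. 1 + (\<Prod>v\<in>e. y v))\<^sup>2)\<^sup>2 = (\<Prod>e\<in>Z. 1 + (\<Prod>v\<in>{fst e, snd e}. y v))\<^sup>2"
    using prod_pairs[OF V, of "\<lambda>e. 1 + (\<Prod>v\<in>e. y v)"] y by (simp add: E_def Z_def add_pos_pos prod_pos)
  also have "\<dots> = (\<Prod>e\<in>Z. (1 + sqrt (x (fst e) * z (snd e) * (x (snd e) * z (fst e))))\<^sup>2)"
    unfolding prod_power_distrib
  proof (intro prod.cong refl)
    fix e assume "e \<in> Z"
    then have "(\<Prod>v\<in>{fst e, snd e}. y v) = y (fst e) * y (snd e)" by (auto simp: Z_def)
    also have "\<dots> = sqrt (x (fst e) * z (snd e) * (x (snd e) * z (fst e)))"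
      unfolding y_def real_sqrt_mult[symmetric] by (simp add: mult_ac)
    finally show "(1 + (\<Prod>v\<in>{fst e, snd e}. y v))\<^sup>2 = (1 + sqrt (x (fst e) * z (snd e) * (x (snd e) * z (fst e))))\<^sup>2"
      by simp
  qed
  also have "\<dots> \<le> (\<Prod>e\<in>Z. (1 + x (fst e) * z (snd e)) * (1 + x (snd e) * z (fst e)))"
    using x z by (intro prod_mono conjI geometric_mean_le) auto
  also have "\<dots> = (\<Prod>e\<in>Z. 1 + x (fst e) * z (snd e))\<^sup>2"
    by (simp add: prod.distrib swap power2_eq_square)
  finally have "(\<Prod>e\<in>E. 1 + (\<Prod>v\<in>e. y v))\<^sup>2 \<le> (\<Prod>e\<in>Z. 1 + x (fst e) * z (snd e))"
    by (rule power2_le_imp_le) (use x z in \<open>auto intro!: prod_nonneg add_nonneg_nonneg simp: less_imp_le\<close>)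
  also have "\<dots> \<le> card (regular_arcs V k) * T\<^sup>2"
    using cap unfolding mult.assoc RHS by (simp add: regular_arcs_def Z_def)
  also have "\<dots> \<le> 256 ^ L * (card (pair_graphs V k))\<^sup>2 * T\<^sup>2"
    using card_regular_arcs_le[OF V pair_graphs_ne] by (intro mult_right_mono) (auto simp: L)
  also have "\<dots> = (16 ^ L * card (pair_graphs V k) * T)\<^sup>2"
    
  proof -
    have "(256::real) ^ L = (16 ^ L)\<^sup>2" by (simp add: power_even_eq[symmetric] power_mult)
    then show ?thesis by (simp add: power_mult_distrib)
  qed
  finally have "(\<Prod>e\<in>E. 1 + (\<Prod>v\<in>e. y v)) \<le> 16 ^ L * card (pair_graphs V k) * T"
    by (rule power2_le_imp_le) (simp add: T_def)
  also have "\<dots> = card (pair_graphs V k) * exp (B + (S + card V * \<delta> + L * ln 16))"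
  proof -
    have "(16::real) ^ L = exp (L * ln 16)" by (simp add: exp_of_nat_mult)
    then show ?thesis by (simp add: T_def exp_add)
  qed
  also have "\<dots> \<le> card (pair_graphs V k) * exp (B + (S + 1 + L * ln 16))"
    using \<delta>1 by (intro mult_left_mono) auto
  finally show ?thesis
    using y ln_edge_weight[OF y] sum_degrees
    by (intro gap_leI[OF E ne, where \<omega> = "\<lambda>e. \<Prod>v\<in>e. y v" and B = B])
      (auto simp: graphs_eq S_def B_def intro!: prod_pos)
qed

lemma even_L: "2 * (L div 2) = L"
  using even_degree_sum[OF V pair_graphs_ne] by (simp add: L)

lemma card_words_eq:
  "real (card (words (pair_positions (L div 2)) V k)) * (\<Prod>v\<in>V. fact (k v)) = fact L"
proof -
  have "card (words (pair_positions (L div 2)) V k) * (\<Prod>v\<in>V. fact (k v)) = fact (card (pair_positions (L div 2)))"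
    by (rule card_words[OF _ V]) (simp_all add: L even_L card_cartesian_product mult.commute[of _ 2])
  also have "card (pair_positions (L div 2)) = L" using even_L by (simp add: card_cartesian_product)
  finally have "real (card (words (pair_positions (L div 2)) V k) * (\<Prod>v\<in>V. fact (k v))) = real (fact L)" by simp
  then show ?thesis by simp
qed

lemma card_simple_eq:
  "real (card {W \<in> words (pair_positions (L div 2)) V k. simple_word (L div 2) W}) =
     real (card (pair_graphs V k)) * (fact (L div 2) * 2 ^ (L div 2))"
  using card_simple_words[OF V, of k "L div 2"] by (simp add: L even_L)

lemma sum_g_fun: "(\<Sum>v\<in>V. g_fun (k v)) = (\<Sum>v\<in>V. ln (fact (k v))) - (\<Sum>v\<in>V. k v * ln (k v)) + L"
  using L by (simp add: g_fun_eq sum.distrib sum_subtractf flip: of_nat_sum)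

text \<open>With \<open>h = L div 2\<close>, the right side is the logarithm of
  \<open>L! / (h! * 2 ^ h * \<Prod> k!)\<close>, expressed by \<open>g_fun\<close>. The bound holds
  because simple words are words.\<close>

lemma ln_card_le:
  assumes "L > 0"
  shows "ln (card (pair_graphs V k)) \<le> g_fun L - g_fun (L div 2) + (L / 2) * ln L - L / 2
      + (\<Sum>v\<in>V. g_fun (k v)) * (-1) + L - (\<Sum>v\<in>V. k v * ln (k v))"
proof -
  define h where "h = L div 2"
  have h: "real L = 2 * real h" "h > 0" using even_L assms by (auto simp: h_def simp flip: of_nat_mult)
  have "real (card {W \<in> words (pair_positions h) V k. simple_word h W}) \<le> card (words (pair_positions h) V k)"
    by (intro of_nat_mono card_mono finite_words V) auto
  then have "real (card (pair_graphs V k)) * (fact h * 2 ^ h) * (\<Prod>v\<in>V. fact (k v)) \<le> fact L"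
    unfolding card_words_eq[symmetric] h_def card_simple_eq by (intro mult_right_mono prod_nonneg) auto
  then have "ln (real (card (pair_graphs V k)) * (fact h * 2 ^ h) * (\<Prod>v\<in>V. fact (k v))) \<le> ln (fact L)"
    using card_pos by (subst ln_le_cancel_iff) (auto intro!: mult_pos_pos prod_pos)
  also have "ln (real (card (pair_graphs V k)) * (fact h * 2 ^ h) * (\<Prod>v\<in>V. fact (k v))) =
      ln (card (pair_graphs V k)) + (ln (fact h) + h * ln 2) + (\<Sum>v\<in>V. ln (fact (k v)))"
    using card_pos V by (simp add: ln_mult ln_prod ln_realpow)
  finally have *: "ln (card (pair_graphs V k)) + (ln (fact h) + h * ln 2) + (\<Sum>v\<in>V. ln (fact (k v))) \<le> ln (fact L)" .
  have "h * ln L = h * ln h + h * ln 2" using h by (simp add: ln_mult distrib_left)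
  then show ?thesis
    using * h g_fun_eq[of L] g_fun_eq[of h] sum_g_fun by (simp add: h_def[symmetric])
qed

text \<open>The same expression, reduced by the cost of the switchings. These apply since
  \<open>m \<ge> 1\<close> and \<open>8 * m^2 \<le> L\<close> imply
  \<open>4 * m * (m + 1) \<le> L\<close>.\<close>

lemma ln_card_ge:
  assumes "L > 0" and m: "\<And>v. v \<in> V \<Longrightarrow> k v \<le> m" and large: "8 * m\<^sup>2 \<le> L"
  shows "ln (card (pair_graphs V k)) \<ge> g_fun L - g_fun (L div 2) + (L / 2) * ln L - L / 2
      + (\<Sum>v\<in>V. g_fun (k v)) * (-1) + L - (\<Sum>v\<in>V. k v * ln (k v)) - 4 * real m * (real m + 1)"
proof -
  define h where "h = L div 2"
  have h: "real L = 2 * real h" "h > 0" using even_L assms by (auto simp: h_def simp flip: of_nat_mult)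
  have "m > 0"
  proof (rule ccontr)
    assume "\<not> m > 0"
    then have "L = 0" using m L by simp
    then show False using assms by simp
  qed
  then have "m \<le> m * m" by simp
  then have "4 * (m * (m + 1)) \<le> 2 * h"
    using large even_L unfolding h_def power2_eq_square distrib_left by linarith
  then have "card (words (pair_positions h) V k) \<le>
      exp (4 * real m * (real m + 1)) * (card {W \<in> words (pair_positions h) V k. simple_word h W})"
    using card_words_le_simple[of V k m h] V m by blast
  then have "fact L \<le> exp (4 * real m * (real m + 1)) * (real (card (pair_graphs V k)) * (fact h * 2 ^ h)) * (\<Prod>v\<in>V. fact (k v))"
    unfolding card_words_eq[symmetric] h_def card_simple_eq by (intro mult_right_mono prod_nonneg) auto
  then have "ln (fact L) \<le> ln (exp (4 * real m * (real m + 1)) * (real (card (pair_graphs V k)) * (fact h * 2 ^ h)) * (\<Prod>v\<in>V. fact (k v)))"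
    using card_pos by (subst ln_le_cancel_iff) (auto intro!: mult_pos_pos prod_pos)
  also have "\<dots> = 4 * real m * (real m + 1) + (ln (card (pair_graphs V k)) + (ln (fact h) + h * ln 2)) + (\<Sum>v\<in>V. ln (fact (k v)))"
    using card_pos V by (simp add: ln_mult ln_prod ln_realpow)
  finally have *: "ln (fact L) \<le> 4 * real m * (real m + 1) + (ln (card (pair_graphs V k)) + (ln (fact h) + h * ln 2)) + (\<Sum>v\<in>V. ln (fact (k v)))" .
  have "h * ln L = h * ln h + h * ln 2" using h by (simp add: ln_mult distrib_left)
  then show ?thesis
    using * h g_fun_eq[of L] g_fun_eq[of h] sum_g_fun by (simp add: h_def[symmetric])
qed

text \<open>The weights are about \<open>k u * k v / L\<close>, the odds in a sparse graph, and
  \<open>1 + \<omega> \<le> exp \<omega>\<close> leaves the exponential of their sum, at most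
  \<open>L / 2 + 2\<close>. Nodes of degree 0 need positive weights as well; the value
  \<open>1 / n\<close> in place of 0 adds at most 1 to the sum of the degrees.\<close>

lemma gap_le_sparse:
  assumes "L > 0" and m: "\<And>v. v \<in> V \<Longrightarrow> k v \<le> m" and large: "8 * m\<^sup>2 \<le> L"
  shows "gap_le E I \<alpha> c ((\<Sum>v\<in>V. g_fun (k v)) + g_fun (L div 2) - g_fun L + 4 * real m * (real m + 1) + 2)"
proof -
  define n where "n = real (card V) + 1"
  have n: "n > 0" by (simp add: n_def)
  define \<kappa> where "\<kappa> v = (if k v = 0 then 1 / n else real (k v)) / sqrt L" for v
  have \<kappa>: "\<kappa> v > 0" for v using assms(1) n by (simp add: \<kappa>_def)
  have "(\<Sum>v\<in>V. \<kappa> v) \<le> (\<Sum>v\<in>V. (real (k v) + 1 / n) / sqrt L)"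
    using n by (intro sum_mono) (auto simp: \<kappa>_def divide_right_mono)
  also have "\<dots> = (real L + card V * (1 / n)) / sqrt L"
    using L by (simp add: sum.distrib flip: sum_divide_distrib of_nat_sum)
  also have "\<dots> \<le> (real L + 1) / sqrt L" using n by (intro divide_right_mono) (auto simp: n_def)
  finally have "(\<Sum>v\<in>V. \<kappa> v)\<^sup>2 \<le> ((real L + 1) / sqrt L)\<^sup>2" using \<kappa> by (intro power_mono sum_nonneg) (auto simp: less_imp_le)
  also have "\<dots> = (real L + 1)\<^sup>2 / L" by (simp add: power_divide)
  also have "\<dots> \<le> L + 3" using assms(1) by (simp add: divide_le_eq power2_eq_square algebra_simps)
  finally have sq: "(\<Sum>v\<in>V. \<kappa> v)\<^sup>2 \<le> L + 3" .
  have "2 * (\<Sum>e\<in>E. \<Prod>v\<in>e. \<kappa> v) = (\<Sum>v\<in>V. \<Sum>u\<in>V - {v}. \<Prod>w\<in>{v, u}. \<kappa> w)"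
    unfolding E_def by (rule sum_pairs(1)[OF V, symmetric])
  also have "\<dots> = (\<Sum>v\<in>V. \<Sum>u\<in>V - {v}. \<kappa> v * \<kappa> u)" by (intro sum.cong) auto
  also have "\<dots> \<le> (\<Sum>v\<in>V. \<Sum>u\<in>V. \<kappa> v * \<kappa> u)"
    using \<kappa> V by (intro sum_mono sum_mono2) (auto simp: less_imp_le)
  also have "\<dots> = (\<Sum>v\<in>V. \<kappa> v)\<^sup>2" by (simp add: power2_eq_square sum_product)
  finally have \<omega>sum: "(\<Sum>e\<in>E. \<Prod>v\<in>e. \<kappa> v) \<le> L / 2 + 2" using sq by simp
  define B where "B = (\<Sum>v\<in>V. k v * ln (\<kappa> v))"
  have "B = (\<Sum>v\<in>V. k v * ln (k v) - k v * (ln L / 2))"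
    unfolding B_def using assms(1) by (intro sum.cong) (auto simp: \<kappa>_def ln_div ln_sqrt right_diff_distrib)
  also have "\<dots> = (\<Sum>v\<in>V. k v * ln (k v)) - (\<Sum>v\<in>V. real (k v)) * (ln L / 2)"
    by (simp only: sum_subtractf sum_distrib_right)
  also have "(\<Sum>v\<in>V. real (k v)) = L" using L by (simp flip: of_nat_sum)
  finally have B: "B = (\<Sum>v\<in>V. k v * ln (k v)) - L * (ln L / 2)" .
  define a where "a = (\<Sum>v\<in>V. g_fun (k v)) + g_fun (L div 2) - g_fun L + 4 * real m * (real m + 1) + 2"
  have "(\<Prod>e\<in>E. 1 + (\<Prod>v\<in>e. \<kappa> v)) \<le> (\<Prod>e\<in>E. exp (\<Prod>v\<in>e. \<kappa> v))"
    using \<kappa> by (intro prod_mono) (auto intro!: add_nonneg_nonneg prod_nonneg simp: less_imp_le)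
  also have "\<dots> = exp (\<Sum>e\<in>E. \<Prod>v\<in>e. \<kappa> v)" by (simp add: exp_sum E)
  also have "\<dots> \<le> exp (ln (card (pair_graphs V k)) + (B + a))"
    using ln_card_ge[OF assms] \<omega>sum by (simp add: B a_def)
  also have "\<dots> = card (pair_graphs V k) * exp (B + a)" using card_pos by (simp add: exp_add)
  finally have "(\<Prod>e\<in>E. 1 + (\<Prod>v\<in>e. \<kappa> v)) \<le> card (pair_graphs V k) * exp (B + a)" .
  then show ?thesis
    using \<kappa> ln_edge_weight[OF \<kappa>] sum_degrees unfolding a_def[symmetric]
    by (intro gap_leI[OF E ne, where \<omega> = "\<lambda>e. \<Prod>v\<in>e. \<kappa> v" and B = B])
      (auto simp: graphs_eq B_def intro!: prod_pos)
qed

text \<open>The link probabilities have the product form \<open>a u * a v\<close>. Prescribing the degrees means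
  \<open>a v * (A - a v) = k v\<close> with \<open>A = (\<Sum>v\<in>V. a v)\<close>; for given \<open>A\<close> this is a quadratic equation for \<open>a v\<close>, and
  \<open>A\<close> itself comes from the intermediate value theorem.\<close>

lemma ex_product_weights:
  assumes "L > 0" and m: "\<And>v. v \<in> V \<Longrightarrow> k v \<le> m" and large: "8 * m\<^sup>2 \<le> L"
  obtains a where "\<And>v. v \<in> V \<Longrightarrow> a v * ((\<Sum>v\<in>V. a v) - a v) = real (k v)"
    "\<And>v. v \<in> V \<Longrightarrow> 0 \<le> a v" "\<And>v. v \<in> V \<Longrightarrow> a v \<le> 2 * real (k v) / sqrt L" "(\<Sum>v\<in>V. a v) \<ge> sqrt L"
proof -
  \<comment> \<open>The smaller root of the quadratic equation. Since
    \<open>4 * k v \<le> 4 * m^2 \<le> L\<close>, its discriminant is nonnegative for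
    \<open>A \<ge> sqrt L\<close>.\<close>
  define r where "r v A = (A - sqrt (A\<^sup>2 - 4 * real (k v))) / 2" for v A
  have sL: "sqrt L > 0" using assms(1) by simp
  have facts: "A\<^sup>2 - 4 * real (k v) \<ge> 0" "r v A * (A - r v A) = k v" "A - r v A \<ge> A / 2" "A - r v A \<le> A" "r v A \<ge> 0"
    if v: "v \<in> V" and A: "A \<ge> sqrt L" for v A
  proof -
    have "real (k v) \<le> real (m\<^sup>2)" using m[OF v] by (intro of_nat_mono order_trans[OF m[OF v]]) (simp add: power2_eq_square)
    also have "8 * real (m\<^sup>2) \<le> L" using large by (metis of_nat_le_iff of_nat_mult of_nat_numeral)
    finally have "4 * real (k v) \<le> L" by simp
    also have "real L \<le> A\<^sup>2" using A sL by (metis less_imp_le power_mono real_sqrt_pow2_iff real_sqrt_ge_0_iff)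
    finally show d: "A\<^sup>2 - 4 * real (k v) \<ge> 0" by simp
    define s where "s = sqrt (A\<^sup>2 - 4 * real (k v))"
    have s: "s\<^sup>2 = A\<^sup>2 - 4 * real (k v)" "s \<ge> 0" using d by (simp_all add: s_def)
    have A0: "A \<ge> 0" using A sL by linarith
    have "s\<^sup>2 \<le> A\<^sup>2" unfolding s(1) by simp
    then have "s \<le> A" using A0 by (rule power2_le_imp_le)
    moreover have rs: "r v A = (A - s) / 2" by (simp add: r_def s_def)
    ultimately show "A - r v A \<ge> A / 2" "A - r v A \<le> A" "r v A \<ge> 0" using s(2) by (simp_all add: field_simps)
    show "r v A * (A - r v A) = k v" using s(1) by (simp add: rs power2_eq_square field_simps)
  qed
  have bounds: "real (k v) / A \<le> r v A" "r v A \<le> 2 * real (k v) / A" if v: "v \<in> V" and A: "A \<ge> sqrt L" for v A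
  proof -
    have Ap: "A > 0" using A sL by linarith
    have "r v A * (A / 2) \<le> k v" "k v \<le> r v A * A"
      unfolding facts(2)[OF v A, symmetric] using facts[OF v A] by (intro mult_left_mono; simp)+
    then show "real (k v) / A \<le> r v A" "r v A \<le> 2 * real (k v) / A" using Ap by (simp_all add: field_simps)
  qed
  have sumk: "(\<Sum>v\<in>V. real (k v)) = L" using L by (simp flip: of_nat_sum)
  \<comment> \<open>Summing \<open>k v / A \<le> r v A \<le> 2 * k v / A\<close> at
    \<open>A = sqrt L\<close> and at \<open>A = 2 * sqrt L\<close> shows that \<open>\<phi>\<close>
    changes sign in between.\<close>
  define \<phi> where "\<phi> A = (\<Sum>v\<in>V. r v A) - A" for A
  have "(\<Sum>v\<in>V. real (k v) / sqrt L) \<le> (\<Sum>v\<in>V. r v (sqrt L))" by (intro sum_mono bounds(1)) auto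
  then have "\<phi> (sqrt L) \<ge> 0" using assms(1) by (simp add: \<phi>_def sumk real_div_sqrt flip: sum_divide_distrib)
  moreover have "(\<Sum>v\<in>V. r v (2 * sqrt L)) \<le> (\<Sum>v\<in>V. 2 * real (k v) / (2 * sqrt L))"
    by (intro sum_mono bounds(2)) auto
  then have "(\<Sum>v\<in>V. r v (2 * sqrt L)) \<le> sqrt L" by (simp add: sumk real_div_sqrt flip: sum_divide_distrib)
  then have "\<phi> (2 * sqrt L) \<le> 0" using sL unfolding \<phi>_def by linarith
  moreover have "continuous_on {sqrt L..2 * sqrt L} \<phi>"
    unfolding \<phi>_def r_def by (intro continuous_intros) auto
  ultimately obtain A where A: "sqrt L \<le> A" "\<phi> A = 0"
    using IVT2'[of \<phi> "2 * sqrt L" 0 "sqrt L"] sL by auto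
  have "(\<Sum>v\<in>V. r v A) = A" using A(2) by (simp add: \<phi>_def)
  moreover have "r v A \<le> 2 * real (k v) / sqrt L" if "v \<in> V" for v
    using bounds(2)[OF that A(1)] A(1) sL by (meson divide_left_mono mult_pos_pos of_nat_0_le_iff mult_nonneg_nonneg order_trans less_le_trans zero_le_numeral)
  ultimately show ?thesis using that[of "\<lambda>v. r v A"] facts(2,5) A(1) by simp
qed

text \<open>The product probabilities are at most \<open>4 * m^2 / L\<close> and sum to
  \<open>L / 2\<close>, so their squares sum to at most \<open>2 * m^2\<close>. The loss
  \<open>4 * m\<close> stems from the missing diagonal: \<open>A - a v\<close> may fall below
  \<open>sqrt L\<close>, but only by a relative amount \<open>2 * m / L\<close>.\<close>

lemma gap_ge_sparse:
  assumes "L > 0" and m: "\<And>v. v \<in> V \<Longrightarrow> k v \<le> m" and large: "8 * m\<^sup>2 \<le> L"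
  shows "gap_ge E I \<alpha> c ((\<Sum>v\<in>V. g_fun (k v)) + g_fun (L div 2) - g_fun L - 4 * real m - 2 * (real m)\<^sup>2)"
proof -
  obtain a where a: "\<And>v. v \<in> V \<Longrightarrow> a v * ((\<Sum>v\<in>V. a v) - a v) = real (k v)"
    "\<And>v. v \<in> V \<Longrightarrow> 0 \<le> a v" "\<And>v. v \<in> V \<Longrightarrow> a v \<le> 2 * real (k v) / sqrt L" "(\<Sum>v\<in>V. a v) \<ge> sqrt L"
    using ex_product_weights[OF assms] by blast
  have sL: "sqrt L > 0" "sqrt L * sqrt L = L" using assms(1) by simp_all
  have m2: "8 * (real m)\<^sup>2 \<le> L" using large by (metis of_nat_le_iff of_nat_mult of_nat_numeral of_nat_power)
  have am: "a v \<le> 2 * real m / sqrt L" if "v \<in> V" for v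
    using a(3)[OF that] m[OF that] sL(1) by (meson divide_right_mono less_imp_le mult_left_mono of_nat_mono order_trans zero_le_numeral)
  define p where "p e = (\<Prod>v\<in>e. a v)" for e
  have p2: "p {v, u} = a v * a u" if "v \<noteq> u" for v u using that by (simp add: p_def)
  have pb: "0 \<le> p e" "p e \<le> 4 * (real m)\<^sup>2 / L" if e: "e \<in> E" for e
  proof -
    obtain v u where vu: "e = {v, u}" "v \<noteq> u" "v \<in> V" "u \<in> V" using e by (auto simp: E_def card_2_iff)
    have pe: "p e = a v * a u" using vu p2 by simp
    show "0 \<le> p e" using pe a(2) vu by simp
    have "p e \<le> (2 * real m / sqrt L) * (2 * real m / sqrt L)"
      unfolding pe using a(2) am vu sL by (intro mult_mono) auto
    also have "\<dots> = 4 * (real m)\<^sup>2 / L" using sL by (simp add: power2_eq_square)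
    finally show "p e \<le> 4 * (real m)\<^sup>2 / L" .
  qed
  have p1: "p e \<le> 1" if "e \<in> E" for e
    using pb(2)[OF that] m2 assms(1) by (elim order_trans) (simp add: divide_le_eq_1)
  have feas_p: "feasible E I \<alpha> c p"
  proof -
    have "(\<Sum>e | e \<in> E \<and> v \<in> e. p e) = k v" if v: "v \<in> V" for v
    proof -
      have "(\<Sum>e | e \<in> E \<and> v \<in> e. p e) = (\<Sum>u\<in>V - {v}. p {v, u})"
        unfolding E_def by (rule sum_pairs(2)[OF V v])
      also have "\<dots> = (\<Sum>u\<in>V - {v}. a v * a u)" by (intro sum.cong p2) auto
      also have "\<dots> = a v * ((\<Sum>u\<in>V. a u) - a v)" using V v by (simp add: sum_diff1 flip: sum_distrib_left)
      finally show ?thesis using a(1)[OF v] by simp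
    qed
    then show ?thesis unfolding feas using pb p1 by simp
  qed
  have sump: "(\<Sum>e\<in>E. p e) = L / 2"
    using sum_degrees[OF feas_p, of "\<lambda>_. 1 / 2"] L
    by (simp add: E_def sum_divide_distrib[symmetric] flip: of_nat_sum)
  \<comment> \<open>An upper estimate of \<open>ln (a v)\<close> from
    \<open>a v = k v / (A - a v)\<close>; the last term bounds \<open>- ln (1 - x)\<close> for
    \<open>x = 2 * m / L \<le> 1 / 2\<close>.\<close>
  define \<xi> where "\<xi> v = ln (k v) - ln L / 2 + 4 * m / L" for v
  have lna: "k v * ln (a v) \<le> k v * \<xi> v" if v: "v \<in> V" for v
  proof (cases "k v = 0")
    case False
    define x where "x = 2 * real m / L"
    have "m > 0" using m[OF v] False by simp
    then have "real m * 1 \<le> real m * real m" by (intro mult_left_mono) auto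
    then have "4 * real m \<le> L" using m2 unfolding power2_eq_square by linarith
    then have x: "0 \<le> x" "x \<le> 1 / 2" using assms(1) by (auto simp: x_def divide_le_eq)
    have "sqrt L * (1 - x) = sqrt L - 2 * real m / sqrt L"
      using sL by (simp add: x_def right_diff_distrib) (simp add: field_simps)
    also have "\<dots> \<le> (\<Sum>v\<in>V. a v) - a v" using a(4) am[OF v] by linarith
    finally have le: "sqrt L * (1 - x) \<le> (\<Sum>v\<in>V. a v) - a v" .
    have pos: "sqrt L * (1 - x) > 0" using sL(1) x by (intro mult_pos_pos) auto
    have "a v * (sqrt L * (1 - x)) \<le> k v" unfolding a(1)[OF v, symmetric] using le a(2)[OF v] by (intro mult_left_mono)
    moreover have av: "a v > 0" using a(1)[OF v] a(2)[OF v] False by (cases "a v = 0") auto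
    ultimately have "ln (a v * (sqrt L * (1 - x))) \<le> ln (k v)"
      using pos False by (subst ln_le_cancel_iff) auto
    moreover have "ln (a v * (sqrt L * (1 - x))) = ln (a v) + (ln L / 2 + ln (1 - x))"
      using av sL(1) x assms(1) by (simp add: ln_mult_pos ln_sqrt)
    moreover have "ln (1 - x) \<ge> - x - 2 * x\<^sup>2" using x by (intro ln_one_minus_pos_lower_bound) auto
    moreover have "2 * x\<^sup>2 \<le> x" using x mult_right_mono[of x "1/2" x] by (simp add: power2_eq_square)
    moreover have "4 * m / L = 2 * x" by (simp add: x_def)
    ultimately have "ln (a v) \<le> \<xi> v" by (simp add: \<xi>_def)
    then show ?thesis by (intro mult_left_mono) auto
  qed simp
  have plnp: "p e * ln (p e) = p e * (\<Sum>v\<in>e. ln (a v))" if "e \<in> E" for e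
  proof (cases "p e = 0")
    case False
    then have "ln (p e) = (\<Sum>v\<in>e. ln (a v))"
      unfolding p_def using edge_finite[OF that] by (intro ln_prod) auto
    then show ?thesis by simp
  qed simp
  have "(\<Sum>e\<in>E. p e * ln (p e)) = (\<Sum>e\<in>E. p e * (\<Sum>v\<in>e. ln (a v)))" by (intro sum.cong plnp) auto
  also have "\<dots> = (\<Sum>v\<in>V. k v * ln (a v))" by (rule sum_degrees[OF feas_p])
  also have "\<dots> \<le> (\<Sum>v\<in>V. k v * \<xi> v)" by (intro sum_mono lna)
  also have "\<dots> = (\<Sum>v\<in>V. k v * ln (k v)) + (\<Sum>v\<in>V. real (k v)) * (4 * m / L - ln L / 2)"
    unfolding \<xi>_def sum_distrib_right sum.distrib[symmetric] by (intro sum.cong) (simp_all add: algebra_simps)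
  also have "(\<Sum>v\<in>V. real (k v)) = L" using L by (simp flip: of_nat_sum)
  also have "L * (4 * m / L - ln L / 2) = 4 * m - L / 2 * ln L" using assms(1) by (simp add: right_diff_distrib)
  finally have e1: "(\<Sum>e\<in>E. p e * ln (p e)) \<le> (\<Sum>v\<in>V. k v * ln (k v)) + (4 * m - L / 2 * ln L)" .
  have "(\<Sum>e\<in>E. (p e)\<^sup>2) \<le> (\<Sum>e\<in>E. p e * (4 * (real m)\<^sup>2 / L))"
    unfolding power2_eq_square[of "p _"] using pb by (intro sum_mono mult_left_mono) auto
  also have "\<dots> = L / 2 * (4 * (real m)\<^sup>2 / L)" by (simp only: sump flip: sum_distrib_right)
  also have "\<dots> = 2 * (real m)\<^sup>2" using assms(1) by simp
  finally have e2: "(\<Sum>e\<in>E. (p e)\<^sup>2) \<le> 2 * (real m)\<^sup>2" .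
  have "(\<Sum>e\<in>E. binary_entropy (p e)) \<ge> (\<Sum>e\<in>E. - p e * ln (p e) + p e - (p e)\<^sup>2)"
    using pb p1 by (intro sum_mono binary_entropy_ge) auto
  also have "(\<Sum>e\<in>E. - p e * ln (p e) + p e - (p e)\<^sup>2) = - (\<Sum>e\<in>E. p e * ln (p e)) + L / 2 - (\<Sum>e\<in>E. (p e)\<^sup>2)"
    by (simp add: sum.distrib sum_subtractf sum_negf sump)
  finally have "(\<Sum>v\<in>V. g_fun (k v)) + g_fun (L div 2) - g_fun L - 4 * real m - 2 * (real m)\<^sup>2 \<le>
    (\<Sum>e\<in>E. binary_entropy (p e)) - ln (card (linear_graphs E I \<alpha> c))"
    using e1 e2 ln_card_le[OF assms(1)] by (simp add: graphs_eq)
  then show ?thesis unfolding gap_ge_def using feas_p by blast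
qed

end

section \<open>Blocks of the multi-layer graph\<close>

lemma g_fun_0 [simp]: "g_fun 0 = 0"
  by (simp add: g_fun_def)

text \<open>For \<open>j \<ge> 1\<close> the increment \<open>g_fun (j + 1) - g_fun j\<close> is
  \<open>1 - j * ln (1 + 1 / j)\<close>, which lies between 0 and \<open>ln (1 + 1 / j)\<close>; the
  latter telescopes to a logarithm.\<close>

lemma g_fun_bounds: "0 \<le> g_fun k \<and> g_fun k \<le> 1 + ln (real k + 1)"
proof -
  have "0 \<le> g_fun (Suc j) \<and> g_fun (Suc j) \<le> 1 + ln (real (Suc j))" for j
  proof (induction j)
    case 0
    then show ?case by (simp add: g_fun_eq)
  next
    case (Suc j)
    define a where "a = real (Suc j)"
    have a: "a > 0" by (simp add: a_def)
    define q where "q = ln (a + 1) - ln a"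
    have "ln (1 + 1 / a) = q" using a by (simp add: q_def flip: ln_divide_pos) (simp add: field_simps)
    moreover have "ln (1 + 1 / a) \<le> 1 / a" using a by (intro ln_add_one_self_le_self) auto
    moreover have "- ln (1 + 1 / a) \<le> inverse (1 + 1 / a) - 1"
    proof -
      have "1 + 1 / a > 0" using a by (intro add_pos_pos) auto
      then show ?thesis using ln_le_minus_one[of "inverse (1 + 1 / a)"] by (simp add: ln_inverse)
    qed
    moreover have "inverse (1 + 1 / a) - 1 = - 1 / (a + 1)" using a by (simp add: field_simps)
    ultimately have q: "q \<le> 1 / a" "1 / (a + 1) \<le> q" by auto
    have "a * q \<le> 1" "1 - a * q \<le> q" using q a by (simp_all add: field_simps)
    moreover have "g_fun (Suc (Suc j)) = g_fun (Suc j) + (1 - a * q)"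
    proof -
      have "ln (fact (Suc (Suc j))) = ln (a + 1) + ln (fact (Suc j))"
        unfolding fact_Suc[of "Suc j"] of_nat_mult by (subst ln_mult_pos) (auto simp: a_def add.commute)
      moreover have "real (Suc (Suc j)) = a + 1" by (simp add: a_def)
      ultimately show ?thesis
        unfolding g_fun_eq q_def a_def[symmetric] by (simp only:) (simp add: algebra_simps del: fact_Suc)
    qed
    moreover have "ln (real (Suc (Suc j))) = ln a + q" by (simp add: q_def a_def add.commute)
    ultimately show ?case using Suc unfolding a_def[symmetric] by linarith
  qed
  note * = this
  show ?thesis
  proof (cases k)
    case (Suc j)
    have "ln (real (Suc j)) \<le> ln (real k + 1)" using Suc by simp
    then show ?thesis using *[of j] unfolding Suc by linarith
  qed simp
qed

section \<open>Constraints as linear functions of the links, and the partition into blocks\<close>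

text \<open>The number of times a link is counted in a constraint. Counting ordered pairs makes a
  link inside a layer count twice in \<open>Links s s\<close>.\<close>

definition link_coeff :: "(nat \<Rightarrow> nat) \<Rightarrow> constraint \<Rightarrow> node set \<Rightarrow> real" where
  "link_coeff N x e = (case x of
     Degree t i \<Rightarrow> real (card {j \<in> layer N t. {i, j} = e})
   | Links s t \<Rightarrow> real (card {a \<in> layer N s \<times> layer N t. {fst a, snd a} = e}))"

lemma finite_layer [simp]: "finite (layer N s)"
  by (simp add: layer_def)

lemma card_layer [simp]: "card (layer N s) = N s"
  by (simp add: layer_def)

lemma layer_fst: "i \<in> layer N s \<Longrightarrow> fst i = s"
  by (auto simp: layer_def)

lemma sum_indicator_swap:
  assumes "finite G" "finite S"
  shows "(\<Sum>a\<in>S. if h a \<in> G then 1 else 0 :: nat) = (\<Sum>e\<in>G. card {a \<in> S. h a = e})"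
proof -
  have "(\<Sum>e\<in>G. card {a \<in> S. h a = e}) = (\<Sum>e\<in>G. \<Sum>a\<in>S. if h a = e then 1 else 0)"
    using assms(2) by (simp add: sum.If_cases Int_def)
  also have "\<dots> = (\<Sum>a\<in>S. \<Sum>e\<in>G. if h a = e then 1 else 0)" by (rule sum.swap)
  also have "\<dots> = (\<Sum>a\<in>S. if h a \<in> G then 1 else 0)" using assms(1) by simp
  finally show ?thesis ..
qed

lemma constraint_value_eq:
  assumes "finite G"
  shows "constraint_value N G x = (\<Sum>e\<in>G. link_coeff N x e)"
proof (cases x)
  case (Degree t i)
  then show ?thesis
    using sum_indicator_swap[OF assms finite_layer, where h = "\<lambda>j. {i, j}"]
    by (simp add: constraint_value_def link_coeff_def targeted_degree_def adj_def flip: of_nat_sum)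
next
  case (Links s t)
  have "num_links N G s t = (\<Sum>a\<in>layer N s \<times> layer N t. if {fst a, snd a} \<in> G then 1 else 0)"
    by (simp add: num_links_def adj_def sum.cartesian_product case_prod_beta)
  also have "\<dots> = (\<Sum>e\<in>G. card {a \<in> layer N s \<times> layer N t. {fst a, snd a} = e})"
    by (rule sum_indicator_swap[OF assms]) simp
  finally show ?thesis using Links by (simp add: constraint_value_def link_coeff_def flip: of_nat_sum)
qed

definition block_links :: "(nat \<Rightarrow> nat) \<Rightarrow> nat \<times> nat \<Rightarrow> node set set" where
  "block_links N b = {{i, j} | i j. i \<in> layer N (fst b) \<and> j \<in> layer N (snd b) \<and> i \<noteq> j}"

text \<open>The constraints of both orders of a pair of layers concern the same links, so they form
  one block.\<close>

definition block_index :: "(nat \<times> nat) set \<Rightarrow> (nat \<Rightarrow> nat) \<Rightarrow> nat \<times> nat \<Rightarrow> constraint set" where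
  "block_index D N b = (if b \<in> D
     then Degree (snd b) ` layer N (fst b) \<union> Degree (fst b) ` layer N (snd b)
     else {Links (fst b) (snd b), Links (snd b) (fst b)})"

lemma block_links_fst: "e \<in> block_links N b \<Longrightarrow> fst ` e = {fst b, snd b}"
  by (auto simp: block_links_def layer_def)

lemma block_links_card: "e \<in> block_links N b \<Longrightarrow> card e = 2"
  by (auto simp: block_links_def)

lemma block_linksI: "i \<in> layer N s \<Longrightarrow> j \<in> layer N t \<Longrightarrow> i \<noteq> j \<Longrightarrow> {i, j} \<in> block_links N (s, t)"
  unfolding block_links_def fst_conv snd_conv by blast

lemma block_linksE:
  assumes "e \<in> block_links N (s, t)"
  obtains i j where "e = {i, j}" "i \<in> layer N s" "j \<in> layer N t" "i \<noteq> j"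
  using assms unfolding block_links_def fst_conv snd_conv by blast

lemma block_links_swap: "block_links N (t, s) = block_links N (s, t)"
proof -
  have "block_links N (t, s) \<subseteq> block_links N (s, t)" for s t
  proof
    fix e assume "e \<in> block_links N (t, s)"
    then obtain i j where "e = {i, j}" "i \<in> layer N t" "j \<in> layer N s" "i \<noteq> j" by (rule block_linksE)
    then show "e \<in> block_links N (s, t)" using block_linksI[of j N s i t] by (simp add: insert_commute)
  qed
  then show ?thesis by blast
qed

lemma block_links_image: "block_links N (s, t) \<subseteq> (\<lambda>a. {fst a, snd a}) ` (layer N s \<times> layer N t)"
proof
  fix e assume "e \<in> block_links N (s, t)"
  then obtain i j where "e = {i, j}" "i \<in> layer N s" "j \<in> layer N t" by (rule block_linksE)
  then show "e \<in> (\<lambda>a. {fst a, snd a}) ` (layer N s \<times> layer N t)"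
    by (intro image_eqI[of _ _ "(i, j)"]) simp_all
qed

lemma finite_block_links [simp]: "finite (block_links N b)"
  using finite_subset[OF block_links_image, of N "fst b" "snd b"] by simp

lemma card_block_links: "card (block_links N (s, t)) \<le> N s * N t"
proof -
  have "card (block_links N (s, t)) \<le> card ((\<lambda>a. {fst a, snd a}) ` (layer N s \<times> layer N t))"
    by (intro card_mono block_links_image) simp
  also have "\<dots> \<le> card (layer N s \<times> layer N t)" by (rule card_image_le) simp
  finally show ?thesis by (simp add: card_cartesian_product)
qed

lemma link_coeff_local:
  assumes x: "x \<in> block_index D N b" and e: "card e = 2" "e \<notin> block_links N b"
  shows "link_coeff N x e = 0"
proof (cases x)
  case (Degree t i)
  have "{j \<in> layer N t. {i, j} = e} = {}"
  proof (rule ccontr)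
    assume "{j \<in> layer N t. {i, j} = e} \<noteq> {}"
    then obtain j where j: "j \<in> layer N t" "{i, j} = e" by blast
    then have "i \<noteq> j" using e by auto
    obtain u v where b: "b = (u, v)" by (cases b)
    have "i \<in> layer N u \<and> t = v \<or> i \<in> layer N v \<and> t = u"
      using x Degree by (auto simp: block_index_def b split: if_splits)
    then have "e \<in> block_links N (u, v)"
      using j \<open>i \<noteq> j\<close> block_linksI[of i N _ j] block_links_swap[of N u v] by blast
    then show False using e b by simp
  qed
  then show ?thesis using Degree by (simp add: link_coeff_def)
next
  case (Links s t)
  have "{a \<in> layer N s \<times> layer N t. {fst a, snd a} = e} = {}"
  proof (rule ccontr)
    assume "{a \<in> layer N s \<times> layer N t. {fst a, snd a} = e} \<noteq> {}"
    then obtain i j where j: "i \<in> layer N s" "j \<in> layer N t" "{i, j} = e" by auto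
    then have "i \<noteq> j" using e by auto
    then have "e \<in> block_links N (s, t)" using j block_linksI by blast
    moreover have "b = (s, t) \<or> b = (t, s)"
      using x Links by (cases b) (auto simp: block_index_def split: if_splits)
    ultimately show False using e block_links_swap by auto
  qed
  then show ?thesis using Links by (simp add: link_coeff_def)
qed

text \<open>One representative for each unordered pair of layers.\<close>

definition blocks :: "(nat \<times> nat) set \<Rightarrow> (nat \<times> nat) set" where
  "blocks E = {b \<in> E. fst b \<le> snd b}"

lemma blocks_disjoint: "disjoint_family_on (block_links N) (blocks E)"
proof -
  have "b = b'" if "e \<in> block_links N b" "e \<in> block_links N b'" "b \<in> blocks E" "b' \<in> blocks E" for e b b'
  proof -
    have "{fst b, snd b} = {fst b', snd b'}" using block_links_fst that by metis
    then show ?thesis using that(3,4) unfolding blocks_def doubleton_eq_iff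
      by (metis (mono_tags, lifting) le_antisym mem_Collect_eq prod_eq_iff)
  qed
  then show ?thesis unfolding disjoint_family_on_def by blast
qed

lemma multilayer_graphs_eq:
  assumes "sym (master_pairs M \<gamma>)"
  shows "multilayer_graphs M \<gamma> N = Pow (\<Union>b\<in>blocks (master_pairs M \<gamma>). block_links N b)"
proof -
  have "(\<exists>(s, t)\<in>master_pairs M \<gamma>. \<exists>i\<in>layer N s. \<exists>j\<in>layer N t. i \<noteq> j \<and> e = {i, j}) \<longleftrightarrow>
    e \<in> (\<Union>b\<in>blocks (master_pairs M \<gamma>). block_links N b)" for e
  proof
    assume "\<exists>(s, t)\<in>master_pairs M \<gamma>. \<exists>i\<in>layer N s. \<exists>j\<in>layer N t. i \<noteq> j \<and> e = {i, j}"
    then obtain b where b: "b \<in> master_pairs M \<gamma>"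
      "case b of (s, t) \<Rightarrow> \<exists>i\<in>layer N s. \<exists>j\<in>layer N t. i \<noteq> j \<and> e = {i, j}" by blast
    obtain s t where bst: "b = (s, t)" by (cases b)
    have "\<exists>i\<in>layer N s. \<exists>j\<in>layer N t. i \<noteq> j \<and> e = {i, j}" using b(2) unfolding bst prod.case .
    then have "e \<in> block_links N (s, t)" unfolding block_links_def fst_conv snd_conv by blast
    then have st: "(s, t) \<in> master_pairs M \<gamma>" "e \<in> block_links N (s, t)" using b(1) bst by simp_all
    show "e \<in> (\<Union>b\<in>blocks (master_pairs M \<gamma>). block_links N b)"
    proof (cases "s \<le> t")
      case True
      then have "(s, t) \<in> blocks (master_pairs M \<gamma>)" using st by (simp add: blocks_def)
      then show ?thesis using st by blast
    next
      case False
      then have "(t, s) \<in> blocks (master_pairs M \<gamma>)" using st assms by (auto simp: blocks_def dest: symD)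
      then show ?thesis using st block_links_swap by blast
    qed
  next
    assume "e \<in> (\<Union>b\<in>blocks (master_pairs M \<gamma>). block_links N b)"
    then show "\<exists>(s, t)\<in>master_pairs M \<gamma>. \<exists>i\<in>layer N s. \<exists>j\<in>layer N t. i \<noteq> j \<and> e = {i, j}"
    proof -
      obtain b where b: "b \<in> master_pairs M \<gamma>" "e \<in> block_links N b"
        using \<open>e \<in> (\<Union>b\<in>blocks (master_pairs M \<gamma>). block_links N b)\<close> by (auto simp: blocks_def)
      obtain s t where st: "b = (s, t)" by (cases b)
      obtain i j where "e = {i, j}" "i \<in> layer N s" "j \<in> layer N t" "i \<noteq> j"
        using b(2) unfolding st by (rule block_linksE)
      then have "case b of (s, t) \<Rightarrow> \<exists>i\<in>layer N s. \<exists>j\<in>layer N t. i \<noteq> j \<and> e = {i, j}"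
        unfolding st prod.case by blast
      then show ?thesis using b(1) by blast
    qed
  qed
  note * = this
  have "multilayer_graphs M \<gamma> N = {G. \<forall>e\<in>G. e \<in> (\<Union>b\<in>blocks (master_pairs M \<gamma>). block_links N b)}"
    unfolding multilayer_graphs_def by (simp only: *)
  then show ?thesis by (simp only: Pow_def subset_iff Ball_def)
qed

lemma constraint_index_eq:
  assumes "D \<inter> L = {}" "sym D" "sym L"
  shows "constraint_index D L N = (\<Union>b\<in>blocks (D \<union> L). block_index D N b)"
proof (intro equalityI subsetI)
  fix x assume "x \<in> constraint_index D L N"
  then consider (deg) s t i where "x = Degree t i" "(s, t) \<in> D" "i \<in> layer N s"
    | (links) s t where "x = Links s t" "(s, t) \<in> L" by (auto simp: constraint_index_def)
  then show "x \<in> (\<Union>b\<in>blocks (D \<union> L). block_index D N b)"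
  proof cases
    case deg
    define b where "b = (if s \<le> t then (s, t) else (t, s))"
    have "b \<in> D" using deg assms(2) by (auto simp: b_def dest: symD)
    then have "b \<in> blocks (D \<union> L)" "x \<in> block_index D N b"
      using deg by (auto simp: b_def blocks_def block_index_def)
    then show ?thesis by blast
  next
    case links
    define b where "b = (if s \<le> t then (s, t) else (t, s))"
    have "b \<in> L" using links assms(3) by (auto simp: b_def dest: symD)
    then have "b \<in> blocks (D \<union> L)" "x \<in> block_index D N b"
      using links assms(1) by (auto simp: b_def blocks_def block_index_def)
    then show ?thesis by blast
  qed
next
  fix x assume "x \<in> (\<Union>b\<in>blocks (D \<union> L). block_index D N b)"
  then obtain s t where b: "(s, t) \<in> D \<union> L" "x \<in> block_index D N (s, t)" by (auto simp: blocks_def)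
  show "x \<in> constraint_index D L N"
  proof (cases "(s, t) \<in> D")
    case True
    then have "(t, s) \<in> D" using assms(2) by (blast dest: symD)
    moreover have "x \<in> Degree t ` layer N s \<union> Degree s ` layer N t" using b(2) True by (simp add: block_index_def)
    ultimately show ?thesis using True unfolding constraint_index_def by blast
  next
    case False
    then show ?thesis using b assms(3) by (auto simp: block_index_def constraint_index_def dest: symD)
  qed
qed

lemma the_endpoint:
  assumes "i \<in> layer N s" "j \<in> layer N t" "s \<noteq> t"
  shows "(THE v. v \<in> {i, j} \<and> fst v = s) = i" "(THE v. v \<in> {i, j} \<and> fst v = t) = j"
  using layer_fst[OF assms(1)] layer_fst[OF assms(2)] assms(3) by (auto intro!: the_equality)

section \<open>The three kinds of block\<close>

text \<open>A link between different layers has exactly one end in each, so its ends can be selected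
  by their layers as source and target.\<close>

lemma bipartite_block_layers:
  assumes st: "(s, t) \<in> D" "s \<noteq> t"
    and ne: "linear_graphs (block_links N (s, t)) (block_index D N (s, t)) (link_coeff N) (constraint_target k Lst) \<noteq> {}"
  shows "bipartite_block (block_links N (s, t)) (block_index D N (s, t)) (link_coeff N) (constraint_target k Lst)
    (\<lambda>e. THE v. v \<in> e \<and> fst v = s) (\<lambda>e. THE v. v \<in> e \<and> fst v = t) (layer N s) (layer N t) (k t) (k s)"
proof
  let ?E = "block_links N (s, t)" and ?src = "\<lambda>e. THE v. v \<in> e \<and> fst v = s" and ?tgt = "\<lambda>e. THE v. v \<in> e \<and> fst v = t"
  have ij: "i \<noteq> j" if "i \<in> layer N s" "j \<in> layer N t" for i j using that st layer_fst by blast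
  have coeff: "link_coeff N (Degree t i) e = of_bool (?src e = i)" if e: "e \<in> ?E" and i: "i \<in> layer N s" for e i
  proof -
    obtain a b where ab: "e = {a, b}" "a \<in> layer N s" "b \<in> layer N t" using e by (rule block_linksE)
    have "{j \<in> layer N t. {i, j} = e} = (if a = i then {b} else {})"
      using ab i ij by (auto simp: doubleton_eq_iff)
    then show ?thesis using the_endpoint[OF ab(2,3) st(2)] ab(1) by (simp add: link_coeff_def)
  qed
  have coeff': "link_coeff N (Degree s j) e = of_bool (?tgt e = j)" if e: "e \<in> ?E" and j: "j \<in> layer N t" for e j
  proof -
    obtain a b where ab: "e = {a, b}" "a \<in> layer N s" "b \<in> layer N t" using e by (rule block_linksE)
    have "{i \<in> layer N s. {j, i} = e} = (if b = j then {a} else {})"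
      using ab j ij by (auto simp: doubleton_eq_iff)
    then show ?thesis using the_endpoint[OF ab(2,3) st(2)] ab(1) by (simp add: link_coeff_def)
  qed
  have sums: "(\<Sum>e\<in>?E. link_coeff N (Degree t i) e * p e) = (\<Sum>e | e \<in> ?E \<and> ?src e = i. p e)" if "i \<in> layer N s" for i p
    using coeff that by (intro sum.mono_neutral_cong_right) auto
  have sums': "(\<Sum>e\<in>?E. link_coeff N (Degree s j) e * p e) = (\<Sum>e | e \<in> ?E \<and> ?tgt e = j. p e)" if "j \<in> layer N t" for j p
    using coeff' that by (intro sum.mono_neutral_cong_right) auto
  show "feasible ?E (block_index D N (s, t)) (link_coeff N) (constraint_target k Lst) p \<longleftrightarrow>
      (\<forall>e\<in>?E. 0 \<le> p e \<and> p e \<le> 1) \<and>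
      (\<forall>u\<in>layer N s. (\<Sum>e | e \<in> ?E \<and> ?src e = u. p e) = real (k t u)) \<and>
      (\<forall>v\<in>layer N t. (\<Sum>e | e \<in> ?E \<and> ?tgt e = v. p e) = real (k s v))" for p
    unfolding feasible_def block_index_def using st(1) by (simp add: ball_Un sums sums' constraint_target_def)
  show "bij_betw (\<lambda>e. (?src e, ?tgt e)) ?E (layer N s \<times> layer N t)"
  proof (rule bij_betw_byWitness[where f' = "\<lambda>a. {fst a, snd a}"])
    show "\<forall>a\<in>layer N s \<times> layer N t. (?src {fst a, snd a}, ?tgt {fst a, snd a}) = a"
    proof
      fix a assume "a \<in> layer N s \<times> layer N t"
      then have a: "fst a \<in> layer N s" "snd a \<in> layer N t" by auto
      show "(?src {fst a, snd a}, ?tgt {fst a, snd a}) = a" unfolding the_endpoint[OF a st(2)] by simp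
    qed
    show "\<forall>e\<in>?E. {fst (?src e, ?tgt e), snd (?src e, ?tgt e)} = e"
      unfolding block_links_def using the_endpoint[OF _ _ st(2)] by fastforce
    show "(\<lambda>e. (?src e, ?tgt e)) ` ?E \<subseteq> layer N s \<times> layer N t"
      unfolding block_links_def using the_endpoint[OF _ _ st(2)] by fastforce
    show "(\<lambda>a. {fst a, snd a}) ` (layer N s \<times> layer N t) \<subseteq> ?E"
    proof (rule image_subsetI)
      fix a assume "a \<in> layer N s \<times> layer N t"
      then show "{fst a, snd a} \<in> ?E" using ij block_linksI by (simp add: mem_Times_iff)
    qed
  qed
qed (use ne in auto)

lemma symmetric_block_layer:
  assumes ss: "(s, s) \<in> D" and L: "Lst s s = (\<Sum>i\<in>layer N s. k s i)"
    and ne: "linear_graphs (block_links N (s, s)) (block_index D N (s, s)) (link_coeff N) (constraint_target k Lst) \<noteq> {}"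
  shows "symmetric_block (block_links N (s, s)) (block_index D N (s, s)) (link_coeff N) (constraint_target k Lst)
    (layer N s) (k s) (Lst s s)"
proof
  let ?E = "block_links N (s, s)"
  show E: "?E = {e. e \<subseteq> layer N s \<and> card e = 2}"
  proof (intro equalityI subsetI)
    fix e assume "e \<in> ?E"
    then obtain i j where "e = {i, j}" "i \<in> layer N s" "j \<in> layer N s" "i \<noteq> j" by (rule block_linksE)
    then show "e \<in> {e. e \<subseteq> layer N s \<and> card e = 2}" by simp
  next
    fix e assume e: "e \<in> {e. e \<subseteq> layer N s \<and> card e = 2}"
    then obtain i j where "e = {i, j}" "i \<noteq> j" by (auto simp: card_2_iff)
    then show "e \<in> ?E" using e block_linksI[of i N s j s] by simp
  qed
  have coeff: "link_coeff N (Degree s i) e = of_bool (i \<in> e)" if e: "e \<in> ?E" for e i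
  proof -
    obtain a b where ab: "e = {a, b}" "a \<in> layer N s" "b \<in> layer N s" "a \<noteq> b" using e by (rule block_linksE)
    have "{j \<in> layer N s. {i, j} = e} = (if i = a then {b} else if i = b then {a} else {})"
      using ab by (auto simp: doubleton_eq_iff)
    then show ?thesis using ab(1) by (simp add: link_coeff_def)
  qed
  have sums: "(\<Sum>e\<in>?E. link_coeff N (Degree s i) e * p e) = (\<Sum>e | e \<in> ?E \<and> i \<in> e. p e)" for i p
    using coeff by (intro sum.mono_neutral_cong_right) auto
  show "feasible ?E (block_index D N (s, s)) (link_coeff N) (constraint_target k Lst) p \<longleftrightarrow>
      (\<forall>e\<in>?E. 0 \<le> p e \<and> p e \<le> 1) \<and> (\<forall>v\<in>layer N s. (\<Sum>e | e \<in> ?E \<and> v \<in> e. p e) = real (k s v))" for p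
    unfolding feasible_def block_index_def using ss by (simp add: sums constraint_target_def)
qed (use ne L in auto)

text \<open>Every link is counted \<open>r\<close> times, twice inside a layer and once otherwise;
  after division by \<open>r\<close> the constraint fixes the number \<open>l\<close> of
  links.\<close>

lemma links_block_gap:
  assumes st: "(s, t) \<notin> D" and L: "Lst s t = Lst t s"
    and ne: "linear_graphs (block_links N (s, t)) (block_index D N (s, t)) (link_coeff N) (constraint_target k Lst) \<noteq> {}"
  obtains l where "l \<le> N s * N t"
    "gap_le (block_links N (s, t)) (block_index D N (s, t)) (link_coeff N) (constraint_target k Lst) (g_fun l + 1)"
proof -
  let ?E = "block_links N (s, t)"
  define r :: real where "r = (if s = t then 2 else 1)"
  have r: "r > 0" by (simp add: r_def)
  have coeff: "link_coeff N (Links s t) e = r \<and> link_coeff N (Links t s) e = r" if e: "e \<in> ?E" for e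
  proof -
    obtain a b where ab: "e = {a, b}" "a \<in> layer N s" "b \<in> layer N t" "a \<noteq> b" using e by (rule block_linksE)
    have "b \<in> layer N s \<longleftrightarrow> s = t" "a \<in> layer N t \<longleftrightarrow> s = t" using ab(2,3) layer_fst by blast+
    then have "{x \<in> layer N s \<times> layer N t. {fst x, snd x} = e} = (if s = t then {(a, b), (b, a)} else {(a, b)})"
      "{x \<in> layer N t \<times> layer N s. {fst x, snd x} = e} = (if s = t then {(a, b), (b, a)} else {(b, a)})"
      using ab by (auto simp: doubleton_eq_iff)
    then show ?thesis using ab(4) by (simp add: link_coeff_def r_def)
  qed
  have sums: "(\<Sum>e\<in>?E. link_coeff N (Links s t) e * p e) = r * (\<Sum>e\<in>?E. p e)"
    "(\<Sum>e\<in>?E. link_coeff N (Links t s) e * p e) = r * (\<Sum>e\<in>?E. p e)" for p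
    unfolding sum_distrib_left using coeff by (auto intro!: sum.cong)
  obtain G where G: "G \<in> linear_graphs ?E (block_index D N (s, t)) (link_coeff N) (constraint_target k Lst)"
    using ne by blast
  then have GE: "G \<subseteq> ?E" by (simp add: linear_graphs_def)
  have "real (Lst s t) = (\<Sum>e\<in>G. link_coeff N (Links s t) e)"
    using G st by (simp add: linear_graphs_def block_index_def constraint_target_def)
  also have "\<dots> = (\<Sum>e\<in>G. r)" using coeff GE by (intro sum.cong) auto
  finally have LG: "real (Lst s t) = r * card G" by (simp add: mult.commute)
  have "feasible ?E (block_index D N (s, t)) (link_coeff N) (constraint_target k Lst) p \<longleftrightarrow>
      (\<forall>e\<in>?E. 0 \<le> p e \<and> p e \<le> 1) \<and> (\<Sum>e\<in>?E. p e) = real (card G)" for p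
    unfolding feasible_def block_index_def using st r LG by (simp add: sums constraint_target_def L[symmetric])
  then have "gap_le ?E (block_index D N (s, t)) (link_coeff N) (constraint_target k Lst) (g_fun (card G) + 1)"
    by (intro single_gap_le ne) auto
  moreover have "card G \<le> N s * N t"
    using card_mono[OF finite_block_links GE] card_block_links order_trans by blast
  ultimately show ?thesis using that by blast
qed

section \<open>Asymptotics\<close>

lemma small_log: "(\<lambda>n. (1 + ln ((real n)\<^sup>2 + 1)) / real n) \<longlonglongrightarrow> 0"
  by real_asymp

text \<open>\<open>g_fun\<close> grows only logarithmically, and numbers of links are of order at
  most \<open>n^2\<close>.\<close>

lemma g_fun_small:
  assumes "\<And>n. u n \<le> n\<^sup>2"
  shows "(\<lambda>n. g_fun (u n) / real n) \<longlonglongrightarrow> 0"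
proof (rule tendsto_sandwich[OF _ _ tendsto_const small_log])
  have "g_fun (u n) \<le> 1 + ln ((real n)\<^sup>2 + 1)" for n
  proof -
    have "real (u n) \<le> (real n)\<^sup>2" using assms[of n] by (metis of_nat_le_iff of_nat_power)
    then have "ln (real (u n) + 1) \<le> ln ((real n)\<^sup>2 + 1)" by (subst ln_le_cancel_iff) (auto intro: add_nonneg_pos)
    then show ?thesis using g_fun_bounds[of "u n"] by linarith
  qed
  then show "\<forall>\<^sub>F n in sequentially. g_fun (u n) / real n \<le> (1 + ln ((real n)\<^sup>2 + 1)) / real n"
    by (intro always_eventually allI divide_right_mono) auto
  show "\<forall>\<^sub>F n in sequentially. 0 \<le> g_fun (u n) / real n"
    using g_fun_bounds by (intro always_eventually allI divide_nonneg_nonneg) auto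
qed

text \<open>Since \<open>x = o(l^(2/3))\<close> means \<open>x^3 = o(l^2)\<close>, the inequality \<open>l^2 \<le> n^2 * x\<close> turns it into \<open>x = o(n)\<close>.\<close>

lemma smallo_two_thirds:
  fixes x l :: "nat \<Rightarrow> real"
  assumes x: "x \<in> o(\<lambda>n. l n powr (2 / 3))" "\<And>n. x n \<ge> 0" and l: "\<And>n. l n \<ge> 0"
    and le: "\<forall>\<^sub>F n in sequentially. (l n)\<^sup>2 \<le> (real n)\<^sup>2 * x n"
  shows "(\<lambda>n. x n / real n) \<longlonglongrightarrow> 0"
proof (rule tendstoI)
  fix \<epsilon> :: real assume \<epsilon>: "\<epsilon> > 0"
  define \<delta> where "\<delta> = \<epsilon> / 2"
  have \<delta>: "\<delta> > 0" "\<delta> < \<epsilon>" using \<epsilon> by (simp_all add: \<delta>_def)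
  have "\<forall>\<^sub>F n in sequentially. norm (x n) \<le> \<delta> powr (2 / 3) * norm (l n powr (2 / 3))"
    using landau_o.smallD[OF x(1)] \<delta>(1) by simp
  then show "\<forall>\<^sub>F n in sequentially. dist (x n / real n) 0 < \<epsilon>"
    using le eventually_gt_at_top[of 0]
  proof eventually_elim
    case (elim n)
    have cube: "(a powr (2 / 3)) ^ 3 = a\<^sup>2" if "a \<ge> 0" for a :: real
      using that by (cases "a = 0") (simp_all add: powr_power)
    have "x n \<le> \<delta> powr (2 / 3) * l n powr (2 / 3)" using elim(1) x(2)[of n] by simp
    then have "(x n) ^ 3 \<le> (\<delta> powr (2 / 3) * l n powr (2 / 3)) ^ 3" using x(2) by (intro power_mono)
    also have "\<dots> = \<delta>\<^sup>2 * (l n)\<^sup>2" using cube[of \<delta>] cube[of "l n"] \<delta> l by (simp add: power_mult_distrib)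
    also have "\<dots> \<le> \<delta>\<^sup>2 * ((real n)\<^sup>2 * x n)" using elim(2) by (intro mult_left_mono) auto
    finally have "(x n)\<^sup>2 * x n \<le> (\<delta> * real n)\<^sup>2 * x n" by (simp add: power2_eq_square power3_eq_cube mult_ac)
    then have "x n \<le> \<delta> * real n"
      using x(2)[of n] \<delta>(1) by (cases "x n = 0") (auto simp: mult_le_cancel_right intro: power2_le_imp_le)
    then have "x n / real n \<le> \<delta>" using elim(3) by (simp add: divide_le_eq)
    then show ?case using \<delta>(2) x(2)[of n] by simp
  qed
qed

lemma l1g_norm_finite:
  assumes "l1g_norm h \<noteq> \<infinity>"
  shows "summable (\<lambda>j. \<bar>h j\<bar> * g_fun j)" "l1g_norm h = ereal (\<Sum>j. \<bar>h j\<bar> * g_fun j)"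
  using summable_ereal[of "\<lambda>j. \<bar>h j\<bar> * g_fun j"] suminf_ereal[of "\<lambda>j. \<bar>h j\<bar> * g_fun j"] assms g_fun_bounds
  unfolding l1g_norm_def by simp_all

text \<open>The sum over degree values is exchanged with the finite sum over nodes.\<close>

lemma empirical_g_sums:
  "(\<lambda>j. empirical_distr N k s t j * g_fun j) sums ((\<Sum>i\<in>layer N s. g_fun (k t i)) / real (N s))"
proof -
  have "(\<lambda>j. \<Sum>i\<in>layer N s. (if j = k t i then g_fun j else 0)) sums (\<Sum>i\<in>layer N s. g_fun (k t i))"
    by (intro sums_sum sums_single)
  then have "(\<lambda>j. (\<Sum>i\<in>layer N s. (if j = k t i then g_fun j else 0)) / real (N s)) sums
      ((\<Sum>i\<in>layer N s. g_fun (k t i)) / real (N s))" by (rule sums_divide)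
  moreover have "(\<Sum>i\<in>layer N s. (if j = k t i then g_fun j else 0)) / real (N s) = empirical_distr N k s t j * g_fun j" for j
    by (auto simp: empirical_distr_def sum_distrib_right intro!: sum.cong arg_cong2[of _ _ _ _ "(/)"])
  ultimately show ?thesis by simp
qed

text \<open>Finiteness of the limiting norm is a consequence: at some index the distance is finite,
  and so is the sum for \<open>q\<close>. The last claim gives convergence of the single frequencies
  wherever \<open>g_fun j\<close> is nonzero.\<close>

lemma l1g_convergence:
  fixes p :: "nat \<Rightarrow> real" and q :: "nat \<Rightarrow> nat \<Rightarrow> real" and Q :: "nat \<Rightarrow> real"
  assumes lim: "(\<lambda>n. l1g_norm (\<lambda>j. q n j - p j)) \<longlonglongrightarrow> 0" and Q: "\<And>n. (\<lambda>j. q n j * g_fun j) sums Q n"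
    and p: "\<And>j. p j \<ge> 0"
  obtains F where "l1g_norm p = ereal F" "(\<lambda>j. p j * g_fun j) sums F" "Q \<longlonglongrightarrow> F"
    "\<And>j. (\<lambda>n. (q n j - p j) * g_fun j) \<longlonglongrightarrow> 0"
proof -
  define h where "h n j = (q n j - p j) * g_fun j" for n j
  have habs: "\<bar>q n j - p j\<bar> * g_fun j = \<bar>h n j\<bar>" for n j using g_fun_bounds[of j] by (simp add: h_def abs_mult)
  have "\<forall>\<^sub>F n in sequentially. l1g_norm (\<lambda>j. q n j - p j) < \<infinity>"
    using order_tendstoD(2)[OF lim, of \<infinity>] by simp
  then have ev: "\<forall>\<^sub>F n in sequentially. summable (\<lambda>j. \<bar>h n j\<bar>) \<and> l1g_norm (\<lambda>j. q n j - p j) = ereal (\<Sum>j. \<bar>h n j\<bar>)"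
  proof eventually_elim
    case (elim n)
    then show ?case using l1g_norm_finite[of "\<lambda>j. q n j - p j"] by (simp add: habs)
  qed
  have "(\<lambda>n. real_of_ereal (l1g_norm (\<lambda>j. q n j - p j))) \<longlonglongrightarrow> 0"
    using lim by (intro lim_real_of_ereal) (simp add: zero_ereal_def)
  then have lim0: "(\<lambda>n. \<Sum>j. \<bar>h n j\<bar>) \<longlonglongrightarrow> 0"
    by (rule Lim_transform_eventually) (use ev in \<open>auto elim!: eventually_mono\<close>)
  obtain n0 where n0: "summable (\<lambda>j. \<bar>h n0 j\<bar>)" using ev eventually_sequentially by force
  have "summable (\<lambda>j. q n0 j * g_fun j - h n0 j)"
    using Q[of n0] n0 by (intro summable_diff summable_rabs_cancel[OF n0]) (rule sums_summable)
  then have sum_p: "summable (\<lambda>j. p j * g_fun j)" by (simp add: h_def left_diff_distrib)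
  define F where "F = (\<Sum>j. p j * g_fun j)"
  have F: "(\<lambda>j. p j * g_fun j) sums F" using sum_p by (simp add: F_def summable_sums)
  have "(\<lambda>j. ereal (\<bar>p j\<bar> * g_fun j)) sums ereal F" using F p by (simp add: sums_ereal)
  then have norm_p: "l1g_norm p = ereal F" by (simp add: l1g_norm_def sums_unique[symmetric])
  have "\<forall>\<^sub>F n in sequentially. norm (Q n - F) \<le> (\<Sum>j. \<bar>h n j\<bar>)"
    using ev
  proof eventually_elim
    case (elim n)
    have "(\<lambda>j. h n j) sums (Q n - F)" using sums_diff[OF Q[of n] F] by (simp add: h_def left_diff_distrib)
    then show ?case using summable_rabs[of "h n"] elim by (simp add: sums_unique[symmetric])
  qed
  then have "(\<lambda>n. Q n - F) \<longlonglongrightarrow> 0" using lim0 by (rule Lim_null_comparison)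
  then have QF: "Q \<longlonglongrightarrow> F" using LIM_zero_iff by blast
  have "(\<lambda>n. h n j) \<longlonglongrightarrow> 0" for j
  proof (rule Lim_null_comparison[OF _ lim0])
    show "\<forall>\<^sub>F n in sequentially. norm (h n j) \<le> (\<Sum>j. \<bar>h n j\<bar>)"
      using ev
    proof eventually_elim
      case (elim n)
      then show ?case using sum_le_suminf[of "\<lambda>j. \<bar>h n j\<bar>" "{j}"] by simp
    qed
  qed
  then show ?thesis using that norm_p F QF by (simp add: h_def)
qed

text \<open>A block between different layers collects the contributions of both of its ordered
  pairs.\<close>

lemma sum_symmetric_pairs:
  fixes h :: "nat \<times> nat \<Rightarrow> real"
  assumes fin: "finite D" and sym: "sym D"
  shows "(\<Sum>b\<in>blocks D. if fst b = snd b then h b else h b + h (prod.swap b)) = (\<Sum>b\<in>D. h b)"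
proof -
  have finB: "finite (blocks D)" using fin by (simp add: blocks_def)
  have split: "D = blocks D \<union> {b \<in> D. snd b < fst b}" by (auto simp: blocks_def)
  have "(\<Sum>b\<in>blocks D. if fst b = snd b then h b else h b + h (prod.swap b)) =
      (\<Sum>b\<in>blocks D. h b + (if fst b \<noteq> snd b then h (prod.swap b) else 0))" by (intro sum.cong) auto
  also have "\<dots> = (\<Sum>b\<in>blocks D. h b) + (\<Sum>b | b \<in> blocks D \<and> fst b \<noteq> snd b. h (prod.swap b))"
    using finB by (simp add: sum.distrib sum.inter_filter)
  also have "(\<Sum>b | b \<in> blocks D \<and> fst b \<noteq> snd b. h (prod.swap b)) = (\<Sum>b | b \<in> D \<and> snd b < fst b. h b)"
    by (rule sum.reindex_bij_witness[of _ prod.swap prod.swap]) (auto simp: blocks_def dest: symD[OF sym])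
  also have "(\<Sum>b\<in>blocks D. h b) + (\<Sum>b | b \<in> D \<and> snd b < fst b. h b) = (\<Sum>b\<in>blocks D \<union> {b \<in> D. snd b < fst b}. h b)"
    using fin finB by (intro sum.union_disjoint[symmetric]) (auto simp: blocks_def)
  finally show ?thesis using split by simp
qed

section \<open>The sequence of ensembles\<close>

locale multilayer_sequence =
  fixes M :: nat and \<gamma> :: "nat \<Rightarrow> nat \<Rightarrow> nat" and D L :: "(nat \<times> nat) set"
    and N :: "nat \<Rightarrow> nat \<Rightarrow> nat" and k :: "nat \<Rightarrow> nat \<Rightarrow> node \<Rightarrow> nat" and Lst :: "nat \<Rightarrow> nat \<Rightarrow> nat \<Rightarrow> nat"
    and A :: "nat \<Rightarrow> real" and f :: "nat \<Rightarrow> nat \<Rightarrow> nat pmf"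
  assumes DL: "D \<union> L = master_pairs M \<gamma>" "D \<inter> L = {}" "sym D" "sym L"
    and N_sum: "\<And>n. (\<Sum>s=1..M. N n s) = n"
    and N_lim: "\<And>s. s \<in> {1..M} \<Longrightarrow> filterlim (\<lambda>n. N n s) at_top sequentially"
    and Lst_L: "\<And>n s t. (s, t) \<in> L \<Longrightarrow> Lst n s t = Lst n t s"
    and Lst_D: "\<And>n s t. (s, t) \<in> D \<Longrightarrow> Lst n s t = (\<Sum>i\<in>layer (N n) s. k n t i)"
    and realised: "\<And>n. realisations (multilayer_graphs M \<gamma> (N n)) (constraint_index D L (N n))
      (constraint_value (N n)) (constraint_target (k n) (Lst n)) \<noteq> {}"
    and layer_lim: "\<And>s. s \<in> {1..M} \<Longrightarrow> (\<lambda>n. real (N n s) / real n) \<longlonglongrightarrow> A s"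
    and bip_sparse: "\<And>s t. (s, t) \<in> D \<Longrightarrow> s \<noteq> t \<Longrightarrow>
      (\<lambda>n. real (max_degree (N n) (k n) s t) * real (max_degree (N n) (k n) t s)) \<in> o(\<lambda>n. real (Lst n s t) powr (2 / 3))"
    and sym_sparse: "\<And>s. (s, s) \<in> D \<Longrightarrow>
      (\<lambda>n. real (max_degree (N n) (k n) s s)) \<in> o(\<lambda>n. real (N n s) powr (1 / 2))"
    and distr_lim: "\<And>s t. (s, t) \<in> D \<Longrightarrow>
      (\<lambda>n. l1g_norm (\<lambda>j. empirical_distr (N n) (k n) s t j - pmf (f s t) j)) \<longlonglongrightarrow> 0"
begin

abbreviation G_sum :: "nat \<Rightarrow> nat \<Rightarrow> nat \<Rightarrow> real" where
  "G_sum n s t \<equiv> \<Sum>i\<in>layer (N n) s. g_fun (k n t i)"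

abbreviation max_deg :: "nat \<Rightarrow> nat \<Rightarrow> nat \<Rightarrow> nat" where
  "max_deg n s t \<equiv> max_degree (N n) (k n) s t"

abbreviation block_graphs :: "nat \<Rightarrow> nat \<times> nat \<Rightarrow> graph set" where
  "block_graphs n b \<equiv> linear_graphs (block_links (N n) b) (block_index D (N n) b) (link_coeff (N n))
     (constraint_target (k n) (Lst n))"

abbreviation block_ge :: "nat \<Rightarrow> nat \<times> nat \<Rightarrow> real \<Rightarrow> bool" where
  "block_ge n b \<equiv> gap_ge (block_links (N n) b) (block_index D (N n) b) (link_coeff (N n))
     (constraint_target (k n) (Lst n))"

abbreviation block_le :: "nat \<Rightarrow> nat \<times> nat \<Rightarrow> real \<Rightarrow> bool" where
  "block_le n b \<equiv> gap_le (block_links (N n) b) (block_index D (N n) b) (link_coeff (N n))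
     (constraint_target (k n) (Lst n))"

lemma range: "(s, t) \<in> D \<union> L \<Longrightarrow> s \<in> {1..M} \<and> t \<in> {1..M}"
  unfolding DL(1) by (auto simp: master_pairs_def)

lemma finite_pairs: "finite D" "finite L"
proof -
  have "D \<union> L \<subseteq> {1..M} \<times> {1..M}" unfolding DL(1) by (auto simp: master_pairs_def)
  then have "finite (D \<union> L)" by (rule finite_subset) simp
  then show "finite D" "finite L" by simp_all
qed

lemma sym_pairs: "sym (D \<union> L)"
  using DL(3,4) by (auto simp: sym_def)

lemma N_le: "s \<in> {1..M} \<Longrightarrow> N n s \<le> n"
  using member_le_sum[of s "{1..M}" "N n"] N_sum[of n] by simp

lemma index_eq: "constraint_index D L (N n) = (\<Union>b\<in>blocks (D \<union> L). block_index D (N n) b)"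
  by (rule constraint_index_eq[OF DL(2-4)])

lemma graphs_eq: "multilayer_graphs M \<gamma> (N n) = Pow (\<Union>b\<in>blocks (D \<union> L). block_links (N n) b)"
  using multilayer_graphs_eq[of M \<gamma> "N n"] sym_pairs unfolding DL(1) .

lemma finite_blocks: "finite (blocks (D \<union> L))"
  using finite_pairs by (simp add: blocks_def)

lemma block_ne:
  assumes b: "b \<in> blocks (D \<union> L)"
  shows "block_graphs n b \<noteq> {}"
proof -
  obtain G where G: "G \<in> multilayer_graphs M \<gamma> (N n)"
    "\<And>x. x \<in> constraint_index D L (N n) \<Longrightarrow> constraint_value (N n) G x = constraint_target (k n) (Lst n) x"
    using realised[of n] by (auto simp: realisations_def)
  define E where "E = (\<Union>b\<in>blocks (D \<union> L). block_links (N n) b)"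
  have finE: "finite E" using finite_blocks by (simp add: E_def)
  have GE: "G \<subseteq> E" "finite G" using G(1) finite_subset[OF _ finE] by (auto simp: graphs_eq E_def)
  have "(\<Sum>e\<in>G \<inter> block_links (N n) b. link_coeff (N n) x e) = constraint_target (k n) (Lst n) x"
    if x: "x \<in> block_index D (N n) b" for x
  proof -
    have "link_coeff (N n) x e = 0" if "e \<in> G - block_links (N n) b" for e
      using that GE(1) block_links_card by (intro link_coeff_local[OF x]) (auto simp: E_def)
    then have "(\<Sum>e\<in>G \<inter> block_links (N n) b. link_coeff (N n) x e) = (\<Sum>e\<in>G. link_coeff (N n) x e)"
      using GE(2) by (intro sum.mono_neutral_left) auto
    also have "\<dots> = constraint_value (N n) G x" by (rule constraint_value_eq[OF GE(2), symmetric])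
    also have "\<dots> = constraint_target (k n) (Lst n) x" using x b by (intro G(2)) (auto simp: index_eq)
    finally show ?thesis .
  qed
  then have "G \<inter> block_links (N n) b \<in> block_graphs n b" by (simp add: linear_graphs_def)
  then show ?thesis by blast
qed

lemma realised_degrees:
  obtains G where "\<And>s t i. (s, t) \<in> D \<Longrightarrow> i \<in> layer (N n) s \<Longrightarrow> targeted_degree (N n) G t i = k n t i"
proof -
  obtain G where "\<And>x. x \<in> constraint_index D L (N n) \<Longrightarrow> constraint_value (N n) G x = constraint_target (k n) (Lst n) x"
    using realised[of n] by (auto simp: realisations_def)
  then have "targeted_degree (N n) G t i = k n t i" if "(s, t) \<in> D" "i \<in> layer (N n) s" for s t i
  proof -
    have "Degree t i \<in> constraint_index D L (N n)" unfolding constraint_index_def using that by blast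
    from \<open>\<And>x. x \<in> constraint_index D L (N n) \<Longrightarrow> constraint_value (N n) G x = constraint_target (k n) (Lst n) x\<close>[OF this]
    show ?thesis by (simp add: constraint_value_def constraint_target_def)
  qed
  then show ?thesis using that by blast
qed

text \<open>Both numbers count the links between the two layers in a graph that realises the
  constraints, once from either side.\<close>

lemma Lst_swap:
  assumes st: "(s, t) \<in> D"
  shows "Lst n s t = Lst n t s"
proof -
  obtain G where G: "\<And>s t i. (s, t) \<in> D \<Longrightarrow> i \<in> layer (N n) s \<Longrightarrow> targeted_degree (N n) G t i = k n t i"
    using realised_degrees by blast
  have L: "Lst n s t = (\<Sum>i\<in>layer (N n) s. \<Sum>j\<in>layer (N n) t. adj G i j)" if "(s, t) \<in> D" for s t
    unfolding Lst_D[OF that] using G[OF that] by (intro sum.cong) (simp_all add: targeted_degree_def)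
  have ts: "(t, s) \<in> D" using st DL(3) by (blast dest: symD)
  show ?thesis unfolding L[OF st] L[OF ts] by (subst sum.swap) (simp add: adj_def insert_commute)
qed

lemma Lst_le:
  assumes st: "(s, t) \<in> D"
  shows "Lst n s t \<le> n\<^sup>2"
proof -
  obtain G where G: "\<And>s t i. (s, t) \<in> D \<Longrightarrow> i \<in> layer (N n) s \<Longrightarrow> targeted_degree (N n) G t i = k n t i"
    using realised_degrees by blast
  have "k n t i \<le> N n t" if "i \<in> layer (N n) s" for i
  proof -
    have "(\<Sum>j\<in>layer (N n) t. adj G i j) \<le> (\<Sum>j\<in>layer (N n) t. 1)" by (intro sum_mono) (simp add: adj_def)
    then show ?thesis using G[OF st that] by (simp add: targeted_degree_def)
  qed
  then have "Lst n s t \<le> (\<Sum>i\<in>layer (N n) s. N n t)" unfolding Lst_D[OF st] by (intro sum_mono)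
  also have "\<dots> = N n s * N n t" by simp
  also have "\<dots> \<le> n * n" using N_le range[of s t] st by (intro mult_mono) auto
  finally show ?thesis by (simp add: power2_eq_square)
qed

lemma degree_le_max: "i \<in> layer (N n) s \<Longrightarrow> k n t i \<le> max_deg n s t"
  unfolding max_degree_def by (intro Max_ge) auto

lemma Lst_le_max:
  assumes st: "(s, t) \<in> D"
  shows "Lst n s t \<le> n * max_deg n s t"
proof -
  have "Lst n s t \<le> (\<Sum>i\<in>layer (N n) s. max_deg n s t)"
    unfolding Lst_D[OF st] by (intro sum_mono degree_le_max)
  also have "\<dots> \<le> n * max_deg n s t" using N_le range[of s t] st by simp
  finally show ?thesis .
qed

definition F :: "nat \<Rightarrow> nat \<Rightarrow> real" where
  "F s t = real_of_ereal (l1g_norm (pmf (f s t)))"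

text \<open>For the third claim: as \<open>g_fun 0 = 0\<close>, a nonzero \<open>F s t\<close>
  yields a degree \<open>j > 0\<close> of positive limiting frequency, so the number of links is at
  least proportional to the layer size. This is what decides the regime inside a layer.\<close>

lemma degree_limits:
  assumes st: "(s, t) \<in> D"
  shows "l1g_norm (pmf (f s t)) = ereal (F s t)" "(\<lambda>n. G_sum n s t / real n) \<longlonglongrightarrow> A s * F s t"
    "F s t \<noteq> 0 \<Longrightarrow> \<exists>c>0. \<forall>\<^sub>F n in sequentially. c * real (N n s) \<le> Lst n s t"
proof -
  obtain F' where F': "l1g_norm (pmf (f s t)) = ereal F'" "(\<lambda>j. pmf (f s t) j * g_fun j) sums F'"
    "(\<lambda>n. G_sum n s t / real (N n s)) \<longlonglongrightarrow> F'"
    "\<And>j. (\<lambda>n. (empirical_distr (N n) (k n) s t j - pmf (f s t) j) * g_fun j) \<longlonglongrightarrow> 0"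
    using l1g_convergence[OF distr_lim[OF st] empirical_g_sums pmf_nonneg] by blast
  then have FF: "F' = F s t" by (simp add: F_def)
  show "l1g_norm (pmf (f s t)) = ereal (F s t)" using F'(1) FF by simp
  have s: "s \<in> {1..M}" using range st by blast
  have "(\<lambda>n. (real (N n s) / real n) * (G_sum n s t / real (N n s))) \<longlonglongrightarrow> A s * F s t"
    using F'(3) unfolding FF by (intro tendsto_mult layer_lim[OF s])
  moreover have "(real (N n s) / real n) * (G_sum n s t / real (N n s)) = G_sum n s t / real n" for n
  proof (cases "N n s = 0")
    case True
    then have "layer (N n) s = {}" by (simp add: layer_def)
    then show ?thesis by simp
  qed simp
  ultimately show "(\<lambda>n. G_sum n s t / real n) \<longlonglongrightarrow> A s * F s t" by simp
  assume "F s t \<noteq> 0"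
  then have "\<exists>j. pmf (f s t) j * g_fun j \<noteq> 0"
    using F'(2) sums_zero sums_unique2 unfolding FF by (metis (no_types, lifting) sums_cong)
  then obtain j where j: "pmf (f s t) j > 0" "g_fun j \<noteq> 0" using pmf_nonneg[of "f s t"] by (auto simp: less_le)
  then have "j \<noteq> 0" by (intro notI) simp
  define e where "e n = empirical_distr (N n) (k n) s t j" for n
  have "(\<lambda>n. (e n - pmf (f s t) j) * g_fun j / g_fun j) \<longlonglongrightarrow> 0 / g_fun j"
    unfolding e_def by (intro tendsto_divide F'(4) tendsto_const j(2))
  then have "(\<lambda>n. e n - pmf (f s t) j) \<longlonglongrightarrow> 0" using j(2) by simp
  then have "e \<longlonglongrightarrow> pmf (f s t) j" using LIM_zero_iff by blast
  then have "\<forall>\<^sub>F n in sequentially. pmf (f s t) j / 2 < e n" using j(1) by (intro order_tendstoD(1)) auto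
  then have "\<forall>\<^sub>F n in sequentially. pmf (f s t) j / 2 * real (N n s) \<le> Lst n s t"
  proof eventually_elim
    case (elim n)
    have "pmf (f s t) j / 2 * real (N n s) \<le> e n * real (N n s)" using elim by (intro mult_right_mono) auto
    also have "\<dots> \<le> (\<Sum>i\<in>layer (N n) s. if k n t i = j then 1 else 0)" by (auto simp: e_def empirical_distr_def intro!: sum_nonneg)
    also have "\<dots> \<le> (\<Sum>i\<in>layer (N n) s. real (k n t i))" using \<open>j \<noteq> 0\<close> by (intro sum_mono) auto
    also have "\<dots> = Lst n s t" by (simp add: Lst_D[OF st])
    finally show ?case .
  qed
  then show "\<exists>c>0. \<forall>\<^sub>F n in sequentially. c * real (N n s) \<le> Lst n s t" using j(1) by (intro exI[of _ "pmf (f s t) j / 2"]) auto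
qed

end

section \<open>Limits of the bounds for each kind of block\<close>

context multilayer_sequence
begin

text \<open>The number of links is at most \<open>n\<close> times the maximal degree on either side,
  so its square is at most \<open>n^2\<close> times the product of the two;
  \<open>smallo_two_thirds\<close> applies. The second claim uses that a natural number is at least
  its power \<open>2 / 3\<close>.\<close>

lemma max_deg_product_small:
  assumes st: "(s, t) \<in> D" "s \<noteq> t"
  shows "(\<lambda>n. real (max_deg n s t * max_deg n t s) / real n) \<longlonglongrightarrow> 0"
    "\<forall>\<^sub>F n in sequentially. max_deg n s t * max_deg n t s \<le> Lst n s t"
proof -
  have ts: "(t, s) \<in> D" using st DL(3) by (blast dest: symD)
  have o: "(\<lambda>n. real (max_deg n s t * max_deg n t s)) \<in> o(\<lambda>n. real (Lst n s t) powr (2 / 3))"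
    using bip_sparse[OF st] by simp
  have "(Lst n s t)\<^sup>2 \<le> n\<^sup>2 * (max_deg n s t * max_deg n t s)" for n
  proof -
    have "Lst n s t * Lst n t s \<le> (n * max_deg n s t) * (n * max_deg n t s)"
      by (intro mult_mono Lst_le_max st(1) ts) auto
    then show ?thesis using Lst_swap[OF st(1)] by (simp add: power2_eq_square mult_ac)
  qed
  then have "(real (Lst n s t))\<^sup>2 \<le> (real n)\<^sup>2 * real (max_deg n s t * max_deg n t s)" for n
    by (metis of_nat_le_iff of_nat_mult of_nat_power)
  then show "(\<lambda>n. real (max_deg n s t * max_deg n t s) / real n) \<longlonglongrightarrow> 0"
    by (intro smallo_two_thirds[OF o]) auto
  have "\<forall>\<^sub>F n in sequentially. norm (real (max_deg n s t * max_deg n t s)) \<le> 1 * norm (real (Lst n s t) powr (2 / 3))"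
    by (rule landau_o.smallD[OF o]) simp
  then show "\<forall>\<^sub>F n in sequentially. max_deg n s t * max_deg n t s \<le> Lst n s t"
  proof eventually_elim
    case (elim n)
    have "real (Lst n s t) powr (2 / 3) \<le> Lst n s t"
    proof (cases "Lst n s t = 0")
      case False
      then have "real (Lst n s t) powr (2 / 3) \<le> real (Lst n s t) powr 1" by (intro powr_mono) auto
      then show ?thesis using False by simp
    qed simp
    then have "real (max_deg n s t * max_deg n t s) \<le> real (Lst n s t)" using elim by simp
    then show ?case by (simp only: of_nat_le_iff)
  qed
qed

lemma max_deg_square_small:
  fixes c :: real
  assumes ss: "(s, s) \<in> D" and c: "c > 0"
  shows "\<forall>\<^sub>F n in sequentially. (real (max_deg n s s))\<^sup>2 \<le> c * N n s"
proof -
  have "\<forall>\<^sub>F n in sequentially. norm (real (max_deg n s s)) \<le> sqrt c * norm (real (N n s) powr (1 / 2))"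
    by (rule landau_o.smallD[OF sym_sparse[OF ss]]) (use c in simp)
  then show ?thesis
  proof eventually_elim
    case (elim n)
    then have "real (max_deg n s s) \<le> sqrt (c * N n s)" using c by (simp add: powr_half_sqrt real_sqrt_mult)
    then have "(real (max_deg n s s))\<^sup>2 \<le> (sqrt (c * N n s))\<^sup>2" by (intro power_mono) auto
    then show ?case using c by simp
  qed
qed

lemma max_deg_square_small':
  assumes ss: "(s, s) \<in> D"
  shows "(\<lambda>n. (real (max_deg n s s))\<^sup>2 / real n) \<longlonglongrightarrow> 0"
proof (rule tendstoI)
  fix \<epsilon> :: real assume \<epsilon>: "\<epsilon> > 0"
  then have "\<forall>\<^sub>F n in sequentially. (real (max_deg n s s))\<^sup>2 \<le> \<epsilon> / 2 * N n s"
    using max_deg_square_small[OF ss, of "\<epsilon> / 2"] by simp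
  then show "\<forall>\<^sub>F n in sequentially. dist ((real (max_deg n s s))\<^sup>2 / real n) 0 < \<epsilon>"
    using eventually_gt_at_top[of 0]
  proof eventually_elim
    case (elim n)
    have "\<epsilon> / 2 * N n s \<le> \<epsilon> / 2 * n" using N_le[of s n] range[of s s] ss \<epsilon> by (intro mult_left_mono) auto
    then have "(real (max_deg n s s))\<^sup>2 / real n \<le> \<epsilon> / 2" using elim by (simp add: divide_le_eq)
    then have "(real (max_deg n s s))\<^sup>2 / real n < \<epsilon>" using \<epsilon> by linarith
    then show ?case by simp
  qed
qed

text \<open>Lower and upper bounds on the gap of one block that agree to order
  \<open>n\<close>.\<close>

definition block_bounds :: "nat \<times> nat \<Rightarrow> real \<Rightarrow> bool" where
  "block_bounds b v \<longleftrightarrow> (\<exists>lo up. (\<forall>\<^sub>F n in sequentially. block_ge n b (lo n) \<and> block_le n b (up n)) \<and>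
     (\<lambda>n. lo n / real n) \<longlonglongrightarrow> v \<and> (\<lambda>n. up n / real n) \<longlonglongrightarrow> v)"

text \<open>Both bounds are the sum of \<open>g_fun\<close> over all degrees of the block, up to
  \<open>g_fun\<close> of the number of links, the product of the maximal degrees and a constant,
  all of them \<open>o(n)\<close>.\<close>

lemma bipartite_bounds:
  assumes st: "(s, t) \<in> D" "s < t"
  shows "block_bounds (s, t) (A s * F s t + A t * F t s)"
proof -
  have ts: "(t, s) \<in> D" using st DL(3) by (blast dest: symD)
  have b: "(s, t) \<in> blocks (D \<union> L)" using st by (simp add: blocks_def)
  define lo where "lo n = G_sum n s t + G_sum n t s - g_fun (Lst n s t) - real (max_deg n s t * max_deg n t s)" for n
  define up where "up n = G_sum n s t + G_sum n t s + 1" for n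
  have block: "bipartite_block (block_links (N n) (s, t)) (block_index D (N n) (s, t)) (link_coeff (N n))
     (constraint_target (k n) (Lst n)) (\<lambda>e. THE v. v \<in> e \<and> fst v = s) (\<lambda>e. THE v. v \<in> e \<and> fst v = t)
     (layer (N n) s) (layer (N n) t) (k n t) (k n s)" for n
    using st block_ne[OF b] by (intro bipartite_block_layers) auto
  have "\<forall>\<^sub>F n in sequentially. block_ge n (s, t) (lo n) \<and> block_le n (s, t) (up n)"
    using max_deg_product_small(2)[OF st(1) less_imp_neq[OF st(2)]]
  proof eventually_elim
    case (elim n)
    have "(\<Sum>i\<in>layer (N n) s. k n t i) = Lst n s t" "(\<Sum>i\<in>layer (N n) t. k n s i) = Lst n s t"
      using Lst_D[OF st(1)] Lst_D[OF ts] Lst_swap[OF st(1)] by simp_all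
    then have "block_ge n (s, t) (lo n)" unfolding lo_def
      using elim st(2) degree_le_max by (intro bipartite_block.gap_ge[OF block]) auto
    moreover have "block_le n (s, t) (up n)" unfolding up_def by (rule bipartite_block.gap_le[OF block])
    ultimately show ?case ..
  qed
  moreover have "(\<lambda>n. G_sum n s t / real n + G_sum n t s / real n - g_fun (Lst n s t) / real n
      - real (max_deg n s t * max_deg n t s) / real n) \<longlonglongrightarrow> A s * F s t + A t * F t s - 0 - 0"
    using st(2) by (intro tendsto_diff tendsto_add degree_limits(2) st(1) ts g_fun_small Lst_le max_deg_product_small(1)) auto
  then have "(\<lambda>n. lo n / real n) \<longlonglongrightarrow> A s * F s t + A t * F t s"
    by (simp add: lo_def add_divide_distrib diff_divide_distrib)
  moreover have "(\<lambda>n. G_sum n s t / real n + G_sum n t s / real n + 1 / real n) \<longlonglongrightarrow> A s * F s t + A t * F t s + 0"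
    by (intro tendsto_add degree_limits(2) st(1) ts lim_1_over_n)
  then have "(\<lambda>n. up n / real n) \<longlonglongrightarrow> A s * F s t + A t * F t s"
    by (simp add: up_def add_divide_distrib)
  ultimately show ?thesis unfolding block_bounds_def by blast
qed

text \<open>The lower bound 0 is always available, and the upper bound is logarithmic.\<close>

lemma links_bounds:
  assumes st: "(s, t) \<in> L" "s \<le> t"
  shows "block_bounds (s, t) 0"
proof -
  have b: "(s, t) \<in> blocks (D \<union> L)" using st by (simp add: blocks_def)
  have nD: "(s, t) \<notin> D" using st DL(2) by blast
  have "\<exists>l. l \<le> n\<^sup>2 \<and> block_le n (s, t) (g_fun l + 1)" for n
  proof -
    obtain l where l: "l \<le> N n s * N n t" "block_le n (s, t) (g_fun l + 1)"
      using links_block_gap[where Lst = "Lst n", OF nD Lst_L[OF st(1)] block_ne[OF b]] by blast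
    have "N n s * N n t \<le> n * n" using N_le range[of s t] st by (intro mult_mono) auto
    then have "l \<le> n\<^sup>2" using l(1) unfolding power2_eq_square by linarith
    then show ?thesis using l(2) by blast
  qed
  then obtain l where l: "\<And>n. l n \<le> n\<^sup>2" "\<And>n. block_le n (s, t) (g_fun (l n) + 1)" by metis
  have "(\<lambda>n. g_fun (l n) / real n + 1 / real n) \<longlonglongrightarrow> 0 + 0"
    by (intro tendsto_add g_fun_small l(1) lim_1_over_n)
  then have "(\<lambda>n. (g_fun (l n) + 1) / real n) \<longlonglongrightarrow> 0" by (simp add: add_divide_distrib)
  moreover have "block_ge n (s, t) 0" for n by (intro gap_ge_0 block_ne b) simp
  ultimately show ?thesis unfolding block_bounds_def
    using l(2) by (intro exI[of _ "\<lambda>_. 0"] exI[of _ "\<lambda>n. g_fun (l n) + 1"]) auto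
qed

text \<open>Whether \<open>P n\<close> holds may vary with \<open>n\<close>. The upper bound has one
  error term for both regimes; the lower bound is just 0 when \<open>P n\<close> fails. This
  suffices: if \<open>F s s = 0\<close> the limit is 0 as well, and otherwise the number of links is
  at least proportional to the layer size while the squared maximal degree is of smaller order, so
  \<open>P n\<close> holds eventually.\<close>

lemma symmetric_bounds:
  assumes ss: "(s, s) \<in> D"
  shows "block_bounds (s, s) (A s * F s s)"
proof -
  have b: "(s, s) \<in> blocks (D \<union> L)" using ss by (simp add: blocks_def)
  define m where "m n = max_deg n s s" for n
  define l where "l n = Lst n s s" for n
  define P where "P n \<longleftrightarrow> 0 < l n \<and> 8 * (m n)\<^sup>2 \<le> l n" for n
  \<comment> \<open>The factor 100 is generous: the sparse bounds need at most
    \<open>8 * m^2\<close> besides constants, and in the other regime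
    \<open>L * ln 16 \<le> 8 * m^2 * 4\<close>.\<close>
  define err where "err n = g_fun (l n div 2) + g_fun (l n) + 100 * (real (m n))\<^sup>2 + 3" for n
  define lo where "lo n = (if P n then G_sum n s s - err n else 0)" for n
  define up where "up n = G_sum n s s + err n" for n
  have block: "symmetric_block (block_links (N n) (s, s)) (block_index D (N n) (s, s)) (link_coeff (N n))
     (constraint_target (k n) (Lst n)) (layer (N n) s) (k n s) (l n)" for n
    unfolding l_def using ss block_ne[OF b] by (intro symmetric_block_layer Lst_D) auto
  have mm: "real (m n) \<le> (real (m n))\<^sup>2" for n
    by (metis of_nat_le_iff of_nat_power power2_nat_le_imp_le power2_eq_square le_square)
  have sparse: "\<And>v. v \<in> layer (N n) s \<Longrightarrow> k n s v \<le> m n" for n unfolding m_def by (rule degree_le_max)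
  have g0: "g_fun j \<ge> 0" for j using g_fun_bounds by blast
  have mono_le: "block_le n (s, s) y" if "block_le n (s, s) x" "x \<le> y" for n x y
    using that unfolding gap_le_def by (meson order_trans)
  have mono_ge: "block_ge n (s, s) x" if "block_ge n (s, s) y" "x \<le> y" for n x y
    using that unfolding gap_ge_def by (meson order_trans)
  have bounds: "block_ge n (s, s) (lo n) \<and> block_le n (s, s) (up n)" for n
  proof (cases "P n")
    case True
    then have P: "0 < l n" "8 * (m n)\<^sup>2 \<le> l n" by (simp_all add: P_def)
    have "lo n = G_sum n s s - err n" using True by (simp add: lo_def)
    then have "lo n \<le> G_sum n s s + g_fun (l n div 2) - g_fun (l n) - 4 * real (m n) - 2 * (real (m n))\<^sup>2"
      using mm[of n] g0[of "l n div 2"] unfolding err_def by linarith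
    then have "block_ge n (s, s) (lo n)"
      using mono_ge[OF symmetric_block.gap_ge_sparse[OF block P(1) _ P(2)]] sparse by blast
    moreover have "block_le n (s, s) (up n)"
      by (rule mono_le[OF symmetric_block.gap_le_sparse[OF block P(1) sparse P(2)]])
        (use mm[of n] g0[of "l n"] in \<open>auto simp: up_def err_def distrib_left power2_eq_square\<close>)
    ultimately show ?thesis ..
  next
    case False
    then have "l n \<le> 8 * (m n)\<^sup>2" unfolding P_def by linarith
    then have l8: "real (l n) \<le> 8 * (real (m n))\<^sup>2" by (metis of_nat_le_iff of_nat_mult of_nat_numeral of_nat_power)
    have "ln (16::real) = 4 * ln 2" using ln_realpow[of 2 4] by simp
    then have "real (l n) * ln 16 \<le> 8 * (real (m n))\<^sup>2 * 4" using l8 ln_2_less_1 by (intro mult_mono) auto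
    then have "G_sum n s s + 1 + real (l n) * ln 16 \<le> up n"
      using g0[of "l n"] g0[of "l n div 2"] zero_le_power2[of "real (m n)"] unfolding up_def err_def by linarith
    then have "block_le n (s, s) (up n)" by (rule mono_le[OF symmetric_block.gap_le_any[OF block]])
    moreover have "block_ge n (s, s) (lo n)" using False by (simp add: lo_def gap_ge_0 block_ne b)
    ultimately show ?thesis by blast
  qed
  have l2: "l n \<le> n\<^sup>2" "l n div 2 \<le> n\<^sup>2" for n
    using Lst_le[OF ss, of n] div_le_dividend[of "l n" 2] unfolding l_def by (auto intro: order_trans)
  have "(\<lambda>n. g_fun (l n div 2) / real n + g_fun (l n) / real n + 100 * ((real (m n))\<^sup>2 / real n) + 3 * (1 / real n))
      \<longlonglongrightarrow> 0 + 0 + 100 * 0 + 3 * 0"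
    unfolding m_def
    by (intro tendsto_add tendsto_mult tendsto_const g_fun_small l2 max_deg_square_small' ss lim_1_over_n)
  then have err: "(\<lambda>n. err n / real n) \<longlonglongrightarrow> 0" by (simp add: err_def add_divide_distrib)
  have err0: "err n \<ge> 0" for n using g0[of "l n"] g0[of "l n div 2"] by (simp add: err_def)
  note G = degree_limits(2)[OF ss]
  have up: "(\<lambda>n. up n / real n) \<longlonglongrightarrow> A s * F s s"
    using tendsto_add[OF G err] by (simp add: up_def add_divide_distrib)
  have G_err: "(\<lambda>n. (G_sum n s s - err n) / real n) \<longlonglongrightarrow> A s * F s s"
    using tendsto_diff[OF G err] by (simp add: diff_divide_distrib)
  have lo: "(\<lambda>n. lo n / real n) \<longlonglongrightarrow> A s * F s s"
  proof (cases "F s s = 0")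
    case True
    have "\<bar>lo n / real n\<bar> \<le> G_sum n s s / real n + err n / real n" for n
    proof -
      have "G_sum n s s \<ge> 0" by (intro sum_nonneg g0)
      then have "\<bar>lo n\<bar> \<le> G_sum n s s + err n" using err0[of n] by (auto simp: lo_def)
      then show ?thesis by (simp add: abs_divide divide_right_mono flip: add_divide_distrib)
    qed
    then have "\<forall>\<^sub>F n in sequentially. norm (lo n / real n) \<le> G_sum n s s / real n + err n / real n" by simp
    moreover have "(\<lambda>n. G_sum n s s / real n + err n / real n) \<longlonglongrightarrow> 0" using tendsto_add[OF G err] True by simp
    ultimately have "(\<lambda>n. lo n / real n) \<longlonglongrightarrow> 0" by (rule Lim_null_comparison)
    then show ?thesis using True by simp
  next
    case False
    then obtain c where c: "c > 0" "\<forall>\<^sub>F n in sequentially. c * real (N n s) \<le> Lst n s s"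
      using degree_limits(3)[OF ss] by blast
    have "s \<in> {1..M}" using range ss by blast
    then have "\<forall>\<^sub>F n in sequentially. N n s \<ge> 1" using N_lim by (simp add: filterlim_at_top)
    moreover have "\<forall>\<^sub>F n in sequentially. (real (m n))\<^sup>2 \<le> c / 8 * N n s"
      unfolding m_def using c(1) by (intro max_deg_square_small ss) auto
    ultimately have "\<forall>\<^sub>F n in sequentially. (G_sum n s s - err n) / real n = lo n / real n" using c(2)
    proof eventually_elim
      case (elim n)
      have "8 * (real (m n))\<^sup>2 \<le> l n" using elim(2,3) by (simp add: l_def)
      then have "8 * (m n)\<^sup>2 \<le> l n" by (metis of_nat_le_iff of_nat_mult of_nat_numeral of_nat_power)
      moreover have "c * real (N n s) > 0" using c(1) elim(1) by simp
      then have "real (l n) > 0" using elim(3) unfolding l_def by linarith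
      ultimately have "P n" by (simp add: P_def)
      then show ?case by (simp add: lo_def)
    qed
    then show ?thesis using G_err by (rule Lim_transform_eventually[rotated])
  qed
  show ?thesis unfolding block_bounds_def
    by (intro exI[of _ lo] exI[of _ up] conjI always_eventually allI bounds lo up)
qed

section \<open>Summation over the blocks\<close>

definition limit :: "nat \<times> nat \<Rightarrow> real" where
  "limit b = A (fst b) * F (fst b) (snd b)"

lemma all_bounds:
  assumes b: "b \<in> blocks (D \<union> L)"
  shows "block_bounds b (if b \<in> D then if fst b = snd b then limit b else limit b + limit (prod.swap b) else 0)"
proof -
  obtain s t where st: "b = (s, t)" "s \<le> t" "(s, t) \<in> D \<union> L" using b by (cases b) (auto simp: blocks_def)
  consider "(s, t) \<in> D" "s = t" | "(s, t) \<in> D" "s < t" | "(s, t) \<in> L" "(s, t) \<notin> D" using st DL(2) by fastforce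
  then show ?thesis
    by cases (use st symmetric_bounds bipartite_bounds links_bounds in \<open>auto simp: limit_def\<close>)
qed

theorem relative_entropy_limit:
  "(\<lambda>n. relative_entropy (multilayer_graphs M \<gamma> (N n))
       (microcanonical (multilayer_graphs M \<gamma> (N n)) (constraint_index D L (N n)) (constraint_value (N n)) (constraint_target (k n) (Lst n)))
       (canonical (multilayer_graphs M \<gamma> (N n)) (constraint_index D L (N n)) (constraint_value (N n)) (constraint_target (k n) (Lst n)))
     / real n) \<longlonglongrightarrow> (\<Sum>(s, t)\<in>D. A s * F s t)"
    (is "(\<lambda>n. ?S n / real n) \<longlonglongrightarrow> _")
proof -
  let ?B = "blocks (D \<union> L)"
  define v where "v b = (if b \<in> D then if fst b = snd b then limit b else limit b + limit (prod.swap b) else 0)" for b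
  have "\<forall>b\<in>?B. \<exists>lu. (\<forall>\<^sub>F n in sequentially. block_ge n b (fst lu n) \<and> block_le n b (snd lu n)) \<and>
     (\<lambda>n. fst lu n / real n) \<longlonglongrightarrow> v b \<and> (\<lambda>n. snd lu n / real n) \<longlonglongrightarrow> v b"
  proof
    fix b assume "b \<in> ?B"
    then obtain lo up where "\<forall>\<^sub>F n in sequentially. block_ge n b (lo n) \<and> block_le n b (up n)"
      "(\<lambda>n. lo n / real n) \<longlonglongrightarrow> v b" "(\<lambda>n. up n / real n) \<longlonglongrightarrow> v b"
      using all_bounds unfolding block_bounds_def v_def by blast
    then show "\<exists>lu. (\<forall>\<^sub>F n in sequentially. block_ge n b (fst lu n) \<and> block_le n b (snd lu n)) \<and>
      (\<lambda>n. fst lu n / real n) \<longlonglongrightarrow> v b \<and> (\<lambda>n. snd lu n / real n) \<longlonglongrightarrow> v b"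
      by (intro exI[of _ "(lo, up)"]) simp
  qed
  from bchoice[OF this] obtain lu where lu:
    "\<And>b. b \<in> ?B \<Longrightarrow> \<forall>\<^sub>F n in sequentially. block_ge n b (fst (lu b) n) \<and> block_le n b (snd (lu b) n)"
    "\<And>b. b \<in> ?B \<Longrightarrow> (\<lambda>n. fst (lu b) n / real n) \<longlonglongrightarrow> v b"
    "\<And>b. b \<in> ?B \<Longrightarrow> (\<lambda>n. snd (lu b) n / real n) \<longlonglongrightarrow> v b" by blast
  define lo up where "lo n = (\<Sum>b\<in>?B. fst (lu b) n)" and "up n = (\<Sum>b\<in>?B. snd (lu b) n)" for n
  have "\<forall>\<^sub>F n in sequentially. \<forall>b\<in>?B. block_ge n b (fst (lu b) n) \<and> block_le n b (snd (lu b) n)"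
    using finite_blocks lu(1) by (simp add: eventually_ball_finite)
  then have bounds: "\<forall>\<^sub>F n in sequentially. lo n \<le> ?S n \<and> ?S n \<le> up n"
  proof eventually_elim
    case (elim n)
    let ?E = "block_links (N n)" and ?I = "block_index D (N n)"
    have loc: "link_coeff (N n) x e = 0" if "b \<in> ?B" "x \<in> ?I b" "e \<in> (\<Union>b\<in>?B. ?E b) - ?E b" for b x e
      using that block_links_card by (intro link_coeff_local[OF that(2)]) auto
    have C: "constraint_value (N n) G x = (\<Sum>e\<in>G. link_coeff (N n) x e)"
      if "G \<subseteq> (\<Union>b\<in>?B. ?E b)" "x \<in> (\<Union>b\<in>?B. ?I b)" for G x
      using finite_subset[OF that(1)] finite_blocks by (intro constraint_value_eq) auto
    have ge: "block_ge n b (fst (lu b) n)" and le: "block_le n b (snd (lu b) n)" if "b \<in> ?B" for b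
      using elim that by blast+
    note entropy = relative_entropy_blocks[where B = ?B and E = ?E and I = ?I and \<alpha> = "link_coeff (N n)" and
      c = "constraint_target (k n) (Lst n)" and lo = "\<lambda>b. fst (lu b) n" and up = "\<lambda>b. snd (lu b) n" and
      C = "constraint_value (N n)"]
    show ?case unfolding graphs_eq index_eq lo_def up_def
    proof
      show "(\<Sum>b\<in>?B. fst (lu b) n) \<le> relative_entropy (Pow (\<Union>b\<in>?B. ?E b))
          (microcanonical (Pow (\<Union>b\<in>?B. ?E b)) (\<Union>b\<in>?B. ?I b) (constraint_value (N n)) (constraint_target (k n) (Lst n)))
          (canonical (Pow (\<Union>b\<in>?B. ?E b)) (\<Union>b\<in>?B. ?I b) (constraint_value (N n)) (constraint_target (k n) (Lst n)))"
        by (rule entropy(1)) (assumption | rule finite_blocks finite_block_links blocks_disjoint loc block_ne ge le C)+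
      show "relative_entropy (Pow (\<Union>b\<in>?B. ?E b))
          (microcanonical (Pow (\<Union>b\<in>?B. ?E b)) (\<Union>b\<in>?B. ?I b) (constraint_value (N n)) (constraint_target (k n) (Lst n)))
          (canonical (Pow (\<Union>b\<in>?B. ?E b)) (\<Union>b\<in>?B. ?I b) (constraint_value (N n)) (constraint_target (k n) (Lst n)))
        \<le> (\<Sum>b\<in>?B. snd (lu b) n)"
        by (rule entropy(2)) (assumption | rule finite_blocks finite_block_links blocks_disjoint loc block_ne ge le C)+
    qed
  qed
  have sum: "(\<Sum>b\<in>?B. v b) = (\<Sum>(s, t)\<in>D. A s * F s t)"
  proof -
    have "(\<Sum>b\<in>?B. v b) = (\<Sum>b\<in>blocks D. if fst b = snd b then limit b else limit b + limit (prod.swap b))"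
      using finite_blocks by (intro sum.mono_neutral_cong_right) (auto simp: blocks_def v_def)
    also have "\<dots> = (\<Sum>b\<in>D. limit b)" by (rule sum_symmetric_pairs[OF finite_pairs(1) DL(3)])
    finally show ?thesis by (simp add: limit_def case_prod_beta)
  qed
  have "(\<lambda>n. \<Sum>b\<in>?B. fst (lu b) n / real n) \<longlonglongrightarrow> (\<Sum>b\<in>?B. v b)"
    by (intro tendsto_sum lu(2))
  then have lo: "(\<lambda>n. lo n / real n) \<longlonglongrightarrow> (\<Sum>(s, t)\<in>D. A s * F s t)"
    unfolding sum by (simp add: lo_def sum_divide_distrib)
  have "(\<lambda>n. \<Sum>b\<in>?B. snd (lu b) n / real n) \<longlonglongrightarrow> (\<Sum>b\<in>?B. v b)"
    by (intro tendsto_sum lu(3))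
  then have up: "(\<lambda>n. up n / real n) \<longlonglongrightarrow> (\<Sum>(s, t)\<in>D. A s * F s t)"
    unfolding sum by (simp add: up_def sum_divide_distrib)
  show ?thesis
    by (rule tendsto_sandwich[OF _ _ lo up]; rule eventually_mono[OF bounds]; simp add: divide_right_mono)
qed

end

theorem theorem1p9:
  fixes M :: nat
    and \<gamma> :: "nat \<Rightarrow> nat \<Rightarrow> nat"
    and D L :: "(nat \<times> nat) set"
    and N :: "nat \<Rightarrow> nat \<Rightarrow> nat"
    and k :: "nat \<Rightarrow> nat \<Rightarrow> node \<Rightarrow> nat"
    and Lst :: "nat \<Rightarrow> nat \<Rightarrow> nat \<Rightarrow> nat"
    and A :: "nat \<Rightarrow> real"
    and f :: "nat \<Rightarrow> nat \<Rightarrow> nat pmf"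
  defines "\<G> \<equiv> \<lambda>n. multilayer_graphs M \<gamma> (N n)"
    and "I \<equiv> \<lambda>n. constraint_index D L (N n)"
    and "C \<equiv> \<lambda>n. constraint_value (N n)"
    and "c \<equiv> \<lambda>n. constraint_target (k n) (Lst n)"
    and "m \<equiv> \<lambda>s t n. real (max_degree (N n) (k n) s t)"
  assumes "master_graph M \<gamma>"
    and "D \<union> L = master_pairs M \<gamma>" and "D \<inter> L = {}" and "sym D" and "sym L"
    and "\<And>n. (\<Sum>s=1..M. N n s) = n"
    and "\<And>s. s \<in> {1..M} \<Longrightarrow> filterlim (\<lambda>n. N n s) at_top sequentially"
    and "\<And>n s t. (s, t) \<in> L \<Longrightarrow> Lst n s t = Lst n t s"
    and "\<And>n s t. (s, t) \<in> D \<Longrightarrow> Lst n s t = (\<Sum>i\<in>layer (N n) s. k n t i)"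
    and "\<And>n. realisations (\<G> n) (I n) (C n) (c n) \<noteq> {}"
    and "\<And>s. s \<in> {1..M} \<Longrightarrow> (\<lambda>n. real (N n s) / real n) \<longlonglongrightarrow> A s"
    and "\<And>s t. (s, t) \<in> D \<Longrightarrow> s \<noteq> t \<Longrightarrow>
           (\<lambda>n. m s t n * m t s n) \<in> o(\<lambda>n. real (Lst n s t) powr (2 / 3))"
    and "\<And>s. (s, s) \<in> D \<Longrightarrow> m s s \<in> o(\<lambda>n. real (N n s) powr (1 / 2))"
    and "\<And>s t. (s, t) \<in> D \<Longrightarrow>
           (\<lambda>n. l1g_norm (\<lambda>j. empirical_distr (N n) (k n) s t j - pmf (f s t) j)) \<longlonglongrightarrow> 0"
  shows "(\<lambda>n. ereal (relative_entropy (\<G> n)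
             (microcanonical (\<G> n) (I n) (C n) (c n))
             (canonical (\<G> n) (I n) (C n) (c n)) / real n))
           \<longlonglongrightarrow> (\<Sum>(s, t)\<in>D. ereal (A s) * l1g_norm (pmf (f s t)))"
proof -
  interpret multilayer_sequence M \<gamma> D L N k Lst A f
    by unfold_locales (use assms in \<open>auto simp: \<G>_def I_def C_def c_def m_def\<close>)
  \<comment> \<open>All norms over \<open>D\<close> are finite, so the extended sum is a real
    one.\<close>
  have "(\<Sum>(s, t)\<in>D. ereal (A s) * l1g_norm (pmf (f s t))) = (\<Sum>(s, t)\<in>D. ereal (A s * F s t))"
    by (intro sum.cong) (auto simp: degree_limits(1))
  also have "\<dots> = ereal (\<Sum>(s, t)\<in>D. A s * F s t)" by (simp add: case_prod_beta sum_ereal)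
  finally show ?thesis unfolding \<G>_def I_def C_def c_def using relative_entropy_limit by simp
qed

end
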